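(* Let $X$ be a real algebraic variety of dimension $n$ and $D$ be a real very ample divisor of $X$. For any $r$-codimensional closed submanifold $\Sigma$ of $\mathbf{R}^n$ with trivial normal bundle, there exist $c>0$ and $m_0\in\mathbf{N}$ such that, for any $m\geq m_0$, there exist $Z_1,\dots,Z_r\in|mD|$ with $$\mathcal{N}_{\Sigma}\left(Z_1(\mathbf{R})\cap\dots\cap Z_r(\mathbf{R})\right)\geq c\,m^{n}.$$
   Context: A real algebraic variety $X$ is an algebraic variety defined over $\mathbf{R}$; it is assumed that $X$ is smooth and projective and that its real locus $X(\mathbf{R})$ is non-empty. For $m>0$, the linear system $|mD|$ consists of the real (effective) divisors, i.e. real algebraic hypersurfaces of $X$, linearly equivalent to $mD$; $Z(\mathbf{R})$ denotes the real locus of $Z$. For a closed smooth manifold $\Sigma$, not necessarily connected, and any smooth manifold $S$, $\mathcal{N}_{\Sigma}(S)$ denotes the number of connected components of $S$ that are diffeomorphic to $\Sigma$.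
   Formalization: Σ is nonempty and n ≥ 1; for disconnected Σ, where no connected component can be diffeomorphic to Σ, N_Σ counts the maximal number of disjoint unions of connected components diffeomorphic to Σ (for connected Σ this is the stated count). *)

theory Defs
  imports "HOL-Analysis.Analysis" "HOL-Library.Poly_Mapping"
begin

section \<open>Submanifolds of Euclidean spaces\<close>

text \<open>
  All manifolds that occur are embedded in Euclidean spaces, so smooth maps between them are
  those that locally extend to smooth maps of the ambient spaces.
\<close>

primrec Ck_on :: "nat \<Rightarrow> 'a::euclidean_space set \<Rightarrow> ('a \<Rightarrow> 'b::euclidean_space) \<Rightarrow> bool" where
  "Ck_on 0 U f \<longleftrightarrow> continuous_on U f"
| "Ck_on (Suc k) U f \<longleftrightarrow>
     f differentiable_on U \<and> (\<forall>v. Ck_on k U (\<lambda>x. frechet_derivative f (at x) v))"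

definition smooth_on :: "'a::euclidean_space set \<Rightarrow> ('a \<Rightarrow> 'b::euclidean_space) \<Rightarrow> bool" where
  "smooth_on U f \<longleftrightarrow> open U \<and> (\<forall>k. Ck_on k U f)"

definition smooth_map :: "'a::euclidean_space set \<Rightarrow> ('a \<Rightarrow> 'b::euclidean_space) \<Rightarrow> bool" where
  "smooth_map S f \<longleftrightarrow>
     (\<forall>p\<in>S. \<exists>U g. p \<in> U \<and> smooth_on U g \<and> (\<forall>x\<in>S \<inter> U. g x = f x))"

definition diffeomorphic :: "'a::euclidean_space set \<Rightarrow> 'b::euclidean_space set \<Rightarrow> bool" where
  "diffeomorphic S T \<longleftrightarrow>
     (\<exists>f g. smooth_map S f \<and> smooth_map T g \<and> f ` S = T \<and> g ` T = S \<and>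
            (\<forall>x\<in>S. g (f x) = x) \<and> (\<forall>y\<in>T. f (g y) = y))"

definition submanifold :: "nat \<Rightarrow> 'a::euclidean_space set \<Rightarrow> bool" where
  "submanifold d M \<longleftrightarrow>
     (\<forall>p\<in>M. \<exists>U V (f :: 'a \<Rightarrow> 'a) g W.
        p \<in> U \<and> smooth_on U f \<and> smooth_on V g \<and> f ` U = V \<and> g ` V = U \<and>
        (\<forall>x\<in>U. g (f x) = x) \<and> (\<forall>y\<in>V. f (g y) = y) \<and>
        subspace W \<and> dim W = d \<and> f ` (M \<inter> U) = W \<inter> V)"

text \<open>A closed manifold is one that is compact and without boundary; manifolds are nonempty.\<close>

definition closed_submanifold :: "nat \<Rightarrow> 'a::euclidean_space set \<Rightarrow> bool" where
  "closed_submanifold d M \<longleftrightarrow> submanifold d M \<and> compact M \<and> M \<noteq> {}"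

definition tangent_space :: "'a::euclidean_space set \<Rightarrow> 'a \<Rightarrow> 'a set" where
  "tangent_space M p =
     {v. \<exists>e>0. \<exists>\<gamma> :: real \<Rightarrow> 'a. smooth_on {-e<..<e} \<gamma> \<and> \<gamma> ` {-e<..<e} \<subseteq> M \<and>
           \<gamma> 0 = p \<and> (\<gamma> has_vector_derivative v) (at 0)}"

definition normal_space :: "'a::euclidean_space set \<Rightarrow> 'a \<Rightarrow> 'a set" where
  "normal_space M p = {w. \<forall>v\<in>tangent_space M p. v \<bullet> w = 0}"

text \<open>The normal bundle, of rank \<open>r\<close>, is trivial iff it has a global smooth frame.\<close>

definition trivial_normal_bundle :: "nat \<Rightarrow> 'a::euclidean_space set \<Rightarrow> bool" where
  "trivial_normal_bundle r M \<longleftrightarrow>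
     (\<exists>\<nu> :: nat \<Rightarrow> 'a \<Rightarrow> 'a. (\<forall>i<r. smooth_map M (\<nu> i)) \<and>
        (\<forall>p\<in>M. inj_on (\<lambda>i. \<nu> i p) {..<r} \<and> independent ((\<lambda>i. \<nu> i p) ` {..<r}) \<and>
               span ((\<lambda>i. \<nu> i p) ` {..<r}) = normal_space M p))"

text \<open>
  The number of components of \<open>S\<close> diffeomorphic to \<open>\<Sigma>\<close>. Since \<open>\<Sigma>\<close> may be disconnected, a copy of
  \<open>\<Sigma>\<close> in \<open>S\<close> is a union of connected components of \<open>S\<close>, and one takes the largest number of
  pairwise disjoint copies. For connected \<open>\<Sigma>\<close> this is the number of connected components
  diffeomorphic to \<open>\<Sigma>\<close>: see \<open>num_copies_connected\<close> below.
\<close>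

definition disjoint_copies ::
    "'a::euclidean_space set \<Rightarrow> 'b::euclidean_space set \<Rightarrow> 'b set set \<Rightarrow> bool" where
  "disjoint_copies \<Sigma> S \<C> \<longleftrightarrow>
     disjoint \<C> \<and> (\<forall>C\<in>\<C>. diffeomorphic \<Sigma> C \<and> (\<exists>\<K>\<subseteq>components S. C = \<Union>\<K>))"

definition num_copies :: "'a::euclidean_space set \<Rightarrow> 'b::euclidean_space set \<Rightarrow> enat" where
  "num_copies \<Sigma> S = (SUP \<C>\<in>{\<C>. finite \<C> \<and> disjoint_copies \<Sigma> S \<C>}. enat (card \<C>))"

lemma smooth_map_continuous_on: "smooth_map S f \<Longrightarrow> continuous_on S f"
proof -
  assume *: "smooth_map S f"
  have "continuous (at x within S) f" if "x \<in> S" for x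
  proof -
    from * that obtain U g where U: "x \<in> U" "smooth_on U g" "\<forall>y\<in>S \<inter> U. g y = f y"
      unfolding smooth_map_def by blast
    then have "open U" "continuous_on U g"
      unfolding smooth_on_def by (auto dest: spec[of _ 0])
    then have "isCont g x" using U(1) by (simp add: continuous_on_eq_continuous_at)
    then have "continuous (at x within S) g" by (rule continuous_at_imp_continuous_within)
    moreover have "\<forall>\<^sub>F y in at x within S. g y = f y"
      using \<open>open U\<close> U(1,3) unfolding eventually_at_topological by blast
    ultimately show ?thesis
      using U that by (auto simp: continuous_within intro: Lim_transform_eventually)
  qed
  then show ?thesis by (simp add: continuous_on_eq_continuous_within)
qed

lemma disjoint_copies_connected:
  assumes "connected \<Sigma>" "\<Sigma> \<noteq> {}"
  shows "disjoint_copies \<Sigma> S \<C> \<longleftrightarrow> \<C> \<subseteq> {C \<in> components S. diffeomorphic \<Sigma> C}"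
proof
  assume *: "disjoint_copies \<Sigma> S \<C>"
  show "\<C> \<subseteq> {C \<in> components S. diffeomorphic \<Sigma> C}"
  proof
    fix C assume "C \<in> \<C>"
    with * obtain \<K> where C: "diffeomorphic \<Sigma> C" "\<K> \<subseteq> components S" "C = \<Union>\<K>"
      unfolding disjoint_copies_def by blast
    from C(1) obtain f where f: "smooth_map \<Sigma> f" "f ` \<Sigma> = C"
      unfolding diffeomorphic_def by blast
    have "connected C" "C \<noteq> {}"
      using connected_continuous_image[OF smooth_map_continuous_on[OF f(1)] assms(1)] f(2) assms(2)
      by auto
    then obtain K where K: "K \<in> \<K>" "C \<inter> K \<noteq> {}" using C(3) by blast
    have "C \<subseteq> S" using C by (metis Sup_least in_components_subset subset_iff)
    then have "C \<subseteq> K"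
      using components_maximal[of K S C] K C(2) \<open>connected C\<close> by blast
    then have "C = K" using K C(3) by blast
    then show "C \<in> {C \<in> components S. diffeomorphic \<Sigma> C}" using K C by blast
  qed
next
  assume *: "\<C> \<subseteq> {C \<in> components S. diffeomorphic \<Sigma> C}"
  then have "disjoint \<C>"
    unfolding disjoint_def using components_nonoverlap by blast
  moreover have "\<exists>\<K>\<subseteq>components S. C = \<Union>\<K>" if "C \<in> \<C>" for C
    using * that by (intro exI[of _ "{C}"]) auto
  ultimately show "disjoint_copies \<Sigma> S \<C>"
    using * unfolding disjoint_copies_def by blast
qed

lemma num_copies_connected:
  fixes \<Sigma> :: "'a::euclidean_space set" and S :: "'b::euclidean_space set"
  assumes "connected \<Sigma>" "\<Sigma> \<noteq> {}"
  defines "N \<equiv> {C \<in> components S. diffeomorphic \<Sigma> C}"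
  shows "num_copies \<Sigma> S = (if finite N then enat (card N) else \<infinity>)"
proof -
  have eq: "num_copies \<Sigma> S = (SUP \<C>\<in>{\<C>. finite \<C> \<and> \<C> \<subseteq> N}. enat (card \<C>))"
    unfolding num_copies_def N_def disjoint_copies_connected[OF assms(1,2)] ..
  show ?thesis
  proof (cases "finite N")
    case True
    then have "(SUP \<C>\<in>{\<C>. finite \<C> \<and> \<C> \<subseteq> N}. enat (card \<C>)) = enat (card N)"
      by (intro antisym SUP_least) (auto intro: card_mono SUP_upper2[of N])
    then show ?thesis using True eq by simp
  next
    case False
    have "enat k \<le> num_copies \<Sigma> S" for k
    proof -
      obtain \<C> where "\<C> \<subseteq> N" "finite \<C>" "card \<C> = k"
        using infinite_arbitrarily_large[OF False] by metis
      then show ?thesis unfolding eq by (intro SUP_upper2[of \<C>]) auto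
    qed
    then show ?thesis using False
      by (metis enat_ord_simps(1) not_enat_eq not_less_eq_eq order_refl)
  qed
qed

section \<open>Projective varieties over the reals\<close>

text \<open>
  \<open>(('v \<Rightarrow>\<^sub>0 nat) \<Rightarrow>\<^sub>0 real)\<close> is the ring of real polynomials in variables indexed by \<open>'v\<close>.
  A subset of complex projective space (with homogeneous coordinates indexed by \<open>'v\<close>) is given by
  the set of all nonzero vectors of \<open>complex ^ 'v\<close> representing its points.
\<close>

type_synonym 'v rpoly = "('v \<Rightarrow>\<^sub>0 nat) \<Rightarrow>\<^sub>0 real"

definition peval :: "'v rpoly \<Rightarrow> ('v \<Rightarrow> complex) \<Rightarrow> complex" where
  "peval F z = (\<Sum>\<mu>\<in>Poly_Mapping.keys F. complex_of_real (Poly_Mapping.lookup F \<mu>) *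
                   (\<Prod>i\<in>Poly_Mapping.keys \<mu>. z i ^ Poly_Mapping.lookup \<mu> i))"

definition homogeneous :: "nat \<Rightarrow> 'v rpoly \<Rightarrow> bool" where
  "homogeneous d F \<longleftrightarrow>
     (\<forall>\<mu>\<in>Poly_Mapping.keys F. (\<Sum>i\<in>Poly_Mapping.keys \<mu>. Poly_Mapping.lookup \<mu> i) = d)"

abbreviation pevalv :: "'v rpoly \<Rightarrow> complex ^ 'v \<Rightarrow> complex" where
  "pevalv F z \<equiv> peval F (vec_nth z)"

definition vanishes_on :: "'v rpoly \<Rightarrow> (complex ^ 'v) set \<Rightarrow> bool" where
  "vanishes_on F X \<longleftrightarrow> (\<forall>z\<in>X. pevalv F z = 0)"

text \<open>
  Closed subsets defined over the reals, i.e. closed subsets of the real projective scheme.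
  Irreducibility, Krull dimension, the function field and local rings below are also those of the
  scheme over the reals. A smooth irreducible such \<open>X\<close> with a real point is geometrically
  irreducible.
\<close>

definition real_closed :: "(complex ^ 'v) set \<Rightarrow> bool" where
  "real_closed X \<longleftrightarrow>
     (\<exists>E :: 'v rpoly set. (\<forall>F\<in>E. \<exists>d. homogeneous d F) \<and>
        X = {z. z \<noteq> 0 \<and> (\<forall>F\<in>E. pevalv F z = 0)})"

definition real_irreducible :: "(complex ^ 'v) set \<Rightarrow> bool" where
  "real_irreducible X \<longleftrightarrow> X \<noteq> {} \<and>
     (\<forall>A B. real_closed A \<and> real_closed B \<and> X \<subseteq> A \<union> B \<longrightarrow> X \<subseteq> A \<or> X \<subseteq> B)"

definition krull_dim :: "(complex ^ 'v) set \<Rightarrow> enat" where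
  "krull_dim X =
     (SUP k\<in>{k. \<exists>Y :: nat \<Rightarrow> (complex ^ 'v) set.
                  (\<forall>i\<le>k. real_closed (Y i) \<and> real_irreducible (Y i) \<and> Y i \<subseteq> X) \<and>
                  (\<forall>i<k. Y i \<subset> Y (Suc i))}. enat k)"

text \<open>
  The Zariski tangent space at \<open>z\<close> of the affine cone over \<open>X\<close>: the vectors along which the
  derivative of every homogeneous element of the ideal of \<open>X\<close> vanishes. Its dimension is one more
  than that of the tangent space of \<open>X\<close> at the point represented by \<open>z\<close>.
\<close>

definition cone_tangent_space :: "(complex ^ 'v) set \<Rightarrow> complex ^ 'v \<Rightarrow> (complex ^ 'v) set" where
  "cone_tangent_space X z =
     {v. \<forall>F :: 'v rpoly. (\<exists>d. homogeneous d F) \<and> vanishes_on F X \<longrightarrow>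
           ((\<lambda>t. pevalv F (z + t *s v)) has_field_derivative 0) (at 0)}"

definition smooth_variety :: "(complex ^ 'v::finite) set \<Rightarrow> bool" where
  "smooth_variety X \<longleftrightarrow>
     (\<forall>z\<in>X. enat (vec.dim (cone_tangent_space X z)) = krull_dim X + 1)"

text \<open>
  Real projective space is regarded as a submanifold of the space of matrices by identifying the
  line spanned by \<open>x\<close> with the orthogonal projection onto it.
\<close>

definition line_projection :: "real ^ 'v::finite \<Rightarrow> real ^ 'v ^ 'v" where
  "line_projection x = (\<chi> i j. x $ i * x $ j / (x \<bullet> x))"

definition real_locus :: "(complex ^ 'v::finite) set \<Rightarrow> (real ^ 'v ^ 'v) set" where
  "real_locus X = {line_projection x |x. x \<noteq> 0 \<and> (\<chi> i. complex_of_real (x $ i)) \<in> X}"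

definition real_algebraic_variety :: "(complex ^ 'v::finite) set \<Rightarrow> bool" where
  "real_algebraic_variety X \<longleftrightarrow>
     real_closed X \<and> real_irreducible X \<and> smooth_variety X \<and> real_locus X \<noteq> {}"

section \<open>Real rational functions\<close>

text \<open>The pair \<open>(F, G)\<close> stands for the rational function \<open>F / G\<close>.\<close>

type_synonym 'v ratfun = "'v rpoly \<times> 'v rpoly"

definition is_ratfun :: "(complex ^ 'v) set \<Rightarrow> 'v ratfun \<Rightarrow> bool" where
  "is_ratfun X f \<longleftrightarrow>
     (\<exists>d. homogeneous d (fst f) \<and> homogeneous d (snd f)) \<and> \<not> vanishes_on (snd f) X"

definition nonzero_ratfun :: "(complex ^ 'v) set \<Rightarrow> 'v ratfun \<Rightarrow> bool" where
  "nonzero_ratfun X f \<longleftrightarrow> is_ratfun X f \<and> \<not> vanishes_on (fst f) X"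

definition rat_eq :: "(complex ^ 'v) set \<Rightarrow> 'v ratfun \<Rightarrow> 'v ratfun \<Rightarrow> bool" where
  "rat_eq X f g \<longleftrightarrow> vanishes_on (fst f * snd g - fst g * snd f) X"

definition rat_mult :: "'v ratfun \<Rightarrow> 'v ratfun \<Rightarrow> 'v ratfun" where
  "rat_mult f g = (fst f * fst g, snd f * snd g)"

definition rat_div :: "'v ratfun \<Rightarrow> 'v ratfun \<Rightarrow> 'v ratfun" where
  "rat_div f g = (fst f * snd g, snd f * fst g)"

definition rat_power :: "'v ratfun \<Rightarrow> nat \<Rightarrow> 'v ratfun" where
  "rat_power f m = (fst f ^ m, snd f ^ m)"

text \<open>\<open>f\<close> lies in the local ring of \<open>X\<close> at \<open>z\<close> and takes the value \<open>w\<close> there.\<close>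

definition has_value :: "(complex ^ 'v) set \<Rightarrow> 'v ratfun \<Rightarrow> complex ^ 'v \<Rightarrow> complex \<Rightarrow> bool" where
  "has_value X f z w \<longleftrightarrow> is_ratfun X f \<and>
     (\<exists>g. is_ratfun X g \<and> rat_eq X f g \<and> pevalv (snd g) z \<noteq> 0 \<and>
          w = pevalv (fst g) z / pevalv (snd g) z)"

definition regular_at :: "(complex ^ 'v) set \<Rightarrow> 'v ratfun \<Rightarrow> complex ^ 'v \<Rightarrow> bool" where
  "regular_at X f z \<longleftrightarrow> (\<exists>w. has_value X f z w)"

definition unit_at :: "(complex ^ 'v) set \<Rightarrow> 'v ratfun \<Rightarrow> complex ^ 'v \<Rightarrow> bool" where
  "unit_at X f z \<longleftrightarrow> (\<exists>w. w \<noteq> 0 \<and> has_value X f z w)"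

section \<open>Real divisors\<close>

text \<open>
  Divisors are Cartier divisors (equivalently Weil divisors, for smooth \<open>X\<close>) on \<open>X\<close> over the reals.
  A divisor is given by a choice of a local equation \<open>D z\<close> at every point \<open>z\<close>, such that \<open>D z\<close> is
  also a local equation at all points of some Zariski neighbourhood of \<open>z\<close>. Two such choices that
  differ by units of the local rings give the same divisor.
\<close>

type_synonym 'v divisor = "complex ^ 'v \<Rightarrow> 'v ratfun"

definition real_divisor :: "(complex ^ 'v) set \<Rightarrow> 'v divisor \<Rightarrow> bool" where
  "real_divisor X D \<longleftrightarrow>
     (\<forall>z\<in>X. nonzero_ratfun X (D z) \<and>
        (\<exists>d H. homogeneous d H \<and> pevalv H z \<noteq> 0 \<and>
           (\<forall>q\<in>X. pevalv H q \<noteq> 0 \<longrightarrow> unit_at X (rat_div (D q) (D z)) q)))"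

definition multiple :: "nat \<Rightarrow> 'v divisor \<Rightarrow> 'v divisor" where
  "multiple m D = (\<lambda>z. rat_power (D z) m)"

definition effective :: "(complex ^ 'v) set \<Rightarrow> 'v divisor \<Rightarrow> bool" where
  "effective X D \<longleftrightarrow> (\<forall>z\<in>X. regular_at X (D z) z)"

definition linearly_equivalent :: "(complex ^ 'v) set \<Rightarrow> 'v divisor \<Rightarrow> 'v divisor \<Rightarrow> bool" where
  "linearly_equivalent X D E \<longleftrightarrow>
     (\<exists>h. nonzero_ratfun X h \<and> (\<forall>z\<in>X. unit_at X (rat_div (rat_mult h (D z)) (E z)) z))"

definition linear_system :: "(complex ^ 'v) set \<Rightarrow> 'v divisor \<Rightarrow> 'v divisor set" where
  "linear_system X D = {Z. real_divisor X Z \<and> effective X Z \<and> linearly_equivalent X Z D}"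

definition hypersurface :: "(complex ^ 'v) set \<Rightarrow> 'v divisor \<Rightarrow> (complex ^ 'v) set" where
  "hypersurface X Z = {z\<in>X. has_value X (Z z) z 0}"

text \<open>
  A rational function \<open>s\<close> is a global section of the line bundle \<open>\<O>(D)\<close> iff \<open>s * D z\<close> is regular at
  every \<open>z\<close>. Sections \<open>s 0, \<dots>, s k\<close> without common zeros define the morphism \<open>section_map\<close> to
  projective \<open>k\<close>-space that pulls back \<open>\<O>(1)\<close> to \<open>\<O>(D)\<close>, and every morphism pulling back \<open>\<O>(1)\<close> to
  \<open>\<O>(D)\<close> is of this form. The homogeneous coordinates on projective \<open>k\<close>-space are the first \<open>k + 1\<close>
  of the coordinates indexed by all natural numbers; the others are set to \<open>0\<close>.
\<close>

definition generating_sections ::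
    "(complex ^ 'v) set \<Rightarrow> 'v divisor \<Rightarrow> nat \<Rightarrow> (nat \<Rightarrow> 'v ratfun) \<Rightarrow> bool" where
  "generating_sections X D k s \<longleftrightarrow>
     (\<forall>i\<le>k. is_ratfun X (s i)) \<and>
     (\<forall>z\<in>X. (\<forall>i\<le>k. regular_at X (rat_mult (s i) (D z)) z) \<and>
             (\<exists>i\<le>k. unit_at X (rat_mult (s i) (D z)) z))"

definition section_map ::
    "(complex ^ 'v) set \<Rightarrow> 'v divisor \<Rightarrow> nat \<Rightarrow> (nat \<Rightarrow> 'v ratfun) \<Rightarrow>
     complex ^ 'v \<Rightarrow> (nat \<Rightarrow> complex)" where
  "section_map X D k s z =
     (\<lambda>i. if i \<le> k then (THE w. has_value X (rat_mult (s i) (D z)) z w) else 0)"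

text \<open>
  A morphism \<open>\<phi>\<close> from \<open>X\<close> to projective \<open>k\<close>-space is a closed immersion iff it is an isomorphism onto
  a closed subvariety: its image is closed, and there is an inverse morphism from the image to \<open>X\<close>,
  which is given locally by homogeneous polynomials \<open>G j\<close> of the same degree.
\<close>

definition closed_immersion ::
    "(complex ^ 'v) set \<Rightarrow> nat \<Rightarrow> (complex ^ 'v \<Rightarrow> (nat \<Rightarrow> complex)) \<Rightarrow> bool" where
  "closed_immersion X k \<phi> \<longleftrightarrow>
     (\<exists>E :: nat rpoly set. (\<forall>F\<in>E. \<exists>d. homogeneous d F) \<and>
        (\<forall>w. w \<noteq> (\<lambda>_. 0) \<and> (\<forall>i>k. w i = 0) \<longrightarrow>
           (\<exists>z\<in>X. \<exists>c. c \<noteq> 0 \<and> w = (\<lambda>i. c * \<phi> z i)) = (\<forall>F\<in>E. peval F w = 0))) \<and>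
     (\<forall>z\<in>X. \<exists>(G :: 'v \<Rightarrow> nat rpoly) d.
        (\<forall>j. homogeneous d (G j)) \<and> (\<exists>j. peval (G j) (\<phi> z) \<noteq> 0) \<and>
        (\<forall>q\<in>X. (\<exists>j. peval (G j) (\<phi> q) \<noteq> 0) \<longrightarrow>
           (\<exists>c. c \<noteq> 0 \<and> (\<forall>j. peval (G j) (\<phi> q) = c * q $ j))))"

definition very_ample :: "(complex ^ 'v) set \<Rightarrow> 'v divisor \<Rightarrow> bool" where
  "very_ample X D \<longleftrightarrow>
     (\<exists>k s. generating_sections X D k s \<and> closed_immersion X k (section_map X D k s))"

end

theory Submission
 imports Defs "HOL-Complex_Analysis.Cauchy_Integral_Formula"
begin

text \<open>
 The real locus of \<open>Z\<^sub>1 \<inter> \<dots> \<inter> Z\<^sub>r\<close> is cut out on \<open>X(\<real>)\<close> by \<open>r\<close> real forms of degree \<open>m\<close> in the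
 sections \<open>s\<^sub>0, \<dots>, s\<^sub>k\<close> that embed \<open>X\<close>, and any such forms that do not vanish on \<open>X(\<real>)\<close> are
 admissible (\<open>real_zeros_of_divisor\<close>). So the task is to choose real forms of degree \<open>m\<close> whose
 common zero set is smooth everywhere and contains about \<open>m\<^sup>n\<close> copies of \<open>\<Sigma>\<close>.

 The triviality of the normal bundle gives a tubular neighbourhood of \<open>\<Sigma>\<close> in \<open>\<real>\<^sup>n\<close> with a smooth
 normal coordinate \<open>tau\<close> whose zero set is \<open>\<Sigma>\<close>. The zero set of every map that is \<open>C\<^sup>1\<close>-close to \<open>tau\<close>
 is again diffeomorphic to \<open>\<Sigma>\<close> (\<open>zero_set_stable\<close>), and polynomials are \<open>C\<^sup>1\<close>-dense
 (\<open>polynomial_C1_approximation\<close>), so \<open>\<Sigma>\<close> is realised by polynomials \<open>p\<^sub>i\<close> of some degree \<open>D\<close>.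
 The Chebyshev polynomial of degree \<open>m'\<close> maps each of \<open>m'\<close> disjoint subintervals of \<open>(-1,1)\<close>
 diffeomorphically onto \<open>(-1,1)\<close>. Substituting it for every variable of \<open>p\<^sub>i\<close> multiplies the degree by
 \<open>m'\<close> and reproduces \<open>\<Sigma>\<close> in each of \<open>m'\<^sup>n\<close> small cubes. With \<open>m' = m div D\<close> and coordinates on a
 chart of \<open>X(\<real>)\<close> that are quotients of sections, this is a system of forms of degree \<open>m\<close> with at
 least \<open>c m\<^sup>n\<close> copies of \<open>\<Sigma>\<close> in that chart (\<open>chebyshev_system\<close>).

 The system may be singular elsewhere. In a chart, adding forms \<open>(a y\<^sub>j + \<Sum>b\<^sub>i y\<^bsub>l i\<^esub>) y\<^sub>j\<^bsup>m-1\<^esup>\<close>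
 changes the dehomogenized equations by arbitrary affine functions, and almost all such
 changes make the system regular on the chart (\<open>generic_affine_perturbation\<close>). Treating finitely many
 charts in turn with sufficiently small perturbations, which preserve both the copies and the regularity
 achieved before, gives the smooth system (\<open>many_copies_in_charts\<close>).

 It remains to find the charts of \<open>X(\<real>)\<close>. Here smoothness of \<open>X\<close> in the sense of Zariski tangent spaces
 must be turned into a smooth structure on the set of real points. Near a real point choose elements
 \<open>F\<^sub>j\<close> of the ideal whose differentials cut out the tangent space, and complete them to local coordinates.
 That the locus where all \<open>F\<^sub>j\<close> vanish contains no points outside \<open>X\<close> is seen over the complex
 numbers: along a holomorphic curve in that locus starting on \<open>X\<close> all derivatives of
 all elements of the ideal vanish at the starting point (\<open>curve_in_variety\<close>). The inverse of the
 closed immersion shows that quotients of the sections separate tangent directions, so that some of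
 them are coordinates (\<open>real_section_chart\<close>).
\<close>

section \<open>Smooth maps\<close>

lemma Ck_on_SucE:
 assumes "Ck_on (Suc k) U f" "open U"
 shows "\<exists>f'. (\<forall>x\<in>U. (f has_derivative f' x) (at x)) \<and> (\<forall>v. Ck_on k U (%x. f' x v))"
proof (intro exI[of _ "%x. frechet_derivative f (at x)"] conjI ballI)
 fix x assume "x \<in> U"
 then have "f differentiable (at x)"
  using assms differentiable_on_eq_differentiable_at[of U f] by simp
 then show "(f has_derivative frechet_derivative f (at x)) (at x)"
  by (simp add: frechet_derivative_works)
qed (use assms(1) in simp)

lemma Ck_on_cong:
 assumes "open U"
 shows "(\<And>x. x \<in> U ==> f x = g x) ==> Ck_on k U f ==> Ck_on k U g"
proof (induction k arbitrary: f g)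
 case 0
 then show ?case using continuous_on_cong[of U U f g] by simp
next
 case (Suc k)
 have df: "f differentiable (at x)" if "x \<in> U" for x
  using assms Suc.prems(2) that by (simp add: differentiable_on_eq_differentiable_at)
 have g: "(g has_derivative frechet_derivative f (at x)) (at x)" if "x \<in> U" for x
  by (rule has_derivative_transform_within_open[OF _ assms that Suc.prems(1)])
   (use df[OF that] in \<open>simp_all add: frechet_derivative_works\<close>)
 have "g differentiable_on U"
  using g unfolding differentiable_on_eq_differentiable_at[OF assms] differentiable_def by blast
 moreover have "Ck_on k U (%x. frechet_derivative g (at x) v)" for v
  by (rule Suc.IH[of "%x. frechet_derivative f (at x) v"])
   (use frechet_derivative_at[OF g] Suc.prems(2) in auto)
 ultimately show ?case by simp
qed

lemma Ck_on_SucI: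
 assumes "open U" "\<And>x. x \<in> U ==> (f has_derivative f' x) (at x)" "\<And>v. Ck_on k U (%x. f' x v)"
 shows "Ck_on (Suc k) U f"
proof -
 have "f differentiable_on U"
  using assms(2) unfolding differentiable_on_eq_differentiable_at[OF assms(1)] differentiable_def by blast
 moreover have "Ck_on k U (%x. frechet_derivative f (at x) v)" for v
  by (rule Ck_on_cong[OF assms(1) _ assms(3)[of v]]) (use frechet_derivative_at[OF assms(2)] in auto)
 ultimately show ?thesis by simp
qed

lemma Ck_on_Suc_imp: "open U ==> Ck_on (Suc k) U f ==> Ck_on k U f"
proof (induction k arbitrary: f)
 case 0
 then show ?case by (simp add: differentiable_imp_continuous_on)
next
 case (Suc k)
 obtain f' where f': "\<And>x. x \<in> U ==> (f has_derivative f' x) (at x)"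
  "\<And>v. Ck_on (Suc k) U (%x. f' x v)" using Ck_on_SucE[OF Suc.prems(2,1)] by blast
 show ?case by (rule Ck_on_SucI[OF Suc.prems(1) f'(1) Suc.IH[OF Suc.prems(1) f'(2)]])
qed

lemma Ck_on_const: "open U ==> Ck_on k U (%x. c)"
proof (induction k arbitrary: c)
 case (Suc k)
 then show ?case by (intro Ck_on_SucI[where f' = "%_ _. 0"]) auto
qed simp

lemma Ck_on_linear:
 assumes L: "bounded_linear L" and "open U"
 shows "Ck_on k U f ==> Ck_on k U (%x. L (f x))"
proof (induction k arbitrary: f)
 case 0
 then show ?case using bounded_linear.continuous_on[OF L] by simp
next
 case (Suc k)
 obtain f' where f': "\<And>x. x \<in> U ==> (f has_derivative f' x) (at x)"
  "\<And>v. Ck_on k U (%x. f' x v)" using Ck_on_SucE[OF Suc.prems(1) \<open>open U\<close>] by blast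
 show ?case
  by (rule Ck_on_SucI[OF \<open>open U\<close> bounded_linear.has_derivative[OF L f'(1)] Suc.IH[OF f'(2)]])
qed

lemma Ck_on_id: "open U ==> Ck_on k U (%x. x)"
proof (cases k)
 case (Suc j)
 then show "open U ==> ?thesis"
  by (auto simp del: Ck_on.simps intro!: Ck_on_SucI[where f' = "%_ v. v"] Ck_on_const)
qed simp

lemma Ck_on_add:
 assumes "open U"
 shows "Ck_on k U f ==> Ck_on k U g ==> Ck_on k U (%x. f x + g x)"
proof (induction k arbitrary: f g)
 case 0
 then show ?case by (simp add: continuous_on_add)
next
 case (Suc k)
 obtain f' where f': "\<And>x. x \<in> U ==> (f has_derivative f' x) (at x)"
  "\<And>v. Ck_on k U (%x. f' x v)" using Ck_on_SucE[OF Suc.prems(1) \<open>open U\<close>] by blast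
 obtain g' where g': "\<And>x. x \<in> U ==> (g has_derivative g' x) (at x)"
  "\<And>v. Ck_on k U (%x. g' x v)" using Ck_on_SucE[OF Suc.prems(2) \<open>open U\<close>] by blast
 show ?case
  by (rule Ck_on_SucI[OF \<open>open U\<close> has_derivative_add[OF f'(1) g'(1)] Suc.IH[OF f'(2) g'(2)]])
qed

lemma Ck_on_sum:
 assumes "open U" "\<And>i. i \<in> I ==> Ck_on k U (f i)"
 shows "Ck_on k U (%x. \<Sum>i\<in>I. f i x)"
 using assms(2)
 by (induction I rule: infinite_finite_induct) (auto intro: Ck_on_const Ck_on_add assms(1))

lemma Ck_on_bilinear:
 assumes B: "bounded_bilinear B" and "open U"
 shows "Ck_on k U f ==> Ck_on k U g ==> Ck_on k U (%x. B (f x) (g x))"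
proof (induction k arbitrary: f g)
 case 0
 then show ?case by (simp add: bounded_bilinear.continuous_on[OF B])
next
 case (Suc k)
 note fg = Suc.prems[THEN Ck_on_Suc_imp[OF \<open>open U\<close>]]
 obtain f' where f': "\<And>x. x \<in> U ==> (f has_derivative f' x) (at x)"
  "\<And>v. Ck_on k U (%x. f' x v)" using Ck_on_SucE[OF Suc.prems(1) \<open>open U\<close>] by blast
 obtain g' where g': "\<And>x. x \<in> U ==> (g has_derivative g' x) (at x)"
  "\<And>v. Ck_on k U (%x. g' x v)" using Ck_on_SucE[OF Suc.prems(2) \<open>open U\<close>] by blast
 show ?case
  by (rule Ck_on_SucI[OF \<open>open U\<close> bounded_bilinear.FDERIV[OF B f'(1) g'(1)]])
   (auto intro!: Ck_on_add[OF \<open>open U\<close>] Suc.IH fg f'(2) g'(2))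
qed

text \<open>
 The chain rule is expanded in a basis, because the recursive definition of \<open>Ck_on\<close> only gives
 access to derivatives in a fixed direction.
\<close>

lemma Ck_on_compose:
 fixes f :: "'a::euclidean_space => 'b::euclidean_space" and g :: "'b => 'c::euclidean_space"
 assumes "open U" "open V" "f ` U \<subseteq> V"
 shows "Ck_on k U f ==> Ck_on k V g ==> Ck_on k U (%x. g (f x))"
proof (induction k arbitrary: g)
 case 0
 then show ?case using assms(3) by (auto intro: continuous_on_compose2)
next
 case (Suc k)
 note f = Ck_on_Suc_imp[OF \<open>open U\<close> Suc.prems(1)]
 obtain f' where f': "\<And>x. x \<in> U ==> (f has_derivative f' x) (at x)"
  "\<And>v. Ck_on k U (%x. f' x v)" using Ck_on_SucE[OF Suc.prems(1) \<open>open U\<close>] by blast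
 obtain g' where g': "\<And>x. x \<in> V ==> (g has_derivative g' x) (at x)"
  "\<And>v. Ck_on k V (%x. g' x v)" using Ck_on_SucE[OF Suc.prems(2) \<open>open V\<close>] by blast
 have d: "((%x. g (f x)) has_derivative (%v. \<Sum>b\<in>Basis. (f' x v \<bullet> b) *\<^sub>R g' (f x) b)) (at x)"
  if "x \<in> U" for x
 proof -
  have fx: "f x \<in> V" using that assms(3) by auto
  have lin: "linear (g' (f x))" using g'(1)[OF fx] has_derivative_linear by blast
  have "((%x. g (f x)) has_derivative (%v. g' (f x) (f' x v))) (at x)"
   using has_derivative_compose[OF f'(1)[OF that] g'(1)[OF fx]] .
  moreover have "g' (f x) (f' x v) = (\<Sum>b\<in>Basis. (f' x v \<bullet> b) *\<^sub>R g' (f x) b)" for v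
  proof -
   have "g' (f x) (f' x v) = g' (f x) (\<Sum>b\<in>Basis. (f' x v \<bullet> b) *\<^sub>R b)"
    by (simp only: euclidean_representation)
   then show ?thesis by (simp add: linear_sum[OF lin] linear_scale[OF lin])
  qed
  ultimately show ?thesis by simp
 qed
 show ?case
  by (rule Ck_on_SucI[OF \<open>open U\<close> d])
   (auto intro!: Ck_on_sum[OF \<open>open U\<close>] Ck_on_bilinear[OF bounded_bilinear_scaleR \<open>open U\<close>]
    Suc.IH[OF f] g'(2) Ck_on_linear[OF bounded_linear_inner_left \<open>open U\<close>] f'(2))
qed

lemma Ck_on_inverse:
 fixes f :: "'a::euclidean_space => real"
 assumes "open U" "\<And>x. x \<in> U ==> f x ~= 0"
 shows "Ck_on k U f ==> Ck_on k U (%x. inverse (f x))"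
proof (induction k)
 case 0
 then show ?case using assms by (simp add: continuous_on_inverse)
next
 case (Suc k)
 note IH = Suc.IH[OF Ck_on_Suc_imp[OF \<open>open U\<close> Suc.prems]]
 obtain f' where f': "\<And>x. x \<in> U ==> (f has_derivative f' x) (at x)"
  "\<And>v. Ck_on k U (%x. f' x v)" using Ck_on_SucE[OF Suc.prems \<open>open U\<close>] by blast
 have d: "((%x. inverse (f x)) has_derivative
   (%v. (-1) * (inverse (f x) * f' x v * inverse (f x)))) (at x)" if "x \<in> U" for x
  using Deriv.has_derivative_inverse[OF assms(2)[OF that] f'(1)[OF that]] by simp
 show ?case
  by (rule Ck_on_SucI[OF \<open>open U\<close> d])
   (assumption, intro Ck_on_bilinear[OF bounded_bilinear_mult \<open>open U\<close>] IH f'(2) Ck_on_const \<open>open U\<close>)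
qed

lemma Ck_on_local:
 assumes "open U" "\<And>x. x \<in> U ==> \<exists>W. open W \<and> x \<in> W \<and> Ck_on k W f"
 shows "Ck_on k U f"
 using assms(2)
proof (induction k arbitrary: f)
 case 0
 then show ?case
  by (simp add: \<open>open U\<close> continuous_on_eq_continuous_at)
   (metis continuous_on_eq_continuous_at)
next
 case (Suc k)
 have "(f has_derivative frechet_derivative f (at x)) (at x)" if "x \<in> U" for x
 proof -
  from Suc.prems[OF that] obtain W where W: "open W" "x \<in> W" "Ck_on (Suc k) W f" by blast
  then have "f differentiable (at x)" by (simp add: differentiable_on_eq_differentiable_at)
  then show ?thesis by (simp add: frechet_derivative_works)
 qed
 then show ?case
 proof (rule Ck_on_SucI[OF \<open>open U\<close>])
  show "Ck_on k U (%x. frechet_derivative f (at x) v)" for v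
   by (rule Suc.IH) (use Suc.prems in force)
 qed
qed

lemma Ck_on_subset:
 assumes "Ck_on k U f" "open U" "open V" "V \<subseteq> U"
 shows "Ck_on k V f"
 using assms(1)
proof (induction k arbitrary: f)
 case 0
 then show ?case using assms(4) continuous_on_subset by auto
next
 case (Suc k)
 then obtain f' where f': "\<And>x. x \<in> U ==> (f has_derivative f' x) (at x)"
  "\<And>v. Ck_on k U (%x. f' x v)" using Ck_on_SucE[OF Suc.prems \<open>open U\<close>] by blast
 show ?case
  by (rule Ck_on_SucI[OF \<open>open V\<close> f'(1) Suc.IH[OF f'(2)]]) (use assms(4) in auto)
qed

lemma smooth_on_open: "smooth_on U f ==> open U"
 by (simp add: smooth_on_def)

lemma smooth_on_cong:
 "smooth_on U f ==> (\<And>x. x \<in> U ==> f x = g x) ==> smooth_on U g"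
 unfolding smooth_on_def using Ck_on_cong by blast

lemma smooth_on_subset: "smooth_on U f ==> open V ==> V \<subseteq> U ==> smooth_on V f"
 unfolding smooth_on_def using Ck_on_subset by blast

lemma smooth_on_local:
 assumes "\<And>x. x \<in> U ==> \<exists>W. x \<in> W \<and> smooth_on W f" "open U"
 shows "smooth_on U f"
 unfolding smooth_on_def
proof (intro conjI allI assms(2) Ck_on_local)
 fix k x assume "x \<in> U"
 then show "\<exists>W. open W \<and> x \<in> W \<and> Ck_on k W f"
  using assms(1) unfolding smooth_on_def by blast
qed

lemma smooth_on_continuous: "smooth_on U f ==> continuous_on U f"
 unfolding smooth_on_def by (metis Ck_on.simps(1))

definition dir_deriv :: "('a::euclidean_space => 'b::euclidean_space) => 'a => 'a => 'b" where
 "dir_deriv f x v = frechet_derivative f (at x) v"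

lemma smooth_on_has_derivative:
 assumes "smooth_on U f" "x \<in> U"
 shows "(f has_derivative dir_deriv f x) (at x)"
proof -
 have "open U" "Ck_on (Suc 0) U f" using assms(1) unfolding smooth_on_def by blast+
 then have "f differentiable (at x)" using assms(2) by (simp add: differentiable_on_eq_differentiable_at)
 moreover have "dir_deriv f x = frechet_derivative f (at x)" by (simp add: dir_deriv_def fun_eq_iff)
 ultimately show ?thesis by (simp add: frechet_derivative_works)
qed

lemma dir_deriv_eq: "(f has_derivative f') (at x) ==> dir_deriv f x = f'"
 unfolding dir_deriv_def using frechet_derivative_at by fastforce

lemma smooth_on_dir_deriv: "smooth_on U f ==> smooth_on U (%x. dir_deriv f x v)"
 unfolding smooth_on_def dir_deriv_def by (metis Ck_on.simps(2))

lemma dir_deriv_linear: "smooth_on U f ==> x \<in> U ==> linear (dir_deriv f x)"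
 using smooth_on_has_derivative has_derivative_linear by blast

named_theorems smooth_intros

lemma smooth_on_const [smooth_intros]: "open U ==> smooth_on U (%x. c)"
 by (simp add: smooth_on_def Ck_on_const)

lemma smooth_on_id [smooth_intros]: "open U ==> smooth_on U (%x. x)"
 by (simp add: smooth_on_def Ck_on_id)

lemma smooth_on_bounded_linear: "bounded_linear L ==> smooth_on U f ==> smooth_on U (%x. L (f x))"
 by (simp add: smooth_on_def Ck_on_linear)

lemma smooth_on_linear: "linear L ==> smooth_on U f ==> smooth_on U (%x. L (f x))"
 by (simp add: linear_conv_bounded_linear smooth_on_bounded_linear)

lemma smooth_on_add [smooth_intros]:
 "smooth_on U f ==> smooth_on U g ==> smooth_on U (%x. f x + g x)"
 by (simp add: smooth_on_def Ck_on_add)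

lemma smooth_on_sum [smooth_intros]:
 "open U ==> (\<And>i. i \<in> I ==> smooth_on U (f i)) ==> smooth_on U (%x. \<Sum>i\<in>I. f i x)"
 by (simp add: smooth_on_def Ck_on_sum)

lemma smooth_on_minus [smooth_intros]: "smooth_on U f ==> smooth_on U (%x. - f x)"
 by (rule smooth_on_bounded_linear[OF bounded_linear_minus[OF bounded_linear_ident]])

lemma smooth_on_diff [smooth_intros]:
 "smooth_on U f ==> smooth_on U g ==> smooth_on U (%x. f x - g x)"
 using smooth_on_add[OF _ smooth_on_minus, of U f g] by simp

lemma smooth_on_bilinear:
 "bounded_bilinear B ==> smooth_on U f ==> smooth_on U g ==> smooth_on U (%x. B (f x) (g x))"
 by (simp add: smooth_on_def Ck_on_bilinear)

lemma smooth_on_mult [smooth_intros]: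
 fixes f g :: "'a::euclidean_space => real"
 shows "smooth_on U f ==> smooth_on U g ==> smooth_on U (%x. f x * g x)"
 by (rule smooth_on_bilinear[OF bounded_bilinear_mult])

lemma smooth_on_scaleR [smooth_intros]:
 "smooth_on U f ==> smooth_on U g ==> smooth_on U (%x. f x *\<^sub>R g x)"
 by (rule smooth_on_bilinear[OF bounded_bilinear_scaleR])

lemma smooth_on_inner [smooth_intros]:
 "smooth_on U f ==> smooth_on U g ==> smooth_on U (%x. f x \<bullet> g x)"
 by (rule smooth_on_bilinear[OF bounded_bilinear_inner])

lemma smooth_on_power [smooth_intros]:
 fixes f :: "'a::euclidean_space => real"
 shows "smooth_on U f ==> smooth_on U (%x. f x ^ n)"
 by (induction n) (auto intro: smooth_intros smooth_on_open)

lemma smooth_on_inverse [smooth_intros]: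
 fixes f :: "'a::euclidean_space => real"
 shows "smooth_on U f ==> (\<And>x. x \<in> U ==> f x ~= 0) ==> smooth_on U (%x. inverse (f x))"
 by (simp add: smooth_on_def Ck_on_inverse)

lemma smooth_on_divide [smooth_intros]:
 fixes f :: "'a::euclidean_space => real"
 shows "smooth_on U f ==> smooth_on U g ==> (\<And>x. x \<in> U ==> g x ~= 0) ==> smooth_on U (%x. f x / g x)"
 unfolding divide_inverse by (intro smooth_intros)

lemma smooth_on_compose:
 assumes "smooth_on V g" "smooth_on U f" "f ` U \<subseteq> V"
 shows "smooth_on U (%x. g (f x))"
 using assms Ck_on_compose[of U V f] unfolding smooth_on_def by blast

lemma smooth_on_vec_nth [smooth_intros]:
 fixes f :: "'a::euclidean_space => 'b::euclidean_space ^ 'n::finite"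
 shows "smooth_on U f ==> smooth_on U (%x. f x $ i)"
 by (rule smooth_on_bounded_linear[OF bounded_linear_vec_nth])

lemma smooth_on_vec_lambda [smooth_intros]:
 fixes f :: "'n::finite => 'a::euclidean_space => 'b::euclidean_space"
 assumes "\<And>i. smooth_on U (f i)"
 shows "smooth_on U (%x. \<chi> i. f i x)"
proof -
 have lin: "linear (%y. axis i y :: 'b ^ 'n)" for i
  by (rule linearI) (auto simp: axis_def vec_eq_iff)
 have "smooth_on U (%x. \<Sum>i\<in>UNIV. axis i (f i x))"
  using assms smooth_on_open by (intro smooth_on_sum smooth_on_linear[OF lin]) blast+
 moreover have "(\<Sum>i\<in>UNIV. axis i (f i x)) = (\<chi> i. f i x)" for x
  by (simp add: vec_eq_iff axis_def sum.delta)
 ultimately show ?thesis by simp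
qed

lemma smooth_on_Pair [smooth_intros]:
 assumes "smooth_on U f" "smooth_on U g"
 shows "smooth_on U (%x. (f x, g x))"
proof -
 have "smooth_on U (%x. (f x, 0) + (0, g x))"
  by (intro smooth_on_add smooth_on_bounded_linear[OF bounded_linear_Pair] assms
   bounded_linear_ident bounded_linear_zero
   smooth_on_bounded_linear[of "%y. (y, 0)"] smooth_on_bounded_linear[of "%y. (0, y)"])
 then show ?thesis by simp
qed

lemma smooth_on_fst [smooth_intros]: "smooth_on U f ==> smooth_on U (%x. fst (f x))"
 by (rule smooth_on_bounded_linear[OF bounded_linear_fst])

lemma smooth_on_snd [smooth_intros]: "smooth_on U f ==> smooth_on U (%x. snd (f x))"
 by (rule smooth_on_bounded_linear[OF bounded_linear_snd])

lemma smooth_mapE: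
 assumes "smooth_map S f" "p \<in> S"
 obtains U g where "p \<in> U" "open U" "smooth_on U g" "\<And>x. x \<in> S ==> x \<in> U ==> g x = f x"
proof -
 from bspec[OF assms(1)[unfolded smooth_map_def] assms(2)] obtain U g
  where "p \<in> U" "smooth_on U g" "\<forall>x\<in>S \<inter> U. g x = f x" by blast
 then show thesis using that[of U g] smooth_on_open by auto
qed

lemma smooth_mapI:
 assumes "\<And>p. p \<in> S ==> \<exists>U g. p \<in> U \<and> smooth_on U g \<and> (\<forall>x\<in>S. x \<in> U --> g x = f x)"
 shows "smooth_map S f"
 unfolding smooth_map_def
proof
 fix p assume "p \<in> S"
 from assms[OF this] obtain U g where "p \<in> U" "smooth_on U g" "\<forall>x\<in>S. x \<in> U --> g x = f x" by blast
 then have "p \<in> U \<and> smooth_on U g \<and> (\<forall>x\<in>S \<inter> U. g x = f x)" by simp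
 then show "\<exists>U g. p \<in> U \<and> smooth_on U g \<and> (\<forall>x\<in>S \<inter> U. g x = f x)" by (intro exI)
qed

lemma smooth_map_on: "smooth_on U f ==> S \<subseteq> U ==> smooth_map S f"
 by (rule smooth_mapI) blast

lemma smooth_map_compose:
 assumes "smooth_map S f" "smooth_map T g" "f ` S \<subseteq> T"
 shows "smooth_map S (%x. g (f x))"
proof (rule smooth_mapI)
 fix p assume p: "p \<in> S"
 obtain U f1 where U: "p \<in> U" "open U" "smooth_on U f1" "\<And>x. x \<in> S ==> x \<in> U ==> f1 x = f x"
  using smooth_mapE[OF assms(1) p] by metis
 have "f p \<in> T" using p assms(3) by auto
 then obtain V g1 where V: "f p \<in> V" "open V" "smooth_on V g1" "\<And>x. x \<in> T ==> x \<in> V ==> g1 x = g x"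
  using smooth_mapE[OF assms(2)] by metis
 define W where "W = U \<inter> f1 -` V"
 have "open W"
  unfolding W_def by (rule continuous_open_preimage[OF smooth_on_continuous[OF U(3)] U(2) V(2)])
 then have "smooth_on W (%x. g1 (f1 x))"
  by (intro smooth_on_compose[OF V(3)] smooth_on_subset[OF U(3)]) (auto simp: W_def)
 moreover have "p \<in> W" using U V p by (auto simp: W_def)
 moreover have "\<forall>x\<in>S. x \<in> W --> g1 (f1 x) = g (f x)"
  using U(4) V(4) assms(3) by (auto simp: W_def)
 ultimately show "\<exists>U ga. p \<in> U \<and> smooth_on U ga \<and> (\<forall>x\<in>S. x \<in> U --> ga x = g (f x))"
  by (intro exI[of _ W] exI[of _ "%x. g1 (f1 x)"]) simp
qed

lemma diffeomorphic_trans: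
 assumes "diffeomorphic S T" "diffeomorphic T W"
 shows "diffeomorphic S W"
proof -
 obtain f g where fg: "smooth_map S f" "smooth_map T g" "f ` S = T" "g ` T = S"
  "\<forall>x\<in>S. g (f x) = x" "\<forall>y\<in>T. f (g y) = y"
  using assms(1) unfolding diffeomorphic_def by blast
 obtain f' g' where fg': "smooth_map T f'" "smooth_map W g'" "f' ` T = W" "g' ` W = T"
  "\<forall>x\<in>T. g' (f' x) = x" "\<forall>y\<in>W. f' (g' y) = y"
  using assms(2) unfolding diffeomorphic_def by blast
 have "smooth_map S (%x. f' (f x))" "smooth_map W (%x. g (g' x))"
  using smooth_map_compose[OF fg(1) fg'(1)] smooth_map_compose[OF fg'(2) fg(2)] fg fg' by auto
 moreover have "(%x. f' (f x)) ` S = W" "(%x. g (g' x)) ` W = S"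
  using fg fg' by (metis image_image)+
 moreover have "\<forall>x\<in>S. g (g' (f' (f x))) = x" "\<forall>y\<in>W. f' (f (g (g' y))) = y"
  using fg fg' by auto
 ultimately show ?thesis unfolding diffeomorphic_def by blast
qed

section \<open>Inverse functions\<close>

text \<open>A product of a differentiable factor that vanishes at the point and a merely continuous one.\<close>

lemma has_derivative_scaleR_zero:
 fixes al :: "'a::real_normed_vector => real" and bt :: "'a => 'b::real_normed_vector"
 assumes al: "(al has_derivative al') (at x)" "al x = 0" and bt: "isCont bt x"
 shows "((%y. al y *\<^sub>R bt y) has_derivative (%u. al' u *\<^sub>R bt x)) (at x)"
proof -
 have bl: "bounded_linear al'" using al(1) has_derivative_bounded_linear by blast
 obtain K where K: "\<And>u. norm (al' u) \<le> norm u * K"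
  using bounded_linear.pos_bounded[OF bl] by blast
 have limal: "((%y. norm (al y - al x - al' (y - x)) / norm (y - x)) \<longlongrightarrow> 0) (at x)"
  using al(1) by (simp add: has_derivative_iff_norm)
 have ev: "\<forall>\<^sub>F y in at x. \<bar>al y\<bar> \<le> (K + 1) * norm (y - x)"
 proof -
  have "\<forall>\<^sub>F y in at x. norm (al y - al x - al' (y - x)) / norm (y - x) < 1"
   using order_tendstoD(2)[OF limal] by simp
  moreover have "\<forall>\<^sub>F y in at x. y ~= x" by (simp add: eventually_at_filter)
  ultimately show ?thesis
  proof eventually_elim
   case (elim y)
   then have "norm (al y - al' (y - x)) < norm (y - x)" using al(2) by (simp add: field_simps)
   moreover have "\<bar>al y\<bar> \<le> norm (al y - al' (y - x)) + norm (al' (y - x))" by simp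
   moreover have "(K + 1) * norm (y - x) = norm (y - x) * K + norm (y - x)" by (simp add: distrib_right)
   ultimately show ?case using K[of "y - x"] by linarith
  qed
 qed
 have "((%y. al y *\<^sub>R (bt y - bt x)) has_derivative (%u. 0)) (at x)"
  unfolding has_derivative_iff_norm
 proof (rule conjI[OF bounded_linear_zero Lim_null_comparison])
  have "((%y. bt y - bt x) \<longlongrightarrow> 0) (at x)" using LIM_zero[OF bt[unfolded isCont_def]] .
  from tendsto_mult_right_zero[OF tendsto_norm_zero[OF this]]
  show "((%y. (K + 1) * norm (bt y - bt x)) \<longlongrightarrow> 0) (at x)" .
  show "\<forall>\<^sub>F y in at x. norm (norm (al y *\<^sub>R (bt y - bt x) - al x *\<^sub>R (bt x - bt x) - 0) / norm (y - x))
    \<le> (K + 1) * norm (bt y - bt x)"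
   using ev
  proof eventually_elim
   case (elim y)
   have "\<bar>al y\<bar> * norm (bt y - bt x) / norm (y - x) \<le> (K + 1) * norm (bt y - bt x)"
   proof (cases "y = x")
    case True
    then show ?thesis by simp
   next
    case False
    have "\<bar>al y\<bar> * norm (bt y - bt x) \<le> (K + 1) * norm (y - x) * norm (bt y - bt x)"
     by (rule mult_right_mono[OF elim norm_ge_zero])
    also have "\<dots> = (K + 1) * norm (bt y - bt x) * norm (y - x)" by (simp only: mult_ac)
    finally show ?thesis using False by (simp only: pos_divide_le_eq zero_less_norm_iff right_minus_eq not_False_eq_True)
   qed
   then show ?case by simp
  qed
 qed
 from has_derivative_add[OF this has_derivative_scaleR_left[OF al(1), of "bt x"]]
 show ?thesis by (simp add: scaleR_diff_right)
qed

text \<open>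
 The inverses of a family of linear isomorphisms are as smooth as the family. The identity
 \<open>h y v = h y0 v + h y (v - A y (h y0 v))\<close> reduces differentiability of \<open>h\<close> to its continuity.
\<close>

lemma Ck_on_inverse_linear:
 fixes A h :: "'a::euclidean_space => 'b::euclidean_space => 'b"
 assumes "open U" and lin: "\<And>y. y \<in> U ==> linear (A y)" "\<And>y. y \<in> U ==> linear (h y)"
  and inv: "\<And>y v. y \<in> U ==> A y (h y v) = v" "\<And>y v. y \<in> U ==> h y (A y v) = v"
 shows "(\<And>w. Ck_on k U (%y. A y w)) ==> Ck_on k U (%y. h y v)"
proof (induction k arbitrary: v)
 case 0
 have contA: "isCont (%y. A y w) y0" if "y0 \<in> U" for w y0
  using 0 that \<open>open U\<close> by (auto simp: continuous_on_eq_continuous_at)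
 have "isCont (%y. h y v) y0" if y0: "y0 \<in> U" for y0
 proof -
  have "inj (A y0)" using inv(2)[OF y0] by (metis injI)
  then obtain B where B: "B > 0" "\<And>w. B * norm w \<le> norm (A y0 w)"
   using linear_inj_bounded_below_pos[OF lin(1)[OF y0]] by blast
  have "((%y. \<Sum>b\<in>Basis. norm (A y b - A y0 b)) \<longlongrightarrow> (\<Sum>b\<in>(Basis::'b set). 0)) (at y0)"
   using contA[OF y0] by (intro tendsto_sum tendsto_norm_zero) (simp add: isCont_def LIM_zero)
  then have "\<forall>\<^sub>F y in at y0. (\<Sum>b\<in>Basis. norm (A y b - A y0 b)) < B / 2"
   using B(1) by (intro order_tendstoD(2)[where a = "B/2"]) auto
  moreover have "\<forall>\<^sub>F y in at y0. y \<in> U"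
   using \<open>open U\<close> y0 by (metis eventually_at_topological)
  ultimately have ev: "\<forall>\<^sub>F y in at y0. norm (h y v - h y0 v) \<le> 2 / B * norm (A y0 (h y0 v) - A y (h y0 v))"
  proof eventually_elim
   case (elim y)
   have low: "B / 2 * norm w \<le> norm (A y w)" for w
   proof -
    have "A y w - A y0 w = (\<Sum>b\<in>Basis. (w \<bullet> b) *\<^sub>R (A y b - A y0 b))"
    proof -
     have "A y w - A y0 w = A y (\<Sum>b\<in>Basis. (w \<bullet> b) *\<^sub>R b) - A y0 (\<Sum>b\<in>Basis. (w \<bullet> b) *\<^sub>R b)"
      by (simp only: euclidean_representation)
     then show ?thesis
      by (simp add: linear_sum[OF lin(1)] linear_scale[OF lin(1)] elim y0 sum_subtractf scaleR_diff_right)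
    qed
    then have "norm (A y w - A y0 w) \<le> (\<Sum>b\<in>Basis. norm ((w \<bullet> b) *\<^sub>R (A y b - A y0 b)))"
     by (simp only: norm_sum)
    also have "\<dots> \<le> (\<Sum>b\<in>Basis. norm w * norm (A y b - A y0 b))"
     by (intro sum_mono) (simp add: Basis_le_norm mult_right_mono)
    also have "\<dots> \<le> norm w * (B / 2)"
     unfolding sum_distrib_left[symmetric] using elim by (intro mult_left_mono) auto
    finally have "norm (A y w - A y0 w) \<le> norm w * (B / 2)" .
    moreover have "norm (A y0 w) \<le> norm (A y w) + norm (A y w - A y0 w)"
     by (metis add.commute norm_minus_commute norm_triangle_sub)
    ultimately show ?thesis using B(2)[of w] by (simp add: algebra_simps)
   qed
   have "A y (h y v - h y0 v) = A y0 (h y0 v) - A y (h y0 v)"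
    using elim y0 by (simp add: linear_diff[OF lin(1)] inv)
   with low[of "h y v - h y0 v"] B(1) show ?case by (simp add: field_simps)
  qed
  have "((%y. 2 / B * norm (A y0 (h y0 v) - A y (h y0 v))) \<longlongrightarrow> 0) (at y0)"
  proof (intro tendsto_mult_right_zero tendsto_norm_zero)
   have "((%y. A y0 (h y0 v) - A y (h y0 v)) \<longlongrightarrow> A y0 (h y0 v) - A y0 (h y0 v)) (at y0)"
    using contA[OF y0] by (intro tendsto_diff tendsto_const) (simp add: isCont_def)
   then show "((%y. A y0 (h y0 v) - A y (h y0 v)) \<longlongrightarrow> 0) (at y0)" by simp
  qed
  from Lim_null_comparison[OF ev this] show ?thesis
   by (simp add: isCont_def LIM_zero_iff)
 qed
 then show ?case using \<open>open U\<close> by (simp add: continuous_on_eq_continuous_at)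
next
 case (Suc k)
 have IH: "Ck_on k U (%y. h y w)" for w
  by (rule Suc.IH) (rule Ck_on_Suc_imp[OF \<open>open U\<close> Suc.prems])
 have cont: "isCont (%y. h y c) y0" if "y0 \<in> U" for c y0
 proof -
  have "continuous_on U (%y. h y c)"
  proof -
   have "Ck_on 0 U (%y. h y c)"
    using IH[of c] by (induction k) (auto intro: Ck_on_Suc_imp[OF \<open>open U\<close>] simp del: Ck_on.simps)
   then show ?thesis by simp
  qed
  then show ?thesis using that \<open>open U\<close> by (simp add: continuous_on_eq_continuous_at)
 qed
 have "\<exists>f'. (\<forall>x\<in>U. ((%y. A y b) has_derivative f' x) (at x)) \<and> (\<forall>v. Ck_on k U (%x. f' x v))" for b
  by (rule Ck_on_SucE[OF Suc.prems \<open>open U\<close>])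
 then obtain A' where A': "\<And>b x. x \<in> U ==> ((%y. A y b) has_derivative A' b x) (at x)"
  "\<And>b u. Ck_on k U (%x. A' b x u)" by metis
 have eq: "h y v = h y0 v + (\<Sum>c\<in>Basis. ((v - (\<Sum>b\<in>Basis. (h y0 v \<bullet> b) *\<^sub>R A y b)) \<bullet> c) *\<^sub>R h y c)"
  if "y \<in> U" "y0 \<in> U" for y y0
 proof -
  have e1: "(\<Sum>b\<in>Basis. (h y0 v \<bullet> b) *\<^sub>R A y b) = A y (h y0 v)"
  proof -
   have "A y (h y0 v) = A y (\<Sum>b\<in>Basis. (h y0 v \<bullet> b) *\<^sub>R b)" by (simp only: euclidean_representation)
   then show ?thesis by (simp add: linear_sum[OF lin(1)] linear_scale[OF lin(1)] that)
  qed
  have e2: "h y w = (\<Sum>c\<in>Basis. (w \<bullet> c) *\<^sub>R h y c)" for w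
  proof -
   have "h y w = h y (\<Sum>b\<in>Basis. (w \<bullet> b) *\<^sub>R b)" by (simp only: euclidean_representation)
   then show ?thesis by (simp add: linear_sum[OF lin(2)] linear_scale[OF lin(2)] that)
  qed
  have "(\<Sum>c\<in>Basis. ((v - (\<Sum>b\<in>Basis. (h y0 v \<bullet> b) *\<^sub>R A y b)) \<bullet> c) *\<^sub>R h y c)
    = h y (v - A y (h y0 v))" unfolding e1 by (rule e2[symmetric])
  then show ?thesis by (simp add: linear_diff[OF lin(2)] inv that)
 qed
 define f' where "f' y u = (\<Sum>c\<in>Basis. ((0 - (\<Sum>b\<in>Basis. (h y v \<bullet> b) *\<^sub>R A' b y u)) \<bullet> c) *\<^sub>R h y c)" for y u
 have d: "((%y. h y v) has_derivative f' y0) (at y0)" if y0: "y0 \<in> U" for y0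
 proof (rule has_derivative_transform_within_open[OF _ \<open>open U\<close> y0 eq[OF _ y0, symmetric]])
  have z: "(v - (\<Sum>b\<in>Basis. (h y0 v \<bullet> b) *\<^sub>R A y0 b)) = 0"
  proof -
   have "A y0 (h y0 v) = A y0 (\<Sum>b\<in>Basis. (h y0 v \<bullet> b) *\<^sub>R b)" by (simp only: euclidean_representation)
   then show ?thesis by (simp add: linear_sum[OF lin(1)] linear_scale[OF lin(1)] y0 inv)
  qed
  have "((%y. h y0 v + (\<Sum>c\<in>Basis. ((v - (\<Sum>b\<in>Basis. (h y0 v \<bullet> b) *\<^sub>R A y b)) \<bullet> c) *\<^sub>R h y c))
    has_derivative (%u. 0 + f' y0 u)) (at y0)"
   unfolding f'_def
   by (intro has_derivative_add has_derivative_const has_derivative_sum has_derivative_scaleR_zero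
     cont y0 has_derivative_inner_left has_derivative_diff has_derivative_scaleR_right A'(1))
    (simp add: z)
  then show "((%y. h y0 v + (\<Sum>c\<in>Basis. ((v - (\<Sum>b\<in>Basis. (h y0 v \<bullet> b) *\<^sub>R A y b)) \<bullet> c) *\<^sub>R h y c))
    has_derivative f' y0) (at y0)" by simp
 qed
 show ?case
 proof (rule Ck_on_SucI[OF \<open>open U\<close> d])
  fix u
  have "Ck_on k U (%y. \<Sum>b\<in>Basis. (h y v \<bullet> b) *\<^sub>R A' b y u)"
   by (intro Ck_on_sum Ck_on_bilinear[OF bounded_bilinear_scaleR] IH A'(2) \<open>open U\<close>
     Ck_on_linear[OF bounded_linear_inner_left])
  then have "Ck_on k U (%y. - (\<Sum>b\<in>Basis. (h y v \<bullet> b) *\<^sub>R A' b y u))"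
   by (rule Ck_on_linear[OF bounded_linear_minus[OF bounded_linear_ident] \<open>open U\<close>])
  then show "Ck_on k U (%y. f' y u)"
   unfolding f'_def diff_0
   by (intro Ck_on_sum Ck_on_bilinear[OF bounded_bilinear_scaleR] IH \<open>open U\<close>
     Ck_on_linear[OF bounded_linear_inner_left])
 qed
qed

lemma smooth_on_inverse_map:
 fixes f :: "'a::euclidean_space => 'a"
 assumes f: "smooth_on U f" and inj: "\<And>x. x \<in> U ==> inj (dir_deriv f x)"
  and g: "\<And>x. x \<in> U ==> g (f x) = x"
 shows "open (f ` U)" "smooth_on (f ` U) g"
proof -
 note U = smooth_on_open[OF f] and contf = smooth_on_continuous[OF f]
 have "inj_on f U" using g by (metis inj_onI)
 then show op: "open (f ` U)" using invariance_of_domain[OF contf U] by blast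
 have contg: "continuous_on (f ` U) g"
  by (rule continuous_on_inverse_open[OF U contf _ g]) auto
 define A where "A y w = dir_deriv f (g y) w" for y w
 define h where "h y = inv (A y)" for y
 have lin: "linear (A y)" "bij (A y)" if "y \<in> f ` U" for y
 proof -
  have "g y \<in> U" using that g by auto
  then show "linear (A y)" using dir_deriv_linear[OF f] by (simp add: A_def[abs_def])
  moreover have "inj (A y)" using inj[OF \<open>g y \<in> U\<close>] by (simp add: A_def[abs_def])
  ultimately show "bij (A y)"
   by (simp add: bij_def linear_injective_imp_surjective)
 qed
 have inv: "A y (h y v) = v" "h y (A y v) = v" if "y \<in> f ` U" for y v
  using lin(2)[OF that] by (simp_all add: h_def bij_inv_eq_iff bij_is_inj surj_f_inv_f bij_is_surj)
 have linh: "linear (h y)" if "y \<in> f ` U" for y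
  unfolding h_def using lin[OF that] by (simp add: bij_is_inj bij_is_surj linear_injective_imp_surjective inj_linear_imp_inv_linear)
 have der: "(g has_derivative h y) (at y)" if y: "y \<in> f ` U" for y
 proof -
  obtain x where x: "x \<in> U" "y = f x" using y by auto
  have "(f has_derivative A y) (at x)"
   using smooth_on_has_derivative[OF f x(1)] x g by (simp add: A_def[abs_def])
  moreover have "A y \<circ> h y = id" using inv(1)[OF y] by (simp add: fun_eq_iff)
  ultimately show ?thesis
   unfolding x(2) by (intro has_derivative_inverse_strong[OF U x(1) contf g])
 qed
 have "Ck_on k (f ` U) g" for k
 proof (induction k)
  case 0
  then show ?case using contg by simp
 next
  case (Suc k)
  show ?case
  proof (rule Ck_on_SucI[OF op der])
   show "Ck_on k (f ` U) (%y. h y v)" for v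
   proof (rule Ck_on_inverse_linear[OF op lin(1) linh inv])
    fix w
    have "Ck_on k U (%x. dir_deriv f x w)"
     using smooth_on_dir_deriv[OF f] by (simp add: smooth_on_def)
    then show "Ck_on k (f ` U) (%y. A y w)"
     unfolding A_def by (intro Ck_on_compose[OF op U _ Suc]) (use g in auto)
   qed
  qed
 qed
 then show "smooth_on (f ` U) g" using op by (simp add: smooth_on_def)
qed

lemma smooth_local_inverse:
 fixes f :: "'a::euclidean_space => 'a"
 assumes f: "smooth_on U f" and p: "p \<in> U" and inj: "inj (dir_deriv f p)"
 obtains U' g where "open U'" "p \<in> U'" "U' \<subseteq> U" "open (f ` U')" "smooth_on (f ` U') g"
  "\<And>x. x \<in> U' ==> g (f x) = x" "\<And>x. x \<in> U' ==> inj (dir_deriv f x)"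
proof -
 define f' where "f' x = Blinfun (dir_deriv f x)" for x
 have app: "blinfun_apply (f' x) = dir_deriv f x" if "x \<in> U" for x
  unfolding f'_def
  using has_derivative_bounded_linear[OF smooth_on_has_derivative[OF f that]]
  by (rule bounded_linear_Blinfun_apply)
 have d: "(f has_derivative blinfun_apply (f' x)) (at x)" if "x \<in> U" for x
  using smooth_on_has_derivative[OF f that] app[OF that] by simp
 have c: "continuous_on U f'"
 proof (rule continuous_on_blinfun_componentwise)
  fix i :: 'a
  have "continuous_on U (%x. dir_deriv f x i)"
   by (rule smooth_on_continuous[OF smooth_on_dir_deriv[OF f]])
  then show "continuous_on U (%x. blinfun_apply (f' x) i)"
   by (subst continuous_on_cong[OF refl, where g = "%x. dir_deriv f x i"]) (auto simp: app)
 qed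
 obtain L where L: "linear L" "L \<circ> dir_deriv f p = id"
  using linear_injective_left_inverse[OF dir_deriv_linear[OF f p] inj] by blast
 have invf: "Blinfun L o\<^sub>L f' p = id_blinfun"
 proof (rule blinfun_eqI)
  fix i
  have "L (dir_deriv f p i) = i" using L(2) by (metis comp_apply id_apply)
  then show "blinfun_apply (Blinfun L o\<^sub>L f' p) i = blinfun_apply id_blinfun i"
   using L(1) by (simp add: app p bounded_linear_Blinfun_apply linear_conv_bounded_linear)
 qed
 obtain U' V g g' where 1: "open U'" "U' \<subseteq> U" "p \<in> U'" "open V" "f p \<in> V" "homeomorphism U' V f g"
  "\<And>y. y \<in> V ==> (g has_derivative (g' y)) (at y)"
  "\<And>y. y \<in> V ==> g' y = inv (blinfun_apply (f'(g y)))"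
  "\<And>y. y \<in> V ==> bij (blinfun_apply (f'(g y)))"
  by (rule inverse_function_theorem[OF smooth_on_open[OF f] d c p invf]) (assumption, rule that)
 have gf: "g (f x) = x" if "x \<in> U'" for x using 1(6) that by (simp add: homeomorphism_def)
 have inj': "inj (dir_deriv f x)" if "x \<in> U'" for x
 proof -
  have "f x \<in> V" using 1(6) that by (auto simp: homeomorphism_def)
  from 1(9)[OF this] show ?thesis using app[of x] that 1(2) gf by (auto simp: bij_def)
 qed
 have "smooth_on U' f" by (rule smooth_on_subset[OF f 1(1,2)])
 from smooth_on_inverse_map[OF this inj' gf] show ?thesis
  using that[OF 1(1,3,2)] gf inj' by blast
qed

section \<open>Recognizing submanifolds\<close>

lemma linear_family_independent_iff:
 fixes a :: "'i => 'a::euclidean_space"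
 assumes "finite I"
 shows "inj_on a I \<and> independent (a ` I) \<longleftrightarrow> (\<forall>c. (\<Sum>i\<in>I. c i *\<^sub>R a i) = 0 --> (\<forall>i\<in>I. c i = 0))"
proof (intro iffI conjI allI impI)
 fix c :: "'i => real"
 assume a: "inj_on a I \<and> independent (a ` I)" and c: "(\<Sum>i\<in>I. c i *\<^sub>R a i) = 0"
 have inv: "the_inv_into I a (a i) = i" if "i \<in> I" for i
  using a that by (simp add: the_inv_into_f_f)
 have "(\<Sum>v\<in>a ` I. c (the_inv_into I a v) *\<^sub>R v) = (\<Sum>i\<in>I. c i *\<^sub>R a i)"
  using a by (simp add: sum.reindex inv)
 with c have c': "(\<Sum>v\<in>a ` I. c (the_inv_into I a v) *\<^sub>R v) = 0" by simp
 have "\<forall>c. (\<Sum>v\<in>a ` I. c v *\<^sub>R v) = 0 --> (\<forall>v\<in>a ` I. c v = 0)"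
  using a unfolding independent_explicit by blast
 from mp[OF spec[OF this] c'] show "\<forall>i\<in>I. c i = 0" using inv by auto
next
 assume *: "\<forall>c. (\<Sum>i\<in>I. c i *\<^sub>R a i) = 0 --> (\<forall>i\<in>I. c i = 0)"
 show inj: "inj_on a I"
 proof (rule inj_onI, rule ccontr)
  fix i j assume ij: "i \<in> I" "j \<in> I" "a i = a j" "i ~= j"
  define c where "c l = (if l = i then 1 else 0) - (if l = j then 1 else (0::real))" for l
  have "(\<Sum>l\<in>I. c l *\<^sub>R a l) = a i - a j"
   unfolding c_def using ij assms
   by (simp add: scaleR_diff_left sum_subtractf if_distrib[of "%x. x *\<^sub>R _"] sum.delta cong: if_cong)
  with * ij(1,3) have "c i = 0" by simp
  then show False using ij(4) by (simp add: c_def)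
 qed
 show "independent (a ` I)"
  unfolding independent_explicit
 proof (intro conjI allI impI)
  fix c assume "(\<Sum>v\<in>a ` I. c v *\<^sub>R v) = 0"
  then have "(\<Sum>i\<in>I. c (a i) *\<^sub>R a i) = 0" using inj by (simp add: sum.reindex)
  with spec[OF *, of "%i. c (a i)"] have "\<forall>i\<in>I. c (a i) = 0" by (rule mp)
  then show "\<forall>v\<in>a ` I. c v = 0" by simp
 qed (use assms in simp)
qed

text \<open>The local condition in the definition of a submanifold, as a property of a single point.\<close>

definition flat_at :: "nat => 'a::euclidean_space set => 'a => bool" where
 "flat_at d M p \<longleftrightarrow> (\<exists>U V (f :: 'a => 'a) g W.
    p \<in> U \<and> smooth_on U f \<and> smooth_on V g \<and> f ` U = V \<and> g ` V = U \<and>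
    (\<forall>x\<in>U. g (f x) = x) \<and> (\<forall>y\<in>V. f (g y) = y) \<and>
    subspace W \<and> dim W = d \<and> f ` (M \<inter> U) = W \<inter> V)"

lemma submanifold_iff_flat_at: "submanifold d M \<longleftrightarrow> (\<forall>p\<in>M. flat_at d M p)"
 unfolding submanifold_def flat_at_def by simp

lemma exists_linear_projection:
 fixes L :: "'a::euclidean_space set"
 assumes "subspace L"
 obtains pj where "linear pj" "\<And>x. pj x \<in> L" "\<And>x. x \<in> L ==> pj x = x"
proof -
 have "\<exists>g. range g \<subseteq> L \<and> linear g \<and> (\<forall>v\<in>L. g (id v) = v)"
  by (rule linear_exists_left_inverse_on[OF linear_id assms inj_on_id])
 then obtain g where "range g \<subseteq> L" "linear g" "\<forall>v\<in>L. g (id v) = v" by auto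
 then show thesis using that[of g] by auto
qed

text \<open>
 A set that is parametrized near \<open>p\<close> by an open subset of a subspace \<open>L\<close>, with a smooth left inverse
 \<open>psi\<close> of the parametrization \<open>sg\<close>, is flattened by moving each point \<open>A\<close> from \<open>sg (pj (psi A))\<close> to the
 corresponding point of the tangent space. The derivative of this map at \<open>p\<close> is the identity.
\<close>

lemma flat_at_parametrizedI:
 fixes psi :: "'a::euclidean_space => 'b::euclidean_space"
 assumes psi: "smooth_on Q psi" and p: "p \<in> Q" "p \<in> M" and sg: "smooth_on V sg"
  and L: "subspace L" "dim L = d"
  and a: "\<And>A. A \<in> M ==> A \<in> Q ==> psi A \<in> L \<and> psi A \<in> V \<and> sg (psi A) = A"
  and b: "\<And>y. y \<in> L ==> y \<in> V ==> sg y \<in> M \<and> sg y \<in> Q \<and> psi (sg y) = y"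
 shows "flat_at d M p"
proof -
 obtain pj where pj: "linear pj" "\<And>x. pj x \<in> L" "\<And>x. x \<in> L ==> pj x = x"
  using exists_linear_projection[OF L(1)] by metis
 define y0 where "y0 = psi p"
 have y0: "y0 \<in> L" "y0 \<in> V" "sg y0 = p" using a[OF p(2,1)] by (auto simp: y0_def)
 note contV = smooth_on_continuous[OF sg] and opV = smooth_on_open[OF sg] and opQ = smooth_on_open[OF psi]
 define S where "S = dir_deriv sg y0"
 have dS: "(sg has_derivative S) (at y0)" using smooth_on_has_derivative[OF sg y0(2)] by (simp add: S_def)
 have linS: "linear S" using dir_deriv_linear[OF sg y0(2)] by (simp add: S_def)
 have pjpsi: "smooth_on Q (%A. pj (psi A))" by (rule smooth_on_linear[OF pj(1) psi])
 define Q1 where "Q1 = Q \<inter> (%A. pj (psi A)) -` V"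
 have opQ1: "open Q1"
  unfolding Q1_def by (rule continuous_open_preimage[OF smooth_on_continuous[OF pjpsi] opQ opV])
 have pQ1: "p \<in> Q1" using p(1) y0 pj(3) by (simp add: Q1_def y0_def)
 have Q1Q: "Q1 \<subseteq> Q" by (simp add: Q1_def)
 define F where "F A = A - sg (pj (psi A)) + S (pj (psi A) - y0)" for A
 have sF: "smooth_on Q1 F"
  unfolding F_def
  by (intro smooth_on_add smooth_on_diff smooth_on_id opQ1 smooth_on_compose[OF sg]
    smooth_on_linear[OF linS] smooth_on_const smooth_on_subset[OF pjpsi opQ1 Q1Q])
   (auto simp: Q1_def)
 define T where "T v = pj (dir_deriv psi p v)" for v
 have dT: "((%A. pj (psi A)) has_derivative T) (at p)"
  unfolding T_def
  by (rule bounded_linear.has_derivative[OF _ smooth_on_has_derivative[OF psi p(1)]])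
   (use pj(1) in \<open>simp add: linear_conv_bounded_linear\<close>)
 have pjy0: "pj (psi p) = y0" using y0 pj(3) by (simp add: y0_def)
 have dsg: "((%A. sg (pj (psi A))) has_derivative (%v. S (T v))) (at p)"
  by (rule has_derivative_compose[OF dT]) (simp add: pjy0 dS)
 have "((%A. S (pj (psi A) - y0)) has_derivative (%v. S (T v - 0))) (at p)"
  using linS by (intro bounded_linear.has_derivative[of S] has_derivative_diff dT has_derivative_const)
   (simp add: linear_conv_bounded_linear)
 from has_derivative_add[OF has_derivative_diff[OF has_derivative_ident dsg] this]
 have "(F has_derivative (%v. v - S (T v) + S (T v - 0))) (at p)" unfolding F_def .
 then have "dir_deriv F p = (%v. v - S (T v) + S (T v - 0))" by (rule dir_deriv_eq)
 then have "inj (dir_deriv F p)" by (simp add: inj_def)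
 from smooth_local_inverse[OF sF pQ1 this] obtain U' g where U': "open U'" "p \<in> U'" "U' \<subseteq> Q1"
  "open (F ` U')" "smooth_on (F ` U') g" "\<And>x. x \<in> U' ==> g (F x) = x" by metis
 have onM: "F A = S (psi A - y0)" if "A \<in> M" "A \<in> Q" for A
  using a[OF that] pj(3) by (simp add: F_def)
 have Fp: "F p = 0" using onM[OF p(2,1)] linear_0[OF linS] by (simp add: y0_def)
 \<comment> \<open>along \<open>L\<close> the derivative of \<open>psi\<close> inverts \<open>S\<close>\<close>
 have inv: "dir_deriv psi p (S w) = w" if w: "w \<in> L" for w
 proof -
  have "((%s. y0 + s *\<^sub>R w) has_derivative (%s. s *\<^sub>R w)) (at (0::real))"
   by (auto intro!: derivative_eq_intros)
  moreover have "(sg has_derivative S) (at (y0 + 0 *\<^sub>R w))" using dS by simp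
  ultimately have 1: "((%s. sg (y0 + s *\<^sub>R w)) has_derivative (%s. S (s *\<^sub>R w))) (at 0)"
   by (rule has_derivative_compose)
  have "(psi has_derivative dir_deriv psi p) (at (sg (y0 + 0 *\<^sub>R w)))"
   using smooth_on_has_derivative[OF psi p(1)] y0 by simp
  from has_derivative_compose[OF 1 this]
  have 2: "((%s. psi (sg (y0 + s *\<^sub>R w))) has_derivative (%s. dir_deriv psi p (S (s *\<^sub>R w)))) (at 0)" .
  define I where "I = (%s. y0 + s *\<^sub>R w) -` V"
  have "open I" unfolding I_def by (rule open_vimage[OF opV]) (intro continuous_intros)
  have "((%s. y0 + s *\<^sub>R w) has_derivative (%s. dir_deriv psi p (S (s *\<^sub>R w)))) (at 0)"
  proof (rule has_derivative_transform_within_open[OF 2 \<open>open I\<close>])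
   show "0 \<in> I" using y0 by (simp add: I_def)
   fix s assume "s \<in> I"
   then show "psi (sg (y0 + s *\<^sub>R w)) = y0 + s *\<^sub>R w"
    using b[of "y0 + s *\<^sub>R w"] w y0 L(1) by (simp add: I_def subspace_add subspace_scale)
  qed
  moreover have "((%s. y0 + s *\<^sub>R w) has_derivative (%s. s *\<^sub>R w)) (at (0::real))"
   by (auto intro!: derivative_eq_intros)
  ultimately have "(%s. dir_deriv psi p (S (s *\<^sub>R w))) = (%s::real. s *\<^sub>R w)"
   by (rule has_derivative_unique)
  from fun_cong[OF this, of 1] show ?thesis by simp
 qed
 have injS: "inj_on S L" using inv by (metis inj_onI)
 obtain B where B: "B > 0" "\<And>x. norm (dir_deriv psi p x) \<le> norm x * B"
  using bounded_linear.pos_bounded[OF has_derivative_bounded_linear[OF smooth_on_has_derivative[OF psi p(1)]]]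
  by metis
 define V1 where "V1 = V \<inter> sg -` U'"
 have "open V1" unfolding V1_def by (rule continuous_open_preimage[OF contV opV U'(1)])
 moreover have "y0 \<in> V1" using y0 U'(2) by (simp add: V1_def)
 ultimately obtain e where e: "e > 0" "ball y0 e \<subseteq> V1" by (metis open_contains_ball)
 define V2 where "V2 = F ` U' \<inter> ball 0 (e / B)"
 have V2: "open V2" "V2 \<subseteq> F ` U'" unfolding V2_def using U'(4) by auto
 define U2 where "U2 = g ` V2"
 have U2: "U2 \<subseteq> U'" "F ` U2 = V2" "\<And>x. x \<in> U2 ==> F x \<in> V2"
  unfolding U2_def using V2(2) U'(6) by (auto simp: image_iff) (metis image_eqI subsetD imageE)+
 have U2eq: "U2 = U' \<inter> F -` V2"
 proof
  show "U2 \<subseteq> U' \<inter> F -` V2" using U2 by auto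
  show "U' \<inter> F -` V2 \<subseteq> U2"
  proof
   fix x assume "x \<in> U' \<inter> F -` V2"
   then show "x \<in> U2" unfolding U2_def using U'(6)[of x] by (metis IntD1 IntD2 image_eqI vimageD)
  qed
 qed
 have opU2: "open U2"
  unfolding U2eq
  by (rule continuous_open_preimage[OF continuous_on_subset[OF smooth_on_continuous[OF sF] U'(3)] U'(1) V2(1)])
 have "F ` (M \<inter> U2) = S ` L \<inter> V2"
 proof
  show "F ` (M \<inter> U2) \<subseteq> S ` L \<inter> V2"
  proof
   fix z assume "z \<in> F ` (M \<inter> U2)"
   then obtain A where A: "A \<in> M" "A \<in> U2" "z = F A" by auto
   then have "A \<in> Q" using U2(1) U'(3) Q1Q by auto
   then have "z = S (psi A - y0)" "psi A \<in> L" using onM[OF A(1)] a[OF A(1)] A(3) by auto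
   moreover have "psi A - y0 \<in> L" using calculation(2) y0(1) L(1) by (simp add: subspace_diff)
   ultimately have "z \<in> S ` L" by (metis imageI)
   then show "z \<in> S ` L \<inter> V2" using U2(3)[OF A(2)] A(3) by simp
  qed
  show "S ` L \<inter> V2 \<subseteq> F ` (M \<inter> U2)"
  proof
   fix z assume "z \<in> S ` L \<inter> V2"
   then obtain w where w: "w \<in> L" "z = S w" "z \<in> V2" by auto
   have "norm w \<le> norm z * B" using B(2)[of z] inv[OF w(1)] w(2) by simp
   moreover have "norm z < e / B" using w(3) by (simp add: V2_def)
   ultimately have "norm w < e" using B(1) by (simp add: field_simps)
   then have "y0 + w \<in> V1" using e(2) by (auto simp: dist_norm)
   then have y: "y0 + w \<in> V" "sg (y0 + w) \<in> U'" by (auto simp: V1_def)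
   have yL: "y0 + w \<in> L" using y0 w L(1) by (simp add: subspace_add)
   from b[OF yL y(1)] have A: "sg (y0 + w) \<in> M" "sg (y0 + w) \<in> Q" "psi (sg (y0 + w)) = y0 + w" by auto
   have "F (sg (y0 + w)) = z" using onM[OF A(1,2)] A(3) w(2) by simp
   moreover have "sg (y0 + w) \<in> U2" using y(2) calculation w(3) by (simp add: U2eq)
   ultimately show "z \<in> F ` (M \<inter> U2)" using A(1) by (auto intro: rev_image_eqI)
  qed
 qed
 moreover have "subspace (S ` L)" by (rule linear_subspace_image[OF linS L(1)])
 moreover have "dim (S ` L) = d"
  using dim_image_eq[OF linS, of L] injS L span_eq_iff by (metis)
 moreover have "p \<in> U2"
 proof -
  have "0 \<in> V2" using Fp U'(2) e(1) B(1) by (auto simp: V2_def intro: rev_image_eqI)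
  then show ?thesis using Fp U'(2) by (simp add: U2eq)
 qed
 moreover have "smooth_on U2 F" using smooth_on_subset[OF sF opU2] U2(1) U'(3) by auto
 moreover have "smooth_on V2 g" by (rule smooth_on_subset[OF U'(5) V2])
 moreover have "\<forall>x\<in>U2. g (F x) = x" using U2(1) U'(6) by auto
 moreover have "\<forall>y\<in>V2. F (g y) = y" using V2(2) U'(6) by (auto dest!: subsetD)
 moreover have "g ` V2 = U2" by (simp add: U2_def)
 ultimately show ?thesis
  unfolding flat_at_def using U2(2)
  by (intro exI[of _ U2] exI[of _ V2] exI[of _ F] exI[of _ g] exI[of _ "S ` L"]) simp
qed

text \<open>
 A system of equations is regular at a point if the derivatives of the equations with indices in
 \<open>R\<close> are linearly independent there.
\<close>

definition regular_at_pt :: "'i set => ('a::euclidean_space => real ^ 'i::finite) => 'a => bool" where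
 "regular_at_pt R g y \<longleftrightarrow>
  (\<forall>c. (\<forall>v. (\<Sum>i\<in>R. c i * (dir_deriv g y v) $ i) = 0) --> (\<forall>i\<in>R. c i = 0))"

lemma flat_at_regular_zero_set:
 fixes g :: "real ^ 'n => real ^ 'i::finite" and psi :: "'m::euclidean_space => real ^ 'n::finite"
 assumes g: "smooth_on V g" and phi: "smooth_on V phi" and psi: "smooth_on Q psi"
  and p: "p \<in> M" "p \<in> Q" and reg: "regular_at_pt R g (psi p)"
  and a: "\<And>A. A \<in> M ==> A \<in> Q ==> psi A \<in> V \<and> phi (psi A) = A \<and> (\<forall>i\<in>R. g (psi A) $ i = 0)"
  and b: "\<And>y. y \<in> V ==> (\<forall>i\<in>R. g y $ i = 0) ==> phi y \<in> M \<and> phi y \<in> Q \<and> psi (phi y) = y"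
  and d: "d + card R = CARD('n)"
 shows "flat_at d M p"
proof -
 define y0 where "y0 = psi p"
 have y0: "y0 \<in> V" "\<And>i. i \<in> R ==> g y0 $ i = 0" "phi y0 = p" using a[OF p] by (auto simp: y0_def)
 define al where "al i = (\<Sum>b\<in>Basis. (dir_deriv g y0 b $ i) *\<^sub>R b)" for i
 have lin: "linear (dir_deriv g y0)" by (rule dir_deriv_linear[OF g y0(1)])
 have al: "dir_deriv g y0 v $ i = al i \<bullet> v" for i v
 proof -
  have "dir_deriv g y0 v $ i = dir_deriv g y0 (\<Sum>b\<in>Basis. (v \<bullet> b) *\<^sub>R b) $ i"
   by (simp only: euclidean_representation)
  also have "\<dots> = (\<Sum>b\<in>Basis. (v \<bullet> b) * dir_deriv g y0 b $ i)"
   by (simp add: linear_sum[OF lin] linear_scale[OF lin])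
  also have "\<dots> = al i \<bullet> v" by (simp add: al_def inner_sum_left inner_commute[of v] mult.commute)
  finally show ?thesis .
 qed
 have ind: "(\<Sum>i\<in>R. c i *\<^sub>R al i) = 0 --> (\<forall>i\<in>R. c i = 0)" for c
 proof
  assume c: "(\<Sum>i\<in>R. c i *\<^sub>R al i) = 0"
  have "(\<Sum>i\<in>R. c i * dir_deriv g y0 v $ i) = (\<Sum>i\<in>R. c i *\<^sub>R al i) \<bullet> v" for v
   by (simp add: al inner_sum_left)
  with c have "\<forall>v. (\<Sum>i\<in>R. c i * dir_deriv g y0 v $ i) = 0" by simp
  with reg show "\<forall>i\<in>R. c i = 0" unfolding regular_at_pt_def y0_def[symmetric] by blast
 qed
 then have ind': "inj_on al R" "independent (al ` R)"
  using linear_family_independent_iff[of R al] by auto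
 define K where "K = {v. \<forall>i\<in>R. al i \<bullet> v = 0}"
 have K: "subspace K" unfolding K_def by (auto simp: subspace_def inner_add_right)
 have dK: "dim K = d"
 proof -
  have "K = {y \<in> UNIV. \<forall>x\<in>span (al ` R). orthogonal x y}"
  proof (intro set_eqI iffI)
   fix y assume "y \<in> K"
   then have "orthogonal y x" if "x \<in> span (al ` R)" for x
    by (intro orthogonal_to_span[OF that]) (auto simp: K_def orthogonal_def inner_commute)
   then show "y \<in> {y \<in> UNIV. \<forall>x\<in>span (al ` R). orthogonal x y}"
    by (simp add: orthogonal_commute)
  next
   fix y assume "y \<in> {y \<in> UNIV. \<forall>x\<in>span (al ` R). orthogonal x y}"
   then show "y \<in> K" by (auto simp: K_def orthogonal_def span_base)
  qed
  moreover have "dim (span (al ` R)) = card R"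
   using ind' by (simp add: dim_eq_card_independent card_image)
  moreover have "dim {y \<in> UNIV. \<forall>x\<in>span (al ` R). orthogonal x y} + dim (span (al ` R)) = dim (UNIV :: (real ^ 'n) set)"
   by (rule dim_subspace_orthogonal_to_vectors) auto
  ultimately show ?thesis using d by simp
 qed
 obtain pj where pj: "linear pj" "\<And>x. pj x \<in> K" "\<And>x. x \<in> K ==> pj x = x"
  using exists_linear_projection[OF K] by metis
 have alpj: "al i \<bullet> pj v = 0" if "i \<in> R" for i v using pj(2)[of v] that by (simp add: K_def)
 \<comment> \<open>straightens the level set into the kernel \<open>K\<close> of the derivatives\<close>
 define f where "f y = pj (y - (\<Sum>i\<in>R. (al i \<bullet> y) *\<^sub>R al i)) + (\<Sum>i\<in>R. (g y $ i) *\<^sub>R al i)" for y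
 have "open V" by (rule smooth_on_open[OF g])
 have sf: "smooth_on V f"
  unfolding f_def
  by (intro smooth_on_add smooth_on_linear[OF pj(1)] smooth_on_diff smooth_on_id smooth_on_sum
    smooth_on_scaleR smooth_on_inner smooth_on_const smooth_on_vec_nth g \<open>open V\<close>)
 have "(f has_derivative (%v. pj (v - (\<Sum>i\<in>R. (al i \<bullet> v) *\<^sub>R al i)) + (\<Sum>i\<in>R. (al i \<bullet> v) *\<^sub>R al i))) (at y0)"
  unfolding f_def
 proof (intro has_derivative_add bounded_linear.has_derivative[of pj] has_derivative_diff
   has_derivative_ident has_derivative_sum has_derivative_scaleR_left has_derivative_inner_right)
  fix i
  have "((%x. g x $ i) has_derivative (%v. dir_deriv g y0 v $ i)) (at y0)"
   by (rule bounded_linear.has_derivative[OF bounded_linear_vec_nth smooth_on_has_derivative[OF g y0(1)]])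
  then show "((%x. g x $ i) has_derivative (%x. al i \<bullet> x)) (at y0)" by (simp add: al)
 qed (use pj(1) in \<open>simp add: linear_conv_bounded_linear\<close>)
 then have df: "dir_deriv f y0 v = pj (v - (\<Sum>i\<in>R. (al i \<bullet> v) *\<^sub>R al i)) + (\<Sum>i\<in>R. (al i \<bullet> v) *\<^sub>R al i)" for v
  by (simp add: dir_deriv_eq)
 have split: "u = 0 \<and> (\<forall>i\<in>R. c i = 0)" if "u + (\<Sum>i\<in>R. c i *\<^sub>R al i) = 0" "u \<in> K" for u c
 proof -
  have "u \<bullet> al i = 0" if "i \<in> R" for i using \<open>u \<in> K\<close> that by (simp add: K_def inner_commute)
  then have "u \<bullet> (u + (\<Sum>i\<in>R. c i *\<^sub>R al i)) = u \<bullet> u"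
   by (simp add: inner_add_right inner_sum_right)
  then have "u = 0" using that(1) by simp
  then show ?thesis using that(1) ind[of c] by simp
 qed
 have "inj (dir_deriv f y0)"
  unfolding linear_injective_0[OF dir_deriv_linear[OF sf y0(1)]]
 proof (intro allI impI)
  fix v assume "dir_deriv f y0 v = 0"
  from split[OF this[unfolded df] pj(2)]
  have "pj (v - (\<Sum>i\<in>R. (al i \<bullet> v) *\<^sub>R al i)) = 0" "\<forall>i\<in>R. al i \<bullet> v = 0" by auto
  then have "pj v = 0" "v \<in> K" by (auto simp: K_def)
  then show "v = 0" using pj(3) by simp
 qed
 from smooth_local_inverse[OF sf y0(1) this] obtain U' h where U': "open U'" "y0 \<in> U'" "U' \<subseteq> V"
  "open (f ` U')" "smooth_on (f ` U') h" "\<And>x. x \<in> U' ==> h (f x) = x" by metis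
 have fK: "f y \<in> K \<longleftrightarrow> (\<forall>i\<in>R. g y $ i = 0)" for y
 proof
  assume "f y \<in> K"
  then have "pj (y - (\<Sum>i\<in>R. (al i \<bullet> y) *\<^sub>R al i)) - f y \<in> K" using pj(2) K by (simp add: subspace_diff)
  from split[OF _ this, of "%i. g y $ i"] show "\<forall>i\<in>R. g y $ i = 0" by (simp add: f_def)
 next
  assume "\<forall>i\<in>R. g y $ i = 0"
  then show "f y \<in> K" using pj(2) by (simp add: f_def)
 qed
 define Q' where "Q' = Q \<inter> psi -` U'"
 have opQ': "open Q'"
  unfolding Q'_def by (rule continuous_open_preimage[OF smooth_on_continuous[OF psi] smooth_on_open[OF psi] U'(1)])
 have sub: "Q' \<subseteq> Q" "U' \<subseteq> V" using U'(3) by (auto simp: Q'_def)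
 show ?thesis
 proof (rule flat_at_parametrizedI[where Q = Q' and psi = "%A. f (psi A)" and V = "f ` U'"
    and sg = "%z. phi (h z)" and L = K])
  show "smooth_on Q' (%A. f (psi A))"
   by (rule smooth_on_compose[OF smooth_on_subset[OF sf U'(1,3)] smooth_on_subset[OF psi opQ' sub(1)]])
    (auto simp: Q'_def)
  show "smooth_on (f ` U') (%z. phi (h z))"
   by (rule smooth_on_compose[OF phi U'(5)]) (use U'(3,6) in auto)
  show "p \<in> Q'" using p U'(2) by (simp add: Q'_def y0_def)
  show "p \<in> M" "subspace K" "dim K = d" by fact+
  show "f (psi A) \<in> K \<and> f (psi A) \<in> f ` U' \<and> phi (h (f (psi A))) = A" if "A \<in> M" "A \<in> Q'" for A
   using a[of A] that U'(6) fK by (auto simp: Q'_def)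
  show "phi (h z) \<in> M \<and> phi (h z) \<in> Q' \<and> f (psi (phi (h z))) = z" if z: "z \<in> K" "z \<in> f ` U'" for z
  proof -
   obtain y where y: "y \<in> U'" "z = f y" using z(2) by auto
   then have "\<forall>i\<in>R. g y $ i = 0" using fK z(1) by simp
   with b[of y] y U'(3,6) show ?thesis by (auto simp: Q'_def)
  qed
 qed
qed

section \<open>Tubular neighbourhoods\<close>

text \<open>
 Systems of equations are indexed by a finite type; only those with index in \<open>R\<close> are imposed, and the
 normal coordinates live in this coordinate subspace.
\<close>

definition suppvec :: "'i set => (real ^ 'i::finite) set" where
 "suppvec R = {t. \<forall>i. i \<notin> R --> t $ i = 0}"

definition tube :: "'i set => ('i => 'a::euclidean_space => 'a) => 'a => real ^ 'i::finite => 'a" where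
 "tube R mu x t = x + (\<Sum>i\<in>R. (t $ i) *\<^sub>R mu i x)"

text \<open>
 Each \<open>z \<in> Q\<close> has tube coordinates: the foot point \<open>pj z\<close> on \<open>\<Sigma>\<close>
 and the coefficients \<open>tau z\<close> with respect to the normal frame \<open>mu\<close>.
\<close>

definition tubular :: "'a set => 'i set => ('i => 'a::euclidean_space => 'a) => real => 'a set =>
  ('a => 'a) => ('a => real ^ 'i::finite) => bool" where
 "tubular \<Sigma> R mu dl Q pj tau \<longleftrightarrow> dl > 0 \<and> smooth_on Q pj \<and> smooth_on Q tau \<and>
  (\<forall>x\<in>\<Sigma>. \<forall>t\<in>suppvec R. norm t < dl -->
    tube R mu x t \<in> Q \<and> pj (tube R mu x t) = x \<and> tau (tube R mu x t) = t) \<and>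
  (\<forall>z\<in>Q. pj z \<in> \<Sigma> \<and> tau z \<in> suppvec R \<and> norm (tau z) < dl \<and> tube R mu (pj z) (tau z) = z)"

lemma suppvec_subspace: "subspace (suppvec R)"
 by (auto simp: subspace_def suppvec_def)

lemma closed_suppvec: "closed (suppvec R)"
 by (rule closed_subspace[OF suppvec_subspace])

lemma norm_sum_vec_le:
 fixes t :: "real ^ 'i::finite"
 assumes "\<And>i. i \<in> R ==> norm (a i) \<le> c"  "c \<ge> 0"
 shows "norm (\<Sum>i\<in>R. (t $ i) *\<^sub>R a i) \<le> real (card R) * c * norm t"
proof -
 have "norm (\<Sum>i\<in>R. (t $ i) *\<^sub>R a i) \<le> (\<Sum>i\<in>R. norm t * c)"
 proof (rule sum_norm_le)
  fix i assume "i \<in> R"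
  then show "norm ((t $ i) *\<^sub>R a i) \<le> norm t * c"
   using assms component_le_norm_cart[of t i] by (auto intro: mult_mono)
 qed
 then show ?thesis by (simp add: algebra_simps)
qed

text \<open>
 Orthonormal vectors spanning the orthogonal complement of \<open>W\<close>, as a model of the normal directions.
\<close>

lemma exists_complementary_frame:
 fixes W :: "(real ^ 'n::finite) set" and R :: "'i::finite set"
 assumes W: "subspace W" "dim W + card R = CARD('n)"
 obtains e :: "'i => real ^ 'n" where "\<And>i j. i \<in> R ==> j \<in> R ==> e i \<bullet> e j = (if i = j then 1 else 0)"
  "\<And>i w. i \<in> R ==> w \<in> W ==> e i \<bullet> w = 0" "\<And>y. y - (\<Sum>i\<in>R. (e i \<bullet> y) *\<^sub>R e i) \<in> W"
proof -
 define W' where "W' = {y \<in> UNIV. \<forall>x\<in>W. orthogonal x y}"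
 have W': "subspace W'"
  unfolding W'_def by (auto simp: subspace_def orthogonal_def inner_add_right)
 have "dim W' + dim W = CARD('n)"
  using dim_subspace_orthogonal_to_vectors[of W UNIV] W(1) by (simp add: W'_def)
 then have dW': "dim W' = card R" using W(2) by simp
 obtain B where B: "B \<subseteq> W'" "pairwise orthogonal B" "\<And>x. x \<in> B ==> norm x = 1" "independent B"
  "card B = dim W'" "span B = W'"
  using orthonormal_basis_subspace[OF W'] by metis
 have "finite B" using B(4) by (rule independent_imp_finite)
 then obtain e where e: "bij_betw e R B"
  using B(5) dW' finite_same_card_bij[of R B] by auto
 have eB: "e i \<in> B" if "i \<in> R" for i using e that by (auto simp: bij_betw_def)
 have inj: "e i = e j \<longleftrightarrow> i = j" if "i \<in> R" "j \<in> R" for i j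
  using e that by (auto simp: bij_betw_def inj_on_def)
 have orth: "e i \<bullet> e j = (if i = j then 1 else 0)" if "i \<in> R" "j \<in> R" for i j
 proof (cases "i = j")
  case True
  then show ?thesis using B(3)[OF eB[OF that(1)]] by (simp add: norm_eq_1)
 next
  case False
  then show ?thesis using pairwiseD[OF B(2) eB[OF that(1)] eB[OF that(2)]] inj[OF that]
   by (simp add: orthogonal_def)
 qed
 have eW: "e i \<bullet> w = 0" if "i \<in> R" "w \<in> W" for i w
  using eB[OF that(1)] B(1) that(2) by (auto simp: W'_def orthogonal_def inner_commute)
 have "y - (\<Sum>i\<in>R. (e i \<bullet> y) *\<^sub>R e i) \<in> W" for y
 proof -
  let ?u = "y - (\<Sum>i\<in>R. (e i \<bullet> y) *\<^sub>R e i)"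
  have "orthogonal ?u x" if x: "x \<in> span (e ` R)" for x
  proof (rule orthogonal_to_span[OF x])
   fix z assume "z \<in> e ` R"
   then obtain j where j: "j \<in> R" "z = e j" by auto
   have "?u \<bullet> e j = y \<bullet> e j - (\<Sum>i\<in>R. (e i \<bullet> y) * (e i \<bullet> e j))"
    by (simp add: inner_diff_left inner_sum_left)
   also have "(\<Sum>i\<in>R. (e i \<bullet> y) * (e i \<bullet> e j)) = (\<Sum>i\<in>R. if i = j then e i \<bullet> y else 0)"
    by (rule sum.cong) (auto simp: orth j)
   also have "\<dots> = e j \<bullet> y" using j(1) by (simp add: sum.delta')
   finally show "orthogonal ?u z" using j(2) by (simp add: orthogonal_def inner_commute)
  qed
  moreover have "span (e ` R) = W'" using e B(6) by (simp add: bij_betw_def)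
  ultimately have u: "orthogonal ?u x" if "x \<in> W'" for x using that by simp
  obtain a b where ab: "a \<in> span W" "\<And>w. w \<in> span W ==> orthogonal b w" "?u = a + b"
   using orthogonal_subspace_decomp_exists[of W ?u] by metis
  have "b \<in> W'" using ab(2) span_base by (auto simp: W'_def orthogonal_commute)
  then have "?u \<bullet> b = 0" using u by (simp add: orthogonal_def)
  moreover have "a \<bullet> b = 0" using ab(1,2) by (simp add: orthogonal_def inner_commute)
  ultimately have "b \<bullet> b = 0" using ab(3) by (simp add: inner_add_left)
  then have "?u = a" using ab(3) by simp
  moreover have "a \<in> W" using ab(1) W(1) by (metis span_eq_iff)
  ultimately show ?thesis by (simp only:)
 qed
 with that[of e] orth eW show thesis by blast
qed

text \<open>
 Near a point of \<open>\<Sigma>\<close> the tube map is a local diffeomorphism in coordinates that straighten \<open>\<Sigma>\<close>: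
 its derivative maps the model space of \<open>\<Sigma>\<close> to the tangent space and a complement to the span
 of the frame.
\<close>

lemma tubular_local:
 fixes \<Sigma> :: "(real ^ 'n::finite) set" and R :: "'i::finite set"
 assumes flat: "flat_at d \<Sigma> p" and p: "p \<in> \<Sigma>" and d: "d + card R = CARD('n)"
  and mu: "\<And>i. i \<in> R ==> smooth_map \<Sigma> (mu i)"
  and ind: "inj_on (%i. mu i p) R" "independent ((%i. mu i p) ` R)"
  and nor: "\<And>i. i \<in> R ==> mu i p \<in> normal_space \<Sigma> p"
 obtains A dl B pj and tau :: "real ^ 'n => real ^ 'i" where "open A" "p \<in> A" "dl > 0" "smooth_on B pj" "smooth_on B tau"
  "\<And>x t. x \<in> \<Sigma> ==> x \<in> A ==> t \<in> suppvec R ==> norm t < dl ==>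
   tube R mu x t \<in> B \<and> pj (tube R mu x t) = x \<and> tau (tube R mu x t) = t"
  "\<And>dl'. dl' \<le> dl ==> open {tube R mu x t |x t. x \<in> \<Sigma> \<and> x \<in> A \<and> t \<in> suppvec R \<and> norm t < dl'}"
proof -
 obtain U V f g and W :: "(real ^ 'n) set" where 1: "p \<in> U" "smooth_on U f" "smooth_on V g" "f ` U = V" "g ` V = U"
  "\<forall>x\<in>U. g (f x) = x" "\<forall>y\<in>V. f (g y) = y" "subspace W" "dim W = d" "f ` (\<Sigma> \<inter> U) = W \<inter> V"
  using flat unfolding flat_at_def by metis
 note opU = smooth_on_open[OF 1(2)] and opV = smooth_on_open[OF 1(3)]
 have gW: "g y \<in> \<Sigma>" if "y \<in> W" "y \<in> V" for y
 proof -
  have "y \<in> f ` (\<Sigma> \<inter> U)" using that 1(10) by simp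
  then show ?thesis using 1(6) by auto
 qed
 have fW: "f x \<in> W" "f x \<in> V" if "x \<in> \<Sigma>" "x \<in> U" for x
  using that 1(10) by blast+
 obtain e :: "'i => real ^ 'n" where e: "\<And>i j. i \<in> R ==> j \<in> R ==> e i \<bullet> e j = (if i = j then 1 else 0)"
  "\<And>i w. i \<in> R ==> w \<in> W ==> e i \<bullet> w = 0" "\<And>y. y - (\<Sum>i\<in>R. (e i \<bullet> y) *\<^sub>R e i) \<in> W"
  by (rule exists_complementary_frame[of W R]) (use 1(8,9) d in auto)
 have "\<exists>S m. p \<in> S \<and> open S \<and> smooth_on S m \<and> (\<forall>x\<in>\<Sigma>. x \<in> S --> m x = mu i x)" if "i \<in> R" for i
  using smooth_mapE[OF mu[OF that] p] by metis
 then obtain S m where S: "\<And>i. i \<in> R ==> p \<in> S i \<and> open (S i) \<and> smooth_on (S i) (m i) \<and> (\<forall>x\<in>\<Sigma>. x \<in> S i --> m i x = mu i x)"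
  by metis
 define A0 where "A0 = U \<inter> (\<Inter>i\<in>R. S i)"
 have A0: "open A0" "p \<in> A0" "A0 \<subseteq> U" "\<And>i. i \<in> R ==> A0 \<subseteq> S i"
  unfolding A0_def using S 1(1) opU by (auto intro!: open_Int open_INT)
 have mA0: "smooth_on A0 (m i)" if "i \<in> R" for i
  using S[OF that] smooth_on_subset A0(1) A0(4)[OF that] by blast
 have mmu: "m i x = mu i x" if "i \<in> R" "x \<in> \<Sigma>" "x \<in> A0" for i x
  using S[OF that(1)] that A0(4)[OF that(1)] by auto
 \<comment> \<open>coordinates \<open>P\<close> along \<open>W\<close> and \<open>T\<close> normal to it; \<open>F\<close> is the tube map in these coordinates\<close>
 define P where "P y = y - (\<Sum>i\<in>R. (e i \<bullet> y) *\<^sub>R e i)" for y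
 have linP: "linear P"
  unfolding P_def by (rule linearI) (simp_all add: inner_add_right scaleR_add_left sum.distrib scaleR_diff_right scaleR_sum_right)
 have PW: "P y \<in> W" for y using e(3) by (simp add: P_def)
 have PidW: "P y = y" if "y \<in> W" for y using e(2) that by (simp add: P_def)
 define J where "J t = (\<Sum>i\<in>R. (t $ i) *\<^sub>R e i)" for t :: "real ^ 'i"
 have linJ: "linear J"
  unfolding J_def by (rule linearI) (simp_all add: scaleR_add_left sum.distrib scaleR_sum_right)
 define T where "T y = (\<chi> i. if i \<in> R then e i \<bullet> y else 0)" for y
 have linT: "linear T" unfolding T_def by (rule linearI) (auto simp: vec_eq_iff inner_add_right)
 have Tsupp: "T y \<in> suppvec R" for y by (simp add: T_def suppvec_def)
 have TW: "T y = 0" if "y \<in> W" for y using e(2) that by (simp add: T_def vec_eq_iff)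
 have eJ: "e i \<bullet> J t = t $ i" if "i \<in> R" for i t
 proof -
  have "e i \<bullet> J t = (\<Sum>j\<in>R. (t $ j) * (e i \<bullet> e j))" by (simp add: J_def inner_sum_right)
  also have "\<dots> = (\<Sum>j\<in>R. if i = j then t $ j else 0)" by (rule sum.cong) (auto simp: e(1) that)
  finally show ?thesis using that by simp
 qed
 have TJ: "T (J t) = t" if "t \<in> suppvec R" for t
  using that eJ by (auto simp: T_def vec_eq_iff suppvec_def)
 have PJ: "P (J t) = 0" for t
 proof -
  have "(\<Sum>i\<in>R. (e i \<bullet> J t) *\<^sub>R e i) = J t" unfolding J_def[of t] by (rule sum.cong) (auto simp: eJ[unfolded J_def])
  then show ?thesis by (simp add: P_def)
 qed
 have decomp: "y = P y + J (T y)" for y by (simp add: P_def J_def T_def)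
 define V1 where "V1 = V \<inter> g -` A0"
 have opV1: "open V1" unfolding V1_def by (rule continuous_open_preimage[OF smooth_on_continuous[OF 1(3)] opV A0(1)])
 define Y0 where "Y0 = P -` V1"
 have opY0: "open Y0"
  unfolding Y0_def by (rule open_vimage[OF opV1]) (simp add: linP linear_continuous_on linear_conv_bounded_linear[symmetric])
 define y0 where "y0 = f p"
 have y0: "y0 \<in> W" "y0 \<in> V" "g y0 = p" using fW[OF p 1(1)] 1(1,6) by (auto simp: y0_def)
 have y0Y: "y0 \<in> Y0" using y0 A0(2) PidW by (simp add: Y0_def V1_def)
 have gP: "smooth_on Y0 (%y. g (P y))"
  by (rule smooth_on_compose[OF 1(3) smooth_on_linear[OF linP smooth_on_id[OF opY0]]]) (auto simp: Y0_def V1_def)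
 define F where "F y = g (P y) + (\<Sum>i\<in>R. (T y $ i) *\<^sub>R m i (g (P y)))" for y
 have sF: "smooth_on Y0 F"
  unfolding F_def
 proof (intro smooth_on_add smooth_on_sum smooth_on_scaleR smooth_on_vec_nth smooth_on_linear[OF linT]
   smooth_on_id opY0 gP)
  fix i assume "i \<in> R"
  show "smooth_on Y0 (%y. m i (g (P y)))"
   by (rule smooth_on_compose[OF mA0[OF \<open>i \<in> R\<close>] gP]) (auto simp: Y0_def V1_def)
 qed
 have Ftube: "F y = tube R mu (g (P y)) (T y)" if "y \<in> Y0" for y
  using that mmu gW[OF PW[of y]] by (auto simp: F_def tube_def Y0_def V1_def intro!: sum.cong)
 have Fy0: "F y0 = p" using y0 PidW TW by (simp add: F_def)
 have dg: "(g has_derivative dir_deriv g y0) (at y0)" by (rule smooth_on_has_derivative[OF 1(3) y0(2)])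
 have dgP: "((%y. g (P y)) has_derivative (%v. dir_deriv g y0 (P v))) (at y0)"
  by (rule has_derivative_compose[where f = P and f' = P])
   (use linP y0(1) PidW dg in \<open>simp_all add: linear_imp_has_derivative\<close>)
 have dF: "dir_deriv F y0 v = dir_deriv g y0 (P v) + (\<Sum>i\<in>R. (T v $ i) *\<^sub>R mu i p)" for v
 proof -
  have "((%y. (T y $ i) *\<^sub>R m i (g (P y))) has_derivative (%v. (T v $ i) *\<^sub>R mu i p)) (at y0)" if i: "i \<in> R" for i
  proof -
   have "((%y. T y $ i) has_derivative (%v. T v $ i)) (at y0)"
    by (rule bounded_linear.has_derivative[OF bounded_linear_vec_nth linear_imp_has_derivative[OF linT]])
   moreover have "T y0 $ i = 0" using TW[OF y0(1)] by simp
   moreover have "isCont (%y. m i (g (P y))) y0"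
   proof -
    have "smooth_on Y0 (%y. m i (g (P y)))"
     by (rule smooth_on_compose[OF mA0[OF i] gP]) (auto simp: Y0_def V1_def)
    then show ?thesis using y0Y opY0 smooth_on_continuous by (metis continuous_on_eq_continuous_at)
   qed
   ultimately have "((%y. (T y $ i) *\<^sub>R m i (g (P y))) has_derivative (%v. (T v $ i) *\<^sub>R m i (g (P y0)))) (at y0)"
    by (rule has_derivative_scaleR_zero)
   moreover have "m i (g (P y0)) = mu i p" using mmu[OF i p A0(2)] y0 PidW by simp
   ultimately show ?thesis by simp
  qed
  then have "(F has_derivative (%v. dir_deriv g y0 (P v) + (\<Sum>i\<in>R. (T v $ i) *\<^sub>R mu i p))) (at y0)"
   unfolding F_def by (intro has_derivative_add dgP has_derivative_sum)
  then show ?thesis by (simp add: dir_deriv_eq)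
 qed
 have tang: "dir_deriv g y0 w \<in> tangent_space \<Sigma> p" if w: "w \<in> W" for w
 proof -
  define I where "I = (%s::real. y0 + s *\<^sub>R w) -` V"
  have "open I" unfolding I_def by (rule open_vimage[OF opV]) (intro continuous_intros)
  moreover have "0 \<in> I" using y0 by (simp add: I_def)
  ultimately obtain ep where ep: "ep > 0" "ball 0 ep \<subseteq> I" by (metis open_contains_ball)
  define gm where "gm s = g (y0 + s *\<^sub>R w)" for s
  have inI: "y0 + s *\<^sub>R w \<in> V" if "s \<in> {-ep<..<ep}" for s
   using ep(2) that by (auto simp: I_def ball_eq_greaterThanLessThan)
  have "smooth_on {-ep<..<ep} gm"
   unfolding gm_def
   by (rule smooth_on_compose[OF 1(3)]) (use inI in \<open>auto intro!: smooth_intros\<close>)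
  moreover have "gm ` {-ep<..<ep} \<subseteq> \<Sigma>"
  proof
   fix z assume "z \<in> gm ` {-ep<..<ep}"
   then obtain s where s: "s \<in> {-ep<..<ep}" "z = g (y0 + s *\<^sub>R w)" by (auto simp: gm_def)
   have "y0 + s *\<^sub>R w \<in> W" using y0(1) w 1(8) by (simp add: subspace_add subspace_scale)
   then show "z \<in> \<Sigma>" using gW[OF _ inI[OF s(1)]] s(2) by simp
  qed
  moreover have "gm 0 = p" using y0 by (simp add: gm_def)
  moreover have "(gm has_vector_derivative dir_deriv g y0 w) (at 0)"
  proof -
   have "((%s::real. y0 + s *\<^sub>R w) has_derivative (%s. s *\<^sub>R w)) (at 0)"
    by (auto intro!: derivative_eq_intros)
   moreover have "(g has_derivative dir_deriv g y0) (at (y0 + 0 *\<^sub>R w))" using dg by simp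
   ultimately have "((%s. g (y0 + s *\<^sub>R w)) has_derivative (%s. dir_deriv g y0 (s *\<^sub>R w))) (at 0)"
    by (rule has_derivative_compose)
   then show ?thesis
    unfolding has_vector_derivative_def gm_def
    by (simp add: linear_scale[OF has_derivative_linear[OF dg]])
  qed
  ultimately show ?thesis using ep(1) unfolding tangent_space_def by blast
 qed
 have injF: "inj (dir_deriv F y0)"
  unfolding linear_injective_0[OF dir_deriv_linear[OF sF y0Y]]
 proof (intro allI impI)
  fix v assume "dir_deriv F y0 v = 0"
  then have 0: "dir_deriv g y0 (P v) + (\<Sum>i\<in>R. (T v $ i) *\<^sub>R mu i p) = 0" by (simp add: dF)
  have "dir_deriv g y0 (P v) \<bullet> mu i p = 0" if "i \<in> R" for i
   using nor[OF that] tang[OF PW] by (auto simp: normal_space_def)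
  then have "dir_deriv g y0 (P v) \<bullet> (\<Sum>i\<in>R. (T v $ i) *\<^sub>R mu i p) = 0"
   by (simp add: inner_sum_right)
  moreover have "(\<Sum>i\<in>R. (T v $ i) *\<^sub>R mu i p) = - dir_deriv g y0 (P v)"
   using 0 by (simp add: eq_neg_iff_add_eq_0 add.commute)
  ultimately have dg0: "dir_deriv g y0 (P v) = 0" by simp
  with 0 have "(\<Sum>i\<in>R. (T v $ i) *\<^sub>R mu i p) = 0" by simp
  then have "\<forall>i\<in>R. T v $ i = 0"
   using linear_family_independent_iff[of R "%i. mu i p"] ind by simp
  then have "J (T v) = 0" by (simp add: J_def)
  moreover have "P v = 0"
  proof -
   have df: "(f has_derivative dir_deriv f p) (at (g y0))"
    using smooth_on_has_derivative[OF 1(2,1)] y0(3) by simp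
   have "((%y. f (g y)) has_derivative (%u. dir_deriv f p (dir_deriv g y0 u))) (at y0)"
    by (rule has_derivative_compose[OF dg df])
   then have "((%y. y) has_derivative (%u. dir_deriv f p (dir_deriv g y0 u))) (at y0)"
    by (rule has_derivative_transform_within_open[OF _ opV y0(2)]) (use 1(7) in auto)
   then have "(%u. dir_deriv f p (dir_deriv g y0 u)) = (%u. u)"
    using has_derivative_unique has_derivative_ident by blast
   from fun_cong[OF this, of "P v"] show ?thesis
    using dg0 linear_0[OF dir_deriv_linear[OF 1(2,1)]] by simp
  qed
  ultimately show "v = 0" using decomp[of v] by simp
 qed
 from smooth_local_inverse[OF sF y0Y injF] obtain Y' h where Y': "open Y'" "y0 \<in> Y'" "Y' \<subseteq> Y0"
  "open (F ` Y')" "smooth_on (F ` Y') h" "\<And>x. x \<in> Y' ==> h (F x) = x" by metis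
 obtain ep where ep: "ep > 0" "ball y0 ep \<subseteq> Y'" using Y'(1,2) by (metis open_contains_ball)
 define A where "A = A0 \<inter> (U \<inter> f -` ball y0 (ep/2))"
 have opA: "open A"
  unfolding A_def by (intro open_Int A0(1) continuous_open_preimage[OF smooth_on_continuous[OF 1(2)] opU open_ball])
 have pA: "p \<in> A" using A0(2) 1(1) ep(1) by (simp add: A_def y0_def)
 define dl where "dl = ep / (2 * (real (card R) + 1))"
 have dl: "dl > 0" using ep(1) by (simp add: dl_def)
 have fJ: "f x + J t \<in> Y' \<and> P (f x + J t) = f x \<and> T (f x + J t) = t \<and> F (f x + J t) = tube R mu x t"
  if x: "x \<in> \<Sigma>" "x \<in> A" and t: "t \<in> suppvec R" "norm t < dl" for x t
 proof -
  have xU: "x \<in> U" "x \<in> A0" "dist y0 (f x) < ep/2" using x(2) by (auto simp: A_def)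
  note fx = fW[OF x(1) xU(1)]
  have "norm (J t) \<le> real (card R) * 1 * norm t"
   unfolding J_def by (rule norm_sum_vec_le) (use e(1) in \<open>auto simp: norm_eq_sqrt_inner\<close>)
  also have "\<dots> \<le> (real (card R) + 1) * norm t" by (simp add: algebra_simps)
  also have "\<dots> < (real (card R) + 1) * dl" using t(2) by (intro mult_strict_left_mono) auto
  also have "\<dots> = ep / 2"
  proof -
   define k where "k = real (card R) + 1"
   have "k > 0" by (simp add: k_def)
   then have "k * (ep / (2 * k)) = ep / 2" by simp
   then show ?thesis by (simp only: dl_def k_def)
  qed
  finally have "norm (J t) < ep / 2" .
  moreover have "dist y0 (f x + J t) \<le> dist y0 (f x) + norm (J t)"
   by (metis add_diff_cancel_left' dist_norm dist_triangle norm_minus_commute)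
  ultimately have "dist y0 (f x + J t) < ep" using xU(3) by linarith
  then have Y: "f x + J t \<in> Y'" using ep(2) by auto
  have P: "P (f x + J t) = f x" using linear_add[OF linP] PidW[OF fx(1)] PJ by simp
  have T: "T (f x + J t) = t" using linear_add[OF linT] TW[OF fx(1)] TJ[OF t(1)] by simp
  have "F (f x + J t) = tube R mu x t" using Ftube[of "f x + J t"] Y Y'(3) P T 1(6) xU(1) by auto
  then show ?thesis using Y P T by simp
 qed
 have hY: "h z \<in> Y'" if "z \<in> F ` Y'" for z using that Y'(6) by auto
 show thesis
 proof (rule that[OF opA pA dl])
  show "smooth_on (F ` Y') (%z. g (P (h z)))"
   by (rule smooth_on_compose[OF gP Y'(5)]) (use hY Y'(3) in auto)
  show "smooth_on (F ` Y') (%z. T (h z))" by (rule smooth_on_linear[OF linT Y'(5)])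
  show "tube R mu x t \<in> F ` Y' \<and> g (P (h (tube R mu x t))) = x \<and> T (h (tube R mu x t)) = t"
   if "x \<in> \<Sigma>" "x \<in> A" "t \<in> suppvec R" "norm t < dl" for x t
  proof -
   from fJ[OF that] have y: "f x + J t \<in> Y'" "P (f x + J t) = f x" "T (f x + J t) = t" "tube R mu x t = F (f x + J t)"
    by auto
   moreover have "g (f x) = x" using that(2) 1(6) by (simp add: A_def)
   ultimately show ?thesis using Y'(6)[OF y(1)] by simp
  qed
  show "open {tube R mu x t |x t. x \<in> \<Sigma> \<and> x \<in> A \<and> t \<in> suppvec R \<and> norm t < dl'}" if dl': "dl' \<le> dl" for dl'
  proof -
   define Y2 where "Y2 = (Y' \<inter> (%y. g (P y)) -` A) \<inter> (%y. norm (T y)) -` {..<dl'}"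
   have "open Y2"
   proof -
    have "continuous_on Y' (%y. g (P y))" using smooth_on_continuous[OF gP] Y'(3) continuous_on_subset by blast
    moreover have "continuous_on UNIV (%y. norm (T y))"
     using linT by (intro continuous_on_norm) (simp add: linear_continuous_on linear_conv_bounded_linear[symmetric])
    ultimately show ?thesis
     unfolding Y2_def by (intro open_Int continuous_open_preimage Y'(1) opA open_vimage open_lessThan)
   qed
   have "{tube R mu x t |x t. x \<in> \<Sigma> \<and> x \<in> A \<and> t \<in> suppvec R \<and> norm t < dl'} = F ` Y' \<inter> h -` Y2"
   proof (intro set_eqI iffI)
    fix z assume "z \<in> {tube R mu x t |x t. x \<in> \<Sigma> \<and> x \<in> A \<and> t \<in> suppvec R \<and> norm t < dl'}"
    then obtain x t where xt: "z = tube R mu x t" "x \<in> \<Sigma>" "x \<in> A" "t \<in> suppvec R" "norm t < dl'" by auto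
    then have "norm t < dl" using dl' by simp
    note y = fJ[OF xt(2-4) this]
    have "g (f x) = x" using xt(3) 1(6) by (simp add: A_def)
    then have "f x + J t \<in> Y2" using y xt by (simp add: Y2_def)
    moreover have "h z = f x + J t" "z \<in> F ` Y'" using y xt(1) Y'(6) by (metis, metis image_eqI)
    ultimately show "z \<in> F ` Y' \<inter> h -` Y2" by simp
   next
    fix z assume "z \<in> F ` Y' \<inter> h -` Y2"
    then obtain y where y: "y \<in> Y'" "z = F y" "y \<in> Y2" using Y'(6) by auto
    then have "z = tube R mu (g (P y)) (T y)" using Ftube Y'(3) by auto
    moreover have "g (P y) \<in> \<Sigma>" using y(1) Y'(3) gW[OF PW] by (auto simp: Y0_def V1_def)
    ultimately show "z \<in> {tube R mu x t |x t. x \<in> \<Sigma> \<and> x \<in> A \<and> t \<in> suppvec R \<and> norm t < dl'}"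
     using y(3) Tsupp[of y] by (auto simp: Y2_def)
   qed
   moreover have "open (F ` Y' \<inter> h -` Y2)"
    by (rule continuous_open_preimage[OF smooth_on_continuous[OF Y'(5)] Y'(4) \<open>open Y2\<close>])
   ultimately show ?thesis by simp
  qed
 qed
qed

lemma frame_bounded:
 fixes R :: "'i::finite set"
 assumes \<Sigma>: "compact \<Sigma>" and mu: "\<And>i. i \<in> R ==> smooth_map \<Sigma> (mu i)"
 shows "\<exists>c\<ge>0. \<forall>i\<in>R. \<forall>x\<in>\<Sigma>. norm (mu i x) \<le> c"
proof -
 have "bounded (\<Union>i\<in>R. mu i ` \<Sigma>)"
  using compact_imp_bounded[OF compact_continuous_image[OF smooth_map_continuous_on[OF mu] \<Sigma>]]
  by (intro bounded_UN) auto
 then obtain c where "\<forall>y\<in>(\<Union>i\<in>R. mu i ` \<Sigma>). norm y \<le> c" by (auto simp: bounded_iff)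
 then show ?thesis by (intro exI[of _ "max c 0"]) (auto intro: max.coboundedI1)
qed

text \<open>
 The local tube coordinates agree where they overlap: by compactness, for a small radius any two discs that meet have
 feet in one of finitely many sets on which the tube map is injective.
\<close>

lemma tubular_neighbourhood_exists:
 fixes \<Sigma> :: "(real ^ 'n::finite) set" and R :: "'i::finite set"
 assumes \<Sigma>: "compact \<Sigma>" "submanifold d \<Sigma>" and d: "d + card R = CARD('n)"
  and mu: "\<And>i. i \<in> R ==> smooth_map \<Sigma> (mu i)"
  and ind: "\<And>p. p \<in> \<Sigma> ==> inj_on (%i. mu i p) R \<and> independent ((%i. mu i p) ` R)"
  and nor: "\<And>p i. p \<in> \<Sigma> ==> i \<in> R ==> mu i p \<in> normal_space \<Sigma> p"
 obtains dl Q pj and tau :: "real ^ 'n => real ^ 'i" where "tubular \<Sigma> R mu dl Q pj tau"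
proof -
 define loc where "loc A dl B pj tau \<longleftrightarrow> open A \<and> dl > 0 \<and> smooth_on B pj \<and> smooth_on B tau \<and>
  (\<forall>x t. x \<in> \<Sigma> --> x \<in> A --> t \<in> suppvec R --> norm t < dl -->
   tube R mu x t \<in> B \<and> pj (tube R mu x t) = x \<and> tau (tube R mu x t) = t) \<and>
  (\<forall>dl'\<le>dl. open {tube R mu x t |x t. x \<in> \<Sigma> \<and> x \<in> A \<and> t \<in> suppvec R \<and> norm t < dl'})"
  for A dl B pj and tau :: "real ^ 'n => real ^ 'i"
 have "\<exists>A dl B pj tau. p \<in> A \<and> loc A dl B pj tau" if p: "p \<in> \<Sigma>" for p
 proof -
  have flat: "flat_at d \<Sigma> p" using \<Sigma>(2) p by (simp add: submanifold_iff_flat_at)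
  show ?thesis
  proof (rule tubular_local[OF flat p d mu conjunct1[OF ind[OF p]] conjunct2[OF ind[OF p]] nor[OF p]])
   fix A dl B pj and tau :: "real ^ 'n => real ^ 'i"
   assume *: "open A" "p \<in> A" "dl > 0" "smooth_on B pj" "smooth_on B tau"
    "\<And>x t. x \<in> \<Sigma> ==> x \<in> A ==> t \<in> suppvec R ==> norm t < dl ==>
     tube R mu x t \<in> B \<and> pj (tube R mu x t) = x \<and> tau (tube R mu x t) = t"
    "\<And>dl'. dl' \<le> dl ==> open {tube R mu x t |x t. x \<in> \<Sigma> \<and> x \<in> A \<and> t \<in> suppvec R \<and> norm t < dl'}"
   show ?thesis
    by (intro exI[of _ A] exI[of _ dl] exI[of _ B] exI[of _ pj] exI[of _ tau])
     (simp add: loc_def *(1-6), intro allI impI *(7), assumption)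
  qed
 qed
 then obtain A dl1 B pj1 and tau1 :: "real ^ 'n => real ^ 'n => real ^ 'i" where
  loc: "\<And>p. p \<in> \<Sigma> ==> p \<in> A p" "\<And>p. p \<in> \<Sigma> ==> loc (A p) (dl1 p) (B p) (pj1 p) (tau1 p)"
  by metis
 have opA: "open (A p)" if "p \<in> \<Sigma>" for p using loc(2)[OF that] by (simp add: loc_def)
 have cov: "\<Sigma> \<subseteq> (\<Union>p\<in>\<Sigma>. A p)" using loc(1) by auto
 obtain D where D: "D \<subseteq> \<Sigma>" "finite D" "\<Sigma> \<subseteq> (\<Union>p\<in>D. A p)"
  using compactE_image[OF \<Sigma>(1) opA cov] by metis
 obtain ep where ep: "ep > 0" "\<And>x. x \<in> \<Sigma> ==> \<exists>G\<in>A ` D. ball x ep \<subseteq> G"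
 proof -
  have cov': "\<Sigma> \<subseteq> \<Union>(A ` D)" using D(3) by simp
  have op': "open G" if "G \<in> A ` D" for G using that D(1) opA by auto
  show ?thesis
  proof (rule Heine_Borel_lemma[OF \<Sigma>(1) cov' op'])
   fix ep :: real assume "0 < ep" "\<And>x. x \<in> \<Sigma> ==> \<exists>G\<in>A ` D. ball x ep \<subseteq> G"
   then show thesis by (rule that)
  qed
 qed
 obtain c where c: "c \<ge> 0" "\<And>i x. i \<in> R ==> x \<in> \<Sigma> ==> norm (mu i x) \<le> c"
 proof -
  have "\<exists>c\<ge>0. \<forall>i\<in>R. \<forall>x\<in>\<Sigma>. norm (mu i x) \<le> c" by (rule frame_bounded[OF \<Sigma>(1)]) (rule mu)
  then obtain c where "c \<ge> 0" "\<forall>i\<in>R. \<forall>x\<in>\<Sigma>. norm (mu i x) \<le> c" by auto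
  then show ?thesis by (intro that[of c]) auto
 qed
 define C where "C = real (card R) * c"
 have C: "C \<ge> 0" using c(1) by (simp add: C_def)
 have tube_dist: "dist (tube R mu x t) x \<le> C * norm t" if "x \<in> \<Sigma>" for x t
  using norm_sum_vec_le[of R "%i. mu i x" c t] c that by (simp add: tube_def dist_norm C_def)
 define dl where "dl = Min (insert (ep / (2 * (C + 1))) (dl1 ` D))"
 have dl1: "dl1 p > 0" if "p \<in> \<Sigma>" for p using loc(2)[OF that] by (simp add: loc_def)
 have dl: "dl > 0" "dl \<le> ep / (2 * (C + 1))" "\<And>p. p \<in> D ==> dl \<le> dl1 p"
  unfolding dl_def using D dl1 ep(1) C by (auto simp: Min_gr_iff)
 define Om where "Om p = {tube R mu x t |x t. x \<in> \<Sigma> \<and> x \<in> A p \<and> t \<in> suppvec R \<and> norm t < dl}" for p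
 have opOm: "open (Om p)" if "p \<in> D" for p
 proof -
  have "p \<in> \<Sigma>" using D(1) that by auto
  note L = loc(2)[OF this, unfolded loc_def]
  have "\<forall>dl'\<le>dl1 p. open {tube R mu x t |x t. x \<in> \<Sigma> \<and> x \<in> A p \<and> t \<in> suppvec R \<and> norm t < dl'}"
   by (rule conjunct2[OF conjunct2[OF conjunct2[OF conjunct2[OF conjunct2[OF L]]]]])
  from mp[OF spec[OF this, of dl] dl(3)[OF that]] show ?thesis unfolding Om_def .
 qed
 have locp: "tube R mu x t \<in> B p \<and> pj1 p (tube R mu x t) = x \<and> tau1 p (tube R mu x t) = t"
  if "p \<in> D" "x \<in> \<Sigma>" "x \<in> A p" "t \<in> suppvec R" "norm t < dl" for p x t
 proof -
  have "norm t < dl1 p" using that(5) dl(3)[OF that(1)] by simp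
  have "p \<in> \<Sigma>" using D(1) that(1) by auto
  note L = loc(2)[OF this, unfolded loc_def]
  have "\<forall>x t. x \<in> \<Sigma> --> x \<in> A p --> t \<in> suppvec R --> norm t < dl1 p -->
   tube R mu x t \<in> B p \<and> pj1 p (tube R mu x t) = x \<and> tau1 p (tube R mu x t) = t"
   by (rule conjunct1[OF conjunct2[OF conjunct2[OF conjunct2[OF conjunct2[OF L]]]]])
  with that(2-4) \<open>norm t < dl1 p\<close> show ?thesis by simp
 qed
 have unique: "x = x' \<and> t = t'"
  if "x \<in> \<Sigma>" "t \<in> suppvec R" "norm t < dl" "x' \<in> \<Sigma>" "t' \<in> suppvec R" "norm t' < dl"
   "tube R mu x t = tube R mu x' t'" for x t x' t'
 proof -
  have "dist x x' \<le> dist (tube R mu x t) x + dist (tube R mu x' t') x'"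
   using that(7) by (metis dist_commute dist_triangle)
  also have "\<dots> \<le> C * norm t + C * norm t'" by (intro add_mono tube_dist that)
  also have "\<dots> \<le> C * dl + C * dl" using C that by (intro add_mono mult_left_mono) auto
  also have "\<dots> < 2 * (C + 1) * dl" using dl(1) by (simp add: algebra_simps)
  also have "\<dots> \<le> ep" using dl(2) C by (simp add: field_simps)
  finally have "x' \<in> ball x ep" by simp
  moreover from ep(2)[OF that(1)] obtain p where p: "p \<in> D" "ball x ep \<subseteq> A p" by auto
  moreover have "x \<in> ball x ep" using ep(1) by simp
  ultimately have xA: "x \<in> A p" and xA': "x' \<in> A p" by auto
  note 1 = locp[OF p(1) that(1) xA that(2,3)] and 2 = locp[OF p(1) that(4) xA' that(5,6)]
  have "x = pj1 p (tube R mu x t)" by (rule sym, rule conjunct1[OF conjunct2[OF 1]])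
  also have "\<dots> = pj1 p (tube R mu x' t')" by (simp only: that(7))
  also have "\<dots> = x'" by (rule conjunct1[OF conjunct2[OF 2]])
  finally have x: "x = x'" .
  have "t = tau1 p (tube R mu x t)" by (rule sym, rule conjunct2[OF conjunct2[OF 1]])
  also have "\<dots> = tau1 p (tube R mu x' t')" by (simp only: that(7))
  also have "\<dots> = t'" by (rule conjunct2[OF conjunct2[OF 2]])
  finally show ?thesis using x by (rule conjI[rotated])
 qed
 define Q where "Q = (\<Union>p\<in>D. Om p)"
 have opQ: "open Q" unfolding Q_def using opOm by auto
 have Qiff: "z \<in> Q \<longleftrightarrow> (\<exists>x t. z = tube R mu x t \<and> x \<in> \<Sigma> \<and> t \<in> suppvec R \<and> norm t < dl)" for z
  unfolding Q_def Om_def using D(3) by blast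
 have "\<exists>x t. z \<in> Q --> z = tube R mu x t \<and> x \<in> \<Sigma> \<and> t \<in> suppvec R \<and> norm t < dl" for z
  using Qiff by blast
 then obtain pj tau where pjtau: "\<And>z. z \<in> Q ==> z = tube R mu (pj z) (tau z)" "\<And>z. z \<in> Q ==> pj z \<in> \<Sigma>"
  "\<And>z. z \<in> Q ==> tau z \<in> suppvec R" "\<And>z. z \<in> Q ==> norm (tau z) < dl" by metis
 have inv: "pj (tube R mu x t) = x \<and> tau (tube R mu x t) = t" if "x \<in> \<Sigma>" "t \<in> suppvec R" "norm t < dl" for x t
 proof -
  have "tube R mu x t \<in> Q" using Qiff that by blast
  from unique[OF pjtau(2-4)[OF this] that pjtau(1)[OF this, symmetric]] show ?thesis .
 qed
 have sm: "\<exists>W. z \<in> W \<and> smooth_on W pj \<and> smooth_on W tau" if "z \<in> Q" for z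
 proof -
  obtain p where p: "p \<in> D" "z \<in> Om p" using \<open>z \<in> Q\<close> by (auto simp: Q_def)
  have s: "smooth_on (B p) (pj1 p)" "smooth_on (B p) (tau1 p)" using loc(2)[of p] D(1) p(1) by (auto simp: loc_def)
  have sub: "Om p \<subseteq> B p" using locp[OF p(1)] by (auto simp: Om_def)
  have eq: "pj1 p y = pj y \<and> tau1 p y = tau y" if "y \<in> Om p" for y
  proof -
   from \<open>y \<in> Om p\<close> obtain x t where xt: "y = tube R mu x t" "x \<in> \<Sigma>" "x \<in> A p" "t \<in> suppvec R" "norm t < dl"
    by (auto simp: Om_def)
   then show ?thesis using locp[OF p(1) xt(2-5)] inv[OF xt(2,4,5)] by simp
  qed
  have "smooth_on (Om p) pj"
   by (rule smooth_on_cong[OF smooth_on_subset[OF s(1) opOm[OF p(1)] sub]]) (simp add: eq)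
  moreover have "smooth_on (Om p) tau"
   by (rule smooth_on_cong[OF smooth_on_subset[OF s(2) opOm[OF p(1)] sub]]) (simp add: eq)
  ultimately show ?thesis using p(2) by blast
 qed
 have "smooth_on Q pj" "smooth_on Q tau"
  by (rule smooth_on_local[OF _ opQ], use sm in blast)+
 moreover have "tube R mu x t \<in> Q" if "x \<in> \<Sigma>" "t \<in> suppvec R" "norm t < dl" for x t
  using Qiff that by blast
 ultimately have "tubular \<Sigma> R mu dl Q pj tau"
  unfolding tubular_def using dl(1) inv pjtau by auto
 then show thesis by (rule that)
qed

text \<open>
 The frame is defined on \<open>\<Sigma>\<close> only, but it extends smoothly to a neighbourhood of every point, and
 the projection takes its values in \<open>\<Sigma>\<close>.
\<close>

lemma smooth_frame_along_projection:
 assumes tub: "tubular \<Sigma> R mu dl Q pj tau" and mu: "smooth_map \<Sigma> (mu i)"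
 shows "smooth_on Q (%z. mu i (pj z))"
  and "z \<in> Q ==> \<exists>D. linear D \<and> ((%z. mu i (pj z)) has_derivative (%v. D (dir_deriv pj z v))) (at z)"
proof -
 have spj: "smooth_on Q pj" and pj\<Sigma>: "\<And>z. z \<in> Q ==> pj z \<in> \<Sigma>" using tub by (auto simp: tubular_def)
 have ex: "\<exists>W S m. z \<in> W \<and> open W \<and> W \<subseteq> Q \<and> smooth_on S m \<and> pj ` W \<subseteq> S \<and> (\<forall>y\<in>W. m (pj y) = mu i (pj y))"
  if z: "z \<in> Q" for z
 proof -
  obtain S m where S: "pj z \<in> S" "open S" "smooth_on S m" "\<And>x. x \<in> \<Sigma> ==> x \<in> S ==> m x = mu i x"
   using smooth_mapE[OF mu pj\<Sigma>[OF z]] by metis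
  have "open (Q \<inter> pj -` S)"
   by (rule continuous_open_preimage[OF smooth_on_continuous[OF spj] smooth_on_open[OF spj] S(2)])
  then show ?thesis using S z pj\<Sigma>
   by (intro exI[of _ "Q \<inter> pj -` S"] exI[of _ S] exI[of _ m]) auto
 qed
 show "smooth_on Q (%z. mu i (pj z))"
 proof (rule smooth_on_local[OF _ smooth_on_open[OF spj]])
  fix z assume "z \<in> Q"
  from ex[OF this] obtain W S m where W: "z \<in> W" "open W" "W \<subseteq> Q" "smooth_on S m" "pj ` W \<subseteq> S"
   "\<forall>y\<in>W. m (pj y) = mu i (pj y)" by blast
  have "smooth_on W (%z. m (pj z))"
   by (rule smooth_on_compose[OF W(4) smooth_on_subset[OF spj W(2,3)] W(5)])
  then have "smooth_on W (%z. mu i (pj z))" by (rule smooth_on_cong) (use W(6) in simp)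
  then show "\<exists>W. z \<in> W \<and> smooth_on W (%z. mu i (pj z))" using W(1) by blast
 qed
 show "\<exists>D. linear D \<and> ((%z. mu i (pj z)) has_derivative (%v. D (dir_deriv pj z v))) (at z)" if z: "z \<in> Q"
 proof -
  from ex[OF z] obtain W S m where W: "z \<in> W" "open W" "W \<subseteq> Q" "smooth_on S m" "pj ` W \<subseteq> S"
   "\<forall>y\<in>W. m (pj y) = mu i (pj y)" by blast
  have zS: "pj z \<in> S" using W(1,5) by auto
  have "((%z. m (pj z)) has_derivative (%v. dir_deriv m (pj z) (dir_deriv pj z v))) (at z)"
   by (rule has_derivative_compose[OF smooth_on_has_derivative[OF spj z] smooth_on_has_derivative[OF W(4) zS]])
  then have "((%z. mu i (pj z)) has_derivative (%v. dir_deriv m (pj z) (dir_deriv pj z v))) (at z)"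
   by (rule has_derivative_transform_within_open[OF _ W(2,1)]) (use W(6) in simp)
  then show ?thesis using dir_deriv_linear[OF W(4) zS] by blast
 qed
qed

text \<open>
 Every map \<open>g\<close> that is \<open>C\<^sup>1\<close>-close to the normal coordinate \<open>tau\<close> has exactly one zero on each normal
 disc, by Brouwer's fixed point theorem and because \<open>t - g\<close> is a contraction on the disc. The
 resulting section of the tube is the local inverse of \<open>z \<mapsto> pj z + g z\<close> (in tube coordinates), so it is smooth.
\<close>

lemma zero_set_stable:
 fixes \<Sigma> :: "(real ^ 'n::finite) set" and R :: "'i::finite set"
 assumes \<Sigma>: "compact \<Sigma>" and mu: "\<And>i. i \<in> R ==> smooth_map \<Sigma> (mu i)"
  and tub: "tubular \<Sigma> R mu dl Q pj tau"
 defines "N \<equiv> {z \<in> Q. norm (tau z) \<le> dl / 2}"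
 obtains eta where "eta > 0" "compact N"
  "\<And>g Q'. smooth_on Q' g ==> N \<subseteq> Q' ==> (\<And>z. z \<in> Q' ==> g z \<in> suppvec R) ==>
   (\<And>z. z \<in> N ==> norm (g z - tau z) \<le> eta) ==>
   (\<And>z v. z \<in> N ==> norm (dir_deriv g z v - dir_deriv tau z v) \<le> eta * norm v) ==>
   compact {z \<in> N. g z = 0} \<and> {z \<in> N. g z = 0} \<subseteq> {z \<in> Q. norm (tau z) < dl / 2} \<and>
   diffeomorphic \<Sigma> {z \<in> N. g z = 0}"
proof -
 have dl: "dl > 0" and spj: "smooth_on Q pj" and stau: "smooth_on Q tau"
  and tin: "\<And>x t. x \<in> \<Sigma> ==> t \<in> suppvec R ==> norm t < dl ==>
    tube R mu x t \<in> Q \<and> pj (tube R mu x t) = x \<and> tau (tube R mu x t) = t"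
  and tout: "\<And>z. z \<in> Q ==> pj z \<in> \<Sigma> \<and> tau z \<in> suppvec R \<and> norm (tau z) < dl \<and> tube R mu (pj z) (tau z) = z"
  using tub by (auto simp: tubular_def)
 note opQ = smooth_on_open[OF spj]
 define K :: "(real ^ 'i) set" where "K = cball 0 (dl / 2) \<inter> suppvec R"
 have K: "compact K" "convex K" "0 \<in> K"
  unfolding K_def using dl subspace_0[OF suppvec_subspace]
  by (auto intro!: compact_Int_closed closed_suppvec convex_Int subspace_imp_convex[OF suppvec_subspace])
 have Kdl: "t \<in> suppvec R \<and> norm t < dl" if "t \<in> K" for t using that dl by (auto simp: K_def)
 have Neq: "N = (%(x, t). tube R mu x t) ` (\<Sigma> \<times> K)"
 proof (intro set_eqI iffI)
  fix z assume "z \<in> N"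
  then have "z = (%(x, t). tube R mu x t) (pj z, tau z)" "(pj z, tau z) \<in> \<Sigma> \<times> K" using tout by (auto simp: N_def K_def)
  then show "z \<in> (%(x, t). tube R mu x t) ` (\<Sigma> \<times> K)" by (rule image_eqI)
 next
  fix z assume "z \<in> (%(x, t). tube R mu x t) ` (\<Sigma> \<times> K)"
  then obtain x t where "x \<in> \<Sigma>" "t \<in> K" "z = tube R mu x t" by auto
  then show "z \<in> N" using tin[of x t] Kdl[of t] by (auto simp: N_def K_def)
 qed
 have cN: "compact N"
 proof -
  have "continuous_on (\<Sigma> \<times> K) (%z. fst z + (\<Sum>i\<in>R. (snd z $ i) *\<^sub>R mu i (fst z)))"
  proof (intro continuous_on_add continuous_on_sum continuous_on_scaleR continuous_on_fst
    bounded_linear.continuous_on[OF bounded_linear_vec_nth] continuous_on_snd continuous_on_id)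
   fix i assume "i \<in> R"
   show "continuous_on (\<Sigma> \<times> K) (%z. mu i (fst z))"
    by (rule continuous_on_compose2[OF smooth_map_continuous_on[OF mu[OF \<open>i \<in> R\<close>]]])
     (auto intro: continuous_on_fst continuous_on_id)
  qed
  then show ?thesis
   unfolding Neq using compact_continuous_image[OF _ compact_Times[OF \<Sigma> K(1)]]
   by (simp add: tube_def case_prod_beta)
 qed
 obtain c where c: "c \<ge> 0" "\<And>i x. i \<in> R ==> x \<in> \<Sigma> ==> norm (mu i x) \<le> c"
 proof -
  have "\<exists>c\<ge>0. \<forall>i\<in>R. \<forall>x\<in>\<Sigma>. norm (mu i x) \<le> c" by (rule frame_bounded[OF \<Sigma>]) (rule mu)
  then obtain c where "c \<ge> 0" "\<forall>i\<in>R. \<forall>x\<in>\<Sigma>. norm (mu i x) \<le> c" by auto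
  then show ?thesis by (intro that[of c]) auto
 qed
 define C where "C = real (card R) * c"
 have C: "C \<ge> 0" using c(1) by (simp add: C_def)
 define J where "J x s = (\<Sum>i\<in>R. (s $ i) *\<^sub>R mu i x)" for x and s :: "real ^ 'i"
 have J: "norm (J x s) \<le> C * norm s" if "x \<in> \<Sigma>" for x s
  using norm_sum_vec_le[of R "%i. mu i x" c s] c that by (simp add: J_def C_def)
 \<comment> \<open>\<open>dl / 4\<close> keeps the zeros in the half-size tube; the other bound makes \<open>t - g\<close> a contraction with factor \<open>1 / 2\<close>\<close>
 define eta where "eta = min (dl / 4) (1 / (2 * (C + 1)))"
 have eta: "eta > 0" "eta \<le> dl / 4" using dl C by (auto simp: eta_def)
 have etaC: "eta * C \<le> 1 / 2"
 proof -
  have "eta * C \<le> 1 / (2 * (C + 1)) * C" using C by (intro mult_right_mono) (auto simp: eta_def)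
  also have "\<dots> \<le> 1 / 2" using C by (simp add: field_simps)
  finally show ?thesis .
 qed
 have dtube: "((%u. tube R mu x (t + u *\<^sub>R s)) has_derivative (%u. u *\<^sub>R J x s)) (at u0)" for x t s and u0 :: real
  unfolding tube_def J_def
  by (auto intro!: derivative_eq_intros simp: scaleR_sum_right)
 have dtau: "dir_deriv tau (tube R mu x t) (J x s) = s"
  if "x \<in> \<Sigma>" "t \<in> suppvec R" "norm t < dl" "s \<in> suppvec R" for x t s
 proof -
  have "(tau has_derivative dir_deriv tau (tube R mu x t)) (at (tube R mu x (t + 0 *\<^sub>R s)))"
   using smooth_on_has_derivative[OF stau, of "tube R mu x t"] tin[OF that(1-3)] by simp
  from has_derivative_compose[OF dtube this]
  have 1: "((%u. tau (tube R mu x (t + u *\<^sub>R s))) has_derivative (%u. dir_deriv tau (tube R mu x t) (u *\<^sub>R J x s))) (at 0)" .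
  define I where "I = (%u::real. norm (t + u *\<^sub>R s)) -` {..<dl}"
  have "open I" unfolding I_def by (intro open_vimage continuous_intros open_lessThan)
  moreover have "0 \<in> I" using that by (simp add: I_def)
  ultimately have "((%u. t + u *\<^sub>R s) has_derivative (%u. dir_deriv tau (tube R mu x t) (u *\<^sub>R J x s))) (at 0)"
   using that tin by (intro has_derivative_transform_within_open[OF 1])
    (auto simp: I_def suppvec_subspace subspace_add subspace_scale)
  moreover have "((%u::real. t + u *\<^sub>R s) has_derivative (%u. u *\<^sub>R s)) (at 0)"
   by (auto intro!: derivative_eq_intros)
  ultimately have "(%u::real. dir_deriv tau (tube R mu x t) (u *\<^sub>R J x s)) = (%u. u *\<^sub>R s)"
   by (rule has_derivative_unique)
  from fun_cong[OF this, of 1] show ?thesis by simp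
 qed
 have main: "compact {z \<in> N. g z = 0} \<and> {z \<in> N. g z = 0} \<subseteq> {z \<in> Q. norm (tau z) < dl / 2} \<and>
   diffeomorphic \<Sigma> {z \<in> N. g z = 0}"
  if g: "smooth_on Q' g" and NQ: "N \<subseteq> Q'" and gR: "\<And>z. z \<in> Q' ==> g z \<in> suppvec R"
   and close0: "\<And>z. z \<in> N ==> norm (g z - tau z) \<le> eta"
   and close1: "\<And>z v. z \<in> N ==> norm (dir_deriv g z v - dir_deriv tau z v) \<le> eta * norm v" for g Q'
 proof -
  let ?Z = "{z \<in> N. g z = 0}"
  have contg: "continuous_on N g" using smooth_on_continuous[OF g] NQ continuous_on_subset by blast
  have "?Z = N \<inter> g -` {0}" by auto
  moreover have "closed (N \<inter> g -` {0})"
   by (rule continuous_closed_preimage[OF contg compact_imp_closed[OF cN]]) simp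
  ultimately have cZ: "compact ?Z" using compact_Int_closed[OF cN, of ?Z] by (simp add: Int_absorb1)
  have Zin: "norm (tau z) < dl / 2" if "z \<in> ?Z" for z
   using close0[of z] that eta(2) dl by simp
  have tN: "tube R mu x t \<in> N" if "x \<in> \<Sigma>" "t \<in> K" for x t using that Neq by auto
  have tQ': "tube R mu x t \<in> Q'" if "x \<in> \<Sigma>" "t \<in> K" for x t using tN[OF that] NQ by auto
  have exist: "\<exists>t\<in>K. g (tube R mu x t) = 0" if x: "x \<in> \<Sigma>" for x
  proof -
   define phi where "phi t = t - g (tube R mu x t)" for t
   have "continuous_on K phi"
    unfolding phi_def tube_def
    by (intro continuous_on_diff continuous_on_id continuous_on_compose2[OF contg])
     (use tN[OF x] in \<open>auto simp: tube_def intro!: continuous_intros\<close>)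
   moreover have "phi t \<in> K" if t: "t \<in> K" for t
   proof -
    have "norm (phi t) \<le> eta"
     using close0[OF tN[OF x t]] tin[OF x] Kdl[OF t] by (simp add: phi_def norm_minus_commute)
    moreover have "phi t \<in> suppvec R"
     using gR[OF tQ'[OF x t]] Kdl[OF t] by (simp add: phi_def subspace_diff[OF suppvec_subspace])
    ultimately show ?thesis using eta(2) dl by (simp add: K_def)
   qed
   ultimately obtain t where "t \<in> K" "phi t = t"
    using brouwer[OF K(1,2), of phi] K(3) by auto
   then show ?thesis by (auto simp: phi_def)
  qed
  have near: "norm (dir_deriv g (tube R mu x t) (J x s) - s) \<le> 1 / 2 * norm s"
   if "x \<in> \<Sigma>" "t \<in> K" "s \<in> suppvec R" for x t s
  proof -
   have "norm (dir_deriv g (tube R mu x t) (J x s) - s) \<le> eta * norm (J x s)"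
    using close1[OF tN[OF that(1,2)], of "J x s"] dtau[OF that(1) _ _ that(3), of t] Kdl[OF that(2)] by simp
   also have "\<dots> \<le> eta * (C * norm s)" using J[OF that(1)] eta(1) by (intro mult_left_mono) auto
   also have "\<dots> \<le> 1 / 2 * norm s" using mult_right_mono[OF etaC norm_ge_zero[of s]] by (simp add: mult.assoc)
   finally show ?thesis .
  qed
  have uniq: "t = t'" if x: "x \<in> \<Sigma>" and t: "t \<in> K" "t' \<in> K" and eq: "g (tube R mu x t) = g (tube R mu x t')" for x t t'
  proof -
   define s where "s = t' - t"
   have s: "s \<in> suppvec R" using t by (simp add: s_def K_def subspace_diff[OF suppvec_subspace])
   have inK: "t + u *\<^sub>R s \<in> K" if "u \<in> {0..1}" for u
   proof -
    have "t + u *\<^sub>R s = (1 - u) *\<^sub>R t + u *\<^sub>R t'" by (simp add: s_def algebra_simps)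
    then show ?thesis using convexD_alt[OF K(2) t] that by auto
   qed
   define phi where "phi u = u *\<^sub>R s - g (tube R mu x (t + u *\<^sub>R s))" for u :: real
   have "(phi has_derivative (%u. u *\<^sub>R (s - dir_deriv g (tube R mu x (t + u0 *\<^sub>R s)) (J x s)))) (at u0 within {0..1})"
    if u0: "u0 \<in> {0..1}" for u0
   proof -
    have "(g has_derivative dir_deriv g (tube R mu x (t + u0 *\<^sub>R s))) (at (tube R mu x (t + u0 *\<^sub>R s)))"
     by (rule smooth_on_has_derivative[OF g tQ'[OF x inK[OF u0]]])
    from has_derivative_diff[OF has_derivative_scaleR_left[OF has_derivative_ident, of s] has_derivative_compose[OF dtube this]]
    have "(phi has_derivative (%u. u *\<^sub>R s - dir_deriv g (tube R mu x (t + u0 *\<^sub>R s)) (u *\<^sub>R J x s))) (at u0)"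
     unfolding phi_def by simp
    moreover have "u *\<^sub>R s - dir_deriv g (tube R mu x (t + u0 *\<^sub>R s)) (u *\<^sub>R J x s) =
      u *\<^sub>R (s - dir_deriv g (tube R mu x (t + u0 *\<^sub>R s)) (J x s))" for u
     by (simp add: linear_scale[OF dir_deriv_linear[OF g tQ'[OF x inK[OF u0]]]] scaleR_diff_right)
    ultimately show ?thesis by (simp add: has_derivative_at_withinI)
   qed
   moreover have "onorm (%u. u *\<^sub>R (s - dir_deriv g (tube R mu x (t + u0 *\<^sub>R s)) (J x s))) \<le> 1 / 2 * norm s"
    if u0: "u0 \<in> {0..1}" for u0
   proof (rule onorm_le)
    fix u :: real
    have "norm (s - dir_deriv g (tube R mu x (t + u0 *\<^sub>R s)) (J x s)) \<le> 1 / 2 * norm s"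
     using near[OF x inK[OF u0] s] by (simp add: norm_minus_commute)
    from mult_left_mono[OF this abs_ge_zero[of u]]
    show "norm (u *\<^sub>R (s - dir_deriv g (tube R mu x (t + u0 *\<^sub>R s)) (J x s))) \<le> 1 / 2 * norm s * norm u"
     by (simp add: mult_ac)
   qed
   ultimately have "norm (phi 1 - phi 0) \<le> 1 / 2 * norm s * norm (1 - 0 :: real)"
    by (intro differentiable_bound[of "{0..1::real}"]) auto
   moreover have "phi 1 - phi 0 = s" using eq by (simp add: phi_def s_def)
   ultimately show ?thesis by (simp add: s_def)
  qed
  have "\<exists>z\<in>?Z. pj z = x" if x: "x \<in> \<Sigma>" for x
  proof -
   from exist[OF x] obtain t where t: "t \<in> K" "g (tube R mu x t) = 0" by blast
   then show ?thesis using tN[OF x t(1)] tin[OF x] Kdl[OF t(1)] by (intro bexI[of _ "tube R mu x t"]) auto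
  qed
  then obtain F where F: "\<And>x. x \<in> \<Sigma> ==> F x \<in> N \<and> g (F x) = 0 \<and> pj (F x) = x" by (simp add: Bex_def) metis
  have Funiq: "F x = z" if "z \<in> N" "g z = 0" "pj z = x" for x z
  proof -
   have zQ: "z \<in> Q" "norm (tau z) \<le> dl / 2" using that(1) by (auto simp: N_def)
   have x: "x \<in> \<Sigma>" using tout[OF zQ(1)] that(3) by simp
   have FQ: "F x \<in> Q" "norm (tau (F x)) \<le> dl / 2" using F[OF x] by (auto simp: N_def)
   have 1: "z = tube R mu x (tau z)" "tau z \<in> K" using tout[OF zQ(1)] zQ(2) that(3) by (auto simp: K_def)
   have 2: "F x = tube R mu x (tau (F x))" "tau (F x) \<in> K" using tout[OF FQ(1)] FQ(2) F[OF x] by (auto simp: K_def)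
   have "tau z = tau (F x)"
    by (rule uniq[OF x 1(2) 2(2)]) (use that(2) F[OF x] 1(1) 2(1) in simp)
   then show ?thesis using 1(1) 2(1) by simp
  qed
  define Q1 where "Q1 = (Q \<inter> Q') \<inter> ((%z. norm (tau z)) -` {..<dl/2} \<inter> Q)"
  have opQ1: "open Q1"
  proof -
   have "open (Q \<inter> (%z. norm (tau z)) -` {..<dl/2})"
    by (rule continuous_open_preimage[OF continuous_on_norm[OF smooth_on_continuous[OF stau]] opQ open_lessThan])
   then show ?thesis unfolding Q1_def using opQ smooth_on_open[OF g] by (simp add: Int_commute open_Int)
  qed
  have Q1: "Q1 \<subseteq> Q" "Q1 \<subseteq> Q'" "Q1 \<subseteq> N" by (auto simp: Q1_def N_def)
  \<comment> \<open>at the zeros of \<open>g\<close> this is the projection \<open>pj\<close>, and its derivative is invertible there\<close>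
  define La where "La z = pj z + (\<Sum>i\<in>R. (g z $ i) *\<^sub>R mu i (pj z))" for z
  have sLa: "smooth_on Q1 La"
   unfolding La_def
   by (intro smooth_on_add smooth_on_sum smooth_on_scaleR smooth_on_vec_nth opQ1
     smooth_on_subset[OF spj opQ1 Q1(1)] smooth_on_subset[OF g opQ1 Q1(2)]
     smooth_on_subset[OF smooth_frame_along_projection(1)[OF tub mu] opQ1 Q1(1)])
  have La: "pj (La z) = pj z" "tau (La z) = g z" "La z \<in> Q" if "z \<in> Q1" for z
  proof -
   have zN: "z \<in> N" "z \<in> Q" "z \<in> Q'" using Q1 that by auto
   have "norm (g z) \<le> norm (g z - tau z) + norm (tau z)" by (metis diff_add_cancel norm_triangle_ineq)
   also have "\<dots> \<le> eta + dl / 2" using close0[OF zN(1)] zN(1) by (auto simp: N_def)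
   also have "\<dots> < dl" using eta(2) dl by simp
   finally have "norm (g z) < dl" .
   from tin[OF _ gR[OF zN(3)] this, of "pj z"] tout[OF zN(2)]
   show "pj (La z) = pj z" "tau (La z) = g z" "La z \<in> Q" by (auto simp: La_def tube_def)
  qed
  have injLa: "inj (dir_deriv La z)" if z: "z \<in> Q1" for z
   unfolding linear_injective_0[OF dir_deriv_linear[OF sLa z]]
  proof (intro allI impI)
   fix v assume v: "dir_deriv La z v = 0"
   have zN: "z \<in> N" "z \<in> Q" "z \<in> Q'" using Q1 z by auto
   note dLa = smooth_on_has_derivative[OF sLa z]
   have "(pj has_derivative (%v. dir_deriv pj (La z) (dir_deriv La z v))) (at z)"
    by (rule has_derivative_transform_within_open[OF has_derivative_compose[OF dLa
      smooth_on_has_derivative[OF spj La(3)[OF z]]] opQ1 z La(1)])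
   then have pjv: "dir_deriv pj z v = 0"
    using v linear_0[OF dir_deriv_linear[OF spj La(3)[OF z]]] by (simp add: dir_deriv_eq)
   have "(g has_derivative (%v. dir_deriv tau (La z) (dir_deriv La z v))) (at z)"
    by (rule has_derivative_transform_within_open[OF has_derivative_compose[OF dLa
      smooth_on_has_derivative[OF stau La(3)[OF z]]] opQ1 z La(2)])
   then have gv: "dir_deriv g z v = 0"
    using v linear_0[OF dir_deriv_linear[OF stau La(3)[OF z]]] by (simp add: dir_deriv_eq)
   have "\<exists>D. i \<in> R --> linear D \<and> ((%z. mu i (pj z)) has_derivative (%v. D (dir_deriv pj z v))) (at z)" for i
    using smooth_frame_along_projection(2)[OF tub mu zN(2), of i] by blast
   then obtain D where D: "\<And>i. i \<in> R ==> linear (D i)"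
    "\<And>i. i \<in> R ==> ((%z. mu i (pj z)) has_derivative (%v. D i (dir_deriv pj z v))) (at z)" by metis
   define s where "s = dir_deriv tau z v"
   have dtauc: "((%z. tau z $ i) has_derivative (%v. dir_deriv tau z v $ i)) (at z)" for i
    by (rule bounded_linear.has_derivative[OF bounded_linear_vec_nth smooth_on_has_derivative[OF stau zN(2)]])
   have "((%z. pj z + (\<Sum>i\<in>R. (tau z $ i) *\<^sub>R mu i (pj z))) has_derivative
     (%v. dir_deriv pj z v + (\<Sum>i\<in>R. (tau z $ i) *\<^sub>R D i (dir_deriv pj z v) + (dir_deriv tau z v $ i) *\<^sub>R mu i (pj z)))) (at z)"
    by (intro has_derivative_add smooth_on_has_derivative[OF spj zN(2)] has_derivative_sum
      has_derivative_scaleR dtauc D(2))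
   then have "((%z. z) has_derivative
     (%v. dir_deriv pj z v + (\<Sum>i\<in>R. (tau z $ i) *\<^sub>R D i (dir_deriv pj z v) + (dir_deriv tau z v $ i) *\<^sub>R mu i (pj z)))) (at z)"
    by (rule has_derivative_transform_within_open[OF _ opQ zN(2)]) (use tout in \<open>auto simp: tube_def\<close>)
   from fun_cong[OF has_derivative_unique[OF this has_derivative_ident], of v]
   have vJ: "v = J (pj z) s"
    using pjv D(1) by (simp add: linear_0 J_def s_def)
   have sR: "s \<in> suppvec R"
   proof -
    have "s $ i = 0" if "i \<notin> R" for i
    proof -
     have "((%z. 0::real) has_derivative (%v. dir_deriv tau z v $ i)) (at z)"
      by (rule has_derivative_transform_within_open[OF dtauc opQ zN(2)])
       (use tout that in \<open>auto simp: suppvec_def\<close>)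
     from fun_cong[OF has_derivative_unique[OF this has_derivative_const], of v] show ?thesis
      by (simp add: s_def)
    qed
    then show ?thesis by (simp add: suppvec_def)
   qed
   have "tau z \<in> K" "tube R mu (pj z) (tau z) = z" "pj z \<in> \<Sigma>" using tout[OF zN(2)] zN(1) by (auto simp: K_def N_def)
   from near[OF this(3,1) sR] this(2) gv vJ have "norm s \<le> 1 / 2 * norm s" by simp
   then have "s = 0" by simp
   then show "v = 0" using vJ by (simp add: J_def)
  qed
  have "smooth_map \<Sigma> F"
  proof (rule smooth_mapI)
   fix x0 assume x0: "x0 \<in> \<Sigma>"
   have z0: "F x0 \<in> Q1"
    using F[OF x0] Zin[of "F x0"] NQ by (auto simp: Q1_def N_def)
   have La0: "La (F x0) = x0" using F[OF x0] by (simp add: La_def)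
   from smooth_local_inverse[OF sLa z0 injLa[OF z0]] obtain Y h where Y: "open Y" "F x0 \<in> Y" "Y \<subseteq> Q1"
    "open (La ` Y)" "smooth_on (La ` Y) h" "\<And>x. x \<in> Y ==> h (La x) = x" by metis
   have "h x = F x" if x: "x \<in> \<Sigma>" "x \<in> La ` Y" for x
   proof -
    obtain z where z: "z \<in> Y" "x = La z" using x(2) by auto
    have zQ1: "z \<in> Q1" using z(1) Y(3) by auto
    have "x = tube R mu x 0" by (simp add: tube_def)
    then have "pj x = x" "tau x = 0" using tin[OF x(1) subspace_0[OF suppvec_subspace]] dl by auto
    then have "pj z = x" "g z = 0" using La(1,2)[OF zQ1] z(2) by auto
    then have "F x = z" using Funiq[of z x] zQ1 Q1(3) by auto
    then show ?thesis using Y(6)[OF z(1)] z(2) by simp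
   qed
   then show "\<exists>U g. x0 \<in> U \<and> smooth_on U g \<and> (\<forall>x\<in>\<Sigma>. x \<in> U --> g x = F x)"
    using Y(2,5) La0 by (intro exI[of _ "La ` Y"] exI[of _ h]) (auto intro: rev_image_eqI)
  qed
  moreover have "smooth_map ?Z pj" by (rule smooth_map_on[OF spj]) (auto simp: N_def)
  moreover have "F ` \<Sigma> = ?Z"
  proof
   show "F ` \<Sigma> \<subseteq> ?Z" using F by auto
   show "?Z \<subseteq> F ` \<Sigma>"
   proof
    fix z assume z: "z \<in> ?Z"
    then have "F (pj z) = z" "pj z \<in> \<Sigma>" using Funiq[of z "pj z"] tout[of z] by (auto simp: N_def)
    then show "z \<in> F ` \<Sigma>" by (metis imageI)
   qed
  qed
  moreover have "pj (F x) = x" if "x \<in> \<Sigma>" for x using F[OF that] by simp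
  moreover have "F (pj z) = z" if "z \<in> ?Z" for z using Funiq[of z "pj z"] that by auto
  moreover have "pj ` ?Z = \<Sigma>" using calculation(3,4) by force
  ultimately have "diffeomorphic \<Sigma> ?Z" unfolding diffeomorphic_def by (intro exI[of _ F] exI[of _ pj]) auto
  moreover have "?Z \<subseteq> {z \<in> Q. norm (tau z) < dl / 2}" using Zin by (auto simp: N_def)
  ultimately show ?thesis using cZ by simp
 qed
 show thesis by (rule that[OF eta(1) cN]) (rule main)
qed

section \<open>Polynomial approximation with derivatives\<close>

lemmas real_polynomial_function_linear = real_polynomial_function.intros(1)
 and real_polynomial_function_const = real_polynomial_function.intros(2)
 and real_polynomial_function_plus = real_polynomial_function.intros(3)
 and real_polynomial_function_times = real_polynomial_function.intros(4)

lemma real_polynomial_function_smooth: "real_polynomial_function q ==> smooth_on UNIV q"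
proof (induction rule: real_polynomial_function.induct)
 case (linear f)
 from smooth_on_bounded_linear[OF linear smooth_on_id[OF open_UNIV]] show ?case by simp
qed (simp_all add: smooth_on_const smooth_on_add smooth_on_mult)

text \<open>Polynomial functions of \<open>x\<close> and a real variable \<open>s\<close>, expanded in powers of \<open>s\<close>.\<close>

inductive poly_in_param :: "('a::euclidean_space => real => real) => bool" where
 monomial: "real_polynomial_function c ==> poly_in_param (%x s. c x * s ^ i)"
| sum: "poly_in_param F ==> poly_in_param G ==> poly_in_param (%x s. F x s + G x s)"

lemma poly_in_param_mult:
 assumes "poly_in_param F" "poly_in_param G"
 shows "poly_in_param (%x s. F x s * G x s)"
 using assms(1)
proof induction
 case (monomial c i)
 show ?case using assms(2)
 proof induction
  case (monomial d j)
  have "(%x s. c x * s ^ i * (d x * s ^ j)) = (%x s. (c x * d x) * s ^ (i + j))"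
   by (simp add: power_add mult_ac)
  then show ?case
   using poly_in_param.monomial[OF real_polynomial_function_times[OF \<open>real_polynomial_function c\<close> monomial]] by simp
 next
  case (sum F G)
  have "(%x s. c x * s ^ i * (F x s + G x s)) = (%x s. c x * s ^ i * F x s + c x * s ^ i * G x s)"
   by (simp add: distrib_left)
  then show ?case using poly_in_param.sum[OF sum(3,4)] by simp
 qed
next
 case (sum F1 F2)
 have "(%x s. (F1 x s + F2 x s) * G x s) = (%x s. F1 x s * G x s + F2 x s * G x s)"
  by (simp add: distrib_right)
 then show ?case using poly_in_param.sum[OF sum(3,4)] by simp
qed

lemma poly_in_param_line:
 assumes "real_polynomial_function q"
 shows "poly_in_param (%x s. q (x + s *\<^sub>R e))"
 using assms
proof induction
 case (linear f)
 have "(%x s. f (x + s *\<^sub>R e)) = (%x s. f x * s ^ 0 + f e * s ^ 1)"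
  using bounded_linear.linear[OF linear] by (simp add: linear_add linear_scale mult.commute)
 then show ?case
  using poly_in_param.sum[OF poly_in_param.monomial[OF real_polynomial_function_linear[OF linear], of 0]
    poly_in_param.monomial[OF real_polynomial_function_const, of "f e" 1]] by simp
next
 case (const c)
 then show ?case using poly_in_param.monomial[OF real_polynomial_function_const, of c 0] by simp
qed (simp_all add: poly_in_param.sum poly_in_param_mult)

text \<open>
 Averages of a polynomial over segments are polynomials, and they can be differentiated under the integral sign.
\<close>

lemma poly_in_param_props:
 assumes "poly_in_param F"
 shows "continuous_on S (%s. F x s)"
  and "smooth_on UNIV (%x. F x s)"
  and "continuous_on S (%s. dir_deriv (%x. F x s) x v)"
  and "real_polynomial_function (%x. integral {a..b} (F x))"
  and "dir_deriv (%x. integral {a..b} (F x)) x v = integral {a..b} (%s. dir_deriv (%x. F x s) x v)"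
proof -
 show c1: "continuous_on S (%s. F x s)" for S x
  using assms by induction (auto intro!: continuous_on_add continuous_on_mult continuous_on_power continuous_on_const continuous_on_id)
 have sm: "smooth_on UNIV (%x. F x s)" for s
  using assms
 proof induction
  case (monomial c i)
  show ?case by (intro smooth_on_mult smooth_on_const real_polynomial_function_smooth[OF monomial] open_UNIV)
 qed (rule smooth_on_add)
 then show "smooth_on UNIV (%x. F x s)" .
 have dm: "dir_deriv (%x. c x * t) x v = dir_deriv c x v * t" if "real_polynomial_function c" for c x v and t :: real
  by (rule fun_cong[OF dir_deriv_eq[OF has_derivative_mult_left]])
   (rule smooth_on_has_derivative[OF real_polynomial_function_smooth[OF that]], simp)
 have da: "dir_deriv (%x. f x + g x) x v = dir_deriv f x v + dir_deriv g x v"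
  if "smooth_on UNIV f" "smooth_on UNIV g" for f g :: "'a => real" and x v
  by (intro fun_cong[OF dir_deriv_eq] has_derivative_add
    smooth_on_has_derivative[OF that(1) UNIV_I] smooth_on_has_derivative[OF that(2) UNIV_I])
 have "continuous_on S (%s. F x s) \<and> smooth_on UNIV (%x. F x s) \<and> continuous_on S (%s. dir_deriv (%x. F x s) x v) \<and>
  real_polynomial_function (%x. integral {a..b} (F x)) \<and>
  dir_deriv (%x. integral {a..b} (F x)) x v = integral {a..b} (%s. dir_deriv (%x. F x s) x v)" for S x v s
  using assms
 proof (induction arbitrary: S x v s)
  case (monomial c i)
  have "(%x. integral {a..b} (%s. c x * s ^ i)) = (%x. c x * integral {a..b} (%s. s ^ i))" by simp
  then show ?case using monomial
   by (auto simp: dm intro!: continuous_on_mult continuous_on_power continuous_on_const continuous_on_id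
     smooth_on_mult smooth_on_const real_polynomial_function_smooth[OF monomial]
     real_polynomial_function_times real_polynomial_function_const)
 next
  case (sum F G)
  have eq: "(%x. integral {a..b} (%s. F x s + G x s)) = (%x. integral {a..b} (F x) + integral {a..b} (G x))"
   using sum.IH by (intro ext integral_add integrable_continuous_real) auto
  have d: "dir_deriv (%x. F x s + G x s) x v = dir_deriv (%x. F x s) x v + dir_deriv (%x. G x s) x v" for x v s
   by (rule da) (use sum.IH in auto)
  have "dir_deriv (%x. integral {a..b} (F x) + integral {a..b} (G x)) x v =
    integral {a..b} (%s. dir_deriv (%x. F x s) x v) + integral {a..b} (%s. dir_deriv (%x. G x s) x v)"
   using sum.IH by (simp add: da real_polynomial_function_smooth)
  also have "\<dots> = integral {a..b} (%s. dir_deriv (%x. F x s) x v + dir_deriv (%x. G x s) x v)"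
   using sum.IH by (intro integral_add[symmetric] integrable_continuous_real) auto
  finally show ?case unfolding eq d using sum.IH
   by (auto intro!: continuous_on_add smooth_on_add real_polynomial_function_plus)
 qed
 then show "continuous_on S (%s. dir_deriv (%x. F x s) x v)"
  "real_polynomial_function (%x. integral {a..b} (F x))"
  "dir_deriv (%x. integral {a..b} (F x)) x v = integral {a..b} (%s. dir_deriv (%x. F x s) x v)" by auto
qed

definition avg :: "real => 'a::euclidean_space => ('a => real) => 'a => real" where
 "avg h e q x = integral {-h..h} (%s. q (x + s *\<^sub>R e)) / (2 * h)"

lemma avg_polynomial:
 assumes "real_polynomial_function q"
 shows "real_polynomial_function (avg h e q)"
  and "dir_deriv (avg h e q) x v = avg h e (%y. dir_deriv q y v) x"
proof -
 note P = poly_in_param_props[OF poly_in_param_line[OF assms]]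
 have eq: "avg h e q = (%x. inverse (2 * h) * integral {-h..h} (%s. q (x + s *\<^sub>R e)))"
  by (simp add: avg_def fun_eq_iff field_simps)
 show "real_polynomial_function (avg h e q)"
  unfolding eq by (intro real_polynomial_function_times real_polynomial_function_const P(4))
 have "(q has_derivative dir_deriv q (x + s *\<^sub>R e)) (at (x + s *\<^sub>R e))" for s
  using smooth_on_has_derivative[OF real_polynomial_function_smooth[OF assms]] by simp
 moreover have "((%x. x + s *\<^sub>R e) has_derivative (%v. v)) (at x)" for s
  by (auto intro!: derivative_eq_intros)
 ultimately have "((%x. q (x + s *\<^sub>R e)) has_derivative (%v. dir_deriv q (x + s *\<^sub>R e) v)) (at x)" for s
  using has_derivative_compose by blast
 then have line: "dir_deriv (%x. q (x + s *\<^sub>R e)) x v = dir_deriv q (x + s *\<^sub>R e) v" for s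
  by (rule fun_cong[OF dir_deriv_eq])
 then have "dir_deriv (%x. integral {-h..h} (%s. q (x + s *\<^sub>R e))) x v = integral {-h..h} (%s. dir_deriv q (x + s *\<^sub>R e) v)"
  using P(5)[where a="-h" and b=h and x=x and v=v] by (simp only: line)
 moreover have "dir_deriv (avg h e q) x v = inverse (2 * h) * dir_deriv (%x. integral {-h..h} (%s. q (x + s *\<^sub>R e))) x v"
  unfolding eq
  by (rule fun_cong[OF dir_deriv_eq[OF has_derivative_mult_right]])
   (rule smooth_on_has_derivative[OF real_polynomial_function_smooth[OF P(4)]], simp)
 ultimately show "dir_deriv (avg h e q) x v = avg h e (%y. dir_deriv q y v) x"
  by (simp add: avg_def field_simps)
qed

lemma avg_dir_deriv:
 assumes q: "real_polynomial_function q" and h: "h > 0"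
 shows "avg h e (%y. dir_deriv q y e) x = (q (x + h *\<^sub>R e) - q (x - h *\<^sub>R e)) / (2 * h)"
proof -
 have "((%s. q (x + s *\<^sub>R e)) has_vector_derivative dir_deriv q (x + s *\<^sub>R e) e) (at s within {-h..h})" for s
 proof -
  have d: "(q has_derivative dir_deriv q (x + s *\<^sub>R e)) (at (x + s *\<^sub>R e))"
   using smooth_on_has_derivative[OF real_polynomial_function_smooth[OF q]] by simp
  have "((%s. x + s *\<^sub>R e) has_derivative (%u. u *\<^sub>R e)) (at s)" by (auto intro!: derivative_eq_intros)
  from has_derivative_compose[OF this d]
  have "((%s. q (x + s *\<^sub>R e)) has_derivative (%u. u *\<^sub>R dir_deriv q (x + s *\<^sub>R e) e)) (at s)"
   by (simp add: linear_scale[OF has_derivative_linear[OF d]])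
  then show ?thesis unfolding has_vector_derivative_def by (rule has_derivative_at_withinI)
 qed
 then have "((%s. dir_deriv q (x + s *\<^sub>R e) e) has_integral (q (x + h *\<^sub>R e) - q (x + (- h) *\<^sub>R e))) {-h..h}"
  using h by (intro fundamental_theorem_of_calculus) auto
 then show ?thesis unfolding avg_def by (simp add: integral_unique)
qed

text \<open>With an orthonormal basis as the list of directions, this is the average over a cube.\<close>

primrec avgs :: "real => 'a::euclidean_space list => ('a => real) => 'a => real" where
 "avgs h [] q = q"
| "avgs h (e # es) q = avg h e (avgs h es q)"

lemma avgs_polynomial: "real_polynomial_function q ==> real_polynomial_function (avgs h es q)"
 by (induction es) (simp_all add: avg_polynomial(1))

lemma avgs_dir_deriv:
 "real_polynomial_function q ==> dir_deriv (avgs h es q) x v = avgs h es (%y. dir_deriv q y v) x"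
proof (induction es arbitrary: x)
 case (Cons e es)
 have "avg h e (%y. dir_deriv (avgs h es q) y v) x = avg h e (avgs h es (%y. dir_deriv q y v)) x"
  using Cons by (simp add: avg_def)
 then show ?case by (simp add: avg_polynomial(2) avgs_polynomial Cons.prems)
qed simp

lemma avg_continuous_integrable:
 fixes q :: "'a::euclidean_space => real"
 assumes "continuous_on UNIV q"
 shows "(%s. q (x + s *\<^sub>R e)) integrable_on {-h..h}"
proof (rule integrable_continuous_real, rule continuous_on_compose2[OF assms])
 show "continuous_on {-h..h} (%s. x + s *\<^sub>R e)"
  by (intro continuous_on_add continuous_on_scaleR continuous_on_const continuous_on_id)
qed simp

lemma real_polynomial_function_continuous:
 fixes q :: "'a::euclidean_space => real"
 shows "real_polynomial_function q ==> continuous_on UNIV q"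
 by (rule smooth_on_continuous[OF real_polynomial_function_smooth])

lemma avgs_difference_quotient:
 assumes "real_polynomial_function q"
 shows "avgs h es (%y. (q (y + u) - q (y - u)) / k) x = (avgs h es q (x + u) - avgs h es q (x - u)) / k"
proof (induction es arbitrary: x)
 case (Cons e es)
 note int = avg_continuous_integrable[OF real_polynomial_function_continuous[OF avgs_polynomial[OF assms]]]
 have "avgs h (e # es) (%y. (q (y + u) - q (y - u)) / k) x =
   integral {-h..h} (%s. (avgs h es q (x + u + s *\<^sub>R e) - avgs h es q (x - u + s *\<^sub>R e)) / k) / (2 * h)"
  by (simp add: avg_def Cons.IH algebra_simps)
 also have "\<dots> = ((integral {-h..h} (%s. avgs h es q (x + u + s *\<^sub>R e)) - integral {-h..h} (%s. avgs h es q (x - u + s *\<^sub>R e))) / k) / (2 * h)"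
  using integral_diff[OF int int] by simp
 also have "\<dots> = (avgs h (e # es) q (x + u) - avgs h (e # es) q (x - u)) / k"
  by (simp add: avg_def diff_divide_distrib mult.commute[of k])
 finally show ?case .
qed simp

lemma avg_close:
 assumes "continuous_on UNIV q" "h > 0" "\<And>s. \<bar>s\<bar> \<le> h ==> \<bar>q (x + s *\<^sub>R e) - c\<bar> \<le> ep"
 shows "\<bar>avg h e q x - c\<bar> \<le> ep"
proof -
 note int = avg_continuous_integrable[OF assms(1)]
 have "integral {-h..h} (%s. c - ep) \<le> integral {-h..h} (%s. q (x + s *\<^sub>R e))"
  using int assms(3) by (intro integral_le) (auto simp: abs_le_iff algebra_simps)
 moreover have "integral {-h..h} (%s. q (x + s *\<^sub>R e)) \<le> integral {-h..h} (%s. c + ep)"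
  using int assms(3) by (intro integral_le) (auto simp: abs_le_iff algebra_simps)
 ultimately have "(c - ep) * (2 * h) \<le> integral {-h..h} (%s. q (x + s *\<^sub>R e))"
  "integral {-h..h} (%s. q (x + s *\<^sub>R e)) \<le> (c + ep) * (2 * h)"
  using assms(2) by (simp_all add: algebra_simps)
 then have "c - ep \<le> avg h e q x" "avg h e q x \<le> c + ep"
  unfolding avg_def using assms(2) by (simp_all add: pos_le_divide_eq pos_divide_le_eq)
 then show ?thesis by (simp add: abs_le_iff)
qed

text \<open>
 Iterated averages in unit directions only see the values of \<open>q\<close> within distance \<open>h * length
 es\<close>.
\<close>

lemma avgs_close:
 assumes "real_polynomial_function q" "h > 0" "\<And>e. e \<in> set es ==> norm e = 1"
  "\<And>y. dist x y \<le> h * real (length es) ==> \<bar>q y - c\<bar> \<le> ep"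
 shows "\<bar>avgs h es q x - c\<bar> \<le> ep"
 using assms(3,4)
proof (induction es arbitrary: x)
 case (Cons e es)
 have "\<bar>avgs h es q (x + s *\<^sub>R e) - c\<bar> \<le> ep" if "\<bar>s\<bar> \<le> h" for s
 proof (rule Cons.IH)
  fix y assume y: "dist (x + s *\<^sub>R e) y \<le> h * real (length es)"
  have "dist x y \<le> dist x (x + s *\<^sub>R e) + dist (x + s *\<^sub>R e) y" by (rule dist_triangle)
  also have "\<dots> \<le> h + h * real (length es)" using y that Cons.prems(1)[of e] by (simp add: dist_norm)
  finally show "\<bar>q y - c\<bar> \<le> ep" by (intro Cons.prems(2)) (simp add: algebra_simps)
 qed (use Cons.prems in auto)
 then show ?case
  using avg_close[OF real_polynomial_function_continuous[OF avgs_polynomial[OF assms(1)]] assms(2)] by simp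
qed simp

text \<open>
 \<open>C\<^sup>1\<close>-approximation by polynomials. A polynomial that is merely uniformly close to \<open>f\<close> is averaged
 over cubes of side \<open>2 h\<close>. The derivatives of the average are averages of difference quotients with
 step \<open>h\<close>, and these are close to those of \<open>f\<close> if the uniform error is small compared with \<open>h\<close>.
\<close>

lemma polynomial_C1_approximation:
 fixes f :: "'a::euclidean_space => real"
 assumes f: "smooth_on U f" and N: "compact N" "N \<subseteq> U" and ep: "ep > 0"
 obtains q where "real_polynomial_function q" "\<And>x. x \<in> N ==> \<bar>q x - f x\<bar> \<le> ep"
  "\<And>x b. x \<in> N ==> b \<in> Basis ==> \<bar>dir_deriv q x b - dir_deriv f x b\<bar> \<le> ep"
proof -
 obtain rho where rho: "rho > 0" "(\<Union>x\<in>N. cball x rho) \<subseteq> U"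
  using compact_subset_open_imp_cball_epsilon_subset[OF N(1) smooth_on_open[OF f] N(2)] by metis
 define M where "M = {x + y |x y. x \<in> N \<and> y \<in> cball 0 rho}"
 have M: "compact M" unfolding M_def by (rule compact_sums[OF N(1) compact_cball])
 have inM: "y \<in> M" if "x \<in> N" "dist x y \<le> rho" for x y
  unfolding M_def using that by (intro CollectI exI[of _ x] exI[of _ "y - x"]) (simp add: dist_norm norm_minus_commute)
 have MU: "M \<subseteq> U"
 proof
  fix z assume "z \<in> M"
  then obtain x y where "x \<in> N" "y \<in> cball 0 rho" "z = x + y" by (auto simp: M_def)
  then have "z \<in> cball x rho" "x \<in> N" by (auto simp: dist_norm)
  then show "z \<in> U" using rho(2) by blast
 qed
 have cont: "continuous_on M f" "continuous_on M (%x. dir_deriv f x b)" for b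
  using smooth_on_continuous[OF f] smooth_on_continuous[OF smooth_on_dir_deriv[OF f]] MU continuous_on_subset by blast+
 have uc: "\<exists>d>0. \<forall>x\<in>M. \<forall>y\<in>M. dist x y < d --> \<bar>g x - g y\<bar> < ep / 2" if "continuous_on M g" for g :: "'a => real"
 proof -
  have "uniformly_continuous_on M g" by (rule compact_uniformly_continuous[OF that M])
  from spec[OF this[unfolded uniformly_continuous_on_def], of "ep / 2"]
  have "\<exists>d>0. \<forall>x\<in>M. \<forall>x'\<in>M. dist x' x < d --> dist (g x') (g x) < ep / 2"
   by (rule mp) (use ep in simp)
  then obtain d where d: "d > 0" "\<forall>x\<in>M. \<forall>x'\<in>M. dist x' x < d --> dist (g x') (g x) < ep / 2" by blast
  have "\<bar>g x - g y\<bar> < ep / 2" if "x \<in> M" "y \<in> M" "dist x y < d" for x y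
   using mp[OF bspec[OF bspec[OF d(2) that(2)] that(1)] that(3)] by (simp only: dist_real_def)
  then show ?thesis using d(1) by blast
 qed
 obtain d0 where d0: "d0 > 0" "\<forall>x\<in>M. \<forall>y\<in>M. dist x y < d0 --> \<bar>f x - f y\<bar> < ep / 2"
  using uc[OF cont(1)] by blast
 have "\<exists>d>0. \<forall>x\<in>M. \<forall>y\<in>M. dist x y < d --> \<bar>dir_deriv f x b - dir_deriv f y b\<bar> < ep / 2" for b
  by (rule uc[OF cont(2)])
 then obtain d1 where d1: "\<And>b. d1 b > 0"
  "\<And>b. \<forall>x\<in>M. \<forall>y\<in>M. dist x y < d1 b --> \<bar>dir_deriv f x b - dir_deriv f y b\<bar> < ep / 2" by metis
 define r where "r = Min (insert rho (insert (d0/2) ((%b. d1 b / 2) ` Basis)))"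
 have r: "r > 0" "r \<le> rho" "r \<le> d0/2" "\<And>b. b \<in> Basis ==> r \<le> d1 b / 2"
 proof -
  show "r > 0" unfolding r_def using rho(1) d0(1) d1(1) by (simp add: Min_gr_iff)
  show "r \<le> rho" "r \<le> d0/2" unfolding r_def by (rule Min_le; simp)+
  show "r \<le> d1 b / 2" if "b \<in> Basis" for b unfolding r_def by (rule Min_le) (use that in simp_all)
 qed
 obtain es :: "'a list" where es: "set es = Basis" "distinct es"
  using finite_distinct_list[OF finite_Basis] by blast
 define k where "k = real (length es)"
 have k: "k \<ge> 0" by (simp add: k_def)
 define h where "h = r / (k + 1)"
 have h: "h > 0" "h * (k + 1) = r" using r(1) k by (auto simp: h_def)
 have ne: "norm e = 1" if "e \<in> set es" for e using that es(1) by simp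
 define eta where "eta = min (ep / 2) (h * ep / 2)"
 have eta: "eta > 0" "eta \<le> ep / 2" "eta / h \<le> ep / 2"
  using ep h(1) by (auto simp: eta_def min_def field_simps)
 obtain q where q: "real_polynomial_function q" "\<And>x. x \<in> M ==> \<bar>f x - q x\<bar> < eta"
  using Stone_Weierstrass_real_polynomial_function[OF M cont(1) eta(1)] by metis
 have 1: "\<bar>avgs h es q x - f x\<bar> \<le> ep" if x: "x \<in> N" for x
 proof (rule avgs_close[OF q(1) h(1) ne])
  fix y assume "dist x y \<le> h * real (length es)"
  then have y: "dist x y \<le> r" using h by (simp add: k_def algebra_simps)
  have yM: "y \<in> M" "x \<in> M" using inM[OF x] y r(2) rho(1) by auto
  have "\<bar>f x - f y\<bar> < ep / 2" using d0 yM y r(1,3) by auto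
  moreover have "\<bar>f y - q y\<bar> < eta" by (rule q(2)[OF yM(1)])
  ultimately show "\<bar>q y - f x\<bar> \<le> ep" using eta(2) by linarith
 qed
 have 2: "\<bar>dir_deriv (avgs h es q) x b - dir_deriv f x b\<bar> \<le> ep" if x: "x \<in> N" and b: "b \<in> Basis" for x b
 proof -
  obtain es1 es2 where split: "es = es1 @ b # es2" using b es(1) by (metis split_list)
  have app: "avgs h (es1 @ fs) g = avgs h es1 (avgs h fs g)" for fs g by (induction es1) auto
  define dq where "dq y = (q (y + h *\<^sub>R b) - q (y - h *\<^sub>R b)) / (2 * h)" for y
  have pdq: "real_polynomial_function dq"
  proof -
   have s: "real_polynomial_function (%y. q (y + u))" for u
   proof -
    have p: "polynomial_function (%y::'a. y + u)" by (intro polynomial_function_add polynomial_function_id polynomial_function_const)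
    show ?thesis using real_polynomial_function_compose[OF p q(1)] by (simp add: o_def)
   qed
   have "real_polynomial_function (%y. (q (y + h *\<^sub>R b) + (- 1) * q (y + (- (h *\<^sub>R b)))) * inverse (2 * h))"
    by (intro real_polynomial_function_times real_polynomial_function_plus real_polynomial_function_const s)
   then show ?thesis
    unfolding dq_def[abs_def] divide_inverse by (simp only: mult_minus1 add_uminus_conv_diff)
  qed
  have "avg h b (avgs h es2 (%y. dir_deriv q y b)) = avgs h es2 dq"
  proof
   fix z
   have "avg h b (avgs h es2 (%y. dir_deriv q y b)) z = avg h b (%y. dir_deriv (avgs h es2 q) y b) z"
    by (simp add: avg_def avgs_dir_deriv[OF q(1)])
   also have "\<dots> = (avgs h es2 q (z + h *\<^sub>R b) - avgs h es2 q (z - h *\<^sub>R b)) / (2 * h)"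
    by (rule avg_dir_deriv[OF avgs_polynomial[OF q(1)] h(1)])
   also have "\<dots> = avgs h es2 dq z"
    unfolding dq_def[abs_def] by (rule avgs_difference_quotient[OF q(1), symmetric])
   finally show "avg h b (avgs h es2 (%y. dir_deriv q y b)) z = avgs h es2 dq z" .
  qed
  then have "avgs h es (%y. dir_deriv q y b) x = avgs h (es1 @ es2) dq x"
   by (simp add: split app)
  then have "dir_deriv (avgs h es q) x b = avgs h (es1 @ es2) dq x"
   by (simp only: avgs_dir_deriv[OF q(1)])
  moreover have "\<bar>avgs h (es1 @ es2) dq x - dir_deriv f x b\<bar> \<le> ep"
  proof (rule avgs_close[OF pdq h(1)])
   fix e assume "e \<in> set (es1 @ es2)"
   then show "norm e = 1" using ne by (auto simp: split)
  next
   fix y assume "dist x y \<le> h * real (length (es1 @ es2))"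
   also have "h * real (length (es1 @ es2)) = h * (k - 1)" by (simp add: k_def split)
   finally have y: "dist x y \<le> h * (k - 1)" .
   have seg: "dist x (y + s *\<^sub>R b) \<le> r" if "\<bar>s\<bar> \<le> h" for s
   proof -
    have "dist x (y + s *\<^sub>R b) \<le> dist x y + dist y (y + s *\<^sub>R b)" by (rule dist_triangle)
    also have "\<dots> \<le> h * (k - 1) + h" using y that b by (simp add: dist_norm)
    also have "\<dots> = h * k" by (simp add: algebra_simps)
    also have "\<dots> \<le> r" using h k by (simp add: algebra_simps)
    finally show ?thesis .
   qed
   have segM: "y + s *\<^sub>R b \<in> M" if "\<bar>s\<bar> \<le> h" for s using inM[OF x] seg[OF that] r(2) by auto
   have xM: "x \<in> M" using inM[OF x] rho(1) by simp
   have "\<exists>s. -h < s \<and> s < h \<and> f (y + h *\<^sub>R b) - f (y + (-h) *\<^sub>R b) = (h - (-h)) * dir_deriv f (y + s *\<^sub>R b) b"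
   proof (rule MVT2)
    fix s assume s: "-h \<le> s" "s \<le> h"
    have "y + s *\<^sub>R b \<in> U" using segM[of s] s MU by auto
    then have d: "(f has_derivative dir_deriv f (y + s *\<^sub>R b)) (at (y + s *\<^sub>R b))" by (rule smooth_on_has_derivative[OF f])
    have "((%s. y + s *\<^sub>R b) has_derivative (%u. u *\<^sub>R b)) (at s)" by (auto intro!: derivative_eq_intros)
    from has_derivative_compose[OF this d]
    have "((%s. f (y + s *\<^sub>R b)) has_derivative (%u. dir_deriv f (y + s *\<^sub>R b) (u *\<^sub>R b))) (at s)" .
    moreover have "(%u. dir_deriv f (y + s *\<^sub>R b) (u *\<^sub>R b)) = (*) (dir_deriv f (y + s *\<^sub>R b) b)"
     by (simp add: fun_eq_iff linear_scale[OF has_derivative_linear[OF d]] mult.commute)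
    ultimately show "((%s. f (y + s *\<^sub>R b)) has_real_derivative dir_deriv f (y + s *\<^sub>R b) b) (at s)"
     unfolding has_field_derivative_def by simp
   qed (use h(1) in simp)
   then obtain s where s: "\<bar>s\<bar> \<le> h" "f (y + h *\<^sub>R b) - f (y - h *\<^sub>R b) = 2 * h * dir_deriv f (y + s *\<^sub>R b) b" by force
   have "\<bar>dir_deriv f x b - dir_deriv f (y + s *\<^sub>R b) b\<bar> < ep / 2"
    using d1(2)[of b] xM segM[OF s(1)] seg[OF s(1)] r(1) r(4)[OF b] by force
   moreover have "\<bar>dq y - dir_deriv f (y + s *\<^sub>R b) b\<bar> \<le> ep / 2"
   proof -
    have e1: "\<bar>f (y + h *\<^sub>R b) - q (y + h *\<^sub>R b)\<bar> < eta" using q(2) segM[of h] h(1) by simp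
    have e2: "\<bar>f (y - h *\<^sub>R b) - q (y - h *\<^sub>R b)\<bar> < eta" using q(2)[of "y - h *\<^sub>R b"] segM[of "-h"] h(1) by simp
    have "dq y - dir_deriv f (y + s *\<^sub>R b) b =
     ((q (y + h *\<^sub>R b) - f (y + h *\<^sub>R b)) - (q (y - h *\<^sub>R b) - f (y - h *\<^sub>R b))) / (2 * h)"
    proof -
     have "dir_deriv f (y + s *\<^sub>R b) b = (f (y + h *\<^sub>R b) - f (y - h *\<^sub>R b)) / (2 * h)"
      using s(2) h(1) by simp
     then show ?thesis by (simp add: dq_def diff_divide_distrib)
    qed
    then have "\<bar>dq y - dir_deriv f (y + s *\<^sub>R b) b\<bar> =
     \<bar>(q (y + h *\<^sub>R b) - f (y + h *\<^sub>R b)) - (q (y - h *\<^sub>R b) - f (y - h *\<^sub>R b))\<bar> / (2 * h)"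
     using h(1) by (simp add: abs_divide)
    also have "\<dots> \<le> (2 * eta) / (2 * h)" using e1 e2 h(1) by (intro divide_right_mono) linarith+
    also have "\<dots> = eta / h" by simp
    finally show ?thesis using eta(3) by (rule order_trans)
   qed
   ultimately show "\<bar>dq y - dir_deriv f x b\<bar> \<le> ep" by linarith
  qed
  ultimately show ?thesis by simp
 qed
 show thesis by (rule that[OF avgs_polynomial[OF q(1)] 1 2])
qed

section \<open>Chebyshev polynomials\<close>

fun cheb :: "nat => real => real" where
 "cheb 0 x = 1"
| "cheb (Suc 0) x = x"
| "cheb (Suc (Suc n)) x = 2 * x * cheb (Suc n) x - cheb n x"

lemma cheb_cos: "cheb n (cos tt) = cos (real n * tt)"
proof -
 have "cheb n (cos tt) = cos (real n * tt) \<and> cheb (Suc n) (cos tt) = cos (real (Suc n) * tt)"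
 proof (induction n)
  case (Suc n)
  have "cos (real (Suc (Suc n)) * tt) = cos (real (Suc n) * tt + tt)" "cos (real n * tt) = cos (real (Suc n) * tt - tt)"
   by (simp_all add: algebra_simps)
  then have "cos (real (Suc (Suc n)) * tt) = 2 * cos tt * cos (real (Suc n) * tt) - cos (real n * tt)"
   by (simp add: cos_add cos_diff)
  then show ?case using Suc by simp
 qed simp
 then show ?thesis ..
qed

lemma cheb_smooth: "smooth_on UNIV (cheb n)"
proof (induction n rule: less_induct)
 case (less n)
 consider "n = 0" | "n = Suc 0" | k where "n = Suc (Suc k)" by (metis not0_implies_Suc)
 then show ?case
 proof cases
  case 1
  then have "cheb n = (%x. 1)" by auto
  then show ?thesis by (simp add: smooth_on_const)
 next
  case 2
  then have "cheb n = (%x. x)" by auto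
  then show ?thesis by (simp add: smooth_on_id)
 next
  case (3 k)
  then have "cheb n = (%x. 2 * x * cheb (Suc k) x - cheb k x)" by auto
  moreover have "smooth_on UNIV (cheb (Suc k))" "smooth_on UNIV (cheb k)" using less 3 by auto
  ultimately show ?thesis
   by (simp only: smooth_on_diff smooth_on_mult smooth_on_const smooth_on_id open_UNIV)
 qed
qed

text \<open>The \<open>m\<close> intervals that the Chebyshev polynomial of degree \<open>m\<close> maps diffeomorphically to \<open>(-1,1)\<close>.\<close>

definition cheb_interval :: "nat => nat => real set" where
 "cheb_interval m j = cos ` {real j * pi / real m <..< (real j + 1) * pi / real m}"

lemma cheb_intervalE:
 assumes "m > 0" "j < m" "x \<in> cheb_interval m j"
 obtains a where "0 < a" "a < pi" "arccos x = (real j * pi + a) / real m" "x = cos ((real j * pi + a) / real m)"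
  "cheb m x = (-1) ^ j * cos a" "arccos x \<in> {0<..<pi}"
proof -
 obtain tt where tt: "real j * pi / real m < tt" "tt < (real j + 1) * pi / real m" "x = cos tt"
  using assms(3) by (auto simp: cheb_interval_def)
 define a where "a = real m * tt - real j * pi"
 have m: "real m > 0" using assms(1) by simp
 have "real j * pi < real m * tt" using tt(1) m by (simp add: field_simps)
 moreover have "real m * tt < (real j + 1) * pi" using tt(2) m by (simp add: field_simps)
 ultimately have a: "0 < a" "a < pi" by (auto simp: a_def algebra_simps)
 have tta: "tt = (real j * pi + a) / real m" using m by (simp add: a_def)
 have "0 \<le> real j * pi / real m" by simp
 then have pos: "0 < tt" using tt(1) by linarith
 have "(real j + 1) * pi \<le> real m * pi" using assms(2) by (intro mult_right_mono) auto
 then have "(real j + 1) * pi / real m \<le> pi" using m by (simp add: field_simps)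
 then have "tt < pi" using tt(2) by linarith
 then have ac: "arccos x = tt" using pos by (simp add: tt(3) arccos_cos)
 have "cheb m x = cos (real j * pi + a)" using m by (simp add: tt(3) cheb_cos tta)
 also have "\<dots> = (-1) ^ j * cos a" by (simp add: cos_add)
 finally have "cheb m x = (-1) ^ j * cos a" .
 then show thesis using that[OF a] ac tta tt(3) pos \<open>tt < pi\<close> by simp
qed

text \<open>The inverse branch is \<open>y \<mapsto> cos ((j pi + arccos ((-1) ^ j y)) / m)\<close>.\<close>

lemma cheb_branch:
 assumes m: "m > 0" "j < m"
 obtains g where "smooth_on {-1<..<1} g" "g ` {-1<..<1} = cheb_interval m j"
  "\<And>y. y \<in> {-1<..<1} ==> cheb m (g y) = y"
  "\<And>x. x \<in> cheb_interval m j ==> g (cheb m x) = x \<and> cheb m x \<in> {-1<..<1}"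
  "open (cheb_interval m j)" "cheb_interval m j \<subseteq> {-1<..<1}"
proof -
 have mpos: "real m > 0" using m(1) by simp
 define g where "g y = cos ((real j * pi + arccos ((-1) ^ j * y)) / real m)" for y
 have sq: "(-1::real) ^ j * (-1) ^ j = 1" by (simp add: power_mult_distrib[symmetric])
 have sgn: "(-1) ^ j * ((-1::real) ^ j * y) = y" for y using sq by (simp add: mult.assoc[symmetric])
 have abs1: "\<bar>(-1) ^ j * y\<bar> = \<bar>y\<bar>" for y :: real by (simp add: abs_mult power_abs)
 have into: "g y \<in> cheb_interval m j \<and> cheb m (g y) = y" if y: "y \<in> {-1<..<1}" for y
 proof -
  define a where "a = arccos ((-1) ^ j * y)"
  have b: "-1 < (-1) ^ j * y" "(-1) ^ j * y < 1" using abs1[of y] y by (auto simp: abs_less_iff)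
  have "0 < a" "a < pi" unfolding a_def using arccos_lt_bounded[OF b] by auto
  then have "(real j * pi + a) / real m \<in> {real j * pi / real m <..< (real j + 1) * pi / real m}"
   using mpos by (auto simp: field_simps)
  then have "g y \<in> cheb_interval m j" by (auto simp: cheb_interval_def g_def a_def)
  moreover have "cheb m (g y) = cos (real j * pi + a)" using mpos by (simp add: g_def cheb_cos a_def)
  moreover have "\<dots> = (-1) ^ j * cos a" by (simp add: cos_add)
  moreover have "cos a = (-1) ^ j * y" using b by (simp add: a_def)
  ultimately show ?thesis using sgn[of y] by simp
 qed
 have bck: "g (cheb m x) = x \<and> cheb m x \<in> {-1<..<1}" if x: "x \<in> cheb_interval m j" for x
 proof -
  obtain a where a: "0 < a" "a < pi" "x = cos ((real j * pi + a) / real m)" "cheb m x = (-1) ^ j * cos a"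
   using cheb_intervalE[OF m x] by metis
  have "cos a < 1" using cos_monotone_0_pi[of 0 a] a by simp
  moreover have "-1 < cos a" using cos_monotone_0_pi[of a pi] a by simp
  ultimately have "\<bar>cheb m x\<bar> < 1" using abs1[of "cos a"] by (simp add: a(4) abs_less_iff)
  moreover have "arccos ((-1) ^ j * cheb m x) = a" using a sgn[of "cos a"] by (simp add: arccos_cos)
  ultimately show ?thesis using a(3) by (simp add: g_def abs_less_iff)
 qed
 have eq: "cheb_interval m j = {-1<..<1} \<inter> arccos -` {real j * pi / real m <..< (real j + 1) * pi / real m}"
 proof (intro set_eqI iffI)
  fix x assume x: "x \<in> cheb_interval m j"
  obtain a where a: "0 < a" "a < pi" "arccos x = (real j * pi + a) / real m" "x = cos (arccos x)" "arccos x \<in> {0<..<pi}"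
   using cheb_intervalE[OF m x] by metis
  have "cos (arccos x) < 1" using cos_monotone_0_pi[of 0 "arccos x"] a(5) by simp
  moreover have "-1 < cos (arccos x)" using cos_monotone_0_pi[of "arccos x" pi] a(5) by simp
  ultimately have "x \<in> {-1<..<1}" using a(4) by simp
  moreover have "real j * pi / real m < arccos x" "arccos x < (real j + 1) * pi / real m"
   unfolding a(3) using a(1,2) mpos by (simp_all add: field_simps)
  ultimately show "x \<in> {-1<..<1} \<inter> arccos -` {real j * pi / real m <..< (real j + 1) * pi / real m}" by simp
 next
  fix x assume x: "x \<in> {-1<..<1} \<inter> arccos -` {real j * pi / real m <..< (real j + 1) * pi / real m}"
  then have "x = cos (arccos x)" by simp
  then show "x \<in> cheb_interval m j" unfolding cheb_interval_def using x by (metis IntD2 image_eqI vimageD)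
 qed
 have op: "open (cheb_interval m j)"
 proof -
  have "continuous_on {-1<..<1} arccos" by (rule continuous_on_subset[OF continuous_on_arccos']) auto
  then show ?thesis unfolding eq by (rule continuous_open_preimage) auto
 qed
 have inj: "inj (dir_deriv (cheb m) x)" if x: "x \<in> cheb_interval m j" for x
 proof -
  obtain a where a: "0 < a" "a < pi" "arccos x = (real j * pi + a) / real m" "x = cos (arccos x)" "arccos x \<in> {0<..<pi}"
   using cheb_intervalE[OF m x] by metis
  let ?tt = "arccos x"
  have d: "(cheb m has_derivative dir_deriv (cheb m) x) (at (cos ?tt))"
   using smooth_on_has_derivative[OF cheb_smooth] a(4) by simp
  have "(cos has_derivative (%h. h * (- sin ?tt))) (at ?tt)"
   by (auto intro!: derivative_eq_intros)
  from has_derivative_compose[OF this d]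
  have 1: "((%t. cheb m (cos t)) has_derivative (%h. dir_deriv (cheb m) x (h * (- sin ?tt)))) (at ?tt)" .
  have "((%t. cos (real m * t)) has_derivative (%h. h * real m * (- sin (real m * ?tt)))) (at ?tt)"
   by (auto intro!: derivative_eq_intros)
  then have 2: "((%t. cheb m (cos t)) has_derivative (%h. h * real m * (- sin (real m * ?tt)))) (at ?tt)"
   by (simp only: cheb_cos)
  from fun_cong[OF has_derivative_unique[OF 1 2], of 1]
  have e: "dir_deriv (cheb m) x (- sin ?tt) = - real m * sin (real m * ?tt)" by simp
  have "real m * ?tt = real j * pi + a" using a(3) mpos by simp
  then have "sin (real m * ?tt) = (-1) ^ j * sin a" by (simp only: sin_add) (simp add: sin_npi)
  moreover have "sin a ~= 0" using sin_gt_zero[OF a(1,2)] by simp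
  ultimately have ne: "dir_deriv (cheb m) x (- sin ?tt) ~= 0" using mpos e by simp
  have lin: "linear (dir_deriv (cheb m) x)" by (rule dir_deriv_linear[OF cheb_smooth UNIV_I])
  show ?thesis
   unfolding linear_injective_0[OF lin]
  proof (intro allI impI)
   fix v assume v: "dir_deriv (cheb m) x v = 0"
   have "dir_deriv (cheb m) x v = v * dir_deriv (cheb m) x 1"
    using linear_scale[OF lin, of v 1] by simp
   moreover have "dir_deriv (cheb m) x 1 ~= 0"
    using ne linear_scale[OF lin, of "- sin ?tt" 1] by auto
   ultimately show "v = 0" using v by simp
  qed
 qed
 have im: "cheb m ` cheb_interval m j = {-1<..<1}"
  using into bck by (auto simp: image_iff) (metis greaterThanLessThan_iff)
 have "smooth_on (cheb m ` cheb_interval m j) g"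
  by (rule smooth_on_inverse_map(2)[OF smooth_on_subset[OF cheb_smooth op subset_UNIV] inj]) (use bck in auto)
 then have sm: "smooth_on {-1<..<1} g" by (simp only: im)
 have gi: "g ` {-1<..<1} = cheb_interval m j"
 proof
  show "g ` {-1<..<1} \<subseteq> cheb_interval m j" using into by auto
  show "cheb_interval m j \<subseteq> g ` {-1<..<1}"
  proof
   fix x assume "x \<in> cheb_interval m j"
   from bck[OF this] show "x \<in> g ` {-1<..<1}" by (metis imageI)
  qed
 qed
 show thesis
  by (rule that[OF sm gi _ bck op]) (use into eq in auto)
qed

lemma cheb_interval_disjoint:
 assumes "m > 0" "i < m" "j < m" "x \<in> cheb_interval m i" "x \<in> cheb_interval m j"
 shows "i = j"
proof -
 obtain a where a: "0 < a" "a < pi" "arccos x = (real i * pi + a) / real m"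
  using cheb_intervalE[OF assms(1,2,4)] by metis
 obtain b where b: "0 < b" "b < pi" "arccos x = (real j * pi + b) / real m"
  using cheb_intervalE[OF assms(1,3,5)] by metis
 have eq: "real i * pi + a = real j * pi + b" using a(3) b(3) assms(1) by simp
 have "real i * pi - real j * pi < pi" "real j * pi - real i * pi < pi"
  using eq a(1,2) b(1,2) by linarith+
 then have 1: "(real i - real j) * pi < 1 * pi" and 2: "(real j - real i) * pi < 1 * pi"
  by (simp_all only: left_diff_distrib mult_1)
 have "real i - real j < 1" "real j - real i < 1"
  by (rule mult_right_less_imp_less[OF 1 pi_ge_zero], rule mult_right_less_imp_less[OF 2 pi_ge_zero])
 then show ?thesis by linarith
qed

section \<open>Perturbing equations to make them regular\<close>

definition perturb :: "('a => real ^ 'i::finite) => ('a => 'w::euclidean_space) => 'w ^ 'i => 'a => real ^ 'i" where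
 "perturb g w e y = (\<chi> i. g y $ i + e $ i \<bullet> w y)"

lemma perturb_smooth:
 fixes g :: "'a::euclidean_space => real ^ 'i::finite"
 assumes "smooth_on V g" "smooth_on V w"
 shows "smooth_on V (perturb g w e)"
 unfolding perturb_def[abs_def] using assms
 by (intro smooth_on_vec_lambda smooth_on_add smooth_on_vec_nth smooth_on_inner smooth_on_const smooth_on_open)

lemma perturb_dir_deriv:
 fixes g :: "'a::euclidean_space => real ^ 'i::finite"
 assumes "smooth_on V g" "smooth_on V w" "y \<in> V"
 shows "dir_deriv (perturb g w e) y v $ i = dir_deriv g y v $ i + e $ i \<bullet> dir_deriv w y v"
proof -
 have 1: "((%y. perturb g w e y $ i) has_derivative (%v. dir_deriv (perturb g w e) y v $ i)) (at y)"
  by (rule bounded_linear.has_derivative[OF bounded_linear_vec_nth smooth_on_has_derivative[OF perturb_smooth[OF assms(1,2)] assms(3)]])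
 have 2: "((%y. g y $ i + e $ i \<bullet> w y) has_derivative (%v. dir_deriv g y v $ i + e $ i \<bullet> dir_deriv w y v)) (at y)"
  by (intro has_derivative_add has_derivative_inner_right smooth_on_has_derivative[OF assms(2,3)]
    bounded_linear.has_derivative[OF bounded_linear_vec_nth smooth_on_has_derivative[OF assms(1,3)]])
 have "((%y. g y $ i + e $ i \<bullet> w y) has_derivative (%v. dir_deriv (perturb g w e) y v $ i)) (at y)"
  using 1 by (simp add: perturb_def)
 from fun_cong[OF has_derivative_unique[OF this 2], of v] show ?thesis .
qed

text \<open>
 The equations \<open>g\<^sub>i + a\<^sub>i + b\<^sub>i \<bullet> y\<close> with \<open>i \<in> R\<close> are singular at the zero \<open>y\<close> if and only if some combination
 of the gradients \<open>\<nabla>g\<^sub>i + b\<^sub>i\<close> with one coefficient equal to \<open>1\<close> vanishes. Given \<open>y\<close>, the other coefficients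
 and the other \<open>b\<^sub>i\<close>, this determines the remaining parameters. So the bad parameters are the image
 of a hyperplane under a differentiable map, which is negligible.
\<close>

lemma generic_affine_perturbation:
 fixes g :: "real ^ 'n::finite => real ^ 'i::finite"
 assumes g: "smooth_on V g" and dim: "CARD('n) = CARD('i)"
 shows "negligible {e. \<exists>y\<in>V. (\<forall>i\<in>R. perturb g (%y. (1::real, y)) e y $ i = 0) \<and>
  \<not> regular_at_pt R (perturb g (%y. (1, y)) e) y}"
proof -
 let ?w = "%y::real ^ 'n. (1::real, y)"
 have opV: "open V" by (rule smooth_on_open[OF g])
 have sw: "smooth_on V ?w" by (intro smooth_on_Pair smooth_on_const smooth_on_id opV)
 have dw: "dir_deriv ?w y = (%v. (0, v))" for y
  by (rule dir_deriv_eq) (auto intro!: derivative_eq_intros)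
 define grad where "grad i y = (\<Sum>b\<in>Basis. (dir_deriv g y b $ i) *\<^sub>R b)" for i y
 have grad: "dir_deriv g y v $ i = grad i y \<bullet> v" if "y \<in> V" for y v i
 proof -
  note lin = dir_deriv_linear[OF g that]
  have "dir_deriv g y v $ i = dir_deriv g y (\<Sum>b\<in>Basis. (v \<bullet> b) *\<^sub>R b) $ i"
   by (simp only: euclidean_representation)
  also have "\<dots> = (\<Sum>b\<in>Basis. (v \<bullet> b) * dir_deriv g y b $ i)"
   by (simp add: linear_sum[OF lin] linear_scale[OF lin])
  also have "\<dots> = grad i y \<bullet> v" by (simp add: grad_def inner_sum_left inner_commute[of v] mult.commute)
  finally show ?thesis .
 qed
 have sgrad: "smooth_on V (grad i)" for i
  unfolding grad_def[abs_def]
  by (intro smooth_on_sum smooth_on_scaleR smooth_on_vec_nth smooth_on_dir_deriv g smooth_on_const opV)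
 \<comment> \<open>\<open>s\<close> encodes \<open>y = snd (s $ i0)\<close>, the coefficients \<open>fst (s $ i)\<close> and the free \<open>b\<^sub>i = snd (s $ i)\<close>; the entry \<open>fst (s $ i0)\<close> is \<open>0\<close>\<close>
 define b0 where "b0 i0 s = - grad i0 (snd (s $ i0)) - (\<Sum>i\<in>R - {i0}. fst (s $ i) *\<^sub>R (grad i (snd (s $ i0)) + snd (s $ i)))"
  for i0 and s :: "(real \<times> (real ^ 'n)) ^ 'i"
 define Ps where "Ps i0 s = (\<chi> i. if i = i0 then (- g (snd (s $ i0)) $ i0 - b0 i0 s \<bullet> snd (s $ i0), b0 i0 s)
   else if i \<in> R then (- g (snd (s $ i0)) $ i - snd (s $ i) \<bullet> snd (s $ i0), snd (s $ i)) else s $ i)"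
  for i0 and s :: "(real \<times> (real ^ 'n)) ^ 'i"
 define U where "U i0 = (%s :: (real \<times> (real ^ 'n)) ^ 'i. snd (s $ i0)) -` V" for i0
 have opU: "open (U i0)" for i0
  unfolding U_def by (rule open_vimage[OF opV]) (intro continuous_on_snd bounded_linear.continuous_on[OF bounded_linear_vec_nth] continuous_on_id)
 have sy: "smooth_on (U i0) (%s. snd (s $ i0))" for i0
  by (intro smooth_on_snd smooth_on_vec_nth smooth_on_id opU)
 have into: "(%s. snd (s $ i0)) ` U i0 \<subseteq> V" for i0 by (auto simp: U_def)
 note c1 = smooth_on_compose[OF g sy into] and c2 = smooth_on_compose[OF sgrad sy into]
 have sb0: "smooth_on (U i0) (b0 i0)" for i0
  unfolding b0_def[abs_def]
  by (intro smooth_on_diff smooth_on_minus smooth_on_sum smooth_on_scaleR smooth_on_add smooth_on_fst smooth_on_snd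
    smooth_on_vec_nth smooth_on_id opU c2)
 have sPs: "smooth_on (U i0) (Ps i0)" for i0
  unfolding Ps_def[abs_def]
 proof (rule smooth_on_vec_lambda)
  fix i
  have "smooth_on (U i0) (%s. (- g (snd (s $ i0)) $ i0 - b0 i0 s \<bullet> snd (s $ i0), b0 i0 s))"
   "smooth_on (U i0) (%s. (- g (snd (s $ i0)) $ i - snd (s $ i) \<bullet> snd (s $ i0), snd (s $ i)))"
   "smooth_on (U i0) (%s. s $ i)"
   by (intro smooth_on_Pair smooth_on_diff smooth_on_minus smooth_on_inner smooth_on_vec_nth c1 sb0 sy
     smooth_on_snd smooth_on_id opU)+
  then show "smooth_on (U i0) (%s. if i = i0 then (- g (snd (s $ i0)) $ i0 - b0 i0 s \<bullet> snd (s $ i0), b0 i0 s)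
   else if i \<in> R then (- g (snd (s $ i0)) $ i - snd (s $ i) \<bullet> snd (s $ i0), snd (s $ i)) else s $ i)"
   by (cases "i = i0"; cases "i \<in> R") simp_all
 qed
 define H where "H i0 = {s :: (real \<times> (real ^ 'n)) ^ 'i. fst (s $ i0) = 0}" for i0
 have negH: "negligible (H i0)" for i0
 proof -
  have "H i0 = {s. axis i0 (1, 0) \<bullet> s = 0}" by (simp add: H_def inner_axis' inner_prod_def)
  moreover have "axis i0 (1::real, 0::real ^ 'n) ~= 0" by (simp add: axis_eq_0_iff prod_eq_iff)
  ultimately show ?thesis using negligible_hyperplane[of "axis i0 (1, 0)" 0] by simp
 qed
 have neg: "negligible (Ps i0 ` (H i0 \<inter> U i0))" for i0
 proof (rule negligible_differentiable_image_negligible)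
  show "negligible (H i0 \<inter> U i0)" using negH negligible_subset by blast
  show "Ps i0 differentiable_on (H i0 \<inter> U i0)"
   unfolding differentiable_on_def
   using smooth_on_has_derivative[OF sPs[of i0]] by (metis IntD2 differentiable_at_withinI differentiable_def)
 qed simp
 have "{e. \<exists>y\<in>V. (\<forall>i\<in>R. perturb g ?w e y $ i = 0) \<and> \<not> regular_at_pt R (perturb g ?w e) y}
   \<subseteq> (\<Union>i0\<in>R. Ps i0 ` (H i0 \<inter> U i0))"
 proof
  fix e assume "e \<in> {e. \<exists>y\<in>V. (\<forall>i\<in>R. perturb g ?w e y $ i = 0) \<and> \<not> regular_at_pt R (perturb g ?w e) y}"
  then obtain y where y: "y \<in> V" "\<forall>i\<in>R. perturb g ?w e y $ i = 0" "\<not> regular_at_pt R (perturb g ?w e) y" by blast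
  have dp: "dir_deriv (perturb g ?w e) y v $ i = (grad i y + snd (e $ i)) \<bullet> v" for v i
   using perturb_dir_deriv[OF g sw y(1)] grad[OF y(1)] by (simp add: dw inner_prod_def inner_add_left)
  obtain c i0 where c: "\<And>v. (\<Sum>i\<in>R. c i * dir_deriv (perturb g ?w e) y v $ i) = 0" "i0 \<in> R" "c i0 ~= 0"
   using y(3) unfolding regular_at_pt_def by blast
  define u where "u = (\<Sum>i\<in>R. c i *\<^sub>R (grad i y + snd (e $ i)))"
  have "u \<bullet> v = 0" for v using c(1)[of v] by (simp add: dp u_def inner_sum_left)
  then have "u = 0" using inner_eq_zero_iff by blast
  define kp where "kp i = c i / c i0" for i
  have "(\<Sum>i\<in>R. kp i *\<^sub>R (grad i y + snd (e $ i))) = (1 / c i0) *\<^sub>R u"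
   by (simp add: u_def kp_def scaleR_sum_right)
  then have "(\<Sum>i\<in>R. kp i *\<^sub>R (grad i y + snd (e $ i))) = 0" using \<open>u = 0\<close> by simp
  then have "(grad i0 y + snd (e $ i0)) + (\<Sum>i\<in>R - {i0}. kp i *\<^sub>R (grad i y + snd (e $ i))) = 0"
   using c(2,3) by (simp add: sum.remove[of R i0] kp_def)
  then have b: "snd (e $ i0) = - grad i0 y - (\<Sum>i\<in>R - {i0}. kp i *\<^sub>R (grad i y + snd (e $ i)))"
   by (simp add: eq_diff_eq eq_neg_iff_add_eq_0 algebra_simps)
  have a: "fst (e $ i) = - g y $ i - snd (e $ i) \<bullet> y" if "i \<in> R" for i
  proof -
   have "g y $ i + (fst (e $ i) + snd (e $ i) \<bullet> y) = 0"
    using y(2) that by (simp add: perturb_def inner_prod_def)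
   then show ?thesis by linarith
  qed
  define s :: "(real \<times> (real ^ 'n)) ^ 'i" where
   "s = (\<chi> i. if i = i0 then (0, y) else if i \<in> R then (kp i, snd (e $ i)) else e $ i)"
  have s0: "s $ i0 = (0, y)" by (simp add: s_def)
  have "(\<Sum>i\<in>R - {i0}. fst (s $ i) *\<^sub>R (grad i y + snd (s $ i))) = (\<Sum>i\<in>R - {i0}. kp i *\<^sub>R (grad i y + snd (e $ i)))"
   by (rule sum.cong) (auto simp: s_def)
  then have b0: "b0 i0 s = snd (e $ i0)" by (simp add: b0_def s0 b)
  have "Ps i0 s $ i = e $ i" for i
  proof -
   consider "i = i0" | "i ~= i0" "i \<in> R" | "i ~= i0" "i \<notin> R" by blast
   then show ?thesis
    by cases (simp_all add: Ps_def s0 b0 prod_eq_iff a c(2), simp_all add: s_def)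
  qed
  then have "Ps i0 s = e" by (simp add: vec_eq_iff)
  moreover have "s \<in> H i0 \<inter> U i0" using y(1) by (simp add: H_def U_def s0)
  ultimately show "e \<in> (\<Union>i0\<in>R. Ps i0 ` (H i0 \<inter> U i0))" using c(2) by blast
 qed
 moreover have "negligible (\<Union>i0\<in>R. Ps i0 ` (H i0 \<inter> U i0))"
  by (rule negligible_Union) (use neg in auto)
 ultimately show ?thesis by (rule negligible_subset[rotated])
qed

lemma smooth_bounded_on_compact:
 fixes w :: "'a::euclidean_space => 'w::euclidean_space"
 assumes w: "smooth_on V w" and K: "compact K" "K \<subseteq> V"
 obtains C where "C \<ge> 0" "\<And>y. y \<in> K ==> norm (w y) \<le> C"
  "\<And>y v. y \<in> K ==> norm (dir_deriv w y v) \<le> C * norm v"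
proof -
 have bd: "\<exists>c\<ge>0. \<forall>y\<in>K. norm (f y) \<le> c" if "smooth_on V f" for f :: "'a => 'w"
 proof -
  have "continuous_on K f" using smooth_on_continuous[OF that] K(2) continuous_on_subset by blast
  then have "bounded (f ` K)" using compact_continuous_image[OF _ K(1)] compact_imp_bounded by blast
  then obtain c where "\<forall>y\<in>K. norm (f y) \<le> c" by (auto simp: bounded_iff)
  then show ?thesis by (intro exI[of _ "max c 0"]) (auto intro: max.coboundedI1)
 qed
 obtain c0 where c0: "c0 \<ge> 0" "\<And>y. y \<in> K ==> norm (w y) \<le> c0" using bd[OF w] by blast
 have "\<exists>c\<ge>0. \<forall>y\<in>K. norm (dir_deriv w y b) \<le> c" for b by (rule bd[OF smooth_on_dir_deriv[OF w]])
 then obtain c1 where c1: "\<And>b. c1 b \<ge> 0" "\<And>b y. y \<in> K ==> norm (dir_deriv w y b) \<le> c1 b" by metis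
 define C where "C = c0 + (\<Sum>b\<in>Basis. c1 b)"
 have s: "(\<Sum>b\<in>Basis. c1 b) \<ge> 0" using c1(1) by (simp add: sum_nonneg)
 have "norm (dir_deriv w y v) \<le> C * norm v" if y: "y \<in> K" for y v
 proof -
  note lin = dir_deriv_linear[OF w subsetD[OF K(2) y]]
  have "dir_deriv w y v = dir_deriv w y (\<Sum>b\<in>Basis. (v \<bullet> b) *\<^sub>R b)" by (simp only: euclidean_representation)
  also have "\<dots> = (\<Sum>b\<in>Basis. (v \<bullet> b) *\<^sub>R dir_deriv w y b)" by (simp add: linear_sum[OF lin] linear_scale[OF lin])
  finally have "norm (dir_deriv w y v) \<le> (\<Sum>b\<in>Basis. norm ((v \<bullet> b) *\<^sub>R dir_deriv w y b))" by (simp only: norm_sum)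
  also have "\<dots> \<le> (\<Sum>b\<in>Basis. norm v * c1 b)"
   using c1(2)[OF y] by (intro sum_mono) (simp add: Basis_le_norm mult_mono)
  also have "\<dots> = norm v * (\<Sum>b\<in>Basis. c1 b)" by (simp add: sum_distrib_left)
  also have "\<dots> \<le> norm v * C" using c0(1) by (intro mult_left_mono) (auto simp: C_def)
  finally show ?thesis by (simp add: mult.commute)
 qed
 moreover have "norm (w y) \<le> C" if "y \<in> K" for y using c0(2)[OF that] s by (simp add: C_def)
 moreover have "C \<ge> 0" using c0(1) s by (simp add: C_def)
 ultimately show thesis using that by blast
qed

text \<open>
 Regularity says that \<open>g\<close> and the derivative of \<open>\<Sum>c\<^sub>i g\<^sub>i\<close> do not vanish
 simultaneously, for unit vectors \<open>c\<close>. On a compact set the sum of their sizes is bounded below, and a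
 small perturbation changes it by less than this bound.
\<close>

lemma regular_stable:
 fixes g :: "'a::euclidean_space => real ^ 'i::finite" and w :: "'a => 'w::euclidean_space"
 assumes g: "smooth_on V g" and w: "smooth_on V w" and K: "compact K" "K \<subseteq> V"
  and reg: "\<And>y. y \<in> K ==> \<forall>i\<in>R. g y $ i = 0 ==> regular_at_pt R g y"
 obtains dl where "dl > 0" "\<And>e y. norm e < dl ==> y \<in> K ==> \<forall>i\<in>R. perturb g w e y $ i = 0 ==>
  regular_at_pt R (perturb g w e) y"
proof -
 define S where "S = sphere 0 1 \<inter> suppvec R"
 have S: "compact S" unfolding S_def by (intro compact_Int_closed closed_suppvec) simp
 define F where "F = (%(y, c). (\<Sum>i\<in>R. \<bar>g y $ i\<bar>) + (\<Sum>b\<in>Basis. \<bar>\<Sum>i\<in>R. c $ i * dir_deriv g y b $ i\<bar>))"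
 have cont: "continuous_on (K \<times> S) F"
 proof -
  have k: "continuous_on K g" "continuous_on K (%y. dir_deriv g y b)" for b
   using smooth_on_continuous[OF g] smooth_on_continuous[OF smooth_on_dir_deriv[OF g]] K(2) continuous_on_subset by blast+
  have kf: "continuous_on (K \<times> S) (%z. g (fst z))" "continuous_on (K \<times> S) (%z. dir_deriv g (fst z) b)" for b
   by (rule continuous_on_compose2[OF k(1)], auto intro: continuous_on_fst continuous_on_id)
    (rule continuous_on_compose2[OF k(2)], auto intro: continuous_on_fst continuous_on_id)
  show ?thesis
   unfolding F_def case_prod_beta
   by (intro continuous_on_add continuous_on_sum continuous_on_rabs continuous_on_mult
     bounded_linear.continuous_on[OF bounded_linear_vec_nth] kf continuous_on_snd continuous_on_id)
 qed
 have pos: "F (y, c) > 0" if y: "y \<in> K" and c: "c \<in> S" for y c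
 proof -
  have lin: "linear (dir_deriv g y)" using dir_deriv_linear[OF g] K(2) y by auto
  have nn: "F (y, c) \<ge> 0" by (auto simp: F_def intro!: add_nonneg_nonneg sum_nonneg)
  have "F (y, c) ~= 0"
  proof
   assume "F (y, c) = 0"
   then have 0: "(\<Sum>i\<in>R. \<bar>g y $ i\<bar>) = 0" "(\<Sum>b\<in>Basis. \<bar>\<Sum>i\<in>R. c $ i * dir_deriv g y b $ i\<bar>) = 0"
    by (auto simp: F_def add_nonneg_eq_0_iff sum_nonneg)
   then have "\<forall>i\<in>R. g y $ i = 0" and b: "\<forall>b\<in>Basis. (\<Sum>i\<in>R. c $ i * dir_deriv g y b $ i) = 0"
    by (simp_all add: sum_nonneg_eq_0_iff)
   from reg[OF y this(1)] have r: "(\<forall>v. (\<Sum>i\<in>R. c $ i * dir_deriv g y v $ i) = 0) ==> \<forall>i\<in>R. c $ i = 0"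
    unfolding regular_at_pt_def by blast
   have "(\<Sum>i\<in>R. c $ i * dir_deriv g y v $ i) = 0" for v
   proof -
    have "dir_deriv g y v = dir_deriv g y (\<Sum>b\<in>Basis. (v \<bullet> b) *\<^sub>R b)" by (simp only: euclidean_representation)
    also have "\<dots> = (\<Sum>b\<in>Basis. (v \<bullet> b) *\<^sub>R dir_deriv g y b)" by (simp add: linear_sum[OF lin] linear_scale[OF lin])
    finally have "(\<Sum>i\<in>R. c $ i * dir_deriv g y v $ i) = (\<Sum>i\<in>R. \<Sum>b\<in>Basis. (v \<bullet> b) * (c $ i * dir_deriv g y b $ i))"
     by (simp add: sum_distrib_left mult_ac)
    also have "\<dots> = (\<Sum>b\<in>Basis. (v \<bullet> b) * (\<Sum>i\<in>R. c $ i * dir_deriv g y b $ i))"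
     by (subst sum.swap) (simp add: sum_distrib_left)
    also have "\<dots> = 0" using b by simp
    finally show ?thesis .
   qed
   from r[OF allI[OF this]] c have "c = 0" by (auto simp: S_def suppvec_def vec_eq_iff)
   then show False using c by (simp add: S_def)
  qed
  with nn show ?thesis by simp
 qed
 obtain m where m: "m > 0" "\<And>y c. y \<in> K ==> c \<in> S ==> F (y, c) \<ge> m"
 proof (cases "K \<times> S = {}")
  case True
  then show thesis using that[of 1] by auto
 next
  case False
  obtain z where z: "z \<in> K \<times> S" "\<forall>z'\<in>K \<times> S. F z \<le> F z'"
   using continuous_attains_inf[OF compact_Times[OF K(1) S] False cont] by blast
  show thesis by (rule that[of "F z"]) (use z pos in auto)
 qed
 obtain C where C: "C \<ge> 0" "\<And>y. y \<in> K ==> norm (w y) \<le> C"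
  "\<And>y v. y \<in> K ==> norm (dir_deriv w y v) \<le> C * norm v"
  using smooth_bounded_on_compact[OF w K] by metis
 define B where "B = real (card R) * C + real DIM('a) * (real (card R) * C)"
 have B: "B \<ge> 0" using C(1) by (simp add: B_def)
 define dl where "dl = m / (B + 1)"
 have dl: "dl > 0" using m(1) B by (simp add: dl_def)
 have "regular_at_pt R (perturb g w e) y"
  if e: "norm e < dl" and y: "y \<in> K" and z: "\<forall>i\<in>R. perturb g w e y $ i = 0" for e y
 proof -
  have yV: "y \<in> V" using y K(2) by auto
  have "\<forall>i\<in>R. c i = 0" if c0: "\<forall>v. (\<Sum>i\<in>R. c i * dir_deriv (perturb g w e) y v $ i) = 0" for c
  proof (rule ccontr)
   assume ne: "\<not> (\<forall>i\<in>R. c i = 0)"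
   define c1 where "c1 = (\<chi> i. if i \<in> R then c i else 0)"
   have "c1 ~= 0" using ne by (auto simp: c1_def vec_eq_iff)
   define c2 where "c2 = (1 / norm c1) *\<^sub>R c1"
   have c2: "c2 \<in> S" using \<open>c1 ~= 0\<close> by (simp add: c2_def S_def suppvec_def c1_def)
   have c2i: "\<bar>c2 $ i\<bar> \<le> 1" for i using component_le_norm_cart[of c2 i] c2 by (simp add: S_def)
   have ee: "norm (e $ i) \<le> norm e" for i by (rule Finite_Cartesian_Product.norm_nth_le)
   have "\<bar>g y $ i\<bar> \<le> norm e * C" if "i \<in> R" for i
   proof -
    have "g y $ i + e $ i \<bullet> w y = 0" using z that by (simp add: perturb_def)
    then have "g y $ i = - (e $ i \<bullet> w y)" by linarith
    then have "\<bar>g y $ i\<bar> \<le> norm (e $ i) * norm (w y)" using Cauchy_Schwarz_ineq2 by simp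
    also have "\<dots> \<le> norm e * C" using ee C(2)[OF y] by (intro mult_mono) auto
    finally show ?thesis .
   qed
   then have 1: "(\<Sum>i\<in>R. \<bar>g y $ i\<bar>) \<le> real (card R) * (norm e * C)"
    using sum_bounded_above[of R "%i. \<bar>g y $ i\<bar>"] by blast
   have "\<bar>\<Sum>i\<in>R. c2 $ i * dir_deriv g y b $ i\<bar> \<le> real (card R) * (norm e * C)" if b: "b \<in> Basis" for b
   proof -
    have "(\<Sum>i\<in>R. c2 $ i * dir_deriv (perturb g w e) y b $ i) = (1 / norm c1) * (\<Sum>i\<in>R. c i * dir_deriv (perturb g w e) y b $ i)"
     unfolding sum_distrib_left by (rule sum.cong) (auto simp: c2_def c1_def)
    also have "\<dots> = 0" using c0 by simp
    finally have "(\<Sum>i\<in>R. c2 $ i * dir_deriv g y b $ i) = - (\<Sum>i\<in>R. c2 $ i * (e $ i \<bullet> dir_deriv w y b))"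
     by (simp add: perturb_dir_deriv[OF g w yV] distrib_left sum.distrib eq_neg_iff_add_eq_0)
    then have "\<bar>\<Sum>i\<in>R. c2 $ i * dir_deriv g y b $ i\<bar> \<le> (\<Sum>i\<in>R. \<bar>c2 $ i * (e $ i \<bullet> dir_deriv w y b)\<bar>)"
     using sum_abs[of "%i. c2 $ i * (e $ i \<bullet> dir_deriv w y b)" R] by simp
    also have "\<dots> \<le> real (card R) * (norm e * C)"
    proof (rule sum_bounded_above)
     fix i
     have "\<bar>e $ i \<bullet> dir_deriv w y b\<bar> \<le> norm (e $ i) * norm (dir_deriv w y b)" by (rule Cauchy_Schwarz_ineq2)
     also have "\<dots> \<le> norm e * C" using ee C(3)[OF y, of b] b by (intro mult_mono) auto
     finally have "\<bar>e $ i \<bullet> dir_deriv w y b\<bar> \<le> norm e * C" .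
     then have "\<bar>c2 $ i\<bar> * \<bar>e $ i \<bullet> dir_deriv w y b\<bar> \<le> 1 * (norm e * C)"
      by (intro mult_mono c2i) auto
     then show "\<bar>c2 $ i * (e $ i \<bullet> dir_deriv w y b)\<bar> \<le> norm e * C" by (simp add: abs_mult)
    qed
    finally show ?thesis .
   qed
   then have "(\<Sum>b\<in>(Basis::'a set). \<bar>\<Sum>i\<in>R. c2 $ i * dir_deriv g y b $ i\<bar>) \<le> real DIM('a) * (real (card R) * (norm e * C))"
    by (rule sum_bounded_above)
   with 1 have "F (y, c2) \<le> B * norm e" by (simp add: F_def B_def algebra_simps)
   also have "\<dots> \<le> B * dl" using e B by (intro mult_left_mono) auto
   also have "\<dots> < m" using m(1) B by (simp add: dl_def field_simps)
   finally show False using m(2)[OF y c2] by simp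
  qed
  then show ?thesis unfolding regular_at_pt_def by blast
 qed
 with dl show thesis using that by blast
qed

section \<open>Homogeneous polynomials and their perturbations in charts\<close>

text \<open>
 Forms of degree \<open>m\<close> in the variables \<open>y 0, \<dots>, y k\<close>, as functions.
\<close>

inductive hpoly :: "nat => nat => ((nat => real) => real) => bool" for k :: nat where
 const: "hpoly k 0 (%y. c)"
| var: "l \<le> k ==> hpoly k 1 (%y. y l)"
| add: "hpoly k m p ==> hpoly k m q ==> hpoly k m (%y. p y + q y)"
| mult: "hpoly k m p ==> hpoly k m' q ==> hpoly k (m + m') (%y. p y * q y)"

lemma hpoly_scale: "hpoly k m p ==> hpoly k m (%y. c * p y)"
 using hpoly.mult[OF hpoly.const[of k c]] by simp

lemma hpoly_power: "hpoly k m p ==> hpoly k (n * m) (%y. p y ^ n)"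
proof (induction n)
 case 0
 then show ?case using hpoly.const[of k 1] by simp
next
 case (Suc n)
 then show ?case using hpoly.mult[OF Suc.prems Suc.IH[OF Suc.prems]] by simp
qed

lemma hpoly_var_power: "l \<le> k ==> hpoly k n (%y. y l ^ n)"
 using hpoly_power[OF hpoly.var, of l k n] by simp

lemma hpoly_zero: "hpoly k m (%y. 0)"
 using hpoly_scale[OF hpoly_var_power[of 0 k m], of 0] by simp

lemma hpoly_sum: "(\<And>i. i \<in> I ==> hpoly k m (p i)) ==> hpoly k m (%y. \<Sum>i\<in>I. p i y)"
proof (induction I rule: infinite_finite_induct)
 case (insert i I)
 have "hpoly k m (%y. p i y + (\<Sum>i\<in>I. p i y))"
  by (rule hpoly.add) (use insert in auto)
 then show ?case using insert(1,2) by simp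
qed (simp_all add: hpoly_zero)

lemma hpoly_smooth:
 assumes "hpoly k m p" "\<And>a. a \<le> k ==> smooth_on V (q a)"
 shows "smooth_on V (%y. p (%a. q a y))"
 using assms(1)
proof induction
 case (const c)
 show ?case by (rule smooth_on_const[OF smooth_on_open[OF assms(2)[of 0]]]) simp
qed (simp_all add: assms(2) smooth_on_add smooth_on_mult)

text \<open>Substituting quotients \<open>A i / B\<close> into a polynomial and clearing denominators.\<close>

lemma homogenize_polynomial:
 fixes p :: "real ^ 'n::finite => real"
 assumes "real_polynomial_function p"
 shows "\<exists>D. \<forall>M A B. (\<forall>i. hpoly k M (A i)) --> hpoly k M B -->
  (\<exists>H. hpoly k (D * M) H \<and> (\<forall>y. B y ~= 0 --> H y = B y ^ D * p (\<chi> i. A i y / B y)))"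
 using assms
proof induction
 case (linear f)
 show ?case
 proof (intro exI[of _ 1] allI impI)
  fix M and A :: "'n => (nat => real) => real" and B :: "(nat => real) => real"
  assume A: "\<forall>i. hpoly k M (A i)" and B: "hpoly k M B"
  have "hpoly k M (%y. \<Sum>i\<in>UNIV. f (axis i 1) * A i y)"
   by (intro hpoly_sum hpoly_scale) (use A in blast)
  moreover have "(\<Sum>i\<in>UNIV. f (axis i 1) * A i y) = B y ^ 1 * f (\<chi> i. A i y / B y)" if "B y ~= 0" for y
  proof -
   have "f (\<chi> i. A i y / B y) = f (\<Sum>i\<in>UNIV. (A i y / B y) *\<^sub>R axis i 1)"
    by (rule arg_cong[where f = f]) (simp add: vec_eq_iff axis_def if_distrib cong: if_cong)
   also have "\<dots> = (\<Sum>i\<in>UNIV. (A i y / B y) * f (axis i 1))"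
    using bounded_linear.linear[OF linear] by (simp add: linear_sum linear_scale)
   finally show ?thesis using that by (simp add: sum_distrib_left mult.commute)
  qed
  ultimately show "\<exists>H. hpoly k (1 * M) H \<and> (\<forall>y. B y ~= 0 --> H y = B y ^ 1 * f (\<chi> i. A i y / B y))"
   by (intro exI[of _ "%y. \<Sum>i\<in>UNIV. f (axis i 1) * A i y"]) simp
 qed
next
 case (const c)
 show ?case
  by (rule exI[of _ 0]) (use hpoly.const[of k c] in auto)
next
 case (add f g)
 from add.IH(1) obtain D1 where D1: "\<And>M A B. (\<forall>i. hpoly k M (A i)) ==> hpoly k M B ==>
  \<exists>H. hpoly k (D1 * M) H \<and> (\<forall>y. B y ~= 0 --> H y = B y ^ D1 * f (\<chi> i. A i y / B y))" by blast
 from add.IH(2) obtain D2 where D2: "\<And>M A B. (\<forall>i. hpoly k M (A i)) ==> hpoly k M B ==>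
  \<exists>H. hpoly k (D2 * M) H \<and> (\<forall>y. B y ~= 0 --> H y = B y ^ D2 * g (\<chi> i. A i y / B y))" by blast
 show ?case
 proof (intro exI[of _ "D1 + D2"] allI impI)
  fix M and A :: "'n => (nat => real) => real" and B :: "(nat => real) => real"
  assume A: "\<forall>i. hpoly k M (A i)" and B: "hpoly k M B"
  from D1[OF this] obtain H1 where H1: "hpoly k (D1 * M) H1" "\<forall>y. B y ~= 0 --> H1 y = B y ^ D1 * f (\<chi> i. A i y / B y)" by blast
  from D2[OF A B] obtain H2 where H2: "hpoly k (D2 * M) H2" "\<forall>y. B y ~= 0 --> H2 y = B y ^ D2 * g (\<chi> i. A i y / B y)" by blast
  have 1: "hpoly k (D2 * M + D1 * M) (%y. B y ^ D2 * H1 y)" by (rule hpoly.mult[OF hpoly_power[OF B] H1(1)])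
  have 2: "hpoly k (D1 * M + D2 * M) (%y. B y ^ D1 * H2 y)" by (rule hpoly.mult[OF hpoly_power[OF B] H2(1)])
  have e: "D2 * M + D1 * M = (D1 + D2) * M" "D1 * M + D2 * M = (D1 + D2) * M" by (simp_all add: algebra_simps)
  have "hpoly k ((D1 + D2) * M) (%y. B y ^ D2 * H1 y + B y ^ D1 * H2 y)"
   by (rule hpoly.add[OF 1[unfolded e] 2[unfolded e]])
  moreover have "B y ^ D2 * H1 y + B y ^ D1 * H2 y = B y ^ (D1 + D2) * (f (\<chi> i. A i y / B y) + g (\<chi> i. A i y / B y))" if "B y ~= 0" for y
   using H1(2) H2(2) that by (simp add: power_add algebra_simps)
  ultimately show "\<exists>H. hpoly k ((D1 + D2) * M) H \<and> (\<forall>y. B y ~= 0 --> H y = B y ^ (D1 + D2) * (f (\<chi> i. A i y / B y) + g (\<chi> i. A i y / B y)))"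
   by (intro exI[of _ "%y. B y ^ D2 * H1 y + B y ^ D1 * H2 y"]) simp
 qed
next
 case (mult f g)
 from mult.IH(1) obtain D1 where D1: "\<And>M A B. (\<forall>i. hpoly k M (A i)) ==> hpoly k M B ==>
  \<exists>H. hpoly k (D1 * M) H \<and> (\<forall>y. B y ~= 0 --> H y = B y ^ D1 * f (\<chi> i. A i y / B y))" by blast
 from mult.IH(2) obtain D2 where D2: "\<And>M A B. (\<forall>i. hpoly k M (A i)) ==> hpoly k M B ==>
  \<exists>H. hpoly k (D2 * M) H \<and> (\<forall>y. B y ~= 0 --> H y = B y ^ D2 * g (\<chi> i. A i y / B y))" by blast
 show ?case
 proof (intro exI[of _ "D1 + D2"] allI impI)
  fix M and A :: "'n => (nat => real) => real" and B :: "(nat => real) => real"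
  assume A: "\<forall>i. hpoly k M (A i)" and B: "hpoly k M B"
  from D1[OF this] obtain H1 where H1: "hpoly k (D1 * M) H1" "\<forall>y. B y ~= 0 --> H1 y = B y ^ D1 * f (\<chi> i. A i y / B y)" by blast
  from D2[OF A B] obtain H2 where H2: "hpoly k (D2 * M) H2" "\<forall>y. B y ~= 0 --> H2 y = B y ^ D2 * g (\<chi> i. A i y / B y)" by blast
  have e: "D1 * M + D2 * M = (D1 + D2) * M" by (simp add: algebra_simps)
  have "hpoly k ((D1 + D2) * M) (%y. H1 y * H2 y)"
   using hpoly.mult[OF H1(1) H2(1)] unfolding e .
  moreover have "H1 y * H2 y = B y ^ (D1 + D2) * (f (\<chi> i. A i y / B y) * g (\<chi> i. A i y / B y))" if "B y ~= 0" for y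
   using H1(2) H2(2) that by (simp add: power_add)
  ultimately show "\<exists>H. hpoly k ((D1 + D2) * M) H \<and> (\<forall>y. B y ~= 0 --> H y = B y ^ (D1 + D2) * (f (\<chi> i. A i y / B y) * g (\<chi> i. A i y / B y)))"
   by (intro exI[of _ "%y. H1 y * H2 y"]) simp
 qed
qed

text \<open>The Chebyshev recursion, homogenized with the denominator \<open>B\<close>.\<close>

lemma homogenize_cheb:
 assumes L: "hpoly k 1 L" and B: "hpoly k 1 B"
 shows "\<exists>H. hpoly k n H \<and> (\<forall>y. B y ~= 0 --> H y = B y ^ n * cheb n (L y / B y))"
proof (induction n rule: less_induct)
 case (less n)
 consider "n = 0" | "n = Suc 0" | m where "n = Suc (Suc m)" by (metis not0_implies_Suc)
 then show ?case
 proof cases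
  case 1
  then show ?thesis using hpoly.const[of k 1] by (intro exI[of _ "%y. 1"]) simp
 next
  case 2
  then show ?thesis using L by (intro exI[of _ L]) simp
 next
  case (3 m)
  obtain H1 where H1: "hpoly k (Suc m) H1" "\<forall>y. B y ~= 0 --> H1 y = B y ^ Suc m * cheb (Suc m) (L y / B y)"
   using less[of "Suc m"] 3 by auto
  obtain H0 where H0: "hpoly k m H0" "\<forall>y. B y ~= 0 --> H0 y = B y ^ m * cheb m (L y / B y)"
   using less[of m] 3 by auto
  have 1: "hpoly k (1 + Suc m) (%y. (2 * L y) * H1 y)" by (rule hpoly.mult[OF hpoly_scale[OF L] H1(1)])
  have 2: "hpoly k (2 * 1 + m) (%y. B y ^ 2 * ((-1) * H0 y))" by (rule hpoly.mult[OF hpoly_power[OF B] hpoly_scale[OF H0(1)]])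
  have e: "1 + Suc m = n" "2 * 1 + m = n" using 3 by simp_all
  have "hpoly k n (%y. (2 * L y) * H1 y + B y ^ 2 * ((-1) * H0 y))"
   by (rule hpoly.add[OF 1[unfolded e] 2[unfolded e]])
  moreover have "(2 * L y) * H1 y + B y ^ 2 * ((-1) * H0 y) = B y ^ n * cheb n (L y / B y)" if "B y ~= 0" for y
   using H1(2) H0(2) that 3 by (simp add: field_simps power2_eq_square)
  ultimately show ?thesis by blast
 qed
qed

definition tuple_fun :: "(nat => 'a => real) => ('i::finite => (nat => real) => real) => 'a => real ^ 'i" where
 "tuple_fun q P y = (\<chi> i. P i (%a. q a y))"

text \<open>
 Dehomogenized with \<open>y j = 1\<close>, the added forms are arbitrary affine functions of the coordinates
 \<open>y (l b)\<close>.
\<close>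

definition pert :: "nat => nat => ('n::finite => nat) => (real \<times> (real ^ 'n)) ^ 'i::finite =>
  ('i => (nat => real) => real) => 'i => (nat => real) => real" where
 "pert m j l e P i y = P i y + (fst (e $ i) * y j + (\<Sum>b\<in>UNIV. snd (e $ i) $ b * y (l b))) * y j ^ (m - 1)"

lemma hpoly_pert:
 assumes "hpoly k m (P i)" "m > 0" "j \<le> k" "\<And>b. l b \<le> k"
 shows "hpoly k m (pert m j l e P i)"
proof -
 have "hpoly k (1 + (m - 1)) (%y. (fst (e $ i) * y j + (\<Sum>b\<in>UNIV. snd (e $ i) $ b * y (l b))) * y j ^ (m - 1))"
  by (intro hpoly.mult hpoly.add hpoly_scale hpoly.var hpoly_sum hpoly_var_power assms)
 then show ?thesis
  unfolding pert_def[abs_def] using assms(1,2) by (intro hpoly.add) auto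
qed

text \<open>The perturbation depends linearly on its parameters; these are the coefficients in a chart.\<close>

definition pert_weight :: "nat => nat => ('n::finite => nat) => (nat => 'a => real) => 'a => real \<times> (real ^ 'n)" where
 "pert_weight m j l q y = (q j y * q j y ^ (m - 1), \<chi> b. q (l b) y * q j y ^ (m - 1))"

lemma tuple_fun_pert: "tuple_fun q (pert m j l e P) = perturb (tuple_fun q P) (pert_weight m j l q) e"
proof (intro ext, unfold vec_eq_iff, intro allI)
 fix y i
 have "(fst (e $ i) * q j y + (\<Sum>b\<in>UNIV. snd (e $ i) $ b * q (l b) y)) * q j y ^ (m - 1) =
   fst (e $ i) * (q j y * q j y ^ (m - 1)) + (\<Sum>b\<in>UNIV. snd (e $ i) $ b * (q (l b) y * q j y ^ (m - 1)))"
  by (simp only: distrib_right sum_distrib_right mult.assoc)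
 also have "\<dots> = e $ i \<bullet> pert_weight m j l q y"
  by (simp add: pert_weight_def inner_prod_def inner_vec_def)
 finally show "tuple_fun q (pert m j l e P) y $ i = perturb (tuple_fun q P) (pert_weight m j l q) e y $ i"
  by (simp add: tuple_fun_def perturb_def pert_def)
qed

lemma pert_weight_smooth:
 assumes "\<And>a. a \<le> k ==> smooth_on V (q a)" "j \<le> k" "\<And>b. l b \<le> k"
 shows "smooth_on V (pert_weight m j l q)"
 unfolding pert_weight_def[abs_def]
 by (intro smooth_on_Pair smooth_on_mult smooth_on_power smooth_on_vec_lambda assms)

lemma tuple_fun_smooth:
 assumes "\<And>i. hpoly k m (P i)" "\<And>a. a \<le> k ==> smooth_on V (q a)"
 shows "smooth_on V (tuple_fun q P)"
 unfolding tuple_fun_def[abs_def] by (intro smooth_on_vec_lambda hpoly_smooth[OF assms(1)] assms(2))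

definition vec_restrict :: "'i set => real ^ 'i::finite => real ^ 'i" where
 "vec_restrict R x = (\<chi> i. if i \<in> R then x $ i else 0)"

lemma vec_restrict_linear: "linear (vec_restrict R)"
 by (rule linearI) (auto simp: vec_restrict_def vec_eq_iff)

lemma vec_restrict_suppvec: "vec_restrict R x \<in> suppvec R"
 by (simp add: vec_restrict_def suppvec_def)

lemma norm_vec_restrict_le: "norm (vec_restrict R x) \<le> norm x"
 unfolding norm_vec_def by (rule L2_set_mono) (auto simp: vec_restrict_def)

text \<open>The bound \<open>eta'\<close> is uniform on \<open>N\<close> and strictly less than \<open>eta\<close>, so that small perturbations preserve the condition.\<close>

definition C1_close :: "'i set => ('b::euclidean_space => real ^ 'i::finite) => 'b set => real => ('b => real ^ 'i) => bool" where
 "C1_close R tau N eta f \<longleftrightarrow> (\<exists>eta'<eta. \<forall>z\<in>N. norm (vec_restrict R (f z) - tau z) \<le> eta' \<and>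
  (\<forall>v. norm (dir_deriv (%z. vec_restrict R (f z)) z v - dir_deriv tau z v) \<le> eta' * norm v))"

lemma C1_close_stable:
 fixes f :: "'b::euclidean_space => real ^ 'i::finite" and w :: "'b => 'w::euclidean_space"
 assumes f: "smooth_on B f" and w: "smooth_on B w" and N: "compact N" "N \<subseteq> B" and close: "C1_close R tau N eta f"
 obtains dl where "dl > 0" "\<And>e. norm e < dl ==> C1_close R tau N eta (perturb f w e)"
proof -
 obtain eta' where eta': "eta' < eta" "\<And>z. z \<in> N ==> norm (vec_restrict R (f z) - tau z) \<le> eta'"
  "\<And>z v. z \<in> N ==> norm (dir_deriv (%z. vec_restrict R (f z)) z v - dir_deriv tau z v) \<le> eta' * norm v"
  using close unfolding C1_close_def by blast
 obtain C where C: "C \<ge> 0" "\<And>y. y \<in> N ==> norm (w y) \<le> C"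
  "\<And>y v. y \<in> N ==> norm (dir_deriv w y v) \<le> C * norm v"
  using smooth_bounded_on_compact[OF w N] by metis
 define D where "D = real CARD('i) * C"
 have D: "D \<ge> 0" using C(1) by (simp add: D_def)
 define dl where "dl = (eta - eta') / (2 * (D + 1))"
 have dl: "dl > 0" using eta'(1) D by (simp add: dl_def)
 have vecb: "norm (\<chi> i. e $ i \<bullet> u) \<le> real CARD('i) * (norm e * norm u)" for e :: "'w ^ 'i" and u :: 'w
 proof -
  have "norm (\<chi> i. e $ i \<bullet> u) \<le> (\<Sum>i\<in>UNIV. \<bar>(\<chi> i. e $ i \<bullet> u) $ i\<bar>)" by (rule norm_le_l1_cart)
  also have "\<dots> \<le> real CARD('i) * (norm e * norm u)"
  proof (rule sum_bounded_above)
   fix i :: 'i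
   have "\<bar>e $ i \<bullet> u\<bar> \<le> norm (e $ i) * norm u" by (rule Cauchy_Schwarz_ineq2)
   also have "\<dots> \<le> norm e * norm u" by (intro mult_right_mono Finite_Cartesian_Product.norm_nth_le) simp
   finally show "\<bar>(\<chi> i. e $ i \<bullet> u) $ i\<bar> \<le> norm e * norm u" by simp
  qed
  finally show ?thesis .
 qed
 have "C1_close R tau N eta (perturb f w e)" if e: "norm e < dl" for e
  unfolding C1_close_def
 proof (intro exI[of _ "eta' + D * norm e"] conjI ballI allI)
  have "D * norm e \<le> D * dl" using e D by (intro mult_left_mono) auto
  also have "\<dots> < 2 * (D + 1) * dl"
  proof (rule mult_strict_right_mono[OF _ dl])
   show "D < 2 * (D + 1)" using D by simp
  qed
  also have "\<dots> = eta - eta'" using D by (simp add: dl_def)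
  finally show "eta' + D * norm e < eta" by simp
  fix z assume z: "z \<in> N"
  then have zB: "z \<in> B" using N(2) by auto
  have "vec_restrict R (perturb f w e z) = vec_restrict R (f z) + vec_restrict R (\<chi> i. e $ i \<bullet> w z)"
   by (simp add: vec_restrict_def perturb_def vec_eq_iff)
  then have "vec_restrict R (perturb f w e z) - tau z = (vec_restrict R (f z) - tau z) + vec_restrict R (\<chi> i. e $ i \<bullet> w z)" by simp
  then have "norm (vec_restrict R (perturb f w e z) - tau z) \<le> norm (vec_restrict R (f z) - tau z) + norm (vec_restrict R (\<chi> i. e $ i \<bullet> w z))"
   by (simp only: norm_triangle_ineq)
  also have "\<dots> \<le> eta' + real CARD('i) * (norm e * norm (w z))"
   using eta'(2)[OF z] norm_vec_restrict_le[of R "\<chi> i. e $ i \<bullet> w z"] vecb[of e "w z"] by linarith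
  also have "\<dots> \<le> eta' + real CARD('i) * (norm e * C)" using C(2)[OF z] by (intro add_left_mono mult_left_mono) auto
  finally show "norm (vec_restrict R (perturb f w e z) - tau z) \<le> eta' + D * norm e" by (simp add: D_def mult_ac)
  fix v
  have "dir_deriv (%z. vec_restrict R (h z)) z v = vec_restrict R (dir_deriv h z v)" if "smooth_on B h" for h :: "'b => real ^ 'i"
   by (rule fun_cong[OF dir_deriv_eq[OF bounded_linear.has_derivative[OF _ smooth_on_has_derivative[OF that zB]]]])
    (simp add: vec_restrict_linear linear_conv_bounded_linear[symmetric])
  note dm = this
  have "dir_deriv (%z. vec_restrict R (perturb f w e z)) z v = dir_deriv (%z. vec_restrict R (f z)) z v + vec_restrict R (\<chi> i. e $ i \<bullet> dir_deriv w z v)"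
   unfolding dm[OF perturb_smooth[OF f w]] dm[OF f]
   by (simp add: vec_restrict_def vec_eq_iff perturb_dir_deriv[OF f w zB])
  then have "dir_deriv (%z. vec_restrict R (perturb f w e z)) z v - dir_deriv tau z v
    = (dir_deriv (%z. vec_restrict R (f z)) z v - dir_deriv tau z v) + vec_restrict R (\<chi> i. e $ i \<bullet> dir_deriv w z v)" by simp
  then have "norm (dir_deriv (%z. vec_restrict R (perturb f w e z)) z v - dir_deriv tau z v)
    \<le> norm (dir_deriv (%z. vec_restrict R (f z)) z v - dir_deriv tau z v) + norm (vec_restrict R (\<chi> i. e $ i \<bullet> dir_deriv w z v))"
   by (simp only: norm_triangle_ineq)
  also have "\<dots> \<le> eta' * norm v + real CARD('i) * (norm e * norm (dir_deriv w z v))"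
   using eta'(3)[OF z, of v] norm_vec_restrict_le[of R "\<chi> i. e $ i \<bullet> dir_deriv w z v"] vecb[of e "dir_deriv w z v"] by linarith
  also have "\<dots> \<le> eta' * norm v + real CARD('i) * (norm e * (C * norm v))"
   using C(3)[OF z, of v] by (intro add_left_mono mult_left_mono) auto
  finally show "norm (dir_deriv (%z. vec_restrict R (perturb f w e z)) z v - dir_deriv tau z v) \<le> (eta' + D * norm e) * norm v"
   by (simp add: D_def algebra_simps)
 qed
 with dl show thesis using that by blast
qed

lemma clopen_union_of_components:
 assumes "openin (top_of_set S) C" "closedin (top_of_set S) C"
 shows "\<exists>\<K>\<subseteq>components S. C = \<Union>\<K>"
proof (intro exI[of _ "{K \<in> components S. K \<subseteq> C}"] conjI equalityI)
 show "C \<subseteq> \<Union> {K \<in> components S. K \<subseteq> C}"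
 proof
  fix x assume x: "x \<in> C"
  then have xS: "x \<in> S" using openin_imp_subset[OF assms(1)] by auto
  let ?K = "connected_component_set S x"
  have K: "?K \<in> components S" "x \<in> ?K" using xS by (auto simp: components_def)
  have sub: "?K \<subseteq> S" by (rule connected_component_subset)
  obtain T where T: "open T" "C = S \<inter> T" using assms(1) by (auto simp: openin_open)
  obtain F where F: "closed F" "C = S \<inter> F" using assms(2) by (auto simp: closedin_closed)
  have "?K \<inter> C = ?K \<inter> T" "?K \<inter> C = ?K \<inter> F" using sub T(2) F(2) by auto
  then have "openin (top_of_set ?K) (?K \<inter> C) \<and> closedin (top_of_set ?K) (?K \<inter> C)"
   using openin_open_Int[OF T(1), of ?K] closedin_closed_Int[OF F(1), of ?K] by simp
  then have "?K \<inter> C = {} \<or> ?K \<inter> C = ?K"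
   using connected_connected_component[of S x] unfolding connected_clopen by blast
  then have "?K \<subseteq> C" using x K(2) by blast
  then show "x \<in> \<Union> {K \<in> components S. K \<subseteq> C}" using K by blast
 qed
qed auto

text \<open>
 The image of \<open>Z\<close> is compact, and it is open in \<open>S\<close> because it is all of \<open>S\<close>
 inside an open set. So it is a union of components of \<open>S\<close>.
\<close>

lemma zero_set_copy:
 fixes sg :: "real ^ 'n::finite => 'm::euclidean_space" and Th :: "'b::euclidean_space => real ^ 'n"
 assumes sg: "smooth_on V sg" and psi: "smooth_on Q psi"
  and sgpsi: "\<And>y. y \<in> V ==> sg y \<in> Q \<and> psi (sg y) = y"
  and S: "\<And>A. A \<in> S ==> A \<in> Q ==> psi A \<in> V \<and> sg (psi A) = A"
  and SG: "\<And>y. y \<in> V ==> sg y \<in> S \<longleftrightarrow> (\<forall>i\<in>R. G y $ i = 0)"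
  and Th: "smooth_on B Th" "Th ` B \<subseteq> V" "open (Th ` B)"
  and Xi: "smooth_on UNIV Xi" "\<And>z. z \<in> B ==> Xi (Th z) = z"
  and Z: "compact Z" "diffeomorphic \<Sigma> Z" "Z \<subseteq> No" "open No" "No \<subseteq> B"
   "\<And>z. z \<in> No ==> z \<in> Z \<longleftrightarrow> (\<forall>i\<in>R. G (Th z) $ i = 0)"
 shows "diffeomorphic \<Sigma> (sg ` Th ` Z)" and "\<exists>\<K>\<subseteq>components S. sg ` Th ` Z = \<Union>\<K>"
proof -
 have ZB: "Z \<subseteq> B" using Z by blast
 have zV: "Th z \<in> V" if "z \<in> B" for z using Th(2) that by blast
 let ?C = "sg ` Th ` Z"
 have s1: "smooth_on B (%z. sg (Th z))" by (rule smooth_on_compose[OF sg Th(1,2)])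
 have s2: "smooth_on Q (%A. Xi (psi A))" by (rule smooth_on_compose[OF Xi(1) psi]) simp
 have inv: "Xi (psi (sg (Th z))) = z" if "z \<in> B" for z using sgpsi[OF zV[OF that]] Xi(2)[OF that] by simp
 have CQ: "?C \<subseteq> Q" using sgpsi zV ZB by blast
 have "diffeomorphic Z ?C"
  unfolding diffeomorphic_def
 proof (intro exI[of _ "%z. sg (Th z)"] exI[of _ "%A. Xi (psi A)"] conjI)
  show "smooth_map Z (%z. sg (Th z))" by (rule smooth_map_on[OF s1 ZB])
  show "smooth_map ?C (%A. Xi (psi A))" by (rule smooth_map_on[OF s2 CQ])
  show "(%z. sg (Th z)) ` Z = ?C" by (simp add: image_image)
  have invZ: "Xi (psi (sg (Th z))) = z" if "z \<in> Z" for z using inv ZB that by blast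
  then show "(%A. Xi (psi A)) ` ?C = Z" by (simp add: image_image)
  show "\<forall>x\<in>Z. Xi (psi (sg (Th x))) = x" using invZ by blast
  show "\<forall>y\<in>?C. sg (Th (Xi (psi y))) = y" using invZ by simp
 qed
 then show "diffeomorphic \<Sigma> ?C" by (rule diffeomorphic_trans[OF Z(2)])
 define W where "W = Q \<inter> psi -` (Th ` B \<inter> Xi -` No)"
 have "open (Th ` B \<inter> Xi -` No)"
  by (intro open_Int Th(3) open_vimage Z(4) smooth_on_continuous[OF Xi(1)])
 then have opW: "open W"
  unfolding W_def by (rule continuous_open_preimage[OF smooth_on_continuous[OF psi] smooth_on_open[OF psi]])
 have "?C = S \<inter> W"
 proof (intro equalityI subsetI)
  fix A assume "A \<in> ?C"
  then obtain z where z: "z \<in> Z" "A = sg (Th z)" by blast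
  then have zB: "z \<in> B" "z \<in> No" using ZB Z(3) by auto
  have "\<forall>i\<in>R. G (Th z) $ i = 0" using Z(6)[OF zB(2)] z(1) by blast
  then have "A \<in> S" using SG[OF zV[OF zB(1)]] z(2) by simp
  moreover have "A \<in> Q" "psi A = Th z" using sgpsi[OF zV[OF zB(1)]] z(2) by auto
  ultimately show "A \<in> S \<inter> W" using zB Xi(2)[OF zB(1)] by (simp add: W_def)
 next
  fix A assume "A \<in> S \<inter> W"
  then have A: "A \<in> S" "A \<in> Q" "psi A \<in> Th ` B" "Xi (psi A) \<in> No" by (auto simp: W_def)
  then obtain z where z: "z \<in> B" "psi A = Th z" by blast
  have zN: "z \<in> No" using A(4) z Xi(2) by simp
  have eq: "sg (Th z) = A" using S[OF A(1,2)] z(2) by simp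
  have "\<forall>i\<in>R. G (Th z) $ i = 0" using SG[OF zV[OF z(1)]] eq A(1) by simp
  then have "z \<in> Z" using Z(6)[OF zN] by blast
  then show "A \<in> ?C" using eq by blast
 qed
 then have "openin (top_of_set S) ?C" using opW by (simp add: openin_open_Int)
 moreover have "closedin (top_of_set S) ?C"
 proof -
  have "compact ((%z. sg (Th z)) ` Z)"
   by (rule compact_continuous_image[OF continuous_on_subset[OF smooth_on_continuous[OF s1] ZB] Z(1)])
  then have "closed ?C" by (simp add: image_image compact_imp_closed)
  then show ?thesis using \<open>?C = S \<inter> W\<close> by (intro closed_subset) auto
 qed
 ultimately show "\<exists>\<K>\<subseteq>components S. ?C = \<Union>\<K>" by (rule clopen_union_of_components)
qed

section \<open>Many copies in a compact real manifold\<close>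

text \<open>
 A chart of the compact set \<open>X\<close>: a parametrization \<open>sg\<close> with smooth left inverse \<open>psi\<close>, together with
 representatives \<open>q a\<close> of the homogeneous coordinates \<open>y a\<close>. Here \<open>y j\<close> is normalized to \<open>1\<close>, and the
 coordinates of the chart are among the \<open>y a\<close>. The set \<open>Zs p\<close> is the zero set of \<open>p\<close> in \<open>X\<close>.
\<close>

definition hchart :: "nat => 'm::euclidean_space set => (((nat => real) => real) => 'm set) =>
  (real ^ 'n::finite) set => (real ^ 'n => 'm) => 'm set => ('m => real ^ 'n) =>
  (nat => real ^ 'n => real) => nat => ('n => nat) => bool" where
 "hchart k X Zs V sg Q psi q j l \<longleftrightarrow>
  smooth_on V sg \<and> smooth_on Q psi \<and> (\<forall>y\<in>V. sg y \<in> X \<and> sg y \<in> Q \<and> psi (sg y) = y) \<and>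
  (\<forall>A\<in>X. A \<in> Q --> psi A \<in> V \<and> sg (psi A) = A) \<and>
  j \<le> k \<and> (\<forall>i. l i \<le> k) \<and> (\<forall>a\<le>k. smooth_on V (q a)) \<and>
  (\<forall>y\<in>V. q j y = 1 \<and> (\<forall>i. q (l i) y = y $ i)) \<and>
  (\<forall>m p y. hpoly k m p --> y \<in> V --> (sg y \<in> Zs p \<longleftrightarrow> p (%a. q a y) = 0))"

lemma hchartD:
 assumes "hchart k X Zs V sg Q psi q j l"
 shows "smooth_on V sg" "smooth_on Q psi" "\<And>y. y \<in> V ==> sg y \<in> X \<and> sg y \<in> Q \<and> psi (sg y) = y"
  "\<And>A. A \<in> X ==> A \<in> Q ==> psi A \<in> V \<and> sg (psi A) = A" "j \<le> k" "\<And>i. l i \<le> k"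
  "\<And>a. a \<le> k ==> smooth_on V (q a)" "\<And>y. y \<in> V ==> q j y = 1" "\<And>y i. y \<in> V ==> q (l i) y = y $ i"
  "\<And>m p y. hpoly k m p ==> y \<in> V ==> sg y \<in> Zs p \<longleftrightarrow> p (%a. q a y) = 0"
 using assms unfolding hchart_def by simp_all

text \<open>
 Conditions on systems of homogeneous polynomials that survive small perturbations. Regularity
 in the charts is achieved for one chart after the other, keeping the conditions achieved before.
\<close>

definition open_cond :: "nat => nat => 'n::finite itself => (('i::finite => (nat => real) => real) => bool) => bool" where
 "open_cond k m T C \<longleftrightarrow> (\<forall>P. (\<forall>i. hpoly k m (P i)) --> C P -->
  (\<forall>j l. j \<le> k --> (\<forall>b. l b \<le> k) -->
    (\<exists>dl>0. \<forall>e. norm e < dl --> C (pert m j (l :: 'n => nat) e P))))"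

definition regular_on :: "'i set => ('a::euclidean_space) set => ('a => real ^ 'i::finite) => bool" where
 "regular_on R K g \<longleftrightarrow> (\<forall>y\<in>K. (\<forall>i\<in>R. g y $ i = 0) --> regular_at_pt R g y)"

lemma open_cond_regular:
 fixes q :: "nat => real ^ 'n::finite => real"
 assumes q: "\<And>a. a \<le> k ==> smooth_on V (q a)" and K: "compact K" "K \<subseteq> V"
 shows "open_cond k m TYPE('n) (%P :: 'i::finite => _. regular_on R K (tuple_fun q P))"
 unfolding open_cond_def
proof (intro allI impI)
 fix P :: "'i => (nat => real) => real" and j and l :: "'n => nat"
 assume P: "\<forall>i. hpoly k m (P i)" and reg: "regular_on R K (tuple_fun q P)" and jl: "j \<le> k" "\<forall>b. l b \<le> k"
 have s: "smooth_on V (tuple_fun q P)" by (rule tuple_fun_smooth[OF _ q]) (use P in blast)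
 have w: "smooth_on V (pert_weight m j l q)" by (rule pert_weight_smooth[OF q jl(1)]) (use jl(2) in blast)+
 have reg': "regular_at_pt R (tuple_fun q P) y" if "y \<in> K" "\<forall>i\<in>R. tuple_fun q P y $ i = 0" for y
  using reg that unfolding regular_on_def by simp
 obtain dl where dl: "dl > 0" "\<And>e y. norm e < dl ==> y \<in> K ==> \<forall>i\<in>R. perturb (tuple_fun q P) (pert_weight m j l q) e y $ i = 0 ==>
  regular_at_pt R (perturb (tuple_fun q P) (pert_weight m j l q) e) y"
  using regular_stable[OF s w K reg'] by metis
 show "\<exists>dl>0. \<forall>e. norm e < dl --> regular_on R K (tuple_fun q (pert m j l e P))"
  unfolding tuple_fun_pert regular_on_def using dl by (intro exI[of _ dl]) simp
qed

lemma open_cond_C1_close: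
 fixes q :: "nat => real ^ 'n::finite => real" and Th :: "'b::euclidean_space => real ^ 'n"
 assumes q: "\<And>a. a \<le> k ==> smooth_on V (q a)" and N: "compact N" "N \<subseteq> B" and Th: "smooth_on B Th" "Th ` B \<subseteq> V"
 shows "open_cond k m TYPE('n) (%P :: 'i::finite => _. C1_close R tau N eta (%z. tuple_fun q P (Th z)))"
 unfolding open_cond_def
proof (intro allI impI)
 fix P :: "'i => (nat => real) => real" and j and l :: "'n => nat"
 assume P: "\<forall>i. hpoly k m (P i)" and c: "C1_close R tau N eta (%z. tuple_fun q P (Th z))" and jl: "j \<le> k" "\<forall>b. l b \<le> k"
 have s: "smooth_on V (tuple_fun q P)" by (rule tuple_fun_smooth[OF _ q]) (use P in blast)
 have w: "smooth_on V (pert_weight m j l q)" by (rule pert_weight_smooth[OF q jl(1)]) (use jl(2) in blast)+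
 obtain dl where dl: "dl > 0"
  "\<And>e. norm e < dl ==> C1_close R tau N eta (perturb (%z. tuple_fun q P (Th z)) (%z. pert_weight m j l q (Th z)) e)"
  using C1_close_stable[OF smooth_on_compose[OF s Th] smooth_on_compose[OF w Th] N c] by metis
 have "perturb (%z. tuple_fun q P (Th z)) (%z. pert_weight m j l q (Th z)) e = (%z. tuple_fun q (pert m j l e P) (Th z))" for e
  by (simp add: fun_eq_iff tuple_fun_pert perturb_def)
 with dl show "\<exists>dl>0. \<forall>e. norm e < dl --> C1_close R tau N eta (%z. tuple_fun q (pert m j l e P) (Th z))" by auto
qed

text \<open>
 Parameters of perturbations that fail form a null set, so there are good ones arbitrarily close to \<open>0\<close>.
\<close>

lemma regular_in_chart:
 fixes P :: "'i::finite => (nat => real) => real" and V :: "(real ^ 'n::finite) set"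
 assumes ch: "hchart k X Zs V sg Q psi q j l" and dim: "CARD('n) = CARD('i)" and K: "K \<subseteq> V" and m: "m > 0"
  and P: "\<And>i. hpoly k m (P i)"
  and Cs: "finite Cs" "\<And>C. C \<in> Cs ==> open_cond k m TYPE('n) C \<and> C P"
 obtains P' where "\<And>i. hpoly k m (P' i)" "\<And>C. C \<in> Cs ==> C P'" "regular_on R K (tuple_fun q P')"
proof -
 note c = hchartD[OF ch]
 have s: "smooth_on V (tuple_fun q P)" by (rule tuple_fun_smooth[OF P c(7)])
 have "\<exists>dl>0. \<forall>e. norm e < dl --> C (pert m j l e P)" if "C \<in> Cs" for C
  using Cs(2)[OF that] P c(5,6) unfolding open_cond_def by blast
 then obtain dl where dl: "\<And>C. C \<in> Cs ==> dl C > 0" "\<And>C e. C \<in> Cs ==> norm e < dl C ==> C (pert m j l e P)"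
  by metis
 define d where "d = Min (insert 1 (dl ` Cs))"
 have d: "d > 0" unfolding d_def using dl(1) Cs(1) by (simp add: Min_gr_iff)
 have dle: "d \<le> dl C" if "C \<in> Cs" for C unfolding d_def by (rule Min_le) (use Cs(1) that in auto)
 define Bad where "Bad = {e. \<exists>y\<in>V. (\<forall>i\<in>R. perturb (tuple_fun q P) (%y. (1::real, y)) e y $ i = 0) \<and>
  \<not> regular_at_pt R (perturb (tuple_fun q P) (%y. (1, y)) e) y}"
 have "negligible Bad" unfolding Bad_def by (rule generic_affine_perturbation[OF s dim])
 moreover have "\<not> negligible (ball (0 :: (real \<times> (real ^ 'n)) ^ 'i) d)"
  by (rule open_not_negligible) (use d in auto)
 ultimately have "\<not> ball 0 d \<subseteq> Bad" using negligible_subset by blast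
 then obtain e where e: "norm e < d" "e \<notin> Bad" by (auto simp: subset_iff)
 have eq: "perturb (tuple_fun q P) (pert_weight m j l q) e y = perturb (tuple_fun q P) (%y. (1, y)) e y" if "y \<in> V" for y
  using c(8,9)[OF that] by (simp add: perturb_def pert_weight_def vec_lambda_eta)
 have w1: "smooth_on V (%y. (1::real, y))" by (intro smooth_on_Pair smooth_on_const smooth_on_id smooth_on_open[OF s])
 note s1 = perturb_smooth[OF s w1, of e]
 show thesis
 proof (rule that[of "pert m j l e P"])
  show "hpoly k m (pert m j l e P i)" for i by (rule hpoly_pert[OF P m c(5,6)])
  show "C (pert m j l e P)" if "C \<in> Cs" for C
   by (rule dl(2)[OF that]) (use e(1) dle[OF that] in simp)
  show "regular_on R K (tuple_fun q (pert m j l e P))"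
   unfolding regular_on_def tuple_fun_pert
  proof (intro ballI impI)
   fix y assume y: "y \<in> K" "\<forall>i\<in>R. perturb (tuple_fun q P) (pert_weight m j l q) e y $ i = 0"
   have yV: "y \<in> V" using y(1) K by auto
   have "regular_at_pt R (perturb (tuple_fun q P) (%y. (1, y)) e) y"
   proof -
    have "\<forall>i\<in>R. perturb (tuple_fun q P) (%y. (1, y)) e y $ i = 0" using y(2) eq[OF yV] by simp
    then show ?thesis using e(2) yV unfolding Bad_def by blast
   qed
   moreover have "dir_deriv (perturb (tuple_fun q P) (pert_weight m j l q) e) y = dir_deriv (perturb (tuple_fun q P) (%y. (1, y)) e) y"
    by (rule dir_deriv_eq[OF has_derivative_transform_within_open[OF smooth_on_has_derivative[OF s1 yV] smooth_on_open[OF s] yV]])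
     (simp add: eq)
   ultimately show "regular_at_pt R (perturb (tuple_fun q P) (pert_weight m j l q) e) y"
    unfolding regular_at_pt_def by simp
  qed
 qed
qed

lemma regular_in_all_charts:
 fixes P :: "'i::finite => (nat => real) => real" and V :: "'x => (real ^ 'n::finite) set"
 assumes D: "finite D" and ch: "\<And>x. x \<in> D ==> hchart k X Zs (V x) (sg x) (Q x) (psi x) (q x) (j x) (l x)"
  and K: "\<And>x. x \<in> D ==> compact (K x) \<and> K x \<subseteq> V x" and dim: "CARD('n) = CARD('i)" and m: "m > 0"
  and P: "\<And>i. hpoly k m (P i)"
  and Cs: "finite Cs" "\<And>C. C \<in> Cs ==> open_cond k m TYPE('n) C \<and> C P"
 shows "\<exists>P'. (\<forall>i. hpoly k m (P' i)) \<and> (\<forall>C\<in>Cs. C P') \<and> (\<forall>x\<in>D. regular_on R (K x) (tuple_fun (q x) P'))"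
 using D ch K
proof (induction D rule: finite_induct)
 case empty
 then show ?case using P Cs(2) by blast
next
 case (insert x F)
 have "\<exists>P'. (\<forall>i. hpoly k m (P' i)) \<and> (\<forall>C\<in>Cs. C P') \<and> (\<forall>x\<in>F. regular_on R (K x) (tuple_fun (q x) P'))"
  by (rule insert.IH) (use insert.prems in simp_all)
 then obtain P1 where P1: "\<And>i. hpoly k m (P1 i)" "\<And>C. C \<in> Cs ==> C P1"
  "\<And>x. x \<in> F ==> regular_on R (K x) (tuple_fun (q x) P1)" by blast
 define Cs' where "Cs' = Cs \<union> (%x P. regular_on R (K x) (tuple_fun (q x) P)) ` F"
 have fin: "finite Cs'" using Cs(1) insert.hyps(1) by (simp add: Cs'_def)
 have chx: "hchart k X Zs (V x) (sg x) (Q x) (psi x) (q x) (j x) (l x)" by (rule insert.prems(1)) simp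
 have Kx: "K x \<subseteq> V x" using insert.prems(2)[of x] by simp
 have oc: "open_cond k m TYPE('n) C \<and> C P1" if "C \<in> Cs'" for C
 proof (cases "C \<in> Cs")
  case True
  then show ?thesis using Cs(2) P1(2) by blast
 next
  case False
  with \<open>C \<in> Cs'\<close> obtain z where z: "z \<in> F" "C = (%P. regular_on R (K z) (tuple_fun (q z) P))"
   by (auto simp: Cs'_def)
  have zi: "z \<in> insert x F" using z(1) by simp
  have "open_cond k m TYPE('n) (%P :: 'i => _. regular_on R (K z) (tuple_fun (q z) P))"
   by (rule open_cond_regular[OF hchartD(7)[OF insert.prems(1)[OF zi]]]) (use insert.prems(2)[OF zi] in simp_all)
  then show ?thesis using z P1(3)[OF z(1)] by simp
 qed
 obtain P2 where P2: "\<And>i. hpoly k m (P2 i)" "\<And>C. C \<in> Cs' ==> C P2" "regular_on R (K x) (tuple_fun (q x) P2)"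
  using regular_in_chart[OF chx dim Kx m P1(1) fin oc, of R] by metis
 have "regular_on R (K z) (tuple_fun (q z) P2)" if "z \<in> F" for z
  using P2(2)[of "%P. regular_on R (K z) (tuple_fun (q z) P)"] that by (auto simp: Cs'_def)
 then show ?case using P2 by (intro exI[of _ P2]) (auto simp: Cs'_def)
qed

lemma hchart_zero_set:
 assumes "hchart k X Zs V sg Q psi q j l" "\<And>i. hpoly k m (P i)" "y \<in> V"
 shows "sg y \<in> (\<Inter>i\<in>R. Zs (P i)) \<longleftrightarrow> (\<forall>i\<in>R. tuple_fun q P y $ i = 0)"
 using hchartD(10)[OF assms(1) assms(2) assms(3)] by (simp add: tuple_fun_def)

lemma regular_zero_set_in_chart:
 fixes P :: "'i::finite => (nat => real) => real" and V :: "(real ^ 'n::finite) set"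
 assumes ch: "hchart k X Zs V sg Q psi q j l" and P: "\<And>i. hpoly k m (P i)" and Zs: "\<And>i. Zs (P i) \<subseteq> X"
  and R: "R ~= {}" "d + card R = CARD('n)"
  and A: "A \<in> (\<Inter>i\<in>R. Zs (P i))" "A \<in> Q" "psi A \<in> K" "regular_on R K (tuple_fun q P)"
 shows "flat_at d (\<Inter>i\<in>R. Zs (P i)) A" and "i \<in> R ==> \<not> X \<subseteq> Zs (P i)"
proof -
 note c = hchartD[OF ch] and z = hchart_zero_set[OF ch, of m P, OF P]
 let ?S = "\<Inter>i\<in>R. Zs (P i)"
 have SX: "?S \<subseteq> X" using R(1) Zs by blast
 have s: "smooth_on V (tuple_fun q P)" by (rule tuple_fun_smooth[OF P c(7)])
 have AX: "A \<in> X" using A(1) SX by blast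
 have psiA: "psi A \<in> V" "sg (psi A) = A" using c(4)[OF AX A(2)] by auto
 have zA: "\<forall>i\<in>R. tuple_fun q P (psi A) $ i = 0" using z[OF psiA(1), of R] psiA(2) A(1) by simp
 have reg: "regular_at_pt R (tuple_fun q P) (psi A)" using A(3,4) zA unfolding regular_on_def by simp
 show "flat_at d ?S A"
 proof (rule flat_at_regular_zero_set[OF s c(1,2) A(1,2) reg _ _ R(2)])
  show "psi B \<in> V \<and> sg (psi B) = B \<and> (\<forall>i\<in>R. tuple_fun q P (psi B) $ i = 0)" if B: "B \<in> ?S" "B \<in> Q" for B
  proof -
   have "B \<in> X" using B(1) SX by blast
   from c(4)[OF this B(2)] have 1: "psi B \<in> V" "sg (psi B) = B" by auto
   then show ?thesis using z[OF 1(1), of R] B(1) by simp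
  qed
  show "sg y \<in> ?S \<and> sg y \<in> Q \<and> psi (sg y) = y" if "y \<in> V" "\<forall>i\<in>R. tuple_fun q P y $ i = 0" for y
   using z[OF that(1), of R] that(2) c(3)[OF that(1)] by simp
 qed
 show "\<not> X \<subseteq> Zs (P i)" if i: "i \<in> R"
 proof
  assume sub: "X \<subseteq> Zs (P i)"
  have zero: "tuple_fun q P y $ i = 0" if "y \<in> V" for y
   using c(10)[OF P that, of i] c(3)[OF that] sub by (auto simp: tuple_fun_def)
  have "((%y. tuple_fun q P y $ i) has_derivative (%v. dir_deriv (tuple_fun q P) (psi A) v $ i)) (at (psi A))"
   by (rule bounded_linear.has_derivative[OF bounded_linear_vec_nth smooth_on_has_derivative[OF s psiA(1)]])
  then have "((%y. 0::real) has_derivative (%v. dir_deriv (tuple_fun q P) (psi A) v $ i)) (at (psi A))"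
   by (rule has_derivative_transform_within_open[OF _ smooth_on_open[OF s] psiA(1)]) (simp add: zero)
  from has_derivative_unique[OF this has_derivative_const]
  have d0: "dir_deriv (tuple_fun q P) (psi A) v $ i = 0" for v by (rule fun_cong)
  have "(\<Sum>l\<in>R. (if l = i then 1 else 0) * dir_deriv (tuple_fun q P) (psi A) v $ l) = 0" for v
   by (rule sum.neutral) (simp add: d0)
  then have "\<forall>v. (\<Sum>l\<in>R. (if l = i then 1 else 0) * dir_deriv (tuple_fun q P) (psi A) v $ l) = 0" by blast
  with spec[OF reg[unfolded regular_at_pt_def], of "%l. if l = i then 1 else 0"]
  have "\<forall>l\<in>R. (if l = i then 1 else 0) = (0::real)" by (rule mp)
  then show False using i by auto
 qed
qed

text \<open>
 The conclusion of the stability of zero sets, with a margin \<open>eta\<close> for the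
 \<open>C\<^sup>1\<close>-distance to \<open>tau\<close>. The margin leaves room for perturbing \<open>f\<close>.
\<close>

definition zero_set_margin :: "'a::euclidean_space set => 'i set => ('a => real ^ 'i::finite) => 'a set => 'a set => real => bool" where
 "zero_set_margin \<Sigma> R tau N No eta \<longleftrightarrow> eta > 0 \<and> (\<forall>f B. smooth_on B f --> N \<subseteq> B --> C1_close R tau N eta f -->
  compact {z \<in> N. \<forall>i\<in>R. f z $ i = 0} \<and> {z \<in> N. \<forall>i\<in>R. f z $ i = 0} \<subseteq> No \<and>
  diffeomorphic \<Sigma> {z \<in> N. \<forall>i\<in>R. f z $ i = 0})"

lemma zero_set_margin_exists:
 fixes \<Sigma> :: "(real ^ 'n::finite) set" and R :: "'i::finite set"
 assumes \<Sigma>: "compact \<Sigma>" and mu: "\<And>i. i \<in> R ==> smooth_map \<Sigma> (mu i)" and tub: "tubular \<Sigma> R mu dl Q pj tau"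
 shows "\<exists>eta. compact {z \<in> Q. norm (tau z) \<le> dl / 2} \<and>
  zero_set_margin \<Sigma> R tau {z \<in> Q. norm (tau z) \<le> dl / 2} {z \<in> Q. norm (tau z) < dl / 2} eta"
proof (rule zero_set_stable[OF \<Sigma> mu tub])
 let ?N = "{z \<in> Q. norm (tau z) \<le> dl / 2}"
 fix eta :: real
 assume eta: "eta > 0" "compact ?N" and st: "\<And>g Q'. smooth_on Q' g ==> ?N \<subseteq> Q' ==> (\<And>z. z \<in> Q' ==> g z \<in> suppvec R) ==>
   (\<And>z. z \<in> ?N ==> norm (g z - tau z) \<le> eta) ==>
   (\<And>z v. z \<in> ?N ==> norm (dir_deriv g z v - dir_deriv tau z v) \<le> eta * norm v) ==>
   compact {z \<in> ?N. g z = 0} \<and> {z \<in> ?N. g z = 0} \<subseteq> {z \<in> Q. norm (tau z) < dl / 2} \<and>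
   diffeomorphic \<Sigma> {z \<in> ?N. g z = 0}"
 have "zero_set_margin \<Sigma> R tau ?N {z \<in> Q. norm (tau z) < dl / 2} eta"
  unfolding zero_set_margin_def
 proof (rule conjI[OF eta(1)], intro allI impI)
  fix f :: "real ^ 'n => real ^ 'i" and B
  assume f: "smooth_on B f" "?N \<subseteq> B" "C1_close R tau ?N eta f"
  obtain eta' where eta': "eta' < eta" "\<And>z. z \<in> ?N ==> norm (vec_restrict R (f z) - tau z) \<le> eta'"
   "\<And>z v. z \<in> ?N ==> norm (dir_deriv (%z. vec_restrict R (f z)) z v - dir_deriv tau z v) \<le> eta' * norm v"
   using f(3) unfolding C1_close_def by blast
  have eq: "vec_restrict R x = 0 \<longleftrightarrow> (\<forall>i\<in>R. x $ i = 0)" for x by (auto simp: vec_restrict_def vec_eq_iff)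
  have "compact {z \<in> ?N. vec_restrict R (f z) = 0} \<and> {z \<in> ?N. vec_restrict R (f z) = 0} \<subseteq> {z \<in> Q. norm (tau z) < dl / 2} \<and>
   diffeomorphic \<Sigma> {z \<in> ?N. vec_restrict R (f z) = 0}"
  proof (rule st[OF smooth_on_linear[OF vec_restrict_linear f(1)] f(2)])
   show "vec_restrict R (f z) \<in> suppvec R" for z by (rule vec_restrict_suppvec)
   show "norm (vec_restrict R (f z) - tau z) \<le> eta" if "z \<in> ?N" for z using eta'(2)[OF that] eta'(1) by linarith
   show "norm (dir_deriv (%z. vec_restrict R (f z)) z v - dir_deriv tau z v) \<le> eta * norm v" if "z \<in> ?N" for z v
    using eta'(3)[OF that, of v] mult_right_mono[OF less_imp_le[OF eta'(1)] norm_ge_zero[of v]] by linarith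
  qed
  then show "compact {z \<in> ?N. \<forall>i\<in>R. f z $ i = 0} \<and> {z \<in> ?N. \<forall>i\<in>R. f z $ i = 0} \<subseteq> {z \<in> Q. norm (tau z) < dl / 2} \<and>
  diffeomorphic \<Sigma> {z \<in> ?N. \<forall>i\<in>R. f z $ i = 0}" by (simp only: eq)
 qed
 with eta(2) show ?thesis by blast
qed

lemma C1_close_cong:
 assumes "C1_close R tau N eta f" "open B" "N \<subseteq> B" "smooth_on B f" "\<And>z. z \<in> B ==> g z = f z"
 shows "C1_close R tau N eta g"
proof -
 have "dir_deriv (%z. vec_restrict R (g z)) z = dir_deriv (%z. vec_restrict R (f z)) z" if "z \<in> N" for z
 proof (rule dir_deriv_eq[OF has_derivative_transform_within_open[OF _ assms(2)]])
  show "((%z. vec_restrict R (f z)) has_derivative dir_deriv (%z. vec_restrict R (f z)) z) (at z)"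
   using smooth_on_has_derivative[OF smooth_on_linear[OF vec_restrict_linear assms(4)]] assms(3) that by auto
 qed (use assms(3,5) that in auto)
 moreover have "g z = f z" if "z \<in> N" for z using assms(3,5) that by auto
 ultimately show ?thesis using assms(1) unfolding C1_close_def by simp
qed

lemma C1_close_polynomial:
 fixes tau :: "'a::euclidean_space => real ^ 'i::finite"
 assumes tau: "smooth_on Q tau" "\<And>z. z \<in> Q ==> tau z \<in> suppvec R" and N: "compact N" "N \<subseteq> Q" and eta: "eta > 0"
 shows "\<exists>p. (\<forall>i. real_polynomial_function (p i)) \<and> C1_close R tau N eta (%z. \<chi> i. p i z)"
proof -
 define c where "c = real CARD('i) * (1 + real DIM('a))"
 have c: "c > 0" by (simp add: c_def add_pos_nonneg)
 define ep where "ep = eta / (2 * c)"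
 have ep: "ep > 0" "c * ep = eta / 2" using c eta by (simp_all add: ep_def)
 have "\<exists>q. real_polynomial_function q \<and> (\<forall>x\<in>N. \<bar>q x - tau x $ i\<bar> \<le> ep) \<and>
  (\<forall>x\<in>N. \<forall>b\<in>Basis. \<bar>dir_deriv q x b - dir_deriv (%z. tau z $ i) x b\<bar> \<le> ep)" for i
  using polynomial_C1_approximation[OF smooth_on_vec_nth[OF tau(1)] N ep(1), of i] by metis
 then obtain p where p: "\<And>i. real_polynomial_function (p i)" "\<And>i x. x \<in> N ==> \<bar>p i x - tau x $ i\<bar> \<le> ep"
  "\<And>i x b. x \<in> N ==> b \<in> Basis ==> \<bar>dir_deriv (p i) x b - dir_deriv (%z. tau z $ i) x b\<bar> \<le> ep" by metis
 let ?f = "%z. \<chi> i. p i z"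
 have sf: "smooth_on UNIV ?f" by (intro smooth_on_vec_lambda real_polynomial_function_smooth p(1))
 have "C1_close R tau N eta ?f"
  unfolding C1_close_def
 proof (intro exI[of _ "c * ep"] conjI ballI allI)
  show "c * ep < eta" using ep(2) eta by simp
  fix z assume z: "z \<in> N"
  have zQ: "z \<in> Q" using z N(2) by auto
  have vecb: "norm x \<le> real CARD('i) * t" if "\<And>i. i \<in> R ==> \<bar>x $ i\<bar> \<le> t" "\<And>i. i \<notin> R ==> x $ i = 0" "t \<ge> 0" for x :: "real ^ 'i" and t
  proof -
   have "norm x \<le> (\<Sum>i\<in>UNIV. \<bar>x $ i\<bar>)" by (rule norm_le_l1_cart)
   also have "\<dots> \<le> real CARD('i) * t"
   proof (rule sum_bounded_above)
    fix i show "\<bar>x $ i\<bar> \<le> t" using that by (cases "i \<in> R") auto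
   qed
   finally show ?thesis .
  qed
  have "norm (vec_restrict R (?f z) - tau z) \<le> real CARD('i) * ep"
   using p(2)[OF z] tau(2)[OF zQ] ep(1) by (intro vecb) (auto simp: vec_restrict_def suppvec_def)
  also have "\<dots> \<le> c * ep" using ep(1) by (intro mult_right_mono) (auto simp: c_def)
  finally show "norm (vec_restrict R (?f z) - tau z) \<le> c * ep" .
  fix v
  have dm: "dir_deriv (%z. vec_restrict R (?f z)) z v = vec_restrict R (dir_deriv ?f z v)"
   by (rule fun_cong[OF dir_deriv_eq[OF bounded_linear.has_derivative[OF _ smooth_on_has_derivative[OF sf UNIV_I]]]])
    (simp add: vec_restrict_linear linear_conv_bounded_linear[symmetric])
  have dc: "dir_deriv (%z. h z $ i) z u = dir_deriv h z u $ i" if "smooth_on W h" "z \<in> W" for h :: "'a => real ^ 'i" and W i u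
   by (rule fun_cong[OF dir_deriv_eq[OF bounded_linear.has_derivative[OF bounded_linear_vec_nth smooth_on_has_derivative[OF that]]]])
  have df: "dir_deriv ?f z u $ i = dir_deriv (p i) z u" for i u using dc[OF sf UNIV_I, of i u] by simp
  have l1: "linear (dir_deriv (p i) z)" for i by (rule dir_deriv_linear[OF real_polynomial_function_smooth[OF p(1)] UNIV_I])
  have l2: "linear (dir_deriv (%z. tau z $ i) z)" for i by (rule dir_deriv_linear[OF smooth_on_vec_nth[OF tau(1)] zQ])
  have comp: "\<bar>dir_deriv (p i) z v - dir_deriv (%z. tau z $ i) z v\<bar> \<le> real DIM('a) * (ep * norm v)" for i
  proof -
   have "dir_deriv (p i) z v - dir_deriv (%z. tau z $ i) z v =
     dir_deriv (p i) z (\<Sum>b\<in>Basis. (v \<bullet> b) *\<^sub>R b) - dir_deriv (%z. tau z $ i) z (\<Sum>b\<in>Basis. (v \<bullet> b) *\<^sub>R b)"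
    by (simp only: euclidean_representation)
   also have "\<dots> = (\<Sum>b\<in>Basis. (v \<bullet> b) * (dir_deriv (p i) z b - dir_deriv (%z. tau z $ i) z b))"
    by (simp add: linear_sum[OF l1] linear_scale[OF l1] linear_sum[OF l2] linear_scale[OF l2] sum_subtractf right_diff_distrib)
   finally have "\<bar>dir_deriv (p i) z v - dir_deriv (%z. tau z $ i) z v\<bar>
     \<le> (\<Sum>b\<in>Basis. \<bar>(v \<bullet> b) * (dir_deriv (p i) z b - dir_deriv (%z. tau z $ i) z b)\<bar>)" by (simp only: sum_abs)
   also have "\<dots> \<le> real DIM('a) * (ep * norm v)"
   proof (rule sum_bounded_above)
    fix b :: 'a assume b: "b \<in> Basis"
    have "\<bar>v \<bullet> b\<bar> * \<bar>dir_deriv (p i) z b - dir_deriv (%z. tau z $ i) z b\<bar> \<le> norm v * ep"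
     using p(3)[OF z b, of i] Basis_le_norm[OF b, of v] by (intro mult_mono) auto
    then show "\<bar>(v \<bullet> b) * (dir_deriv (p i) z b - dir_deriv (%z. tau z $ i) z b)\<bar> \<le> ep * norm v"
     by (simp add: abs_mult mult.commute)
   qed
   finally show ?thesis .
  qed
  have off: "dir_deriv tau z v $ i = 0" if "i \<notin> R" for i
  proof -
   have "((%z. tau z $ i) has_derivative (%v. dir_deriv tau z v $ i)) (at z)"
    by (rule bounded_linear.has_derivative[OF bounded_linear_vec_nth smooth_on_has_derivative[OF tau(1) zQ]])
   then have "((%z. 0::real) has_derivative (%v. dir_deriv tau z v $ i)) (at z)"
    by (rule has_derivative_transform_within_open[OF _ smooth_on_open[OF tau(1)] zQ])
     (use tau(2) that in \<open>auto simp: suppvec_def\<close>)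
   from fun_cong[OF has_derivative_unique[OF this has_derivative_const], of v] show ?thesis .
  qed
  have "norm (dir_deriv (%z. vec_restrict R (?f z)) z v - dir_deriv tau z v) \<le> real CARD('i) * (real DIM('a) * (ep * norm v))"
  proof (rule vecb)
   fix i
   show "\<bar>(dir_deriv (%z. vec_restrict R (?f z)) z v - dir_deriv tau z v) $ i\<bar> \<le> real DIM('a) * (ep * norm v)" if "i \<in> R"
    unfolding dm using comp[of i] that by (simp add: vec_restrict_def df dc[OF tau(1) zQ])
   show "(dir_deriv (%z. vec_restrict R (?f z)) z v - dir_deriv tau z v) $ i = 0" if "i \<notin> R"
    unfolding dm using off[OF that] that by (simp add: vec_restrict_def)
  qed (use ep(1) in simp)
  also have "\<dots> = (real CARD('i) * real DIM('a)) * (ep * norm v)" by (simp only: mult.assoc)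
  also have "\<dots> \<le> c * (ep * norm v)" using ep(1) by (intro mult_right_mono) (auto simp: c_def distrib_left)
  finally show "norm (dir_deriv (%z. vec_restrict R (?f z)) z v - dir_deriv tau z v) \<le> c * ep * norm v" by (simp only: mult.assoc)
 qed
 with p(1) show ?thesis by blast
qed

text \<open>
 The system with many copies: \<open>p\<close>, an approximation of the normal coordinate of \<open>\<Sigma>\<close>, composed with
 Chebyshev polynomials in each variable. On each of the \<open>m' ^ n\<close> cubes with sides in Chebyshev
 intervals, the composition is \<open>p\<close> up to the diffeomorphism \<open>Th kp\<close> onto that cube.
\<close>

lemma chebyshev_system:
 fixes tau :: "real ^ 'n::finite => real ^ 'n"
 assumes ch: "hchart k X Zs (V :: (real ^ 'n) set) sg Q psi q j l" and u0: "u0 \<in> V"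
  and p: "\<And>i. real_polynomial_function (p i)" "C1_close R tau N eta (%z. \<chi> i. p i z)" and N: "compact N"
 shows "\<exists>D>0. \<exists>B. N \<subseteq> B \<and> open B \<and> (\<forall>m\<ge>D. \<exists>P Xi Th (I :: ('n => nat) set). (\<forall>i. hpoly k m (P i)) \<and> finite I \<and> I ~= {} \<and>
  real (card I) \<ge> (real m / (2 * real D)) ^ CARD('n) \<and> smooth_on UNIV Xi \<and> disjoint_family_on (%kp. Th kp ` B) I \<and>
  (\<forall>kp\<in>I. smooth_on B (Th kp) \<and> Th kp ` B \<subseteq> V \<and> open (Th kp ` B) \<and> (\<forall>z\<in>B. Xi (Th kp z) = z) \<and>
    C1_close R tau N eta (%z. tuple_fun q P (Th kp z))))"
proof -
 note c = hchartD[OF ch]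
 obtain r where r: "r > 0" "ball u0 r \<subseteq> V" using smooth_on_open[OF c(1)] u0 by (metis open_contains_ball)
 \<comment> \<open>the cube with half side \<open>ep\<close> about \<open>u0\<close> lies in \<open>V\<close>: the norm is at most \<open>CARD('n)\<close> times the largest coordinate\<close>
 define ep where "ep = r / (2 * real CARD('n))"
 have ep: "ep > 0" "ep * real CARD('n) < r" using r(1) by (simp_all add: ep_def)
 have inV: "u0 + ep *\<^sub>R v \<in> V" if "\<And>i. \<bar>v $ i\<bar> < 1" for v
 proof -
  have "norm v \<le> (\<Sum>i\<in>UNIV. \<bar>v $ i\<bar>)" by (rule norm_le_l1_cart)
  also have "\<dots> \<le> real CARD('n) * 1" by (rule sum_bounded_above) (use that in \<open>auto intro: less_imp_le\<close>)
  finally have "ep * norm v \<le> ep * real CARD('n)" using ep(1) by (intro mult_left_mono) auto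
  moreover have "norm (ep *\<^sub>R v) = ep * norm v" using ep(1) by simp
  ultimately have "norm (ep *\<^sub>R v) < r" using ep(2) by linarith
  then show ?thesis using r(2) by (auto simp: dist_norm)
 qed
 obtain rho where rho: "rho > 0" "\<And>z. z \<in> N ==> norm z < rho"
 proof -
  obtain a where "\<forall>z\<in>N. norm z \<le> a" using compact_imp_bounded[OF N] by (auto simp: bounded_iff)
  then show ?thesis by (intro that[of "max a 0 + 1"]) fastforce+
 qed
 define B where "B = {z :: real ^ 'n. \<forall>i. z $ i / rho \<in> {-1<..<1}}"
 have Bi: "z $ i / rho \<in> {-1<..<1} \<longleftrightarrow> \<bar>z $ i\<bar> < rho" for z :: "real ^ 'n" and i
  using rho(1) by (auto simp: abs_less_iff field_simps)
 have NB: "N \<subseteq> B"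
 proof
  fix z assume "z \<in> N"
  then have "\<bar>z $ i\<bar> < rho" for i using rho(2)[of z] component_le_norm_cart[of z i] by simp
  then show "z \<in> B" unfolding B_def mem_Collect_eq Bi by blast
 qed
 have opB: "open B"
 proof -
  have "B = (\<Inter>i\<in>UNIV. (%z. z $ i / rho) -` {-1<..<1})" by (auto simp: B_def)
  moreover have "open (\<Inter>i\<in>UNIV. (%z :: real ^ 'n. z $ i / rho) -` {-1<..<1})"
   by (intro open_INT ballI open_vimage finite_UNIV open_greaterThanLessThan continuous_on_divide
     bounded_linear.continuous_on[OF bounded_linear_vec_nth] continuous_on_id continuous_on_const) (use rho(1) in auto)
  ultimately show ?thesis by simp
 qed
 have "\<exists>D. \<forall>M A B. (\<forall>i. hpoly k M (A i)) --> hpoly k M B -->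
  (\<exists>H. hpoly k (D * M) H \<and> (\<forall>y. B y ~= 0 --> H y = B y ^ D * p i (\<chi> i. A i y / B y)))" for i
  by (rule homogenize_polynomial[OF p(1)])
 then obtain Di where Di: "\<And>i M A B. (\<forall>i. hpoly k M (A i)) ==> hpoly k M B ==>
  \<exists>H. hpoly k (Di i * M) H \<and> (\<forall>y. B y ~= 0 --> H y = B y ^ Di i * p i (\<chi> i. A i y / B y))" by metis
 define D where "D = Suc (\<Sum>i\<in>UNIV. Di i)"
 have DiD: "Di i \<le> D" for i
  using member_le_sum[of i UNIV Di] by (simp add: D_def)
 have "\<exists>P Xi Th (I :: ('n => nat) set). (\<forall>i. hpoly k m (P i)) \<and> finite I \<and> I ~= {} \<and>
  real (card I) \<ge> (real m / (2 * real D)) ^ CARD('n) \<and> smooth_on UNIV Xi \<and> disjoint_family_on (%kp. Th kp ` B) I \<and>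
  (\<forall>kp\<in>I. smooth_on B (Th kp) \<and> Th kp ` B \<subseteq> V \<and> open (Th kp ` B) \<and> (\<forall>z\<in>B. Xi (Th kp z) = z) \<and>
    C1_close R tau N eta (%z. tuple_fun q P (Th kp z)))" if m: "m \<ge> D" for m
 proof -
  \<comment> \<open>\<open>D\<close> bounds the degrees of the \<open>p i\<close>, so that substituting polynomials of degree \<open>m'\<close> gives degree at most \<open>m\<close>\<close>
  define m' where "m' = m div D"
  have Dpos: "D > 0" by (simp add: D_def)
  have m': "m' > 0" "D * m' \<le> m" "m < 2 * D * m'"
  proof -
   show m1: "m' > 0" using m Dpos by (simp add: m'_def div_greater_zero_iff)
   show "D * m' \<le> m" by (simp add: m'_def)
   have "m < D + D * m'" using Dpos by (simp add: m'_def mult.commute dividend_less_times_div)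
   also have "\<dots> \<le> 2 * D * m'" using m1 by simp
   finally show "m < 2 * D * m'" .
  qed
  have L: "hpoly k 1 (%y. (1 / ep) * (y (l i) + (- u0 $ i) * y j))" for i
   by (intro hpoly_scale hpoly.add hpoly.var c(5,6))
  have "\<exists>H. hpoly k m' H \<and> (\<forall>y. y j ~= 0 --> H y = y j ^ m' * cheb m' (((1 / ep) * (y (l i) + (- u0 $ i) * y j)) / y j))" for i
   by (rule homogenize_cheb[OF L hpoly.var[OF c(5)]])
  then have "\<forall>i. \<exists>H. hpoly k m' H \<and> (\<forall>y. y j ~= 0 --> H y = y j ^ m' * cheb m' (((1 / ep) * (y (l i) + (- u0 $ i) * y j)) / y j))"
   by blast
  from choice[OF this] obtain T where T0: "\<forall>i. hpoly k m' (T i) \<and> (\<forall>y. y j ~= 0 --> T i y = y j ^ m' * cheb m' (((1 / ep) * (y (l i) + (- u0 $ i) * y j)) / y j))"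
   by blast
  have T: "hpoly k m' (T i)" "y j ~= 0 ==> T i y = y j ^ m' * cheb m' (((1 / ep) * (y (l i) + (- u0 $ i) * y j)) / y j)" for i y
   using T0 by blast+
  have "\<exists>H. hpoly k (Di i * m') H \<and> (\<forall>y. y j ^ m' ~= 0 --> H y = (y j ^ m') ^ Di i * p i (\<chi> i. (rho * T i y) / y j ^ m'))" for i
  proof (rule Di)
   show "\<forall>i. hpoly k m' (%y. rho * T i y)" by (intro allI hpoly_scale T(1))
   show "hpoly k m' (%y. y j ^ m')" by (rule hpoly_var_power[OF c(5)])
  qed
  then have "\<forall>i. \<exists>H. hpoly k (Di i * m') H \<and> (\<forall>y. y j ^ m' ~= 0 --> H y = (y j ^ m') ^ Di i * p i (\<chi> i. (rho * T i y) / y j ^ m'))"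
   by blast
  from choice[OF this] obtain H where H0: "\<forall>i. hpoly k (Di i * m') (H i) \<and> (\<forall>y. y j ^ m' ~= 0 --> H i y = (y j ^ m') ^ Di i * p i (\<chi> i. (rho * T i y) / y j ^ m'))"
   by blast
  have H: "hpoly k (Di i * m') (H i)" "y j ^ m' ~= 0 ==> H i y = (y j ^ m') ^ Di i * p i (\<chi> i. (rho * T i y) / y j ^ m')" for i y
   using H0 by blast+
  define P where "P i y = H i y * y j ^ (m - Di i * m')" for i y
  have hP: "hpoly k m (P i)" for i
  proof -
   have "Di i * m' \<le> m" using mult_le_mono1[OF DiD, of i m'] m'(2) by linarith
   then have e: "Di i * m' + (m - Di i * m') = m" by simp
   have "hpoly k (Di i * m' + (m - Di i * m')) (P i)"
    unfolding P_def[abs_def] by (rule hpoly.mult[OF H(1) hpoly_var_power[OF c(5)]])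
   then show ?thesis unfolding e .
  qed
  \<comment> \<open>a common left inverse of all the maps \<open>Th kp\<close> onto the small cubes\<close>
  define Xi where "Xi y = (\<chi> i. rho * cheb m' ((y $ i - u0 $ i) * (1 / ep)))" for y
  have sXi: "smooth_on UNIV Xi"
   unfolding Xi_def[abs_def]
   by (intro smooth_on_vec_lambda smooth_on_mult smooth_on_const open_UNIV smooth_on_compose[OF cheb_smooth]
     smooth_on_diff smooth_on_vec_nth smooth_on_id subset_UNIV)
  have tP: "tuple_fun q P y = (\<chi> i. p i (Xi y))" if y: "y \<in> V" for y
  proof -
   have Ti: "T i (%a. q a y) = cheb m' ((y $ i - u0 $ i) * (1 / ep))" for i
   proof -
    have e: "((1 / ep) * (q (l i) y + (- u0 $ i) * q j y)) / q j y = (y $ i - u0 $ i) * (1 / ep)"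
     unfolding c(8)[OF y] c(9)[OF y] by simp
    have "q j y ~= 0" using c(8)[OF y] by simp
    from T(2)[of "%a. q a y" i, OF this] show ?thesis
     unfolding e unfolding c(8)[OF y] power_one mult_1_left .
   qed
   have "P i (%a. q a y) = p i (Xi y)" for i
    using H(2)[of "%a. q a y" i] c(8)[OF y] Ti by (simp add: P_def Xi_def)
   then show ?thesis by (simp add: tuple_fun_def)
  qed
  have "\<exists>g. i < m' --> smooth_on {-1<..<1} g \<and> g ` {-1<..<1} = cheb_interval m' i \<and>
   (\<forall>y\<in>{-1<..<1}. cheb m' (g y) = y) \<and> (\<forall>x\<in>cheb_interval m' i. g (cheb m' x) = x \<and> cheb m' x \<in> {-1<..<1}) \<and>
   open (cheb_interval m' i) \<and> cheb_interval m' i \<subseteq> {-1<..<1}" for i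
  proof (cases "i < m'")
   case True
   show ?thesis
   proof (rule cheb_branch[OF m'(1) True])
    fix g :: "real => real"
    assume "smooth_on {-1<..<1} g" "g ` {-1<..<1} = cheb_interval m' i"
     "\<And>y. y \<in> {-1<..<1} ==> cheb m' (g y) = y"
     and x: "\<And>x. x \<in> cheb_interval m' i ==> g (cheb m' x) = x \<and> cheb m' x \<in> {-1<..<1}"
     and "open (cheb_interval m' i)" "cheb_interval m' i \<subseteq> {-1<..<1}"
    then show ?thesis using conjunct1[OF x] conjunct2[OF x]
     by (intro exI[of _ g] impI conjI ballI)
   qed
  qed simp
  then have "\<forall>i. \<exists>g. i < m' --> smooth_on {-1<..<1} g \<and> g ` {-1<..<1} = cheb_interval m' i \<and>
   (\<forall>y\<in>{-1<..<1}. cheb m' (g y) = y) \<and> (\<forall>x\<in>cheb_interval m' i. g (cheb m' x) = x \<and> cheb m' x \<in> {-1<..<1}) \<and>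
   open (cheb_interval m' i) \<and> cheb_interval m' i \<subseteq> {-1<..<1}" by blast
  from choice[OF this] obtain G where G0: "\<forall>i. i < m' --> smooth_on {-1<..<1} (G i) \<and> G i ` {-1<..<1} = cheb_interval m' i \<and>
   (\<forall>y\<in>{-1<..<1}. cheb m' (G i y) = y) \<and> (\<forall>x\<in>cheb_interval m' i. G i (cheb m' x) = x \<and> cheb m' x \<in> {-1<..<1}) \<and>
   open (cheb_interval m' i) \<and> cheb_interval m' i \<subseteq> {-1<..<1}" by blast
  have G: "smooth_on {-1<..<1} (G i)" "G i ` {-1<..<1} = cheb_interval m' i"
   "\<And>y. y \<in> {-1<..<1} ==> cheb m' (G i y) = y"
   "\<And>x. x \<in> cheb_interval m' i ==> G i (cheb m' x) = x \<and> cheb m' x \<in> {-1<..<1}"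
   "open (cheb_interval m' i)" "cheb_interval m' i \<subseteq> {-1<..<1}" if "i < m'" for i
   using mp[OF spec[OF G0] that] by blast+
  define I where "I = {kp :: 'n => nat. \<forall>i. kp i < m'}"
  have IPi: "I = PiE UNIV (%_. {..<m'})" by (auto simp: I_def PiE_def Pi_def)
  have finI: "finite I" unfolding IPi by (rule finite_PiE) auto
  have cardI: "card I = m' ^ CARD('n)" unfolding IPi by (simp add: card_PiE)
  have Ine: "I ~= {}" using m'(1) by (auto simp: I_def)
  have cI: "real (card I) \<ge> (real m / (2 * real D)) ^ CARD('n)"
  proof -
   have "real m \<le> real (2 * D * m')" using m'(3) by (intro of_nat_mono) simp
   then have "real m / (2 * real D) \<le> real m'" using Dpos by (simp add: field_simps)
   then show ?thesis unfolding cardI of_nat_power by (intro power_mono) auto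
  qed
  define Th where "Th kp z = u0 + ep *\<^sub>R (\<chi> i. G (kp i) (z $ i / rho))" for kp :: "'n => nat" and z :: "real ^ 'n"
  have Gin: "G (kp i) (z $ i / rho) \<in> cheb_interval m' (kp i)" if "kp \<in> I" "z \<in> B" for kp z i
   using G(2)[of "kp i"] that by (auto simp: I_def B_def)
  have sTh: "smooth_on B (Th kp)" if kp: "kp \<in> I" for kp
   unfolding Th_def[abs_def]
  proof (intro smooth_on_add smooth_on_scaleR smooth_on_const opB smooth_on_vec_lambda)
   fix i
   show "smooth_on B (%z. G (kp i) (z $ i / rho))"
   proof (rule smooth_on_compose[OF G(1)])
    show "kp i < m'" using kp by (simp add: I_def)
    show "smooth_on B (%z. z $ i / rho)"
     by (intro smooth_on_divide smooth_on_vec_nth smooth_on_id smooth_on_const opB) (use rho(1) in simp)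
    show "(%z. z $ i / rho) ` B \<subseteq> {-1<..<1}" by (auto simp: B_def)
   qed
  qed
  have ThV: "Th kp z \<in> V" if "kp \<in> I" "z \<in> B" for kp z
   unfolding Th_def
  proof (rule inV)
   fix i
   have "kp i < m'" using that(1) by (simp add: I_def)
   then show "\<bar>(\<chi> i. G (kp i) (z $ i / rho)) $ i\<bar> < 1"
    using Gin[OF that, of i] G(6)[of "kp i"] by (auto simp: abs_less_iff)
  qed
  have inv: "Xi (Th kp z) = z" if "kp \<in> I" "z \<in> B" for kp z
  proof -
   have "rho * cheb m' ((Th kp z $ i - u0 $ i) * (1 / ep)) = z $ i" for i
    using G(3)[of "kp i" "z $ i / rho"] that ep(1) rho(1) by (simp add: Th_def I_def B_def)
   then show ?thesis by (simp add: Xi_def vec_eq_iff)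
  qed
  have im: "Th kp ` B = {y. \<forall>i. (y $ i - u0 $ i) / ep \<in> cheb_interval m' (kp i)}" if kp: "kp \<in> I" for kp
  proof (intro set_eqI iffI)
   fix y assume "y \<in> Th kp ` B"
   then obtain z where "z \<in> B" "y = Th kp z" by blast
   then show "y \<in> {y. \<forall>i. (y $ i - u0 $ i) / ep \<in> cheb_interval m' (kp i)}"
    using Gin[OF kp] ep(1) by (simp add: Th_def)
  next
   fix y assume "y \<in> {y. \<forall>i. (y $ i - u0 $ i) / ep \<in> cheb_interval m' (kp i)}"
   then have y: "(y $ i - u0 $ i) / ep \<in> cheb_interval m' (kp i)" for i by simp
   have kpi: "kp i < m'" for i using kp by (simp add: I_def)
   define z where "z = (\<chi> i. rho * cheb m' ((y $ i - u0 $ i) / ep))"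
   have zi: "z $ i / rho = cheb m' ((y $ i - u0 $ i) / ep)" for i using rho(1) by (simp add: z_def)
   have "z \<in> B" unfolding B_def using G(4)[OF kpi y] zi by simp
   moreover have "Th kp z = y"
    using G(4)[OF kpi y] ep(1) by (simp add: Th_def zi vec_eq_iff)
   ultimately show "y \<in> Th kp ` B" by blast
  qed
  have opTh: "open (Th kp ` B)" if kp: "kp \<in> I" for kp
  proof -
   have "Th kp ` B = (\<Inter>i\<in>UNIV. (%y. (y $ i - u0 $ i) / ep) -` cheb_interval m' (kp i))" using im[OF kp] by auto
   moreover have "open (\<Inter>i\<in>UNIV. (%y. (y $ i - u0 $ i) / ep) -` cheb_interval m' (kp i))"
    by (intro open_INT ballI open_vimage finite_UNIV G(5) continuous_on_divide continuous_on_diff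
     bounded_linear.continuous_on[OF bounded_linear_vec_nth] continuous_on_id continuous_on_const) (use kp ep(1) in \<open>auto simp: I_def\<close>)
   ultimately show ?thesis by simp
  qed
  have disj: "disjoint_family_on (%kp. Th kp ` B) I"
   unfolding disjoint_family_on_def
  proof (intro ballI impI)
   fix kp kp' assume k: "kp \<in> I" "kp' \<in> I" "kp ~= kp'"
   show "Th kp ` B \<inter> Th kp' ` B = {}"
   proof (rule ccontr)
    assume "Th kp ` B \<inter> Th kp' ` B ~= {}"
    then obtain y where "y \<in> Th kp ` B" "y \<in> Th kp' ` B" by blast
    then have "(y $ i - u0 $ i) / ep \<in> cheb_interval m' (kp i)" "(y $ i - u0 $ i) / ep \<in> cheb_interval m' (kp' i)" for i
     using im[OF k(1)] im[OF k(2)] by blast+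
    moreover have "kp i < m'" "kp' i < m'" for i using k(1,2) by (simp_all add: I_def)
    ultimately have "kp i = kp' i" for i by (rule cheb_interval_disjoint[OF m'(1), rotated 2])
    then show False using k(3) by (simp add: fun_eq_iff)
   qed
  qed
  have close: "C1_close R tau N eta (%z. tuple_fun q P (Th kp z))" if kp: "kp \<in> I" for kp
  proof (rule C1_close_cong[OF p(2) opB NB])
   show "smooth_on B (%z. \<chi> i. p i z)"
    by (intro smooth_on_vec_lambda smooth_on_subset[OF real_polynomial_function_smooth[OF p(1)] opB subset_UNIV])
   show "tuple_fun q P (Th kp z) = (\<chi> i. p i z)" if "z \<in> B" for z
    using tP[OF ThV[OF kp that]] inv[OF kp that] by simp
  qed
  show ?thesis
   using hP finI Ine cI sXi disj sTh ThV opTh inv close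
   by (intro exI[of _ P] exI[of _ Xi] exI[of _ Th] exI[of _ I] conjI allI ballI) auto
 qed
 moreover have "D > 0" by (simp add: D_def)
 ultimately show ?thesis using NB opB by (intro exI[of _ D] exI[of _ B] conjI allI impI) auto
qed

text \<open>
 Starting from the Chebyshev system in one chart, generic perturbations make the system regular in finitely many
 charts that cover \<open>X\<close>. Only perturbations so small that the system stays \<open>C\<^sup>1\<close>-close
 to \<open>tau\<close> on each cube are used, so all copies survive.
\<close>

lemma many_copies_in_charts:
 fixes X :: "'m::euclidean_space set" and \<Sigma> :: "(real ^ 'n::finite) set"
 assumes X: "compact X" "X ~= {}"
  and charts: "\<And>A. A \<in> X ==> \<exists>V sg Q psi q j l. A \<in> Q \<and> hchart k X Zs V (sg :: real ^ 'n => 'm) Q psi q j l"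
  and Zs: "\<And>m p. hpoly k m p ==> Zs p \<subseteq> X"
  and \<Sigma>: "closed_submanifold d \<Sigma>" and R: "R ~= {}" "d + card R = CARD('n)"
  and mu: "\<And>i. i \<in> R ==> smooth_map \<Sigma> (mu i)"
   "\<And>p. p \<in> \<Sigma> ==> inj_on (%i. mu i p) R \<and> independent ((%i. mu i p) ` R)"
   "\<And>p i. p \<in> \<Sigma> ==> i \<in> R ==> mu i p \<in> normal_space \<Sigma> p"
 shows "\<exists>c>0. \<exists>m0>0. \<forall>m\<ge>m0. \<exists>P :: 'n => (nat => real) => real. (\<forall>i. hpoly k m (P i)) \<and>
  (\<forall>i\<in>R. \<not> X \<subseteq> Zs (P i)) \<and> submanifold d (\<Inter>i\<in>R. Zs (P i)) \<and>
  ereal (c * real m ^ CARD('n)) \<le> ereal_of_enat (num_copies \<Sigma> (\<Inter>i\<in>R. Zs (P i)))"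
proof -
 have S: "compact \<Sigma>" "submanifold d \<Sigma>" "\<Sigma> ~= {}" using \<Sigma> by (auto simp: closed_submanifold_def)
 have "\<exists>dl Qt pj (tau :: real ^ 'n => real ^ 'n). tubular \<Sigma> R mu dl Qt pj tau"
 proof (rule tubular_neighbourhood_exists[OF S(1,2) R(2) mu])
  fix dl Qt pj and tau :: "real ^ 'n => real ^ 'n"
  assume "tubular \<Sigma> R mu dl Qt pj tau"
  then show ?thesis by blast
 qed
 then obtain dl Qt pj and tau :: "real ^ 'n => real ^ 'n" where tub: "tubular \<Sigma> R mu dl Qt pj tau" by blast
 define N where "N = {z \<in> Qt. norm (tau z) \<le> dl / 2}"
 define No where "No = {z \<in> Qt. norm (tau z) < dl / 2}"
 have stau: "smooth_on Qt tau" and tauR: "\<And>z. z \<in> Qt ==> tau z \<in> suppvec R" using tub by (auto simp: tubular_def)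
 have NoN: "No \<subseteq> N" by (auto simp: No_def N_def)
 have opNo: "open No"
 proof -
  have "No = Qt \<inter> (%z. norm (tau z)) -` {..<dl/2}" by (auto simp: No_def)
  then show ?thesis
   using continuous_open_preimage[OF continuous_on_norm[OF smooth_on_continuous[OF stau]] smooth_on_open[OF stau] open_lessThan]
   by simp
 qed
 obtain eta where cN: "compact N" and eta: "zero_set_margin \<Sigma> R tau N No eta"
  using zero_set_margin_exists[OF S(1) mu(1) tub] unfolding N_def No_def by blast
 have etapos: "eta > 0" using eta by (simp add: zero_set_margin_def)
 have NQ: "N \<subseteq> Qt" by (auto simp: N_def)
 obtain p where p: "\<And>i. real_polynomial_function (p i)" "C1_close R tau N eta (%z. \<chi> i. p i z)"
  using C1_close_polynomial[OF stau tauR cN NQ etapos] by blast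
 obtain V sg Q psi q j l where inQ: "\<And>A. A \<in> X ==> A \<in> Q A"
  and ch: "\<And>A. A \<in> X ==> hchart k X Zs (V A) (sg A :: real ^ 'n => 'm) (Q A) (psi A) (q A) (j A) (l A)"
  using charts by metis
 have "\<exists>r>0. cball (psi A A) r \<subseteq> V A" if "A \<in> X" for A
  using hchartD(4)[OF ch[OF that] that inQ[OF that]] smooth_on_open[OF hchartD(1)[OF ch[OF that]]]
  by (metis open_contains_cball)
 then obtain r where r: "\<And>A. A \<in> X ==> r A > 0" "\<And>A. A \<in> X ==> cball (psi A A) (r A) \<subseteq> V A" by metis
 define K where "K A = cball (psi A A) (r A)" for A
 define Om where "Om A = Q A \<inter> psi A -` ball (psi A A) (r A)" for A
 have opOm: "open (Om A)" if "A \<in> X" for A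
  unfolding Om_def
  by (rule continuous_open_preimage[OF smooth_on_continuous[OF hchartD(2)[OF ch[OF that]]]
    smooth_on_open[OF hchartD(2)[OF ch[OF that]]] open_ball])
 have cov: "X \<subseteq> (\<Union>A\<in>X. Om A)" using inQ r(1) by (auto simp: Om_def)
 obtain Dp where Dp: "Dp \<subseteq> X" "finite Dp" "X \<subseteq> (\<Union>A\<in>Dp. Om A)"
  using compactE_image[OF X(1) opOm cov] by metis
 obtain A0 where A0: "A0 \<in> X" using X(2) by blast
 note ch0 = ch[OF A0]
 note c0 = hchartD[OF ch0]
 have u0: "psi A0 A0 \<in> V A0" using c0(4)[OF A0 inQ[OF A0]] by simp
 obtain D B where D: "D > 0" and NB: "N \<subseteq> B" and opB: "open B" and sys: "\<And>m. m \<ge> D ==>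
  \<exists>P Xi Th (I :: ('n => nat) set). (\<forall>i. hpoly k m (P i)) \<and> finite I \<and> I ~= {} \<and>
  real (card I) \<ge> (real m / (2 * real D)) ^ CARD('n) \<and> smooth_on UNIV Xi \<and> disjoint_family_on (%kp. Th kp ` B) I \<and>
  (\<forall>kp\<in>I. smooth_on B (Th kp) \<and> Th kp ` B \<subseteq> V A0 \<and> open (Th kp ` B) \<and> (\<forall>z\<in>B. Xi (Th kp z) = z) \<and>
    C1_close R tau N eta (%z. tuple_fun (q A0) P (Th kp z)))"
  using chebyshev_system[OF ch0 u0 p cN] by blast
 have main: "\<exists>P :: 'n => (nat => real) => real. (\<forall>i. hpoly k m (P i)) \<and>
  (\<forall>i\<in>R. \<not> X \<subseteq> Zs (P i)) \<and> submanifold d (\<Inter>i\<in>R. Zs (P i)) \<and>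
  ereal ((1 / (2 * real D)) ^ CARD('n) * real m ^ CARD('n)) \<le> ereal_of_enat (num_copies \<Sigma> (\<Inter>i\<in>R. Zs (P i)))"
  if m: "m \<ge> D" for m
 proof -
  obtain P0 Xi Th and I :: "('n => nat) set" where H: "(\<forall>i. hpoly k m (P0 i)) \<and> finite I \<and> I ~= {} \<and>
   real (card I) \<ge> (real m / (2 * real D)) ^ CARD('n) \<and> smooth_on UNIV Xi \<and> disjoint_family_on (%kp. Th kp ` B) I \<and>
   (\<forall>kp\<in>I. smooth_on B (Th kp) \<and> Th kp ` B \<subseteq> V A0 \<and> open (Th kp ` B) \<and> (\<forall>z\<in>B. Xi (Th kp z) = z) \<and>
    C1_close R tau N eta (%z. tuple_fun (q A0) P0 (Th kp z)))"
   using sys[OF m] by (elim exE) (rule that)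
  have P0: "\<And>i. hpoly k m (P0 i)" and I: "finite I" "I ~= {}"
   "real (card I) \<ge> (real m / (2 * real D)) ^ CARD('n)" and Xi: "smooth_on UNIV Xi"
   and disj: "disjoint_family_on (%kp. Th kp ` B) I"
   and H': "\<forall>kp\<in>I. smooth_on B (Th kp) \<and> Th kp ` B \<subseteq> V A0 \<and> open (Th kp ` B) \<and> (\<forall>z\<in>B. Xi (Th kp z) = z) \<and>
    C1_close R tau N eta (%z. tuple_fun (q A0) P0 (Th kp z))"
   using H by simp_all
  have Th: "\<And>kp. kp \<in> I ==> smooth_on B (Th kp)" "\<And>kp. kp \<in> I ==> Th kp ` B \<subseteq> V A0" "\<And>kp. kp \<in> I ==> open (Th kp ` B)"
    "\<And>kp z. kp \<in> I ==> z \<in> B ==> Xi (Th kp z) = z"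
    "\<And>kp. kp \<in> I ==> C1_close R tau N eta (%z. tuple_fun (q A0) P0 (Th kp z))"
   by (blast dest: bspec[OF H'])+
  \<comment> \<open>the conditions that keep the copies; they are preserved when the system is made regular\<close>
  define Cs where "Cs = (%kp P. C1_close R tau N eta (%z. tuple_fun (q A0) P (Th kp z))) ` I"
  have Cs: "open_cond k m TYPE('n) C \<and> C P0" if C: "C \<in> Cs" for C
  proof -
   obtain kp where kp: "kp \<in> I" "C = (%P. C1_close R tau N eta (%z. tuple_fun (q A0) P (Th kp z)))"
    using C by (auto simp: Cs_def)
   have "open_cond k m TYPE('n) (%P :: 'n => _. C1_close R tau N eta (%z. tuple_fun (q A0) P (Th kp z)))"
    by (rule open_cond_C1_close[OF c0(7) cN NB Th(1,2)[OF kp(1)]])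
   then show ?thesis using kp Th(5) by simp
  qed
  have finCs: "finite Cs" using I(1) by (simp add: Cs_def)
  have mpos: "m > 0" using m D by simp
  have chD: "hchart k X Zs (V A) (sg A) (Q A) (psi A) (q A) (j A) (l A)" if "A \<in> Dp" for A
   using ch Dp(1) that by blast
  have KD: "compact (K A) \<and> K A \<subseteq> V A" if "A \<in> Dp" for A
   unfolding K_def using r(2) Dp(1) that by auto
  have "\<exists>P. (\<forall>i. hpoly k m (P i)) \<and> (\<forall>C\<in>Cs. C P) \<and> (\<forall>A\<in>Dp. regular_on R (K A) (tuple_fun (q A) P))"
   by (rule regular_in_all_charts[OF Dp(2) chD KD refl mpos P0 finCs Cs])
  then obtain P where P0': "\<forall>i. hpoly k m (P i)" "\<forall>C\<in>Cs. C P" "\<forall>A\<in>Dp. regular_on R (K A) (tuple_fun (q A) P)"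
   by (elim exE conjE) (rule that)
  note P = spec[OF P0'(1)] bspec[OF P0'(2)] bspec[OF P0'(3)]
  let ?S = "\<Inter>i\<in>R. Zs (P i)"
  have SX: "?S \<subseteq> X" using R(1) Zs[OF P(1)] by blast
  have inK: "\<exists>B\<in>Dp. A \<in> Q B \<and> psi B A \<in> K B" if "A \<in> ?S" for A
  proof -
   have "A \<in> X" using SX that by blast
   then obtain B where "B \<in> Dp" "A \<in> Om B" using Dp(3) by blast
   then show ?thesis by (intro bexI[of _ B]) (auto simp: Om_def K_def)
  qed
  have sub: "submanifold d ?S"
   unfolding submanifold_iff_flat_at
  proof
   fix A assume A: "A \<in> ?S"
   obtain B where B: "B \<in> Dp" "A \<in> Q B" "psi B A \<in> K B" using inK[OF A] by blast
   show "flat_at d ?S A"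
    by (rule regular_zero_set_in_chart(1)[OF chD[OF B(1)] P(1) Zs[OF P(1)] R A B(2,3) P(3)[OF B(1)]])
  qed
  define Z where "Z kp = {z \<in> N. \<forall>i\<in>R. tuple_fun (q A0) P (Th kp z) $ i = 0}" for kp
  have sP: "smooth_on (V A0) (tuple_fun (q A0) P)" by (rule tuple_fun_smooth[OF P(1) c0(7)])
  have Z: "compact (Z kp)" "Z kp \<subseteq> No" "diffeomorphic \<Sigma> (Z kp)" if kp: "kp \<in> I" for kp
  proof -
   have cl: "C1_close R tau N eta (%z. tuple_fun (q A0) P (Th kp z))"
    using P(2)[of "%P. C1_close R tau N eta (%z. tuple_fun (q A0) P (Th kp z))"] kp by (auto simp: Cs_def)
   have "smooth_on B (%z. tuple_fun (q A0) P (Th kp z))" by (rule smooth_on_compose[OF sP Th(1,2)[OF kp]])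
   with eta NB cl have "compact (Z kp) \<and> Z kp \<subseteq> No \<and> diffeomorphic \<Sigma> (Z kp)"
    unfolding zero_set_margin_def Z_def by blast
   then show "compact (Z kp)" "Z kp \<subseteq> No" "diffeomorphic \<Sigma> (Z kp)" by auto
  qed
  define C where "C kp = sg A0 ` Th kp ` Z kp" for kp
  have copy: "diffeomorphic \<Sigma> (C kp) \<and> (\<exists>\<K>\<subseteq>components ?S. C kp = \<Union>\<K>)" if kp: "kp \<in> I" for kp
  proof -
   have 1: "sg A0 y \<in> Q A0 \<and> psi A0 (sg A0 y) = y" if "y \<in> V A0" for y using c0(3)[OF that] by simp
   have 2: "psi A0 A \<in> V A0 \<and> sg A0 (psi A0 A) = A" if "A \<in> ?S" "A \<in> Q A0" for A
    using c0(4)[OF subsetD[OF SX that(1)] that(2)] .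
   have 3: "sg A0 y \<in> ?S \<longleftrightarrow> (\<forall>i\<in>R. tuple_fun (q A0) P y $ i = 0)" if "y \<in> V A0" for y
    by (rule hchart_zero_set[OF ch0 P(1) that])
   have 4: "z \<in> Z kp \<longleftrightarrow> (\<forall>i\<in>R. tuple_fun (q A0) P (Th kp z) $ i = 0)" if "z \<in> No" for z
    using that NoN by (auto simp: Z_def)
   have NoB: "No \<subseteq> B" using NoN NB by blast
   note zc = zero_set_copy[OF c0(1,2) 1 2 3 Th(1,2,3)[OF kp] Xi Th(4)[OF kp] Z(1,3,2)[OF kp] opNo NoB 4]
   show ?thesis unfolding C_def by (rule conjI[OF zc])
  qed
  have Zne: "Z kp ~= {}" if "kp \<in> I" for kp
   using Z(3)[OF that] S(3) unfolding diffeomorphic_def by blast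
  have ZB: "Z kp \<subseteq> B" for kp using NB by (auto simp: Z_def)
  have Cdisj: "C kp \<inter> C kp' = {}" if k: "kp \<in> I" "kp' \<in> I" "kp ~= kp'" for kp kp'
  proof (rule ccontr)
   assume "C kp \<inter> C kp' ~= {}"
   then obtain z z' where z: "z \<in> Z kp" "z' \<in> Z kp'" "sg A0 (Th kp z) = sg A0 (Th kp' z')" by (auto simp: C_def)
   have zB: "z \<in> B" "z' \<in> B" using ZB z by auto
   have "Th kp z \<in> V A0" "Th kp' z' \<in> V A0" using Th(2)[OF k(1)] Th(2)[OF k(2)] zB by auto
   then have "Th kp z = Th kp' z'" using c0(3) z(3) by metis
   then have "Th kp z \<in> Th kp ` B \<inter> Th kp' ` B" using zB by (metis IntI imageI)
   then show False using disj k unfolding disjoint_family_on_def by blast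
  qed
  have Cne: "C kp ~= {}" if "kp \<in> I" for kp using Zne[OF that] by (simp add: C_def)
  have injC: "inj_on C I"
  proof (rule inj_onI, rule ccontr)
   fix kp kp' assume "kp \<in> I" "kp' \<in> I" "C kp = C kp'" "kp ~= kp'"
   then show False using Cdisj[of kp kp'] Cne[of kp] by simp
  qed
  have "disjoint_copies \<Sigma> ?S (C ` I)"
   unfolding disjoint_copies_def
  proof (intro conjI ballI)
   show "disjoint (C ` I)"
   proof (rule disjointI)
    fix a b assume "a \<in> C ` I" "b \<in> C ` I" "a ~= b"
    then show "a \<inter> b = {}" using Cdisj by blast
   qed
   fix a assume "a \<in> C ` I"
   then obtain kp where "kp \<in> I" "a = C kp" by blast
   then show "diffeomorphic \<Sigma> a" "\<exists>\<K>\<subseteq>components ?S. a = \<Union>\<K>" using copy[of kp] by simp_all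
  qed
  then have "enat (card (C ` I)) \<le> num_copies \<Sigma> ?S"
   unfolding num_copies_def using I(1) by (intro SUP_upper) simp
  then have le: "enat (card I) \<le> num_copies \<Sigma> ?S" by (simp add: card_image[OF injC])
  have "(1 / (2 * real D)) ^ CARD('n) * real m ^ CARD('n) \<le> real (card I)"
   using I(3) by (simp add: power_mult_distrib[symmetric])
  then have "ereal ((1 / (2 * real D)) ^ CARD('n) * real m ^ CARD('n)) \<le> ereal (real (card I))" by simp
  also have "\<dots> = ereal_of_enat (enat (card I))" by simp
  also have "\<dots> \<le> ereal_of_enat (num_copies \<Sigma> ?S)" using le by (simp only: ereal_of_enat_le_iff)
  finally have num: "ereal ((1 / (2 * real D)) ^ CARD('n) * real m ^ CARD('n)) \<le> ereal_of_enat (num_copies \<Sigma> ?S)" .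
  obtain kp where kp: "kp \<in> I" using I(2) by blast
  obtain A where A: "A \<in> ?S"
  proof -
   obtain z where z: "z \<in> Z kp" using Zne[OF kp] by blast
   have "Th kp z \<in> V A0" using Th(2)[OF kp] ZB z by blast
   from hchart_zero_set[OF ch0 P(1) this, where R = R] z have "sg A0 (Th kp z) \<in> ?S" by (simp add: Z_def)
   then show thesis by (rule that)
  qed
  obtain Bp where Bp: "Bp \<in> Dp" "A \<in> Q Bp" "psi Bp A \<in> K Bp" using inK[OF A] by blast
  have "\<not> X \<subseteq> Zs (P i)" if "i \<in> R" for i
   by (rule regular_zero_set_in_chart(2)[OF chD[OF Bp(1)] P(1) Zs[OF P(1)] R A Bp(2,3) P(3)[OF Bp(1)] that])
  then show ?thesis using P(1) sub num by blast
 qed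
 show ?thesis
  by (intro exI[of _ "(1 / (2 * real D)) ^ CARD('n)"] exI[of _ D] conjI allI impI main D) (use D in auto)
qed

section \<open>Evaluation of polynomials\<close>

definition mono_eval :: "('v \<Rightarrow>\<^sub>0 nat) => ('v => complex) => complex" where
 "mono_eval mu z = (\<Prod>i\<in>Poly_Mapping.keys mu. z i ^ Poly_Mapping.lookup mu i)"

definition mono_deg :: "('v \<Rightarrow>\<^sub>0 nat) => nat" where
 "mono_deg mu = (\<Sum>i\<in>Poly_Mapping.keys mu. Poly_Mapping.lookup mu i)"

lemma mono_eval_superset:
 assumes "finite A" "Poly_Mapping.keys mu \<subseteq> A"
 shows "mono_eval mu z = (\<Prod>i\<in>A. z i ^ Poly_Mapping.lookup mu i)"
 unfolding mono_eval_def
 by (rule prod.mono_neutral_left[OF assms]) (auto simp: not_in_keys_iff_lookup_eq_zero)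

lemma mono_deg_superset:
 assumes "finite A" "Poly_Mapping.keys mu \<subseteq> A"
 shows "mono_deg mu = (\<Sum>i\<in>A. Poly_Mapping.lookup mu i)"
 unfolding mono_deg_def
 by (rule sum.mono_neutral_left[OF assms]) (auto simp: not_in_keys_iff_lookup_eq_zero)

lemma mono_eval_add: "mono_eval (mu + nu) z = mono_eval mu z * mono_eval nu z"
proof -
 let ?A = "Poly_Mapping.keys mu \<union> Poly_Mapping.keys nu"
 have A: "finite ?A" "Poly_Mapping.keys mu \<subseteq> ?A" "Poly_Mapping.keys nu \<subseteq> ?A" "Poly_Mapping.keys (mu + nu) \<subseteq> ?A"
  using Poly_Mapping.keys_add[of mu nu] by auto
 show ?thesis
  unfolding mono_eval_superset[OF A(1,2)] mono_eval_superset[OF A(1,3)] mono_eval_superset[OF A(1,4)]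
  by (simp add: lookup_add power_add prod.distrib)
qed

lemma mono_deg_add: "mono_deg (mu + nu) = mono_deg mu + mono_deg nu"
proof -
 let ?A = "Poly_Mapping.keys mu \<union> Poly_Mapping.keys nu"
 have A: "finite ?A" "Poly_Mapping.keys mu \<subseteq> ?A" "Poly_Mapping.keys nu \<subseteq> ?A" "Poly_Mapping.keys (mu + nu) \<subseteq> ?A"
  using Poly_Mapping.keys_add[of mu nu] by auto
 show ?thesis
  unfolding mono_deg_superset[OF A(1,2)] mono_deg_superset[OF A(1,3)] mono_deg_superset[OF A(1,4)]
  by (simp add: lookup_add sum.distrib)
qed

lemma peval_superset:
 assumes "finite A" "Poly_Mapping.keys F \<subseteq> A"
 shows "peval F z = (\<Sum>mu\<in>A. complex_of_real (Poly_Mapping.lookup F mu) * mono_eval mu z)"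
 unfolding peval_def mono_eval_def[symmetric]
 by (rule sum.mono_neutral_left[OF assms]) (auto simp: not_in_keys_iff_lookup_eq_zero)

lemma peval_add: "peval (F + G) z = peval F z + peval G z"
proof -
 let ?A = "Poly_Mapping.keys F \<union> Poly_Mapping.keys G"
 have A: "finite ?A" "Poly_Mapping.keys F \<subseteq> ?A" "Poly_Mapping.keys G \<subseteq> ?A" "Poly_Mapping.keys (F + G) \<subseteq> ?A"
  using Poly_Mapping.keys_add[of F G] by auto
 show ?thesis
  unfolding peval_superset[OF A(1,2)] peval_superset[OF A(1,3)] peval_superset[OF A(1,4)]
  by (simp add: lookup_add distrib_right sum.distrib)
qed

lemma peval_zero: "peval 0 z = 0"
 by (simp add: peval_def)

lemma peval_uminus: "peval (- F) z = - peval F z"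
 using peval_add[of F "- F" z] by (simp add: peval_zero eq_neg_iff_add_eq_0 add.commute)

lemma peval_diff: "peval (F - G) z = peval F z - peval G z"
 using peval_add[of F "- G" z] by (simp add: peval_uminus)

lemma peval_sum: "peval (\<Sum>i\<in>I. F i) z = (\<Sum>i\<in>I. peval (F i) z)"
 by (induction I rule: infinite_finite_induct) (simp_all add: peval_zero peval_add)

lemma peval_single: "peval (Poly_Mapping.single mu c) z = complex_of_real c * mono_eval mu z"
 by (subst peval_superset[of "{mu}"]) (auto simp: lookup_single)

lemma rpoly_sum_monomials: "F = (\<Sum>mu\<in>Poly_Mapping.keys F. Poly_Mapping.single mu (Poly_Mapping.lookup F mu))"
 by (rule poly_mapping_eqI)
  (simp add: lookup_sum lookup_single when_def sum.delta' not_in_keys_iff_lookup_eq_zero)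

lemma peval_mult: "peval (F * G) z = peval F z * peval G z"
proof -
 have "F * G = (\<Sum>mu\<in>Poly_Mapping.keys F. \<Sum>nu\<in>Poly_Mapping.keys G.
   Poly_Mapping.single (mu + nu) (Poly_Mapping.lookup F mu * Poly_Mapping.lookup G nu))"
  by (subst rpoly_sum_monomials[of F], subst rpoly_sum_monomials[of G])
   (simp add: sum_product mult_single)
 then have "peval (F * G) z = (\<Sum>mu\<in>Poly_Mapping.keys F. \<Sum>nu\<in>Poly_Mapping.keys G.
   (complex_of_real (Poly_Mapping.lookup F mu) * mono_eval mu z) * (complex_of_real (Poly_Mapping.lookup G nu) * mono_eval nu z))"
  by (simp add: peval_sum peval_single mono_eval_add mult_ac)
 then show ?thesis by (simp add: sum_product[symmetric] peval_def mono_eval_def)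
qed

lemma peval_one: "peval 1 z = 1"
 using peval_single[of 0 1 z] by (simp add: mono_eval_def)

lemma peval_power: "peval (F ^ n) z = peval F z ^ n"
 by (induction n) (simp_all add: peval_one peval_mult)

lemma peval_prod: "peval (\<Prod>i\<in>I. F i) z = (\<Prod>i\<in>I. peval (F i) z)"
 by (induction I rule: infinite_finite_induct) (simp_all add: peval_one peval_mult)

definition pconst :: "real => 'v rpoly" where
 "pconst c = Poly_Mapping.single 0 c"

definition pvar :: "'v => 'v rpoly" where
 "pvar i = Poly_Mapping.single (Poly_Mapping.single i 1) 1"

lemma peval_pconst: "peval (pconst c) z = complex_of_real c"
 by (simp add: pconst_def peval_single mono_eval_def)

lemma peval_pvar: "peval (pvar i) z = z i"
 by (simp add: pvar_def peval_single mono_eval_def)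

lemma homogeneous_iff: "homogeneous d F \<longleftrightarrow> (\<forall>mu\<in>Poly_Mapping.keys F. mono_deg mu = d)"
 by (simp add: homogeneous_def mono_deg_def)

lemma homogeneous_pconst: "homogeneous 0 (pconst c)"
 by (simp add: homogeneous_iff pconst_def mono_deg_def)

lemma homogeneous_one: "homogeneous 0 1"
 using homogeneous_pconst[of 1] by (simp add: pconst_def)

lemma homogeneous_zero: "homogeneous d 0"
 by (simp add: homogeneous_iff)

lemma homogeneous_add: "homogeneous d F ==> homogeneous d G ==> homogeneous d (F + G)"
 using Poly_Mapping.keys_add[of F G] unfolding homogeneous_iff by blast

lemma homogeneous_diff: "homogeneous d F ==> homogeneous d G ==> homogeneous d (F - G)"
 using keys_diff[of F G] unfolding homogeneous_iff by blast

lemma homogeneous_mult: "homogeneous d F ==> homogeneous d' G ==> homogeneous (d + d') (F * G)"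
 using keys_mult[of F G] unfolding homogeneous_iff by (fastforce simp: mono_deg_add)

lemma homogeneous_power: "homogeneous d F ==> homogeneous (n * d) (F ^ n)"
 by (induction n) (simp_all add: homogeneous_one homogeneous_mult)

lemma homogeneous_prod: "(\<And>i. i \<in> I ==> homogeneous (d i) (F i)) ==> homogeneous (\<Sum>i\<in>I. d i) (\<Prod>i\<in>I. F i)"
 by (induction I rule: infinite_finite_induct) (simp_all add: homogeneous_one homogeneous_mult)

lemma mono_eval_scale: "mono_eval mu (%i. c * z i) = c ^ mono_deg mu * mono_eval mu z"
 by (simp add: mono_eval_def mono_deg_def power_mult_distrib prod.distrib power_sum)

lemma peval_scale: "homogeneous d F ==> peval F (%i. c * z i) = c ^ d * peval F z"
 unfolding peval_def mono_eval_def[symmetric] homogeneous_iff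
 by (simp add: mono_eval_scale sum_distrib_left mult_ac)

lemma pevalv_scale: "homogeneous d F ==> pevalv F (c *s z) = c ^ d * pevalv F z"
proof -
 have "vec_nth (c *s z) = (%i. c * z $ i)" by (simp add: fun_eq_iff)
 then show "homogeneous d F ==> ?thesis" using peval_scale[of d F c "vec_nth z"] by simp
qed

definition hcomp :: "nat => 'v rpoly => 'v rpoly" where
 "hcomp d F = (\<Sum>mu\<in>{mu \<in> Poly_Mapping.keys F. mono_deg mu = d}. Poly_Mapping.single mu (Poly_Mapping.lookup F mu))"

lemma hcomp_homogeneous: "homogeneous d (hcomp d F)"
proof -
 have gen: "homogeneous d (\<Sum>mu\<in>S. Poly_Mapping.single mu (c mu))" if "\<And>mu. mu \<in> S ==> mono_deg mu = d" for S and c :: "_ => real"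
  using that
 proof (induction S rule: infinite_finite_induct)
  case (insert mu S)
  have "homogeneous d (Poly_Mapping.single mu (c mu))" using insert.prems by (auto simp: homogeneous_iff)
  then show ?case using insert by (simp add: homogeneous_add)
 qed (simp_all add: homogeneous_zero)
 show ?thesis unfolding hcomp_def by (rule gen) simp
qed

lemma peval_hcomp_sum:
 obtains n where "\<And>z. peval F z = (\<Sum>d\<le>n. peval (hcomp d F) z)"
proof -
 define n where "n = Max (insert 0 (mono_deg ` Poly_Mapping.keys F))"
 have n: "mono_deg mu \<le> n" if "mu \<in> Poly_Mapping.keys F" for mu
  unfolding n_def by (rule Max_ge) (use that in auto)
 have "(\<Sum>d\<le>n. hcomp d F) = (\<Sum>mu\<in>Poly_Mapping.keys F. Poly_Mapping.single mu (Poly_Mapping.lookup F mu))"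
  unfolding hcomp_def by (rule sum.group) (use n in auto)
 then have "F = (\<Sum>d\<le>n. hcomp d F)" using rpoly_sum_monomials[of F] by simp
 then have "peval F z = (\<Sum>d\<le>n. peval (hcomp d F) z)" for z
  using peval_sum[of "%d. hcomp d F" "{..n}" z] by simp
 then show thesis by (rule that)
qed

section \<open>Derivatives of polynomials\<close>

definition pdiff :: "'v => 'v rpoly => 'v rpoly" where
 "pdiff i F = (\<Sum>mu\<in>Poly_Mapping.keys F.
  Poly_Mapping.single (mu - Poly_Mapping.single i 1) (Poly_Mapping.lookup F mu * real (Poly_Mapping.lookup mu i)))"

text \<open>The chain rule along a curve with holomorphic components.\<close>

lemma peval_has_field_derivative:
 fixes gm :: "'v::finite => complex => complex"
 assumes "\<And>i. (gm i has_field_derivative gm' i) (at s)"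
 shows "((%s. peval F (%i. gm i s)) has_field_derivative (\<Sum>i\<in>UNIV. gm' i * peval (pdiff i F) (%i. gm i s))) (at s)"
proof -
 have mono: "((%s. mono_eval mu (%i. gm i s)) has_field_derivative
   (\<Sum>i\<in>UNIV. gm' i * (of_nat (Poly_Mapping.lookup mu i) * mono_eval (mu - Poly_Mapping.single i 1) (%i. gm i s)))) (at s)" for mu
 proof -
  have "((%s. \<Prod>i\<in>UNIV. gm i s ^ Poly_Mapping.lookup mu i) has_derivative
    (%y. \<Sum>i\<in>UNIV. (of_nat (Poly_Mapping.lookup mu i) * (y * gm' i) * gm i s ^ (Poly_Mapping.lookup mu i - 1)) *
     (\<Prod>j\<in>UNIV - {i}. gm j s ^ Poly_Mapping.lookup mu j))) (at s)"
  proof (rule has_derivative_prod)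
   fix i
   have "(gm i has_derivative (%y. y * gm' i)) (at s)"
    using assms[of i] unfolding has_field_derivative_def
    by (rule has_derivative_eq_rhs) (simp add: fun_eq_iff mult.commute)
   from has_derivative_power[OF this, of "Poly_Mapping.lookup mu i"]
   show "((%x. gm i x ^ Poly_Mapping.lookup mu i) has_derivative
     (%y. of_nat (Poly_Mapping.lookup mu i) * (y * gm' i) * gm i s ^ (Poly_Mapping.lookup mu i - 1))) (at s)" .
  qed
  moreover have "(of_nat (Poly_Mapping.lookup mu i) * (y * gm' i) * gm i s ^ (Poly_Mapping.lookup mu i - 1)) *
     (\<Prod>j\<in>UNIV - {i}. gm j s ^ Poly_Mapping.lookup mu j) =
    y * (gm' i * (of_nat (Poly_Mapping.lookup mu i) * mono_eval (mu - Poly_Mapping.single i 1) (%i. gm i s)))" for y i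
  proof -
   have "mono_eval (mu - Poly_Mapping.single i 1) (%i. gm i s) =
     (\<Prod>j\<in>UNIV. gm j s ^ Poly_Mapping.lookup (mu - Poly_Mapping.single i 1) j)"
    by (rule mono_eval_superset) auto
   also have "\<dots> = gm i s ^ (Poly_Mapping.lookup mu i - 1) * (\<Prod>j\<in>UNIV - {i}. gm j s ^ Poly_Mapping.lookup mu j)"
    by (subst prod.remove[of UNIV i]) (auto simp: lookup_minus lookup_single intro!: prod.cong)
   finally show ?thesis by (simp add: mult_ac)
  qed
  ultimately have D: "((%s. \<Prod>i\<in>UNIV. gm i s ^ Poly_Mapping.lookup mu i) has_derivative
    (%y. \<Sum>i\<in>UNIV. y * (gm' i * (of_nat (Poly_Mapping.lookup mu i) * mono_eval (mu - Poly_Mapping.single i 1) (%i. gm i s))))) (at s)"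
   by (simp only:)
  have "mono_eval mu z = (\<Prod>i\<in>UNIV. z i ^ Poly_Mapping.lookup mu i)" for z
   by (rule mono_eval_superset) auto
  then show ?thesis
   using D unfolding has_field_derivative_def
   by (simp only: sum_distrib_left[symmetric]) (erule has_derivative_eq_rhs, simp add: fun_eq_iff mult.commute)
 qed
 have "((%s. \<Sum>mu\<in>Poly_Mapping.keys F. complex_of_real (Poly_Mapping.lookup F mu) * mono_eval mu (%i. gm i s)) has_field_derivative
   (\<Sum>mu\<in>Poly_Mapping.keys F. complex_of_real (Poly_Mapping.lookup F mu) *
    (\<Sum>i\<in>UNIV. gm' i * (of_nat (Poly_Mapping.lookup mu i) * mono_eval (mu - Poly_Mapping.single i 1) (%i. gm i s))))) (at s)"
  by (intro DERIV_sum DERIV_cmult mono)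
 also have "(\<Sum>mu\<in>Poly_Mapping.keys F. complex_of_real (Poly_Mapping.lookup F mu) *
    (\<Sum>i\<in>UNIV. gm' i * (of_nat (Poly_Mapping.lookup mu i) * mono_eval (mu - Poly_Mapping.single i 1) (%i. gm i s)))) =
   (\<Sum>i\<in>UNIV. gm' i * peval (pdiff i F) (%i. gm i s))"
  unfolding pdiff_def peval_sum peval_single sum_distrib_left
  by (subst sum.swap) (simp add: mult_ac)
 finally show ?thesis by (simp only: peval_def mono_eval_def)
qed

section \<open>Smoothness of polynomials\<close>

lemma smooth_on_times:
 fixes f g :: "'a::euclidean_space => 'b::{euclidean_space, real_normed_field}"
 shows "smooth_on U f ==> smooth_on U g ==> smooth_on U (%x. f x * g x)"
 by (rule smooth_on_bilinear[OF bounded_bilinear_mult])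

lemma smooth_on_product:
 fixes f :: "'i => 'a::euclidean_space => 'b::{euclidean_space, real_normed_field}"
 assumes "open U" "\<And>i. i \<in> I ==> smooth_on U (f i)"
 shows "smooth_on U (%x. \<Prod>i\<in>I. f i x)"
 using assms(2)
 by (induction I rule: infinite_finite_induct) (simp_all add: smooth_on_const smooth_on_times assms(1))

lemma smooth_on_pow:
 fixes f :: "'a::euclidean_space => 'b::{euclidean_space, real_normed_field}"
 assumes "smooth_on U f"
 shows "smooth_on U (%x. f x ^ n)"
 by (induction n) (simp_all add: smooth_on_const smooth_on_times assms smooth_on_open[OF assms])

lemma peval_smooth:
 assumes "open U" "\<And>i. smooth_on U (f i)"
 shows "smooth_on U (%x. peval F (%i. f i x))"
 unfolding peval_def
 by (intro smooth_on_sum smooth_on_times smooth_on_product smooth_on_pow smooth_on_const assms)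

definition peval_real :: "'v rpoly => ('v => real) => real" where
 "peval_real F x = Re (peval F (%i. complex_of_real (x i)))"

lemma peval_of_real: "peval F (%i. complex_of_real (x i)) = complex_of_real (peval_real F x)"
proof -
 have "peval F (%i. complex_of_real (x i)) \<in> \<real>"
  unfolding peval_def by (intro sum_in_Reals Reals_mult prod_in_Reals Reals_power Reals_of_real)
 then show ?thesis by (simp add: peval_real_def of_real_Re)
qed

lemma peval_real_smooth:
 assumes "open U" "\<And>i. smooth_on U (f i)"
 shows "smooth_on U (%x. peval_real F (%i. f i x))"
 unfolding peval_real_def
 by (intro smooth_on_bounded_linear[OF bounded_linear_Re] peval_smooth assms
   smooth_on_bounded_linear[OF bounded_linear_of_real])

lemma peval_real_scale:
 assumes "homogeneous d F"
 shows "peval_real F (%i. c * x i) = c ^ d * peval_real F x"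
proof -
 have "complex_of_real (peval_real F (%i. c * x i)) = complex_of_real (c ^ d * peval_real F x)"
  using peval_scale[OF assms, of "complex_of_real c" "%i. complex_of_real (x i)"]
  by (simp only: of_real_mult[symmetric] of_real_power[symmetric] peval_of_real)
 then show ?thesis by (simp only: of_real_eq_iff)
qed

section \<open>Values of rational functions\<close>

definition irred_closed :: "(complex ^ 'v) set => bool" where
 "irred_closed X \<longleftrightarrow> real_closed X \<and> real_irreducible X"

lemma real_closed_nonzero: "real_closed X ==> z \<in> X ==> z ~= 0"
 unfolding real_closed_def by blast

lemma real_closed_hypersurface: "homogeneous d F ==> real_closed {z. z ~= 0 \<and> pevalv F z = 0}"
 unfolding real_closed_def by (intro exI[of _ "{F}"]) auto

text \<open>Irreducibility makes the homogeneous ideal prime.\<close>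

lemma vanishes_on_mult:
 assumes X: "irred_closed X" and F: "homogeneous d F" and G: "homogeneous e G"
  and v: "\<And>z. z \<in> X ==> pevalv F z * pevalv G z = 0"
 shows "vanishes_on F X \<or> vanishes_on G X"
proof -
 let ?A = "{z. z ~= 0 \<and> pevalv F z = 0}" and ?B = "{z. z ~= 0 \<and> pevalv G z = 0}"
 have "X \<subseteq> ?A \<union> ?B"
 proof
  fix z assume z: "z \<in> X"
  have "z ~= 0" using real_closed_nonzero z X by (auto simp: irred_closed_def)
  then show "z \<in> ?A \<union> ?B" using v[OF z] by auto
 qed
 then have "X \<subseteq> ?A \<or> X \<subseteq> ?B"
  using X real_closed_hypersurface[OF F] real_closed_hypersurface[OF G]
  unfolding irred_closed_def real_irreducible_def by blast
 then show ?thesis unfolding vanishes_on_def by blast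
qed

lemma not_vanishes_on_mult:
 assumes "irred_closed X" "homogeneous d F" "homogeneous e G" "\<not> vanishes_on F X" "\<not> vanishes_on G X"
 shows "\<not> vanishes_on (F * G) X"
 using vanishes_on_mult[OF assms(1-3)] assms(4,5) by (auto simp: vanishes_on_def peval_mult)

lemma irred_closed_nonempty: "irred_closed X ==> X ~= {}"
 by (simp add: irred_closed_def real_irreducible_def)

lemma not_vanishes_on_one: "irred_closed X ==> \<not> vanishes_on 1 X"
 using irred_closed_nonempty[of X] by (auto simp: vanishes_on_def peval_one)

lemma not_vanishes_on_power:
 assumes "\<not> vanishes_on F X"
 shows "\<not> vanishes_on (F ^ n) X"
 using assms by (auto simp: vanishes_on_def peval_power)

lemma not_vanishes_on_prod:
 assumes "irred_closed X" "finite I" "\<And>i. i \<in> I ==> homogeneous (d i) (F i)" "\<And>i. i \<in> I ==> \<not> vanishes_on (F i) X"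
 shows "\<not> vanishes_on (\<Prod>i\<in>I. F i) X"
 using assms(2-4)
proof (induction I rule: finite_induct)
 case empty
 then show ?case using not_vanishes_on_one[OF assms(1)] by simp
next
 case (insert i I)
 have "homogeneous (\<Sum>i\<in>I. d i) (\<Prod>i\<in>I. F i)" using insert.prems(1) by (intro homogeneous_prod) simp
 then have "\<not> vanishes_on (F i * (\<Prod>i\<in>I. F i)) X"
  using insert by (intro not_vanishes_on_mult[OF assms(1), of "d i" _ "\<Sum>i\<in>I. d i"]) simp_all
 then show ?case using insert.hyps by simp
qed

lemma cancel_on:
 assumes X: "irred_closed X" and "homogeneous d F" "homogeneous d F'" and G: "homogeneous e G" "\<not> vanishes_on G X"
  and eq: "\<And>z. z \<in> X ==> pevalv F z * pevalv G z = pevalv F' z * pevalv G z" and z: "z \<in> X"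
 shows "pevalv F z = pevalv F' z"
proof -
 have "vanishes_on (F - F') X \<or> vanishes_on G X"
  by (rule vanishes_on_mult[OF X homogeneous_diff[OF assms(2,3)] G(1)]) (simp add: peval_diff algebra_simps eq)
 then show ?thesis using G(2) z by (auto simp: vanishes_on_def peval_diff)
qed

lemma has_valueI:
 assumes "is_ratfun X f" "homogeneous e C" "homogeneous e E" "z \<in> X" "pevalv E z ~= 0"
  and "\<And>q. q \<in> X ==> pevalv (fst f) q * pevalv E q = pevalv C q * pevalv (snd f) q"
 shows "has_value X f z (pevalv C z / pevalv E z)"
 unfolding has_value_def
proof (intro conjI exI[of _ "(C, E)"])
 show "is_ratfun X (C, E)" using assms(2-5) by (auto simp: is_ratfun_def vanishes_on_def)
 show "rat_eq X f (C, E)" using assms(6) by (simp add: rat_eq_def vanishes_on_def peval_diff peval_mult)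
qed (use assms in simp_all)

lemma has_valueE:
 assumes "has_value X f z w"
 obtains e C E where "homogeneous e C" "homogeneous e E" "pevalv E z ~= 0" "w = pevalv C z / pevalv E z"
  "\<forall>q\<in>X. pevalv (fst f) q * pevalv E q = pevalv C q * pevalv (snd f) q"
proof -
 from assms obtain g where g: "is_ratfun X g" "rat_eq X f g" "pevalv (snd g) z ~= 0" "w = pevalv (fst g) z / pevalv (snd g) z"
  unfolding has_value_def by blast
 from g(1) obtain e where e: "homogeneous e (fst g)" "homogeneous e (snd g)"
  unfolding is_ratfun_def by blast
 have "pevalv (fst f) q * pevalv (snd g) q = pevalv (fst g) q * pevalv (snd f) q" if "q \<in> X" for q
  using g(2) that by (simp add: rat_eq_def vanishes_on_def peval_diff peval_mult)
 then show ?thesis by (intro that[OF e g(3,4)]) blast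
qed

text \<open>
 Two representatives of a rational function agree after multiplication with its denominator, which can be cancelled
 since the ideal of \<open>X\<close> is prime.
\<close>

lemma has_value_unique:
 assumes X: "irred_closed X" and z: "z \<in> X" and "has_value X f z w" "has_value X f z w'"
 shows "w = w'"
proof -
 obtain e C E where 1: "homogeneous e C" "homogeneous e E" "pevalv E z ~= 0" "w = pevalv C z / pevalv E z"
  "\<forall>q\<in>X. pevalv (fst f) q * pevalv E q = pevalv C q * pevalv (snd f) q"
  by (rule has_valueE[OF assms(3)])
 obtain e' C' E' where 2: "homogeneous e' C'" "homogeneous e' E'" "pevalv E' z ~= 0" "w' = pevalv C' z / pevalv E' z"
  "\<forall>q\<in>X. pevalv (fst f) q * pevalv E' q = pevalv C' q * pevalv (snd f) q"
  by (rule has_valueE[OF assms(4)])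
 obtain d where d: "homogeneous d (snd f)" "\<not> vanishes_on (snd f) X"
  using assms(3) unfolding has_value_def is_ratfun_def by blast
 have "pevalv (C * E') z = pevalv (C' * E) z"
 proof (rule cancel_on[OF X homogeneous_mult[OF 1(1) 2(2)] _ d _ z])
  show "homogeneous (e + e') (C' * E)" using homogeneous_mult[OF 2(1) 1(2)] by (simp add: add.commute)
  fix q assume q: "q \<in> X"
  have "pevalv (C * E') q * pevalv (snd f) q = (pevalv C q * pevalv (snd f) q) * pevalv E' q" by (simp add: peval_mult)
  also have "\<dots> = (pevalv (fst f) q * pevalv E' q) * pevalv E q" using bspec[OF 1(5) q] by simp
  also have "\<dots> = pevalv (C' * E) q * pevalv (snd f) q" using bspec[OF 2(5) q] by (simp add: peval_mult)
  finally show "pevalv (C * E') q * pevalv (snd f) q = pevalv (C' * E) q * pevalv (snd f) q" .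
 qed
 then show ?thesis using 1(3,4) 2(3,4) by (simp add: peval_mult frac_eq_eq)
qed

lemma is_ratfun_mult: "irred_closed X ==> is_ratfun X f ==> is_ratfun X g ==> is_ratfun X (rat_mult f g)"
 unfolding is_ratfun_def rat_mult_def fst_conv snd_conv
 using homogeneous_mult not_vanishes_on_mult by blast

lemma is_ratfun_div: "irred_closed X ==> is_ratfun X f ==> nonzero_ratfun X g ==> is_ratfun X (rat_div f g)"
 unfolding nonzero_ratfun_def is_ratfun_def rat_div_def fst_conv snd_conv
 using homogeneous_mult not_vanishes_on_mult by blast

lemma is_ratfun_power: "is_ratfun X f ==> is_ratfun X (rat_power f m)"
 unfolding is_ratfun_def rat_power_def fst_conv snd_conv
 using homogeneous_power not_vanishes_on_power by blast

lemma nonzero_ratfun_power: "nonzero_ratfun X f ==> nonzero_ratfun X (rat_power f m)"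
 using is_ratfun_power[of X f m] not_vanishes_on_power
 by (auto simp: nonzero_ratfun_def rat_power_def)

section \<open>The map given by sections of a line bundle\<close>

lemma section_map_value:
 assumes X: "irred_closed X" and g: "generating_sections X D k s" and z: "z \<in> X" and l: "l \<le> k"
 shows "has_value X (rat_mult (s l) (D z)) z (section_map X D k s z l)"
proof -
 obtain w where w: "has_value X (rat_mult (s l) (D z)) z w"
  using g z l unfolding generating_sections_def regular_at_def by blast
 have "(THE w. has_value X (rat_mult (s l) (D z)) z w) = w"
 proof (rule the_equality)
  fix v assume "has_value X (rat_mult (s l) (D z)) z v"
  then show "v = w" using w by (rule has_value_unique[OF X z])
 qed (rule w)
 then show ?thesis using w l by (simp add: section_map_def)
qed

lemma section_map_nonzero:
 assumes X: "irred_closed X" and g: "generating_sections X D k s" and z: "z \<in> X"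
 shows "\<exists>l\<le>k. section_map X D k s z l ~= 0"
proof -
 obtain l w where l: "l \<le> k" and w: "w ~= 0" "has_value X (rat_mult (s l) (D z)) z w"
  using g z unfolding generating_sections_def unit_at_def by blast
 have "section_map X D k s z l = w"
  by (rule has_value_unique[OF X z section_map_value[OF X g z l] w(2)])
 then show ?thesis using l w(1) by blast
qed

text \<open>Clearing denominators: the numerators of \<open>C l / E l\<close> over the common denominator \<open>\<Prod>E\<close>.\<close>

definition numer :: "nat => (nat => 'v rpoly) => (nat => 'v rpoly) => nat => 'v rpoly" where
 "numer k C E l = (if l \<le> k then C l * (\<Prod>i\<in>{..k} - {l}. E i) else 0)"

lemma homogeneous_numer:
 assumes "\<And>i. i \<le> k ==> homogeneous (e i) (C i)" "\<And>i. i \<le> k ==> homogeneous (e i) (E i)"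
 shows "homogeneous (\<Sum>i\<le>k. e i) (numer k C E l)"
proof (cases "l \<le> k")
 case True
 have "homogeneous (\<Sum>i\<in>{..k} - {l}. e i) (\<Prod>i\<in>{..k} - {l}. E i)" using assms(2) by (intro homogeneous_prod) simp
 from homogeneous_mult[OF assms(1)[OF True] this] show ?thesis
  using True by (simp add: numer_def sum.remove[of "{..k}" l])
qed (simp add: numer_def homogeneous_zero)

lemma peval_numer:
 assumes "l \<le> k" "\<And>i. i \<le> k ==> peval (E i) z ~= 0"
 shows "peval (numer k C E l) z = peval (C l) z / peval (E l) z * (\<Prod>i\<le>k. peval (E i) z)"
 using assms by (simp add: numer_def peval_mult peval_prod prod.remove[of "{..k}" l])

lemma local_section_reps:
 assumes X: "irred_closed X" and g: "generating_sections X D k s" and z: "z \<in> X"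
 obtains e C E where "\<forall>l\<le>k. homogeneous (e l) (C l)" "\<forall>l\<le>k. homogeneous (e l) (E l)"
  "\<forall>l\<le>k. pevalv (E l) z ~= 0" "\<forall>l\<le>k. section_map X D k s z l = pevalv (C l) z / pevalv (E l) z"
  "\<forall>l\<le>k. \<forall>q\<in>X. pevalv (fst (s l)) q * pevalv (fst (D z)) q * pevalv (E l) q =
   pevalv (C l) q * (pevalv (snd (s l)) q * pevalv (snd (D z)) q)"
proof -
 have "\<forall>l. \<exists>e C E. l \<le> k --> homogeneous e C \<and> homogeneous e E \<and> pevalv E z ~= 0 \<and>
   section_map X D k s z l = pevalv C z / pevalv E z \<and> (\<forall>q\<in>X. pevalv (fst (s l)) q * pevalv (fst (D z)) q * pevalv E q =
   pevalv C q * (pevalv (snd (s l)) q * pevalv (snd (D z)) q))"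
 proof
  fix l
  show "\<exists>e C E. l \<le> k --> homogeneous e C \<and> homogeneous e E \<and> pevalv E z ~= 0 \<and>
   section_map X D k s z l = pevalv C z / pevalv E z \<and> (\<forall>q\<in>X. pevalv (fst (s l)) q * pevalv (fst (D z)) q * pevalv E q =
   pevalv C q * (pevalv (snd (s l)) q * pevalv (snd (D z)) q))"
  proof (cases "l \<le> k")
   case True
   obtain e C E where "homogeneous e C" "homogeneous e E" "pevalv E z ~= 0" "section_map X D k s z l = pevalv C z / pevalv E z"
    "\<forall>q\<in>X. pevalv (fst (rat_mult (s l) (D z))) q * pevalv E q = pevalv C q * pevalv (snd (rat_mult (s l) (D z))) q"
    by (rule has_valueE[OF section_map_value[OF X g z True]])
   then show ?thesis
    by (intro exI[of _ e] exI[of _ C] exI[of _ E]) (simp add: rat_mult_def peval_mult)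
  qed simp
 qed
 then obtain e C E where r: "\<forall>l. l \<le> k --> homogeneous (e l) (C l) \<and> homogeneous (e l) (E l) \<and> pevalv (E l) z ~= 0 \<and>
   section_map X D k s z l = pevalv (C l) z / pevalv (E l) z \<and> (\<forall>q\<in>X. pevalv (fst (s l)) q * pevalv (fst (D z)) q * pevalv (E l) q =
   pevalv (C l) q * (pevalv (snd (s l)) q * pevalv (snd (D z)) q))"
  unfolding choice_iff by (elim exE) (rule that)
 show ?thesis
  by (rule that[of e C E]) (simp_all add: r)
qed

text \<open>
 At \<open>q\<close> the sections are trivialised by the local equation \<open>D q\<close>. Trivialising them near
 \<open>z0\<close> by \<open>D z0\<close> instead changes all their values by the same unit, so that representatives
 chosen at \<open>z0\<close> serve in a neighbourhood.
\<close>

lemma section_map_locally_polynomial: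
 assumes X: "irred_closed X" and D: "real_divisor X D" and g: "generating_sections X D k s" and z0: "z0 \<in> X"
 obtains e Q dN N where "\<And>l. homogeneous e (Q l)" "\<And>l. l > k ==> Q l = 0" "homogeneous dN N" "pevalv N z0 ~= 0"
  "\<And>q. q \<in> X ==> pevalv N q ~= 0 ==> \<exists>c. c ~= 0 \<and> (\<forall>l. section_map X D k s q l = c * pevalv (Q l) q)"
proof -
 obtain e C E where r0: "\<forall>l\<le>k. homogeneous (e l) (C l)" "\<forall>l\<le>k. homogeneous (e l) (E l)"
  "\<forall>l\<le>k. pevalv (E l) z0 ~= 0" "\<forall>l\<le>k. section_map X D k s z0 l = pevalv (C l) z0 / pevalv (E l) z0"
  "\<forall>l\<le>k. \<forall>q\<in>X. pevalv (fst (s l)) q * pevalv (fst (D z0)) q * pevalv (E l) q =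
   pevalv (C l) q * (pevalv (snd (s l)) q * pevalv (snd (D z0)) q)"
  by (rule local_section_reps[OF X g z0])
 note r = r0(1)[rule_format] r0(2)[rule_format] r0(3)[rule_format] r0(4)[rule_format] r0(5)
 obtain dH H where H: "homogeneous dH H" "pevalv H z0 ~= 0"
  "\<And>q. q \<in> X ==> pevalv H q ~= 0 ==> unit_at X (rat_div (D q) (D z0)) q"
  using D z0 unfolding real_divisor_def by blast
 have nz: "nonzero_ratfun X (D q)" if "q \<in> X" for q using D that unfolding real_divisor_def by blast
 obtain d0 where d0: "homogeneous d0 (fst (D z0))" "homogeneous d0 (snd (D z0))" "\<not> vanishes_on (snd (D z0)) X" "\<not> vanishes_on (fst (D z0)) X"
  using nz[OF z0] unfolding nonzero_ratfun_def is_ratfun_def by blast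
 define N where "N = H * (\<Prod>i\<le>k. E i)"
 define dN where "dN = dH + (\<Sum>i\<le>k. e i)"
 have hN: "homogeneous dN N" unfolding N_def dN_def by (intro homogeneous_mult H(1) homogeneous_prod r(2)) simp
 have Nz0: "pevalv N z0 ~= 0" using H(2) r(3) by (simp add: N_def peval_mult peval_prod)
 have rep: "\<exists>c. c ~= 0 \<and> (\<forall>l. section_map X D k s q l = c * pevalv (numer k C E l) q)"
  if q: "q \<in> X" and Nq: "pevalv N q ~= 0" for q
 proof -
  have Hq: "pevalv H q ~= 0" and Eq: "\<And>i. i \<le> k ==> pevalv (E i) q ~= 0"
   using Nq by (auto simp: N_def peval_mult peval_prod)
  obtain u where u: "u ~= 0" "has_value X (rat_div (D q) (D z0)) q u" using H(3)[OF q Hq] unfolding unit_at_def by blast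
  obtain w U W where UW: "homogeneous w U" "homogeneous w W" "pevalv W q ~= 0" "u = pevalv U q / pevalv W q"
   "\<forall>p\<in>X. pevalv (fst (rat_div (D q) (D z0))) p * pevalv W p = pevalv U p * pevalv (snd (rat_div (D q) (D z0))) p"
   by (rule has_valueE[OF u(2)])
  obtain d1 where d1: "homogeneous d1 (fst (D q))" "homogeneous d1 (snd (D q))"
   using nz[OF q] unfolding nonzero_ratfun_def is_ratfun_def by blast
  have val: "section_map X D k s q l = u * (pevalv (C l) q / pevalv (E l) q)" if l: "l \<le> k" for l
  proof -
   obtain a where a: "homogeneous a (fst (s l))" "homogeneous a (snd (s l))" "\<not> vanishes_on (snd (s l)) X"
    using g l unfolding generating_sections_def is_ratfun_def by blast
   have "is_ratfun X (s l)" using g l unfolding generating_sections_def by blast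
   then have rf: "is_ratfun X (rat_mult (s l) (D q))" using nz[OF q] by (auto simp: nonzero_ratfun_def intro: is_ratfun_mult[OF X])
   have "has_value X (rat_mult (s l) (D q)) q (pevalv (U * C l) q / pevalv (W * E l) q)"
   proof (rule has_valueI[OF rf homogeneous_mult[OF UW(1) r(1)[OF l]] homogeneous_mult[OF UW(2) r(2)[OF l]] q])
    show "pevalv (W * E l) q ~= 0" using UW(3) Eq[OF l] by (simp add: peval_mult)
    fix p assume p: "p \<in> X"
    have "pevalv ((fst (s l) * fst (D q)) * (W * E l)) p = pevalv ((U * C l) * (snd (s l) * snd (D q))) p"
    proof (rule cancel_on[OF X _ _ homogeneous_mult[OF d0(1,2)] not_vanishes_on_mult[OF X d0(1,2,4,3)] _ p])
     show "homogeneous (a + d1 + (w + e l)) ((fst (s l) * fst (D q)) * (W * E l))"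
      by (intro homogeneous_mult a(1) d1(1) UW(2) r(2) l)
     have "homogeneous (w + e l + (a + d1)) ((U * C l) * (snd (s l) * snd (D q)))"
      by (intro homogeneous_mult a(2) d1(2) UW(1) r(1) l)
     then show "homogeneous (a + d1 + (w + e l)) ((U * C l) * (snd (s l) * snd (D q)))" by (simp add: add.commute)
     fix y assume y: "y \<in> X"
     have "pevalv ((fst (s l) * fst (D q)) * (W * E l)) y * pevalv (fst (D z0) * snd (D z0)) y =
       (pevalv (fst (s l)) y * pevalv (fst (D z0)) y * pevalv (E l) y) * (pevalv (fst (D q)) y * pevalv (snd (D z0)) y * pevalv W y)"
      by (simp add: peval_mult mult_ac)
     also have "\<dots> = (pevalv (C l) y * (pevalv (snd (s l)) y * pevalv (snd (D z0)) y)) * (pevalv U y * (pevalv (snd (D q)) y * pevalv (fst (D z0)) y))"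
      using r(5)[rule_format, OF l y] bspec[OF UW(5) y] by (simp add: rat_div_def peval_mult)
     also have "\<dots> = pevalv ((U * C l) * (snd (s l) * snd (D q))) y * pevalv (fst (D z0) * snd (D z0)) y"
      by (simp add: peval_mult mult_ac)
     finally show "pevalv ((fst (s l) * fst (D q)) * (W * E l)) y * pevalv (fst (D z0) * snd (D z0)) y =
       pevalv ((U * C l) * (snd (s l) * snd (D q))) y * pevalv (fst (D z0) * snd (D z0)) y" .
    qed
    then show "pevalv (fst (rat_mult (s l) (D q))) p * pevalv (W * E l) p = pevalv (U * C l) p * pevalv (snd (rat_mult (s l) (D q))) p"
     by (simp add: rat_mult_def peval_mult)
   qed
   from has_value_unique[OF X q section_map_value[OF X g q l] this] show ?thesis
    using UW(4) by (simp add: peval_mult)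
  qed
  have Pnz: "(\<Prod>i\<le>k. pevalv (E i) q) ~= 0" using Eq by simp
  show ?thesis
  proof (intro exI[of _ "u / (\<Prod>i\<le>k. pevalv (E i) q)"] conjI allI)
   show "u / (\<Prod>i\<le>k. pevalv (E i) q) ~= 0" using u(1) Pnz by simp
   fix l
   show "section_map X D k s q l = u / (\<Prod>i\<le>k. pevalv (E i) q) * pevalv (numer k C E l) q"
   proof (cases "l \<le> k")
    case True
    then show ?thesis using val[OF True] peval_numer[where E = E and C = C and z = "vec_nth q", OF True Eq] Pnz by simp
   qed (simp add: section_map_def numer_def peval_zero)
  qed
 qed
 show ?thesis
 proof (rule that[OF homogeneous_numer[OF r(1,2)] _ hN Nz0 rep])
  show "numer k C E l = 0" if "l > k" for l using that by (simp add: numer_def)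
 qed
qed

lemma has_value_real:
 assumes "has_value X f (\<chi> i. complex_of_real (x $ i)) w"
 shows "w \<in> \<real>"
proof (rule has_valueE[OF assms])
 fix C E assume "w = pevalv C (\<chi> i. complex_of_real (x $ i)) / pevalv E (\<chi> i. complex_of_real (x $ i))"
 moreover have "vec_nth (\<chi> i. complex_of_real (x $ i)) = (%i. complex_of_real (x $ i))" by (simp add: fun_eq_iff)
 ultimately show ?thesis by (simp only: peval_of_real) simp
qed

lemma section_map_real:
 assumes X: "irred_closed X" and g: "generating_sections X D k s" and z: "(\<chi> i. complex_of_real (x $ i)) \<in> X"
 shows "section_map X D k s (\<chi> i. complex_of_real (x $ i)) l \<in> \<real>"
 using has_value_real[OF section_map_value[OF X g z, of l]] by (cases "l \<le> k") (simp_all add: section_map_def)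

section \<open>Members of the linear system\<close>

text \<open>A form on projective space has a complexification, and it can be pulled back along tuples of forms.\<close>

definition complexification :: "nat => ((nat => real) => real) => ((nat => complex) => complex) => 'v itself => bool" where
 "complexification m p pc T \<longleftrightarrow> (\<forall>y. pc (%l. complex_of_real (y l)) = complex_of_real (p y)) \<and>
  (\<forall>c y. pc (%l. c * y l) = c ^ m * pc y) \<and>
  (\<forall>(Q :: nat => 'v rpoly) e. (\<forall>l. homogeneous e (Q l)) -->
    (\<exists>R. homogeneous (m * e) R \<and> (\<forall>z. peval R z = pc (%l. peval (Q l) z))))"

lemma complexification_exists: "hpoly k m p ==> \<exists>pc. complexification m p pc TYPE('v)"
proof (induction rule: hpoly.induct)
 case (const c)
 show ?case unfolding complexification_def
  by (intro exI[of _ "%_. complex_of_real c"] conjI allI impI exI[of _ "pconst c"])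
   (simp_all add: homogeneous_pconst peval_pconst)
next
 case (var l)
 show ?case unfolding complexification_def
 proof (intro exI[of _ "%y. y l"] conjI allI impI)
  fix Q :: "nat => 'v rpoly" and e assume "\<forall>l. homogeneous e (Q l)"
  then show "\<exists>R. homogeneous (1 * e) R \<and> (\<forall>z. peval R z = peval (Q l) z)" by (intro exI[of _ "Q l"]) simp
 qed simp_all
next
 case (add m p q)
 then obtain pc qc where c: "complexification m p pc TYPE('v)" "complexification m q qc TYPE('v)" by blast
 show ?case unfolding complexification_def
 proof (intro exI[of _ "%y. pc y + qc y"] conjI allI impI)
  fix Q :: "nat => 'v rpoly" and e assume Q: "\<forall>l. homogeneous e (Q l)"
  obtain R where "homogeneous (m * e) R" "\<forall>z. peval R z = pc (%l. peval (Q l) z)"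
   using c(1) Q unfolding complexification_def by blast
  moreover obtain S where "homogeneous (m * e) S" "\<forall>z. peval S z = qc (%l. peval (Q l) z)"
   using c(2) Q unfolding complexification_def by blast
  ultimately show "\<exists>R. homogeneous (m * e) R \<and> (\<forall>z. peval R z = pc (%l. peval (Q l) z) + qc (%l. peval (Q l) z))"
   by (intro exI[of _ "R + S"]) (simp add: homogeneous_add peval_add)
 qed (use c in \<open>simp_all add: complexification_def algebra_simps\<close>)
next
 case (mult m p m' q)
 then obtain pc qc where c: "complexification m p pc TYPE('v)" "complexification m' q qc TYPE('v)" by blast
 show ?case unfolding complexification_def
 proof (intro exI[of _ "%y. pc y * qc y"] conjI allI impI)
  fix Q :: "nat => 'v rpoly" and e assume Q: "\<forall>l. homogeneous e (Q l)"
  obtain R where "homogeneous (m * e) R" "\<forall>z. peval R z = pc (%l. peval (Q l) z)"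
   using c(1) Q unfolding complexification_def by blast
  moreover obtain S where "homogeneous (m' * e) S" "\<forall>z. peval S z = qc (%l. peval (Q l) z)"
   using c(2) Q unfolding complexification_def by blast
  ultimately show "\<exists>R. homogeneous ((m + m') * e) R \<and> (\<forall>z. peval R z = pc (%l. peval (Q l) z) * qc (%l. peval (Q l) z))"
   by (intro exI[of _ "R * S"]) (simp add: homogeneous_mult peval_mult add_mult_distrib)
 qed (use c in \<open>simp_all add: complexification_def power_add algebra_simps\<close>)
qed

text \<open>
 Write the sections as \<open>A l / B\<close> with a common denominator. If \<open>R\<close> is the form \<open>p\<close> in the \<open>A l\<close>,
 then \<open>p(s 0, \<dots>, s k) = R / B ^ m\<close> is a section of \<open>\<O>(m D)\<close>, and its divisor of zeros is the one below.
\<close>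

definition form_divisor :: "nat => 'v rpoly => 'v rpoly => 'v divisor => 'v divisor" where
 "form_divisor m R B D z = (R * fst (D z) ^ m, B ^ m * snd (D z) ^ m)"

lemma form_divisor_in_linear_system:
 fixes X :: "(complex ^ 'v::finite) set"
 assumes X: "irred_closed X" and D: "real_divisor X D" and g: "generating_sections X D k s"
  and p: "complexification m p pc TYPE('v)"
  and nz: "\<exists>z\<in>X. pc (section_map X D k s z) ~= 0"
 shows "\<exists>Z :: 'v divisor. Z \<in> linear_system X (multiple m D) \<and>
  hypersurface X Z = {z \<in> X. pc (section_map X D k s z) = 0}"
proof -
 let ?phi = "section_map X D k s"
 have "\<forall>l. \<exists>d. l \<le> k --> homogeneous d (fst (s l)) \<and> homogeneous d (snd (s l)) \<and> \<not> vanishes_on (snd (s l)) X"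
  using g unfolding generating_sections_def is_ratfun_def by blast
 then obtain ds where ds: "\<And>l. l \<le> k ==> homogeneous (ds l) (fst (s l))" "\<And>l. l \<le> k ==> homogeneous (ds l) (snd (s l))"
  "\<And>l. l \<le> k ==> \<not> vanishes_on (snd (s l)) X"
  unfolding choice_iff by blast
 define al where "al = (\<Sum>i\<le>k. ds i)"
 define A where "A = numer k (%l. fst (s l)) (%l. snd (s l))"
 define B where "B = (\<Prod>i\<le>k. snd (s i))"
 have hA: "homogeneous al (A l)" for l unfolding A_def al_def by (rule homogeneous_numer[OF ds(1,2)])
 have hB: "homogeneous al B" unfolding B_def al_def using ds(2) by (intro homogeneous_prod) simp
 have Bnv: "\<not> vanishes_on B X" unfolding B_def
  by (rule not_vanishes_on_prod[OF X finite_atMost, where d = ds]) (use ds in simp_all)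
 obtain R where hR: "homogeneous (m * al) R" and R: "\<forall>z. peval R z = pc (%l. peval (A l) z)"
  using p hA unfolding complexification_def by blast
 have pch: "pc (%l. c * y l) = c ^ m * pc y" for c y using p unfolding complexification_def by blast
 have nzD: "nonzero_ratfun X (D z)" if "z \<in> X" for z using D that unfolding real_divisor_def by blast
 define Z where "Z = form_divisor m R B D"
 have dD: "\<exists>dl. homogeneous dl (fst (D z)) \<and> homogeneous dl (snd (D z)) \<and> \<not> vanishes_on (snd (D z)) X \<and> \<not> vanishes_on (fst (D z)) X" if "z \<in> X" for z
  using nzD[OF that] unfolding nonzero_ratfun_def is_ratfun_def by blast
 have rfZ: "is_ratfun X (Z z)" if z: "z \<in> X" for z
 proof -
  obtain dl where d: "homogeneous dl (fst (D z))" "homogeneous dl (snd (D z))" "\<not> vanishes_on (snd (D z)) X" using dD[OF z] by blast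
  show ?thesis unfolding is_ratfun_def Z_def form_divisor_def fst_conv snd_conv
  proof (intro conjI exI)
   show "homogeneous (m * al + m * dl) (R * fst (D z) ^ m)" by (intro homogeneous_mult homogeneous_power hR d)
   show "homogeneous (m * al + m * dl) (B ^ m * snd (D z) ^ m)" by (intro homogeneous_mult homogeneous_power hB d)
   show "\<not> vanishes_on (B ^ m * snd (D z) ^ m) X"
    by (rule not_vanishes_on_mult[OF X homogeneous_power[OF hB] homogeneous_power[OF d(2)] not_vanishes_on_power[OF Bnv] not_vanishes_on_power[OF d(3)]])
  qed
 qed
 have val: "has_value X (Z z) z (pc (?phi z)) \<and> (vanishes_on R X --> pc (?phi z) = 0)" if z: "z \<in> X" for z
 proof -
  obtain e C E where r0: "\<forall>l\<le>k. homogeneous (e l) (C l)" "\<forall>l\<le>k. homogeneous (e l) (E l)"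
   "\<forall>l\<le>k. pevalv (E l) z ~= 0" "\<forall>l\<le>k. ?phi z l = pevalv (C l) z / pevalv (E l) z"
   "\<forall>l\<le>k. \<forall>q\<in>X. pevalv (fst (s l)) q * pevalv (fst (D z)) q * pevalv (E l) q =
    pevalv (C l) q * (pevalv (snd (s l)) q * pevalv (snd (D z)) q)"
   by (rule local_section_reps[OF X g z])
  define ep where "ep = (\<Sum>i\<le>k. e i)"
  define Q where "Q = numer k C E"
  define EE where "EE = (\<Prod>i\<le>k. E i)"
  have hQ: "homogeneous ep (Q l)" for l unfolding Q_def ep_def by (rule homogeneous_numer) (use r0(1,2) in simp_all)
  have hE: "homogeneous ep EE" unfolding EE_def ep_def using r0(2) by (intro homogeneous_prod) simp
  have Ez: "pevalv EE z ~= 0" using r0(3) by (simp add: EE_def peval_prod)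
  obtain RQ where hRQ: "homogeneous (m * ep) RQ" and RQ: "\<forall>z. peval RQ z = pc (%l. peval (Q l) z)"
   using p hQ unfolding complexification_def by blast
  have AQ: "(pevalv (fst (D z)) q * pevalv EE q) * pevalv (A l) q = (pevalv B q * pevalv (snd (D z)) q) * pevalv (Q l) q"
   if q: "q \<in> X" for q l
  proof (cases "l \<le> k")
   case True
   let ?S = "\<Prod>i\<in>{..k} - {l}. pevalv (snd (s i)) q" and ?T = "\<Prod>i\<in>{..k} - {l}. pevalv (E i) q"
   have "(pevalv (fst (D z)) q * pevalv EE q) * pevalv (A l) q =
     (pevalv (fst (s l)) q * pevalv (fst (D z)) q * pevalv (E l) q) * ?S * ?T"
    using True by (simp add: A_def EE_def numer_def peval_mult peval_prod prod.remove[of "{..k}" l] mult_ac)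
   also have "\<dots> = (pevalv (C l) q * (pevalv (snd (s l)) q * pevalv (snd (D z)) q)) * ?S * ?T"
    using r0(5) True q by simp
   also have "\<dots> = (pevalv B q * pevalv (snd (D z)) q) * pevalv (Q l) q"
    using True by (simp add: B_def Q_def numer_def peval_mult peval_prod prod.remove[of "{..k}" l] mult_ac)
   finally show ?thesis .
  qed (simp add: A_def Q_def numer_def peval_zero)
  have eq: "(pevalv (fst (D z)) q * pevalv EE q) ^ m * pevalv R q = (pevalv B q * pevalv (snd (D z)) q) ^ m * pevalv RQ q"
   if q: "q \<in> X" for q
  proof -
   have "(pevalv (fst (D z)) q * pevalv EE q) ^ m * pevalv R q = pc (%l. (pevalv (fst (D z)) q * pevalv EE q) * pevalv (A l) q)"
    by (simp only: pch R)
   also have "\<dots> = pc (%l. (pevalv B q * pevalv (snd (D z)) q) * pevalv (Q l) q)" by (simp only: AQ[OF q])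
   finally show ?thesis by (simp only: pch RQ)
  qed
  have hv: "has_value X (Z z) z (pevalv RQ z / pevalv (EE ^ m) z)"
  proof (rule has_valueI[OF rfZ[OF z] hRQ homogeneous_power[OF hE] z])
   show "pevalv (EE ^ m) z ~= 0" using Ez by (simp add: peval_power)
   show "pevalv (fst (Z z)) q * pevalv (EE ^ m) q = pevalv RQ q * pevalv (snd (Z z)) q" if "q \<in> X" for q
    using eq[OF that] by (simp add: Z_def form_divisor_def peval_mult peval_power power_mult_distrib mult_ac)
  qed
  have phiQ: "?phi z = (%l. inverse (pevalv EE z) * pevalv (Q l) z)"
  proof
   fix l show "?phi z l = inverse (pevalv EE z) * pevalv (Q l) z"
   proof (cases "l \<le> k")
    case True
    have "pevalv (Q l) z = pevalv (C l) z / pevalv (E l) z * pevalv EE z"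
     unfolding Q_def EE_def peval_prod by (rule peval_numer[OF True]) (use r0(3) in simp)
    then show ?thesis using r0(4) True Ez by simp
   qed (simp add: section_map_def Q_def numer_def peval_zero)
  qed
  have ph: "pc (?phi z) = pevalv RQ z / pevalv (EE ^ m) z"
   unfolding phiQ pch using RQ by (simp add: peval_power power_inverse divide_inverse mult.commute)
  have "pevalv RQ z = 0" if v: "vanishes_on R X"
  proof -
   obtain dl where d: "homogeneous dl (snd (D z))" "\<not> vanishes_on (snd (D z)) X" using dD[OF z] by blast
   have "vanishes_on (B ^ m * snd (D z) ^ m) X \<or> vanishes_on RQ X"
   proof (rule vanishes_on_mult[OF X homogeneous_mult[OF homogeneous_power[OF hB] homogeneous_power[OF d(1)]] hRQ])
    fix q assume q: "q \<in> X"
    show "pevalv (B ^ m * snd (D z) ^ m) q * pevalv RQ q = 0"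
     using eq[OF q] v q by (auto simp: vanishes_on_def peval_mult peval_power power_mult_distrib)
   qed
   then show ?thesis
    using not_vanishes_on_mult[OF X homogeneous_power[OF hB] homogeneous_power[OF d(1)] not_vanishes_on_power[OF Bnv] not_vanishes_on_power[OF d(2)]] z
    by (auto simp: vanishes_on_def)
  qed
  then show ?thesis using hv ph by simp
 qed
 have Rnv: "\<not> vanishes_on R X" using nz val by blast
 have nzZ: "nonzero_ratfun X (Z z)" if z: "z \<in> X" for z
 proof -
  obtain dl where d: "homogeneous dl (fst (D z))" "\<not> vanishes_on (fst (D z)) X" using dD[OF z] by blast
  show ?thesis unfolding nonzero_ratfun_def
   using rfZ[OF z] not_vanishes_on_mult[OF X hR homogeneous_power[OF d(1)] Rnv not_vanishes_on_power[OF d(2)]]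
   by (simp add: Z_def form_divisor_def)
 qed
 have rd: "real_divisor X Z"
  unfolding real_divisor_def
 proof (intro ballI conjI nzZ)
  fix z assume z: "z \<in> X"
  obtain dH H where H: "homogeneous dH H" "pevalv H z ~= 0"
   "\<And>q. q \<in> X ==> pevalv H q ~= 0 ==> unit_at X (rat_div (D q) (D z)) q"
   using D z unfolding real_divisor_def by blast
  show "\<exists>d H. homogeneous d H \<and> pevalv H z ~= 0 \<and> (\<forall>q\<in>X. pevalv H q ~= 0 --> unit_at X (rat_div (Z q) (Z z)) q)"
  proof (intro exI conjI ballI impI)
   show "homogeneous dH H" "pevalv H z ~= 0" by (rule H(1), rule H(2))
   fix q assume q: "q \<in> X" "pevalv H q ~= 0"
   obtain u where u: "u ~= 0" "has_value X (rat_div (D q) (D z)) q u" using H(3)[OF q] unfolding unit_at_def by blast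
   obtain w U W where UW: "homogeneous w U" "homogeneous w W" "pevalv W q ~= 0" "u = pevalv U q / pevalv W q"
    "\<forall>p\<in>X. pevalv (fst (rat_div (D q) (D z))) p * pevalv W p = pevalv U p * pevalv (snd (rat_div (D q) (D z))) p"
    by (rule has_valueE[OF u(2)])
   have "has_value X (rat_div (Z q) (Z z)) q (pevalv (U ^ m) q / pevalv (W ^ m) q)"
   proof (rule has_valueI[OF is_ratfun_div[OF X rfZ[OF q(1)] nzZ[OF z]] homogeneous_power[OF UW(1)] homogeneous_power[OF UW(2)] q(1)])
    show "pevalv (W ^ m) q ~= 0" using UW(3) by (simp add: peval_power)
    fix x assume x: "x \<in> X"
    have "(pevalv (fst (D q)) x * pevalv (snd (D z)) x * pevalv W x) ^ m = (pevalv U x * (pevalv (snd (D q)) x * pevalv (fst (D z)) x)) ^ m"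
     using bspec[OF UW(5) x] by (simp add: rat_div_def peval_mult)
    then have "pevalv R x * pevalv B x ^ m * (pevalv (fst (D q)) x * pevalv (snd (D z)) x * pevalv W x) ^ m =
      pevalv R x * pevalv B x ^ m * (pevalv U x * (pevalv (snd (D q)) x * pevalv (fst (D z)) x)) ^ m" by simp
    then show "pevalv (fst (rat_div (Z q) (Z z))) x * pevalv (W ^ m) x = pevalv (U ^ m) x * pevalv (snd (rat_div (Z q) (Z z))) x"
     by (simp add: Z_def form_divisor_def rat_div_def peval_mult peval_power power_mult_distrib mult_ac)
   qed
   then show "unit_at X (rat_div (Z q) (Z z)) q"
    unfolding unit_at_def using u(1) UW(3,4) by (intro exI conjI) (auto simp: peval_power)
  qed
 qed
 have eff: "effective X Z" unfolding effective_def regular_at_def using val by blast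
 have nzh: "nonzero_ratfun X (B ^ m, R)"
  unfolding nonzero_ratfun_def is_ratfun_def using homogeneous_power[OF hB] hR Rnv not_vanishes_on_power[OF Bnv] by auto
 have lin: "linearly_equivalent X Z (multiple m D)"
  unfolding linearly_equivalent_def
 proof (intro exI conjI ballI)
  show "nonzero_ratfun X (B ^ m, R)" by (rule nzh)
  fix z assume z: "z \<in> X"
  have rf: "is_ratfun X (rat_div (rat_mult (B ^ m, R) (Z z)) (multiple m D z))"
   unfolding multiple_def
   by (intro is_ratfun_div[OF X] is_ratfun_mult[OF X] rfZ[OF z] nonzero_ratfun_power nzD[OF z])
    (use nzh in \<open>simp add: nonzero_ratfun_def\<close>)
  have "has_value X (rat_div (rat_mult (B ^ m, R) (Z z)) (multiple m D z)) z (pevalv 1 z / pevalv 1 z)"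
   by (rule has_valueI[OF rf homogeneous_one homogeneous_one z])
    (simp_all add: peval_one rat_div_def rat_mult_def multiple_def rat_power_def Z_def form_divisor_def peval_mult peval_power mult_ac)
  then show "unit_at X (rat_div (rat_mult (B ^ m, R) (Z z)) (multiple m D z)) z"
   unfolding unit_at_def by (intro exI conjI) (auto simp: peval_one)
 qed
 have "hypersurface X Z = {z \<in> X. pc (?phi z) = 0}"
 proof -
  have "has_value X (Z z) z 0 \<longleftrightarrow> pc (?phi z) = 0" if z: "z \<in> X" for z
   using val[OF z] has_value_unique[OF X z, of "Z z" 0 "pc (?phi z)"] by auto
  then show ?thesis by (auto simp: hypersurface_def)
 qed
 then show ?thesis using rd eff lin by (intro exI[of _ Z]) (simp add: linear_system_def)
qed

section \<open>Tangent spaces of cones over projective varieties\<close>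

definition pdir :: "'v::finite rpoly => complex ^ 'v => complex ^ 'v => complex" where
 "pdir F z v = (\<Sum>i\<in>UNIV. v $ i * pevalv (pdiff i F) z)"

definition jac :: "('v::finite => 'v rpoly) => complex ^ 'v => complex ^ 'v ^ 'v" where
 "jac F z = (\<chi> j i. pevalv (pdiff i (F j)) z)"

lemma jac_mult: "(jac F z *v v) $ j = pdir (F j) z v"
 by (simp add: jac_def pdir_def matrix_vector_mult_def mult.commute)

lemma pdir_add: "pdir F z (v + w) = pdir F z v + pdir F z w"
 by (simp add: pdir_def distrib_right sum.distrib)

lemma pdir_scale: "pdir F z (c *s v) = c * pdir F z v"
 by (simp add: pdir_def sum_distrib_left mult.assoc)

lemma pevalv_line_derivative:
 "((%t. pevalv F (z + t *s v)) has_field_derivative pdir F z v) (at 0)"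
proof -
 have "((%t. z $ i + t * v $ i) has_field_derivative v $ i) (at 0)" for i
  by (rule DERIV_cong, (rule derivative_intros)+) simp
 from peval_has_field_derivative[where gm = "%i t. z $ i + t * v $ i", OF this, of F]
 have "((%t. peval F (%i. z $ i + t * v $ i)) has_field_derivative pdir F z v) (at 0)"
  by (simp add: pdir_def)
 moreover have "vec_nth (z + t *s v) = (%i. z $ i + t * v $ i)" for t by (simp add: fun_eq_iff)
 ultimately show ?thesis by simp
qed

lemma pdir_pvar: "pdir (pvar i) z v = v $ i"
proof -
 have "((%t. z $ i + t * v $ i) has_field_derivative v $ i) (at 0)"
  by (rule DERIV_cong, (rule derivative_intros)+) simp
 then show ?thesis
  using DERIV_unique[OF pevalv_line_derivative[of "pvar i" z v]] by (simp add: peval_pvar)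
qed

lemma real_closed_scale:
 assumes X: "real_closed X" and z: "z \<in> X" and c: "c ~= 0"
 shows "c *s z \<in> X"
proof -
 obtain E where E: "\<forall>F\<in>E. \<exists>d. homogeneous d F" "X = {z. z ~= 0 \<and> (\<forall>F\<in>E. pevalv F z = 0)}"
  using X unfolding real_closed_def by blast
 have "pevalv F (c *s z) = 0" if "F \<in> E" for F
  using E z that pevalv_scale[of _ F c z] by auto
 moreover have "c *s z ~= 0" using real_closed_nonzero[OF X z] c by simp
 ultimately show ?thesis using E(2) by blast
qed

text \<open>
 The homogeneous components of a polynomial that vanishes on a cone vanish on the cone, so that
 arbitrary polynomials can be used to describe the tangent spaces.
\<close>

lemma cone_tangent_space_iff:
 assumes X: "real_closed X"
 shows "v \<in> cone_tangent_space X z \<longleftrightarrow> (\<forall>F. vanishes_on F X --> pdir F z v = 0)"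
proof
 assume R: "\<forall>F. vanishes_on F X --> pdir F z v = 0"
 show "v \<in> cone_tangent_space X z"
  unfolding cone_tangent_space_def
 proof (intro CollectI allI impI)
  fix F :: "'a rpoly" assume "(\<exists>d. homogeneous d F) \<and> vanishes_on F X"
  then show "((%t. pevalv F (z + t *s v)) has_field_derivative 0) (at 0)"
   using pevalv_line_derivative[of F z v] R by simp
 qed
next
 assume L: "v \<in> cone_tangent_space X z"
 have hom: "pdir F z v = 0" if "homogeneous d F" "vanishes_on F X" for F d
  using L that DERIV_unique[OF pevalv_line_derivative[of F z v]] unfolding cone_tangent_space_def by blast
 show "\<forall>F. vanishes_on F X --> pdir F z v = 0"
 proof (intro allI impI)
  fix F assume F: "vanishes_on F X"
  obtain n where n: "\<And>z. peval F z = (\<Sum>d\<le>n. peval (hcomp d F) z)" by (rule peval_hcomp_sum) blast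
  have van: "vanishes_on (hcomp d F) X" if d: "d \<le> n" for d
   unfolding vanishes_on_def
  proof (rule ballI, rule ccontr)
   fix z assume z: "z \<in> X" and nz: "pevalv (hcomp d F) z ~= 0"
   have "(\<Sum>i\<le>n. pevalv (hcomp i F) z * t ^ i) = 0" if "t ~= 0" for t
    using n[of "vec_nth (t *s z)"] F real_closed_scale[OF X z that]
    by (simp add: vanishes_on_def pevalv_scale[OF hcomp_homogeneous] mult.commute)
   then have "- {0} \<subseteq> {t. (\<Sum>i\<le>n. pevalv (hcomp i F) z * t ^ i) = 0}" by auto
   moreover have "finite {t. (\<Sum>i\<le>n. pevalv (hcomp i F) z * t ^ i) = 0}"
    using polyfun_finite_roots[of "%i. pevalv (hcomp i F) z" n] nz d by blast
   ultimately have "finite (- {0 :: complex})" using finite_subset by blast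
   then show False using infinite_UNIV_char_0[where 'a = complex] by simp
  qed
  have "((%t. \<Sum>d\<le>n. pevalv (hcomp d F) (z + t *s v)) has_field_derivative (\<Sum>d\<le>n. pdir (hcomp d F) z v)) (at 0)"
   by (intro DERIV_sum pevalv_line_derivative)
  then have "pdir F z v = (\<Sum>d\<le>n. pdir (hcomp d F) z v)"
   using DERIV_unique[OF pevalv_line_derivative[of F z v]] n by simp
  then show "pdir F z v = 0" using hom[OF hcomp_homogeneous van] by simp
 qed
qed

lemma dim_coordinate_kernel:
 fixes M :: "complex ^ 'v::finite ^ 'v"
 assumes "det M ~= 0"
 shows "vec.dim {v. \<forall>j\<in>J. (M *v v) $ j = 0} = card (- J)"
proof -
 obtain M' where M': "M ** M' = mat 1" "M' ** M = mat 1"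
  using assms by (auto simp: invertible_det_nz[symmetric] invertible_def)
 let ?S = "{w :: complex ^ 'v. \<forall>j. j \<notin> - J --> w $ j = 0}"
 have 1: "M *v (M' *v w) = w" "M' *v (M *v w) = w" for w
  by (simp_all add: matrix_vector_mul_assoc M')
 have "{v. \<forall>j\<in>J. (M *v v) $ j = 0} = (*v) M' ` ?S"
 proof (intro set_eqI iffI)
  fix v assume "v \<in> {v. \<forall>j\<in>J. (M *v v) $ j = 0}"
  then have "M *v v \<in> ?S" by simp
  then have "M' *v (M *v v) \<in> (*v) M' ` ?S" by (rule imageI)
  then show "v \<in> (*v) M' ` ?S" by (simp only: 1)
 next
  fix v assume "v \<in> (*v) M' ` ?S"
  then obtain w where "w \<in> ?S" "v = M' *v w" by (rule imageE)
  then show "v \<in> {v. \<forall>j\<in>J. (M *v v) $ j = 0}" by (simp add: 1)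
 qed
 moreover have "vec.dim ((*v) M' ` ?S) = vec.dim ?S"
 proof (rule vec.dim_image_eq[OF matrix_vector_mul_linear_gen])
  show "inj_on ((*v) M') (vec.span ?S)"
   by (rule inj_on_inverseI[of _ "(*v) M"]) (rule 1(1))
 qed
 ultimately show ?thesis using dim_substandard_cart[of "- J", where 'a = complex] by simp
qed

lemma jac_kernel_subspace: "vec.subspace {v. \<forall>j\<in>J. pdir (F j) z v = 0}"
 by (rule vec.subspaceI) (simp_all add: pdir_add pdir_scale, simp add: pdir_def)

lemma tangent_space_subspace: "real_closed X ==> vec.subspace (cone_tangent_space X z)"
 by (rule vec.subspaceI) (simp_all add: cone_tangent_space_iff pdir_add pdir_scale, simp add: pdir_def)

text \<open>
 Where the tangent space has codimension \<open>card J\<close> and the differentials of \<open>card J\<close> elements of the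
 ideal are independent, these differentials cut out the tangent space.
\<close>

lemma pdir_zero_of_jac_kernel:
 assumes X: "real_closed X" and dim: "vec.dim (cone_tangent_space X z) = card (- J)"
  and F: "\<forall>j\<in>J. vanishes_on (F j) X" and det: "det (jac F z) ~= 0"
  and v: "\<forall>j\<in>J. pdir (F j) z v = 0" and G: "vanishes_on G X"
 shows "pdir G z v = 0"
proof -
 have K: "{v. \<forall>j\<in>J. pdir (F j) z v = 0} = {v. \<forall>j\<in>J. (jac F z *v v) $ j = 0}" by (simp add: jac_mult)
 have "cone_tangent_space X z = {v. \<forall>j\<in>J. pdir (F j) z v = 0}"
 proof (rule vec.subspace_dim_equal[OF tangent_space_subspace[OF X] jac_kernel_subspace])
  show "cone_tangent_space X z \<subseteq> {v. \<forall>j\<in>J. pdir (F j) z v = 0}"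
   using F by (auto simp: cone_tangent_space_iff[OF X])
  show "vec.dim {v. \<forall>j\<in>J. pdir (F j) z v = 0} \<le> vec.dim (cone_tangent_space X z)"
   unfolding K dim_coordinate_kernel[OF det] dim ..
 qed
 then have "v \<in> cone_tangent_space X z" using v by simp
 then show ?thesis using G by (simp add: cone_tangent_space_iff[OF X])
qed

text \<open>
 A maximal independent set of differentials of elements of the ideal is extended to a basis by differentials of
 variables.
\<close>

lemma adapted_coordinates:
 fixes X :: "(complex ^ 'v::finite) set"
 assumes X: "real_closed X"
 obtains F J where "\<forall>j\<in>J. vanishes_on (F j) X" "card (- J) = vec.dim (cone_tangent_space X z)" "det (jac F z) ~= 0"
proof -
 define gr :: "'v rpoly => complex ^ 'v" where "gr F = (\<chi> i. pevalv (pdiff i F) z)" for F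
 define pair where "pair g v = (\<Sum>i\<in>UNIV. v $ i * g $ i)" for g v :: "complex ^ 'v"
 have pg: "pdir F z v = pair (gr F) v" for F v by (simp add: pdir_def pair_def gr_def)
 have pair_span: "pair g v = 0" if "g \<in> vec.span B" "\<And>b. b \<in> B ==> pair b v = 0" for g v B
  using that(1)
 proof (induction rule: vec.span_induct_alt)
  case base
  then show ?case by (simp add: pair_def)
 next
  case (step c x y)
  have "pair (c *s x + y) v = c * pair x v + pair y v"
   by (simp add: pair_def distrib_left sum.distrib sum_distrib_left mult_ac)
  then show ?case using step that(2) by simp
 qed
 let ?Gr = "gr ` {F. vanishes_on F X}" and ?Ax = "gr ` range pvar"
 obtain B where B: "B \<subseteq> ?Gr" "vec.independent B" "?Gr \<subseteq> vec.span B" by (rule vec.maximal_independent_subset)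
 obtain B' where B': "B \<subseteq> B'" "B' \<subseteq> B \<union> ?Ax" "vec.independent B'" "B \<union> ?Ax \<subseteq> vec.span B'"
  by (rule vec.maximal_independent_subset_extend[of B "B \<union> ?Ax"]) (use B(2) in auto)
 have ker: "v = 0" if "\<And>b. b \<in> B' ==> pair b v = 0" for v
 proof -
  have "v $ i = 0" for i
  proof -
   have "gr (pvar i) \<in> vec.span B'" using B'(4) by blast
   from pair_span[OF this that] show ?thesis by (simp add: pg[symmetric] pdir_pvar)
  qed
  then show ?thesis by (simp add: vec_eq_iff)
 qed
 have axis: "axis i 1 \<in> ?Ax" for i
 proof -
  have "gr (pvar i) $ j = axis i 1 $ j" for j
   using pg[of "pvar i" "axis j 1"] pdir_pvar[of i z "axis j 1"]
   by (simp add: pair_def axis_def if_distrib[of "%x. x * _"] cong: if_cong)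
  then have "axis i 1 = gr (pvar i)" by (simp add: vec_eq_iff)
  then show ?thesis by blast
 qed
 have "vec.span B' = UNIV"
 proof -
  have "cart_basis \<subseteq> vec.span B'" using axis B'(4) by (auto simp: cart_basis_def)
  then have "vec.span (cart_basis :: (complex ^ 'v) set) \<subseteq> vec.span B'" by (rule vec.span_minimal[OF _ vec.subspace_span])
  then show ?thesis unfolding span_cart_basis by blast
 qed
 then have cB: "card B' = CARD('v)" and fB: "finite B'"
  using vec.dim_eq_card[of B' "UNIV :: (complex ^ 'v) set"] B'(3) vec.finiteI_independent
  by (simp_all add: card_cart_basis vec.dim_UNIV)
 obtain bt where bt: "bij_betw bt (UNIV :: 'v set) B'"
  using finite_same_card_bij[of "UNIV :: 'v set" B'] fB cB by auto
 have "\<exists>F. gr F = bt j \<and> (bt j \<in> B --> vanishes_on F X)" for j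
 proof (cases "bt j \<in> B")
  case True
  then have "bt j \<in> ?Gr" using B(1) by blast
  then obtain F where "vanishes_on F X" "bt j = gr F" by (elim imageE CollectE) (rule that)
  then show ?thesis by auto
 next
  case False
  then have "bt j \<in> ?Ax" using B'(2) bij_betwE[OF bt] by blast
  then obtain F where "bt j = gr F" by (elim imageE) (rule that)
  then show ?thesis using False by auto
 qed
 then obtain F where F: "\<And>j. gr (F j) = bt j" "\<And>j. bt j \<in> B ==> vanishes_on (F j) X" by metis
 define J where "J = {j. bt j \<in> B}"
 have "v = 0" if "jac F z *v v = 0" for v
 proof (rule ker)
  fix b assume "b \<in> B'"
  then obtain j where "b = bt j" using bij_betw_imp_surj_on[OF bt] by blast
  then show "pair b v = 0" using that F(1)[of j] jac_mult[of F z v j] by (simp add: pg)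
 qed
 then have det: "det (jac F z) ~= 0"
  using matrix_left_invertible_ker[of "jac F z"] by (simp add: invertible_det_nz[symmetric] invertible_left_inverse)
 have "cone_tangent_space X z = {v. \<forall>j\<in>J. (jac F z *v v) $ j = 0}"
 proof (intro set_eqI iffI)
  fix v assume "v \<in> cone_tangent_space X z"
  then show "v \<in> {v. \<forall>j\<in>J. (jac F z *v v) $ j = 0}"
   using F(2) by (simp add: jac_mult J_def cone_tangent_space_iff[OF X])
 next
  fix v assume v: "v \<in> {v. \<forall>j\<in>J. (jac F z *v v) $ j = 0}"
  have "pair b v = 0" if "b \<in> B" for b
  proof -
   have "b \<in> range bt" using bij_betw_imp_surj_on[OF bt] that B'(1) by blast
   then obtain j where j: "b = bt j" by (elim imageE) (rule that)
   have "(jac F z *v v) $ j = 0" using v \<open>b \<in> B\<close> j by (simp add: J_def)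
   then show ?thesis using j F(1)[of j] by (simp add: jac_mult pg)
  qed
  note pB = this
  have "pdir G z v = 0" if G: "vanishes_on G X" for G
  proof -
   have "gr G \<in> vec.span B" by (rule subsetD[OF B(3)], rule imageI) (simp add: G)
   then show ?thesis unfolding pg using pB by (rule pair_span)
  qed
  then show "v \<in> cone_tangent_space X z" by (simp add: cone_tangent_space_iff[OF X])
 qed
 then have "card (- J) = vec.dim (cone_tangent_space X z)" using dim_coordinate_kernel[OF det, of J] by simp
 then show ?thesis using F(2) det by (intro that[of J F]) (auto simp: J_def)
qed

section \<open>Curves in a variety\<close>

lemma peval_sign: "peval (of_int (sign p)) z = of_int (sign p)"
 by (cases "sign p = 1") (auto simp: sign_def peval_one peval_uminus)

lemma peval_det: "peval (det A) z = det (\<chi> i j. peval (A $ i $ j) z)"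
 unfolding det_def by (simp add: peval_sum peval_mult peval_prod peval_sign)

definition det_jac :: "('v::finite => 'v rpoly) => 'v rpoly" where
 "det_jac F = det (\<chi> r c. pdiff c (F r))"

text \<open>By Cramer's rule, these are the entries of the adjugate of the Jacobian matrix.\<close>

definition adj_jac :: "('v::finite => 'v rpoly) => 'v => 'v => 'v rpoly" where
 "adj_jac F j i = det (\<chi> r c. if c = i then (if r = j then 1 else 0) else pdiff c (F r))"

lemma peval_det_jac: "pevalv (det_jac F) z = det (jac F z)"
 by (simp add: det_jac_def peval_det jac_def)

lemma jac_adj_jac:
 assumes "det (jac F z) ~= 0"
 shows "jac F z *v (\<chi> i. pevalv (adj_jac F j i) z / det (jac F z)) = axis j 1"
proof -
 have "(\<chi> i. pevalv (adj_jac F j i) z / det (jac F z)) =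
   (\<chi> k. det (\<chi> r c. if c = k then axis j 1 $ r else jac F z $ r $ c) / det (jac F z))"
  by (simp add: vec_eq_iff adj_jac_def peval_det jac_def axis_def if_distrib[of "%p. peval p _"] peval_one peval_zero cong: if_cong)
 then show ?thesis using cramer[OF assms] by blast
qed

text \<open>All Taylor coefficients at \<open>0\<close> vanish.\<close>

lemma derivation_closed_zero:
 assumes S: "open S" "connected S" "0 \<in> S"
  and zero: "\<And>f. A f ==> f 0 = 0"
  and der: "\<And>f. A f ==> \<exists>g. A g \<and> (\<forall>s\<in>S. (f has_field_derivative g s) (at s))"
  and f: "A f" and s: "s \<in> S"
 shows "f s = (0 :: complex)"
proof -
 have hol: "f holomorphic_on S" if "A f" for f
  using der[OF that] unfolding holomorphic_on_open[OF S(1)] by blast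
 have "(deriv ^^ n) f 0 = 0" if "A f" for n f
  using that
 proof (induction n arbitrary: f)
  case 0
  then show ?case using zero by simp
 next
  case (Suc n)
  obtain g where g: "A g" "\<forall>s\<in>S. (f has_field_derivative g s) (at s)" using der[OF Suc.prems] by blast
  have "(deriv ^^ n) (deriv f) 0 = (deriv ^^ n) g 0"
   by (rule higher_deriv_transform_within_open[OF holomorphic_deriv[OF hol[OF Suc.prems] S(1)] hol[OF g(1)] S(1,3)])
    (use g(2) DERIV_imp_deriv in blast)
  then show ?case using Suc.IH[OF g(1)] by (simp add: funpow_Suc_right del: funpow.simps)
 qed
 then show ?thesis using holomorphic_fun_eq_0_on_connected[OF hol[OF f] S(1,2) _ S(3) s] f by blast
qed

text \<open>
 Linear combinations of quotients \<open>G / D ^ k\<close> along the curve \<open>gm\<close>, with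
 \<open>G\<close> in the ideal of \<open>X\<close>. For \<open>D\<close> the determinant of the Jacobian matrix, this
 class is closed under differentiation.
\<close>

inductive ideal_along :: "(complex ^ 'v::finite) set => 'v rpoly => ('v => complex => complex) => (complex => complex) => bool"
 for X D gm where
 base: "vanishes_on G X ==> ideal_along X D gm (%s. peval G (%i. gm i s) / peval D (%i. gm i s) ^ k)"
| add: "ideal_along X D gm f ==> ideal_along X D gm g ==> ideal_along X D gm (%s. f s + g s)"
| cmult: "ideal_along X D gm f ==> ideal_along X D gm (%s. c * f s)"

lemma ideal_along_sum:
 assumes "\<And>i. i \<in> I ==> ideal_along X D gm (f i)"
 shows "ideal_along X D gm (%s. \<Sum>i\<in>I. f i s)"
proof -
 have z: "ideal_along X D gm (%s. 0)"
  using ideal_along.base[of 0 X D gm 0] by (simp add: vanishes_on_def peval_zero)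
 show ?thesis using assms
  by (induction I rule: infinite_finite_induct) (simp_all add: z ideal_along.add)
qed

text \<open>
 A holomorphic curve that starts on \<open>X\<close> and along which the differentials of the \<open>F j\<close>, \<open>j \<in> J\<close>,
 vanish stays in \<open>X\<close>. The velocity of the curve is a combination of the columns of the adjugate of
 the Jacobian matrix divided by its determinant; differentiation in these directions, followed by
 multiplication with the determinant, maps the ideal of \<open>X\<close> into itself. Hence all derivatives
 at the starting point of an element of the ideal along the curve are zero.
\<close>

lemma curve_in_variety:
 fixes X :: "(complex ^ 'v::finite) set" and V :: "complex => complex ^ 'v"
 assumes X: "real_closed X" and dim: "\<And>z. z \<in> X ==> vec.dim (cone_tangent_space X z) = card (- J)"
  and F: "\<forall>j\<in>J. vanishes_on (F j) X"
  and S: "open S" "connected S" "0 \<in> S"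
  and gm: "\<And>s i. s \<in> S ==> (gm i has_field_derivative V s $ i) (at s)"
  and det: "\<And>s. s \<in> S ==> det (jac F (\<chi> i. gm i s)) ~= 0"
  and V: "\<And>s. s \<in> S ==> jac F (\<chi> i. gm i s) *v V s = c" and c: "\<And>j. j \<in> J ==> c $ j = 0"
  and start: "(\<chi> i. gm i 0) \<in> X" and G: "vanishes_on G X" and s: "s \<in> S"
 shows "peval G (%i. gm i s) = 0"
proof -
 let ?D = "det_jac F"
 have vn: "vec_nth (\<chi> i. gm i s) = (%i. gm i s)" for s by (simp add: fun_eq_iff)
 have D: "peval ?D (%i. gm i s) = det (jac F (\<chi> i. gm i s))" for s
  using peval_det_jac[of F "\<chi> i. gm i s"] by (simp only: vn)
 have Dnz: "peval ?D (%i. gm i s) ~= 0" if "s \<in> S" for s using det[OF that] by (simp only: D not_False_eq_True)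
 have Vi: "V s $ i = (\<Sum>j\<in>-J. c $ j * (peval (adj_jac F j i) (%i. gm i s) / peval ?D (%i. gm i s)))" if s: "s \<in> S" for s i
 proof -
  let ?M = "jac F (\<chi> i. gm i s)" and ?x = "%j. (\<chi> i. pevalv (adj_jac F j i) (\<chi> i. gm i s) / det (jac F (\<chi> i. gm i s)))"
  have "?M *v (\<Sum>j\<in>UNIV. c $ j *s ?x j) = (\<Sum>j\<in>UNIV. c $ j *s (?M *v ?x j))"
   by (simp only: vec.linear_sum[OF matrix_vector_mul_linear_gen] vec.linear_scale[OF matrix_vector_mul_linear_gen])
  also have "\<dots> = (\<Sum>j\<in>UNIV. c $ j *s axis j 1)" by (simp only: jac_adj_jac[OF det[OF s]])
  also have "\<dots> = c" by (rule basis_expansion)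
  finally have "?M *v (\<Sum>j\<in>UNIV. c $ j *s ?x j) = ?M *v V s" using V[OF s] by simp
  then have e: "?M *v V s = ?M *v (\<Sum>j\<in>UNIV. c $ j *s ?x j)" by (rule sym)
  have inj: "inj ((*v) ?M)"
   using det[OF s] by (simp add: invertible_det_nz[symmetric] invertible_left_inverse matrix_left_invertible_injective)
  have "V s = (\<Sum>j\<in>UNIV. c $ j *s ?x j)" by (rule injD[OF inj e])
  then have "V s $ i = (\<Sum>j\<in>UNIV. c $ j * (peval (adj_jac F j i) (%i. gm i s) / peval ?D (%i. gm i s)))"
   by (simp add: D vn sum_component)
  also have "\<dots> = (\<Sum>j\<in>-J. c $ j * (peval (adj_jac F j i) (%i. gm i s) / peval ?D (%i. gm i s)))"
   by (rule sum.mono_neutral_right) (use c in auto)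
  finally show ?thesis .
 qed
 define along where "along j P = (\<Sum>i\<in>UNIV. adj_jac F j i * pdiff i P)" for j P
 have dP: "((%s. peval P (%i. gm i s)) has_field_derivative
   (\<Sum>j\<in>-J. c $ j * peval (along j P) (%i. gm i s)) / peval ?D (%i. gm i s)) (at s)" if s: "s \<in> S" for P s
 proof -
  have "(\<Sum>i\<in>UNIV. V s $ i * peval (pdiff i P) (%i. gm i s)) =
    (\<Sum>i\<in>UNIV. \<Sum>j\<in>-J. c $ j * (peval (adj_jac F j i) (%i. gm i s) * peval (pdiff i P) (%i. gm i s)) / peval ?D (%i. gm i s))"
   unfolding Vi[OF s] sum_distrib_right by (simp add: mult_ac)
  also have "\<dots> = (\<Sum>j\<in>-J. \<Sum>i\<in>UNIV. c $ j * (peval (adj_jac F j i) (%i. gm i s) * peval (pdiff i P) (%i. gm i s)) / peval ?D (%i. gm i s))"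
   by (rule sum.swap)
  also have "\<dots> = (\<Sum>j\<in>-J. c $ j * peval (along j P) (%i. gm i s)) / peval ?D (%i. gm i s)"
   by (simp add: along_def peval_sum peval_mult sum_distrib_left sum_divide_distrib)
  finally show ?thesis using peval_has_field_derivative[where gm = gm and gm' = "%i. V s $ i", OF gm[OF s], of P] by simp
 qed
 have stable: "vanishes_on (?D * along j P) X" if j: "j \<notin> J" and P: "vanishes_on P X" for j P
  unfolding vanishes_on_def
 proof
  fix z assume z: "z \<in> X"
  show "pevalv (?D * along j P) z = 0"
  proof (cases "det (jac F z) = 0")
   case True
   then show ?thesis by (simp add: peval_mult peval_det_jac)
  next
   case False
   have "pdir P z (\<chi> i. pevalv (adj_jac F j i) z / det (jac F z)) = 0"
   proof (rule pdir_zero_of_jac_kernel[OF X dim[OF z] F False _ P], rule ballI)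
    fix r assume "r \<in> J"
    then show "pdir (F r) z (\<chi> i. pevalv (adj_jac F j i) z / det (jac F z)) = 0"
     using j by (simp add: jac_mult[symmetric] jac_adj_jac[OF False] axis_def) auto
   qed
   then have "pevalv (along j P) z / det (jac F z) = 0"
    by (simp add: pdir_def along_def peval_sum peval_mult sum_divide_distrib)
   then show ?thesis using False by (simp add: peval_mult)
  qed
 qed
 have main: "f 0 = 0 \<and> (\<exists>g. ideal_along X ?D gm g \<and> (\<forall>s\<in>S. (f has_field_derivative g s) (at s)))" if "ideal_along X ?D gm f" for f
  using that
 proof (induction rule: ideal_along.induct)
  case (base G k)
  \<comment> \<open>numerator of the derivative of \<open>G / D ^ k\<close>; the denominator is \<open>D ^ (k + 2)\<close>\<close>
  define N where "N j = ?D * along j G - pconst (real k) * G * along j ?D" for j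
  have vN: "vanishes_on (N j) X" if "j \<in> - J" for j
   using stable[of j G] that base by (simp add: N_def vanishes_on_def peval_diff peval_mult)
  show ?case
  proof (intro conjI exI[of _ "%s. \<Sum>j\<in>-J. c $ j * (peval (N j) (%i. gm i s) / peval ?D (%i. gm i s) ^ (k + 2))"] ballI)
   have "pevalv G (\<chi> i. gm i 0) = 0" using base start by (simp add: vanishes_on_def)
   then show "peval G (%i. gm i 0) / peval ?D (%i. gm i 0) ^ k = 0" by (simp add: vn)
   show "ideal_along X ?D gm (%s. \<Sum>j\<in>-J. c $ j * (peval (N j) (%i. gm i s) / peval ?D (%i. gm i s) ^ (k + 2)))"
    by (intro ideal_along_sum ideal_along.cmult ideal_along.base vN)
   fix s assume s: "s \<in> S"
   let ?g = "peval G (%i. gm i s)" and ?d = "peval ?D (%i. gm i s)"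
   let ?g' = "\<Sum>j\<in>-J. c $ j * peval (along j G) (%i. gm i s)" and ?d' = "\<Sum>j\<in>-J. c $ j * peval (along j ?D) (%i. gm i s)"
   have "((%s. peval G (%i. gm i s) / peval ?D (%i. gm i s) ^ k) has_field_derivative
     (?g' / ?d * ?d ^ k - ?g * (of_nat k * (?d' / ?d) * ?d ^ (k - 1))) / (?d ^ k * ?d ^ k)) (at s)"
    by (rule DERIV_cong[OF DERIV_divide[OF dP[OF s] DERIV_power[OF dP[OF s]]]]) (use Dnz[OF s] in simp_all)
   moreover have "(?g' / ?d * ?d ^ k - ?g * (of_nat k * (?d' / ?d) * ?d ^ (k - 1))) / (?d ^ k * ?d ^ k) =
     (?d * ?g' - of_nat k * ?g * ?d') / ?d ^ (k + 2)"
    using Dnz[OF s] by (cases k) (simp_all add: field_simps power_add power2_eq_square)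
   moreover have "(?d * ?g' - of_nat k * ?g * ?d') = (\<Sum>j\<in>-J. c $ j * peval (N j) (%i. gm i s))"
    by (simp add: N_def peval_diff peval_mult peval_pconst sum_distrib_left right_diff_distrib sum_subtractf mult_ac)
   ultimately show "((%s. peval G (%i. gm i s) / peval ?D (%i. gm i s) ^ k) has_field_derivative
     (\<Sum>j\<in>-J. c $ j * (peval (N j) (%i. gm i s) / ?d ^ (k + 2)))) (at s)"
    by (simp add: sum_divide_distrib)
  qed
 next
  case (add f g)
  then obtain f' g' where "ideal_along X ?D gm f'" "\<forall>s\<in>S. (f has_field_derivative f' s) (at s)"
   "ideal_along X ?D gm g'" "\<forall>s\<in>S. (g has_field_derivative g' s) (at s)" by blast
  then show ?case using add.IH by (intro conjI exI[of _ "%s. f' s + g' s"] ballI ideal_along.add DERIV_add) auto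
 next
  case (cmult f c)
  then obtain f' where "ideal_along X ?D gm f'" "\<forall>s\<in>S. (f has_field_derivative f' s) (at s)" by blast
  then show ?case using cmult.IH by (intro conjI exI[of _ "%s. c * f' s"] ballI ideal_along.cmult DERIV_cmult) auto
 qed
 have "peval G (%i. gm i s) / peval ?D (%i. gm i s) ^ 0 = 0"
 proof (rule derivation_closed_zero[where A = "ideal_along X ?D gm" and f = "%s. peval G (%i. gm i s) / peval ?D (%i. gm i s) ^ 0",
   OF S _ _ ideal_along.base[OF G] s])
  fix f assume f: "ideal_along X ?D gm f"
  show "f 0 = 0" by (rule conjunct1[OF main[OF f]])
  show "\<exists>g. ideal_along X ?D gm g \<and> (\<forall>s\<in>S. (f has_field_derivative g s) (at s))" by (rule conjunct2[OF main[OF f]])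
 qed
 then show ?thesis by simp
qed

section \<open>The real points of a smooth variety\<close>

abbreviation cvec :: "real ^ 'v => complex ^ 'v" where
 "cvec x \<equiv> (\<chi> i. complex_of_real (x $ i))"

lemma vec_nth_cvec: "vec_nth (cvec x) = (%i. complex_of_real (x $ i))"
 by (simp add: fun_eq_iff)

lemma linear_cvec: "linear cvec"
 by (rule linearI) (simp_all add: vec_eq_iff scaleR_conv_of_real[where 'a = complex])

lemma inj_cvec: "cvec x = cvec y ==> x = y"
 by (simp add: vec_eq_iff)

lemma cvec_eq_0: "cvec x = 0 \<longleftrightarrow> x = 0"
 by (simp add: vec_eq_iff)

definition pmap :: "('v::finite => 'v rpoly) => complex ^ 'v => complex ^ 'v" where
 "pmap F z = (\<chi> j. pevalv (F j) z)"

definition pmap_real :: "('v::finite => 'v rpoly) => real ^ 'v => real ^ 'v" where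
 "pmap_real F x = (\<chi> j. peval_real (F j) (vec_nth x))"

lemma pmap_cvec: "pmap F (cvec x) = cvec (pmap_real F x)"
 by (simp add: pmap_def pmap_real_def vec_nth_cvec peval_of_real)

lemma pmap_smooth: "smooth_on UNIV (pmap F)"
 unfolding pmap_def[abs_def]
 by (intro smooth_on_vec_lambda peval_smooth open_UNIV smooth_on_vec_nth smooth_on_id)

lemma pmap_real_smooth: "smooth_on UNIV (pmap_real F)"
 unfolding pmap_real_def[abs_def]
 by (intro smooth_on_vec_lambda peval_real_smooth open_UNIV smooth_on_vec_nth smooth_on_id)

lemma linear_vector_scale: "linear (%t::complex. t *s (v :: complex ^ 'v::finite))"
 by (rule linearI) (simp_all add: vec_eq_iff distrib_right scaleR_conv_of_real[where 'a = complex])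

lemma bounded_linear_vector_scale: "bounded_linear (%t::complex. t *s (v :: complex ^ 'v::finite))"
 using linear_vector_scale linear_conv_bounded_linear by blast

lemma line_has_derivative:
 "((%t::complex. z + t *s v) has_derivative (%t. t *s (v :: complex ^ 'v::finite))) (at s)"
 using has_derivative_add[OF has_derivative_const bounded_linear_imp_has_derivative[OF bounded_linear_vector_scale], of z v]
 by simp

lemma dir_deriv_pmap: "dir_deriv (pmap F) z = (*v) (jac F z)"
proof
 fix v
 have "dir_deriv (pmap F) z v $ j = (jac F z *v v) $ j" for j
 proof -
  have d: "(pmap F has_derivative dir_deriv (pmap F) z) (at z)"
   by (rule smooth_on_has_derivative[OF pmap_smooth UNIV_I])
  then have "(pmap F has_derivative dir_deriv (pmap F) z) (at (z + 0 *s v))" by simp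
  from has_derivative_compose[OF line_has_derivative this]
  have "((%t. pmap F (z + t *s v)) has_derivative (%t. dir_deriv (pmap F) z (t *s v))) (at 0)" .
  from bounded_linear.has_derivative[OF bounded_linear_vec_nth this]
  have "((%t. pevalv (F j) (z + t *s v)) has_derivative (%t. dir_deriv (pmap F) z (t *s v) $ j)) (at 0)"
   by (simp add: pmap_def)
  moreover have "((%t. pevalv (F j) (z + t *s v)) has_derivative (*) (pdir (F j) z v)) (at 0)"
   using pevalv_line_derivative by (simp only: has_field_derivative_def)
  ultimately have "(%t. dir_deriv (pmap F) z (t *s v) $ j) = (*) (pdir (F j) z v)" by (rule has_derivative_unique)
  from fun_cong[OF this, of 1] show ?thesis by (simp add: jac_mult)
 qed
 then show "dir_deriv (pmap F) z v = jac F z *v v" by (simp add: vec_eq_iff)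
qed

lemma det_nonzero_iff_inj: "det (M :: complex ^ 'v::finite ^ 'v) ~= 0 \<longleftrightarrow> inj ((*v) M)"
 by (simp add: invertible_det_nz[symmetric] invertible_left_inverse matrix_left_invertible_injective)

text \<open>
 In the local coordinates given by the \<open>F j\<close>, a segment from the given point in the coordinate space where the
 coordinates in \<open>J\<close> vanish corresponds to a curve that stays in \<open>X\<close>.
\<close>

lemma local_membership:
 fixes X :: "(complex ^ 'v::finite) set"
 assumes X: "real_closed X" and dim: "\<And>z. z \<in> X ==> vec.dim (cone_tangent_space X z) = card (- J)"
  and F: "\<forall>j\<in>J. vanishes_on (F j) X" and det: "det (jac F z0) ~= 0" and z0: "z0 \<in> X"
 obtains U ep where "open U" "z0 \<in> U" "ep > 0"
  "\<forall>z\<in>U. dist (pmap F z0) (pmap F z) < ep --> (z \<in> X \<longleftrightarrow> (\<forall>j\<in>J. pmap F z $ j = 0))"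
proof -
 have sm: "smooth_on (- {0}) (pmap F)" by (rule smooth_on_subset[OF pmap_smooth]) auto
 have nz: "z0 \<in> - {0}" using real_closed_nonzero[OF X z0] by simp
 have inj: "inj (dir_deriv (pmap F) z0)" using det by (simp add: dir_deriv_pmap det_nonzero_iff_inj)
 obtain U H where U: "open U" "z0 \<in> U" "U \<subseteq> - {0}" "open (pmap F ` U)" and sH: "smooth_on (pmap F ` U) H"
  and H: "\<And>x. x \<in> U ==> H (pmap F x) = x" and injU: "\<And>x. x \<in> U ==> inj (dir_deriv (pmap F) x)"
  using smooth_local_inverse[OF sm nz inj] by metis
 let ?w0 = "pmap F z0"
 obtain ep where ep: "ep > 0" "ball ?w0 ep \<subseteq> pmap F ` U" using U(2,4) by (metis imageI open_contains_ball)
 have w0J: "?w0 $ j = 0" if "j \<in> J" for j using F z0 that by (simp add: pmap_def vanishes_on_def)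
 have FH: "pmap F (H w) = w" "H w \<in> U" if "w \<in> pmap F ` U" for w using H that by auto
 have Hd: "(H has_derivative dir_deriv H w) (at w)" if "w \<in> pmap F ` U" for w
  by (rule smooth_on_has_derivative[OF sH that])
 have JH: "jac F (H w) *v dir_deriv H w u = u" if w: "w \<in> pmap F ` U" for w u
 proof -
  have "(pmap F has_derivative (*v) (jac F (H w))) (at (H w))"
   using smooth_on_has_derivative[OF pmap_smooth UNIV_I, of F "H w"] by (simp only: dir_deriv_pmap)
  from has_derivative_compose[OF Hd[OF w] this]
  have "((%w. pmap F (H w)) has_derivative (%u. jac F (H w) *v dir_deriv H w u)) (at w)" .
  then have "((%w. w) has_derivative (%u. jac F (H w) *v dir_deriv H w u)) (at w)"
   by (rule has_derivative_transform_within_open[OF _ U(4) w]) (rule FH(1))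
  from fun_cong[OF has_derivative_unique[OF this has_derivative_ident], of u] show ?thesis .
 qed
 have mem: "H w \<in> X" if w: "w \<in> ball ?w0 ep" and wJ: "\<And>j. j \<in> J ==> w $ j = 0" for w
 proof -
  define c where "c = w - ?w0"
  define path where "path s = ?w0 + s *s c" for s
  define S where "S = (%s. s *s c) -` ball 0 ep"
  have S: "open S" "connected S"
  proof -
   show "open S" unfolding S_def
    by (intro open_vimage open_ball bounded_linear.continuous_on[OF bounded_linear_vector_scale continuous_on_id])
   show "connected S" unfolding S_def
    by (intro convex_connected convex_linear_vimage linear_vector_scale convex_ball)
  qed
  have S01: "0 \<in> S" "1 \<in> S" using ep(1) w by (simp_all add: S_def c_def dist_norm norm_minus_commute)
  have inS: "path s \<in> pmap F ` U" if "s \<in> S" for s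
  proof -
   have "path s \<in> ball ?w0 ep" using that by (simp add: S_def path_def dist_norm)
   then show ?thesis using ep(2) by blast
  qed
  define V where "V s = dir_deriv H (path s) c" for s
  have vl: "(\<chi> i. H (path s) $ i) = H (path s)" for s by (simp add: vec_eq_iff)
  have der: "((%s. H (path s) $ i) has_field_derivative V s $ i) (at s)" if s: "s \<in> S" for s i
  proof -
   have p: "(path has_derivative (%t. t *s c)) (at s)" unfolding path_def by (rule line_has_derivative)
   from has_derivative_compose[OF p Hd[OF inS[OF s]]]
   have "((%s. H (path s)) has_derivative (%t. dir_deriv H (path s) (t *s c))) (at s)" .
   from bounded_linear.has_derivative[OF bounded_linear_vec_nth this]
   have "((%s. H (path s) $ i) has_derivative (%t. dir_deriv H (path s) (t *s c) $ i)) (at s)" .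
   moreover have "dir_deriv H (path s) (t *s c) = t *s V s" for t
   proof (rule injD)
    show "inj ((*v) (jac F (H (path s))))" using injU[OF FH(2)[OF inS[OF s]]] by (simp only: dir_deriv_pmap)
    show "jac F (H (path s)) *v dir_deriv H (path s) (t *s c) = jac F (H (path s)) *v (t *s V s)"
     by (simp only: V_def vec.linear_scale[OF matrix_vector_mul_linear_gen] JH[OF inS[OF s]])
   qed
   ultimately show ?thesis by (simp add: has_field_derivative_def mult.commute[of _ "V s $ i"])
  qed
  have "pevalv G (H w) = 0" if G: "vanishes_on G X" for G
  proof -
   have "peval G (%i. H (path 1) $ i) = 0"
   proof (rule curve_in_variety[OF X dim F S S01(1) der _ _ _ _ G S01(2)])
    fix s assume s: "s \<in> S"
    show "det (jac F (\<chi> i. H (path s) $ i)) ~= 0"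
     using injU[OF FH(2)[OF inS[OF s]]] by (simp only: vl dir_deriv_pmap det_nonzero_iff_inj)
    show "jac F (\<chi> i. H (path s) $ i) *v V s = c" by (simp only: vl V_def JH[OF inS[OF s]])
   next
    show "c $ j = 0" if "j \<in> J" for j using wJ[OF that] w0J[OF that] by (simp add: c_def)
    show "(\<chi> i. H (path 0) $ i) \<in> X" using z0 H[OF U(2)] by (simp add: vl path_def)
   qed
   then show ?thesis by (simp add: path_def c_def)
  qed
  moreover have "H w ~= 0" using FH(2)[of w] w ep(2) U(3) by blast
  ultimately show ?thesis
   using X unfolding real_closed_def vanishes_on_def by auto
 qed
 have "z \<in> X \<longleftrightarrow> (\<forall>j\<in>J. pmap F z $ j = 0)" if z: "z \<in> U" and d: "dist ?w0 (pmap F z) < ep" for z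
 proof
  assume "z \<in> X"
  then show "\<forall>j\<in>J. pmap F z $ j = 0" using F by (simp add: pmap_def vanishes_on_def)
 next
  assume "\<forall>j\<in>J. pmap F z $ j = 0"
  then have "H (pmap F z) \<in> X" using d by (intro mem) auto
  then show "z \<in> X" using H[OF z] by simp
 qed
 then show ?thesis by (intro that[OF U(1,2) ep(1)]) blast
qed

text \<open>The straightening is defined over the reals, so it straightens the real points of the cone as well.\<close>

lemma real_cone_flat:
 fixes X :: "(complex ^ 'v::finite) set"
 assumes X: "real_closed X" and dim: "\<And>z. z \<in> X ==> vec.dim (cone_tangent_space X z) = N"
  and x0: "cvec x0 \<in> X"
 obtains J Og and Ps :: "real ^ 'v => real ^ 'v" where "card (- J) = N" "smooth_on Og Ps" "x0 \<in> Og" "inj (dir_deriv Ps x0)"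
  "\<forall>x\<in>Og. cvec x \<in> X \<longleftrightarrow> (\<forall>j\<in>J. Ps x $ j = 0)"
proof -
 obtain F J where F: "\<forall>j\<in>J. vanishes_on (F j) X" "card (- J) = vec.dim (cone_tangent_space X (cvec x0))" "det (jac F (cvec x0)) ~= 0"
  by (rule adapted_coordinates[OF X])
 have cJ: "card (- J) = N" using F(2) dim[OF x0] by simp
 have dim': "vec.dim (cone_tangent_space X z) = card (- J)" if "z \<in> X" for z using dim[OF that] cJ by simp
 obtain U ep where U: "open U" "cvec x0 \<in> U" "ep > 0"
  "\<forall>z\<in>U. dist (pmap F (cvec x0)) (pmap F z) < ep --> (z \<in> X \<longleftrightarrow> (\<forall>j\<in>J. pmap F z $ j = 0))"
  by (rule local_membership[OF X dim' F(1,3) x0])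
 define Og where "Og = cvec -` (U \<inter> pmap F -` ball (pmap F (cvec x0)) ep)"
 have bl: "bounded_linear (cvec :: real ^ 'v => _)" using linear_cvec linear_conv_bounded_linear by blast
 have op: "open Og" unfolding Og_def
  by (intro open_vimage open_Int U(1) open_ball smooth_on_continuous[OF pmap_smooth]
    bounded_linear.continuous_on[OF bl continuous_on_id])
 have inOg: "x0 \<in> Og" using U(2,3) by (simp add: Og_def)
 have "dir_deriv (pmap_real F) x0 v = dir_deriv (pmap_real F) x0 w ==> v = w" for v w
 proof -
  assume e: "dir_deriv (pmap_real F) x0 v = dir_deriv (pmap_real F) x0 w"
  have "(pmap_real F has_derivative dir_deriv (pmap_real F) x0) (at x0)"
   by (rule smooth_on_has_derivative[OF pmap_real_smooth UNIV_I])
  from bounded_linear.has_derivative[OF bl this]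
  have 1: "((%x. cvec (pmap_real F x)) has_derivative (%v. cvec (dir_deriv (pmap_real F) x0 v))) (at x0)" .
  have "(pmap F has_derivative (*v) (jac F (cvec x0))) (at (cvec x0))"
   using smooth_on_has_derivative[OF pmap_smooth UNIV_I, of F "cvec x0"] by (simp only: dir_deriv_pmap)
  from has_derivative_compose[OF bounded_linear_imp_has_derivative[OF bl] this]
  have "((%x. pmap F (cvec x)) has_derivative (%v. jac F (cvec x0) *v cvec v)) (at x0)" .
  then have "((%x. cvec (pmap_real F x)) has_derivative (%v. jac F (cvec x0) *v cvec v)) (at x0)" by (simp only: pmap_cvec)
  note u = fun_cong[OF has_derivative_unique[OF 1 this]]
  have "jac F (cvec x0) *v cvec v = jac F (cvec x0) *v cvec w" by (simp only: u[symmetric] e)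
  then have "cvec v = cvec w" using F(3) injD[of "(*v) (jac F (cvec x0))"] by (simp only: det_nonzero_iff_inj)
  then show "v = w" by (rule inj_cvec)
 qed
 then have inj: "inj (dir_deriv (pmap_real F) x0)" by (rule injI)
 have "\<forall>x\<in>Og. cvec x \<in> X \<longleftrightarrow> (\<forall>j\<in>J. pmap_real F x $ j = 0)"
 proof
  fix x assume x: "x \<in> Og"
  have "cvec x \<in> X \<longleftrightarrow> (\<forall>j\<in>J. pmap F (cvec x) $ j = 0)" using U(4) x by (simp add: Og_def)
  then show "cvec x \<in> X \<longleftrightarrow> (\<forall>j\<in>J. pmap_real F x $ j = 0)" by (simp add: pmap_cvec)
 qed
 then show ?thesis
  by (intro that[OF cJ smooth_on_subset[OF pmap_real_smooth op subset_UNIV] inOg inj])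
qed

section \<open>Real sections and their zeros\<close>

lemma hpoly_homogeneous: "hpoly k m p ==> p (%l. c * y l) = c ^ m * p y"
 by (induction rule: hpoly.induct) (simp_all add: distrib_left power_add)

lemma hpoly_zero_scale: "hpoly k m p ==> c ~= 0 ==> p (%l. c * y l) = 0 \<longleftrightarrow> p y = 0"
 by (simp add: hpoly_homogeneous)

definition real_sections :: "(complex ^ 'v::finite) set => 'v divisor => nat => (nat => 'v ratfun) => real ^ 'v => nat => real" where
 "real_sections X D k s x l = Re (section_map X D k s (cvec x) l)"

text \<open>
 The zero set of the form \<open>p\<close> in the sections. As the sections have a common scaling ambiguity, only the
 vanishing of forms is meaningful.
\<close>

definition real_zeros :: "(complex ^ 'v::finite) set => 'v divisor => nat => (nat => 'v ratfun) =>
  ((nat => real) => real) => (real ^ 'v ^ 'v) set" where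
 "real_zeros X D k s p = {line_projection x |x. x ~= 0 \<and> cvec x \<in> X \<and> p (real_sections X D k s x) = 0}"

lemma section_map_cvec:
 assumes "irred_closed X" "generating_sections X D k s" "cvec x \<in> X"
 shows "section_map X D k s (cvec x) l = complex_of_real (real_sections X D k s x l)"
 using section_map_real[OF assms, of l] by (simp add: real_sections_def of_real_Re)

lemma real_sections_locally_polynomial:
 fixes X :: "(complex ^ 'v::finite) set"
 assumes X: "irred_closed X" and D: "real_divisor X D" and g: "generating_sections X D k s" and x0: "cvec x0 \<in> X"
 obtains e Q dN N where "\<forall>l. homogeneous e (Q l)" "\<forall>l>k. Q l = 0" "homogeneous dN N" "peval_real N (vec_nth x0) ~= 0"
  "\<forall>x. cvec x \<in> X --> peval_real N (vec_nth x) ~= 0 -->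
   (\<exists>c. c ~= 0 \<and> (\<forall>l. real_sections X D k s x l = c * peval_real (Q l) (vec_nth x)))"
proof (rule section_map_locally_polynomial[OF X D g x0])
 fix e dN N and Q :: "nat => 'v rpoly"
 assume Q: "\<And>l. homogeneous e (Q l)" "\<And>l. l > k ==> Q l = 0" "homogeneous dN N" "pevalv N (cvec x0) ~= 0"
  and rep: "\<And>q. q \<in> X ==> pevalv N q ~= 0 ==> \<exists>c. c ~= 0 \<and> (\<forall>l. section_map X D k s q l = c * pevalv (Q l) q)"
 have "\<exists>c. c ~= 0 \<and> (\<forall>l. real_sections X D k s x l = c * peval_real (Q l) (vec_nth x))"
  if x: "cvec x \<in> X" and N: "peval_real N (vec_nth x) ~= 0" for x
 proof -
  have "pevalv N (cvec x) ~= 0" using N by (simp add: vec_nth_cvec peval_of_real)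
  from rep[OF x this] obtain c where c: "c ~= 0" "\<forall>l. section_map X D k s (cvec x) l = c * pevalv (Q l) (cvec x)" by blast
  have eq: "real_sections X D k s x l = Re c * peval_real (Q l) (vec_nth x)" for l
   using c(2) by (simp add: real_sections_def vec_nth_cvec peval_of_real)
  obtain l where "section_map X D k s (cvec x) l ~= 0" using section_map_nonzero[OF X g x] by blast
  then have "real_sections X D k s x l ~= 0" using section_map_cvec[OF X g x, of l] by simp
  then have "Re c ~= 0" using eq[of l] by auto
  then show ?thesis using eq by blast
 qed
 moreover have "peval_real N (vec_nth x0) ~= 0" using Q(4) by (simp add: vec_nth_cvec peval_of_real)
 ultimately show ?thesis using Q by (intro that[of e Q dN N]) blast+
qed

lemma cvec_scale: "cvec (t *\<^sub>R x) = complex_of_real t *s cvec x"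
 by (simp add: vec_eq_iff)

lemma cvec_scale_mem: "real_closed X ==> cvec x \<in> X ==> t ~= 0 ==> cvec (t *\<^sub>R x) \<in> X"
 unfolding cvec_scale by (rule real_closed_scale) simp_all

lemma real_sections_scale:
 fixes X :: "(complex ^ 'v::finite) set"
 assumes X: "irred_closed X" and D: "real_divisor X D" and g: "generating_sections X D k s" and x: "cvec x \<in> X" and t: "t ~= 0"
 shows "\<exists>c. c ~= 0 \<and> (\<forall>l. real_sections X D k s (t *\<^sub>R x) l = c * real_sections X D k s x l)"
proof -
 have Xc: "real_closed X" using X by (simp add: irred_closed_def)
 obtain e Q dN N where Q: "\<forall>l. homogeneous e (Q l)" "\<forall>l>k. Q l = 0" "homogeneous dN N" "peval_real N (vec_nth x) ~= 0"
  "\<forall>y. cvec y \<in> X --> peval_real N (vec_nth y) ~= 0 -->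
   (\<exists>c. c ~= 0 \<and> (\<forall>l. real_sections X D k s y l = c * peval_real (Q l) (vec_nth y)))"
  by (rule real_sections_locally_polynomial[OF X D g x])
 have v: "vec_nth (t *\<^sub>R x) = (%i. t * x $ i)" by (simp add: fun_eq_iff)
 obtain c where c: "c ~= 0" "\<forall>l. real_sections X D k s x l = c * peval_real (Q l) (vec_nth x)" using Q(4,5) x by blast
 have "peval_real N (vec_nth (t *\<^sub>R x)) ~= 0" unfolding v peval_real_scale[OF Q(3)] using Q(4) t by simp
 then obtain c' where c': "c' ~= 0" "\<forall>l. real_sections X D k s (t *\<^sub>R x) l = c' * peval_real (Q l) (vec_nth (t *\<^sub>R x))"
  using Q(5) cvec_scale_mem[OF Xc x t] by blast
 have "real_sections X D k s (t *\<^sub>R x) l = (c' * t ^ e / c) * real_sections X D k s x l" for l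
 proof -
  have "peval_real (Q l) (vec_nth (t *\<^sub>R x)) = t ^ e * peval_real (Q l) (vec_nth x)"
   unfolding v by (rule peval_real_scale) (use Q(1) in blast)
  then show ?thesis using c c' by simp
 qed
 then show ?thesis using c(1) c'(1) t by (intro exI[of _ "c' * t ^ e / c"]) simp
qed

section \<open>Line projections\<close>

lemma line_projection_mult: "line_projection x *v y = ((x \<bullet> y) / (x \<bullet> x)) *\<^sub>R x"
 by (simp add: vec_eq_iff line_projection_def matrix_vector_mult_def inner_vec_def sum_distrib_left sum_divide_distrib mult_ac)

lemma line_projection_scale: "t ~= 0 ==> line_projection (t *\<^sub>R x) = line_projection x"
 by (simp add: vec_eq_iff line_projection_def)

lemma line_projection_eqD:
 assumes "line_projection x = line_projection y" "x ~= 0" "y ~= 0"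
 shows "\<exists>t. t ~= 0 \<and> y = t *\<^sub>R x"
proof -
 have "y = line_projection y *v y" using assms(3) by (simp add: line_projection_mult)
 also have "\<dots> = ((x \<bullet> y) / (x \<bullet> x)) *\<^sub>R x" unfolding assms(1)[symmetric] by (rule line_projection_mult)
 finally have y: "y = ((x \<bullet> y) / (x \<bullet> x)) *\<^sub>R x" .
 then have "(x \<bullet> y) / (x \<bullet> x) ~= 0" using assms(3) by (metis scaleR_zero_left)
 then show ?thesis using y by blast
qed

lemma line_projection_smooth: "smooth_on (- {0}) line_projection"
 unfolding line_projection_def[abs_def]
 by (intro smooth_on_vec_lambda smooth_on_divide smooth_on_mult smooth_on_vec_nth smooth_on_inner smooth_on_id) auto

lemma real_zeros_iff:
 fixes X :: "(complex ^ 'v::finite) set"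
 assumes X: "irred_closed X" and D: "real_divisor X D" and g: "generating_sections X D k s" and x: "cvec x \<in> X" "x ~= 0"
  and p: "hpoly k m p"
 shows "line_projection x \<in> real_zeros X D k s p \<longleftrightarrow> p (real_sections X D k s x) = 0"
proof
 assume "line_projection x \<in> real_zeros X D k s p"
 then obtain y where y: "line_projection x = line_projection y" "y ~= 0" "cvec y \<in> X" "p (real_sections X D k s y) = 0"
  unfolding real_zeros_def by blast
 obtain t where t: "t ~= 0" "x = t *\<^sub>R y" using line_projection_eqD[OF y(1)[symmetric] y(2) x(2)] by blast
 obtain c where c: "c ~= 0" "\<forall>l. real_sections X D k s x l = c * real_sections X D k s y l"
  using real_sections_scale[OF X D g y(3) t(1)] t(2) by blast
 then have "real_sections X D k s x = (%l. c * real_sections X D k s y l)" by (simp add: fun_eq_iff)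
 then show "p (real_sections X D k s x) = 0" using hpoly_zero_scale[OF p c(1)] y(4) by simp
next
 assume "p (real_sections X D k s x) = 0"
 then show "line_projection x \<in> real_zeros X D k s p" using x unfolding real_zeros_def by blast
qed

section \<open>Choice of coordinates\<close>

text \<open>
 On the subspace of vectors \<open>v\<close> with \<open>L v $ i = 0\<close> for \<open>i \<in> J\<close> and
 \<open>x0 \<bullet> v = 0\<close>, which has dimension \<open>CARD('n)\<close>, the functionals \<open>w a\<close>
 are inner products with vectors that span it. A basis is chosen among these vectors.
\<close>

lemma choose_functionals:
 fixes L :: "real ^ 'v::finite => real ^ 'v" and w :: "nat => real ^ 'v => real"
 assumes L: "linear L" "inj L" and J: "card (- J) = Suc CARD('n::finite)"
  and x0: "x0 ~= 0" "\<And>i. i \<in> J ==> L x0 $ i = 0" and w: "\<And>a. a \<le> k ==> linear (w a)"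
  and ker: "\<And>v. (\<And>i. i \<in> J ==> L v $ i = 0) ==> (\<And>a. a \<le> k ==> w a v = 0) ==> x0 \<bullet> v = 0 ==> v = 0"
 shows "\<exists>l :: 'n => nat. (\<forall>i. l i \<le> k) \<and>
  (\<forall>v. (\<forall>i\<in>J. L v $ i = 0) --> (\<forall>i. w (l i) v = 0) --> x0 \<bullet> v = 0 --> v = 0)"
proof -
 define T where "T = {v. \<forall>i\<in>J. L v $ i = 0}"
 define T0 where "T0 = {v \<in> T. \<forall>x\<in>span {x0}. orthogonal x v}"
 have sT: "subspace T"
  unfolding T_def by (rule subspaceI) (simp_all add: linear_0[OF L(1)] linear_add[OF L(1)] linear_scale[OF L(1)])
 have dT: "dim T = Suc CARD('n)"
 proof -
  let ?S = "{u :: real ^ 'v. \<forall>j. j \<notin> - J --> u $ j = 0}"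
  have surjL: "surj L" by (rule linear_injective_imp_surjective[OF L]) simp
  have "L ` T = ?S"
  proof (intro set_eqI iffI)
   fix u assume u: "u \<in> ?S"
   obtain v where "u = L v" using surjL by (metis surjD)
   then show "u \<in> L ` T" using u by (auto simp: T_def)
  qed (auto simp: T_def)
  moreover have "dim (L ` T) = dim T" by (rule dim_image_eq[OF L(1) inj_on_subset[OF L(2) subset_UNIV]])
  ultimately show ?thesis using dim_substandard_cart[of "- J", where 'a = real] J by (simp add: dim_vec_eq)
 qed
 have x0T: "span {x0} \<subseteq> T" using x0(2) by (intro span_minimal sT) (simp add: T_def)
 have dT0: "dim T0 = CARD('n)"
 proof -
  have "dim T0 + dim (span {x0}) = dim T"
   unfolding T0_def by (rule dim_subspace_orthogonal_to_vectors[OF subspace_span sT x0T])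
  then show ?thesis using dT x0(1) by (simp add: dim_span)
 qed
 have T0iff: "v \<in> T0 \<longleftrightarrow> (\<forall>i\<in>J. L v $ i = 0) \<and> x0 \<bullet> v = 0" for v
  unfolding T0_def T_def by (auto simp: span_singleton orthogonal_def)
 have sT0: "subspace T0"
  by (rule subspaceI) (simp_all add: T0iff linear_0[OF L(1)] linear_add[OF L(1)] linear_scale[OF L(1)] inner_add_right)
 have "\<forall>a. \<exists>y. a \<le> k --> y \<in> T0 \<and> (\<forall>v\<in>T0. w a v = y \<bullet> v)"
 proof
  fix a
  show "\<exists>y. a \<le> k --> y \<in> T0 \<and> (\<forall>v\<in>T0. w a v = y \<bullet> v)"
  proof (cases "a \<le> k")
   case True
   define g where "g = adjoint (w a) 1"
   have wg: "w a v = g \<bullet> v" for v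
    using adjoint_works[OF w[OF True], of v 1] by (simp add: g_def inner_commute)
   obtain y z where yz: "y \<in> span T0" "\<And>u. u \<in> span T0 ==> orthogonal z u" "g = y + z"
    using orthogonal_subspace_decomp_exists[of T0 g] by metis
   have "y \<in> T0" using yz(1) sT0 by (simp add: span_eq_iff[THEN iffD2])
   moreover have "w a v = y \<bullet> v" if "v \<in> T0" for v
    using yz(2)[OF span_base[OF that]] yz(3) wg by (simp add: inner_add_left orthogonal_def)
   ultimately show ?thesis by blast
  qed simp
 qed
 from choice[OF this] obtain y where y: "\<forall>a. a \<le> k --> y a \<in> T0 \<and> (\<forall>v\<in>T0. w a v = y a \<bullet> v)" ..
 let ?Y = "y ` {..k}"
 have YT: "?Y \<subseteq> T0" using y by auto
 have spanY: "span ?Y = T0"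
 proof (rule ccontr)
  assume "span ?Y ~= T0"
  then have "span ?Y \<subset> span T0" using span_minimal[OF YT sT0] sT0 by (simp add: span_eq_iff[THEN iffD2] psubset_eq)
  then obtain v where v: "v ~= 0" "v \<in> span T0" "\<And>u. u \<in> span ?Y ==> orthogonal v u"
   using orthogonal_to_subspace_exists_gen by metis
  have vT: "v \<in> T0" using v(2) sT0 by (simp add: span_eq_iff[THEN iffD2])
  have "v = 0"
  proof (rule ker)
   fix a assume a: "a \<le> k"
   have "orthogonal v (y a)" using v(3)[OF span_base] a by blast
   then show "w a v = 0" using y a vT by (simp add: orthogonal_def inner_commute)
  qed (use vT T0iff in auto)
  then show False using v(1) by simp
 qed
 obtain B where B: "B \<subseteq> ?Y" "independent B" "?Y \<subseteq> span B" "card B = dim ?Y" by (rule basis_exists)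
 have spanB: "T0 = span B" using spanY span_minimal[OF B(3) subspace_span] span_mono[OF B(1)] by blast
 have cB: "card B = CARD('n)" using B(4) spanY dT0 dim_span[of ?Y] by simp
 have fB: "finite B" using B(1) finite_subset by blast
 obtain bt where bt: "bij_betw bt (UNIV :: 'n set) B" using finite_same_card_bij[of "UNIV :: 'n set" B] fB cB by auto
 have "\<forall>i. \<exists>a. a \<le> k \<and> bt i = y a"
 proof
  fix i
  have "bt i \<in> ?Y" using bij_betwE[OF bt] B(1) by blast
  then show "\<exists>a. a \<le> k \<and> bt i = y a" by auto
 qed
 from choice[OF this] obtain l where l: "\<forall>i. l i \<le> k \<and> bt i = y (l i)" ..
 show ?thesis
 proof (intro exI[of _ l] conjI allI impI)
  show "l i \<le> k" for i using l by blast
  fix v assume v: "\<forall>i\<in>J. L v $ i = 0" "\<forall>i. w (l i) v = 0" "x0 \<bullet> v = 0"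
  have vT: "v \<in> T0" using v by (simp add: T0iff)
  have "orthogonal v b" if "b \<in> B" for b
  proof -
   have "b \<in> range bt" using that bij_betw_imp_surj_on[OF bt] by simp
   then obtain i where i: "b = bt i" by (elim imageE) (rule that)
   then have "w (l i) v = b \<bullet> v" using y l vT by metis
   then show ?thesis using v(2) by (simp add: orthogonal_def inner_commute)
  qed
  then have "orthogonal v v" using orthogonal_to_span[of v B v] vT spanB by blast
  then show "v = 0" by (simp add: orthogonal_self)
 qed
qed

section \<open>Charts given by quotients of sections\<close>

lemma peval_real_expand:
 "peval_real F y = (\<Sum>mu\<in>Poly_Mapping.keys F. Poly_Mapping.lookup F mu * (\<Prod>i\<in>Poly_Mapping.keys mu. y i ^ Poly_Mapping.lookup mu i))"
 by (simp add: peval_real_def peval_def Re_sum of_real_power[symmetric] of_real_prod[symmetric] of_real_mult[symmetric] del: of_real_power of_real_prod of_real_mult)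

lemma DERIV_power_zero:
 fixes f :: "real => real"
 assumes "(f has_real_derivative 0) (at t)"
 shows "((%t. f t ^ n) has_real_derivative 0) (at t)"
 using DERIV_power[OF assms, of n] by simp

lemma DERIV_prod_zero:
 fixes f :: "'i => real => real"
 assumes "\<And>i. i \<in> I ==> (f i has_real_derivative 0) (at t)"
 shows "((%t. \<Prod>i\<in>I. f i t) has_real_derivative 0) (at t)"
 using assms
proof (induction I rule: infinite_finite_induct)
 case (insert i I)
 have "((%t. f i t * (\<Prod>i\<in>I. f i t)) has_real_derivative 0 * (\<Prod>i\<in>I. f i t) + 0 * f i t) (at t)"
  using insert by (intro DERIV_mult) simp_all
 then show ?case using insert.hyps by simp
qed simp_all

text \<open>
 A polynomial in infinitely many variables involves only finitely many of them, so the chain rule is proved from the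
 monomials.
\<close>

lemma peval_real_derivative_zero:
 assumes "\<And>a. (w a has_real_derivative 0) (at t)"
 shows "((%t. peval_real F (%a. w a t)) has_real_derivative 0) (at t)"
proof -
 have "((%t. \<Sum>mu\<in>Poly_Mapping.keys F. Poly_Mapping.lookup F mu * (\<Prod>i\<in>Poly_Mapping.keys mu. w i t ^ Poly_Mapping.lookup mu i))
   has_real_derivative (\<Sum>mu\<in>Poly_Mapping.keys F. Poly_Mapping.lookup F mu * 0)) (at t)"
  by (intro DERIV_sum DERIV_cmult DERIV_prod_zero DERIV_power_zero assms)
 then show ?thesis by (simp add: peval_real_expand)
qed

lemma dir_deriv_nth:
 fixes f :: "'a::euclidean_space => real ^ 'v::finite"
 assumes "smooth_on U f" "x \<in> U"
 shows "dir_deriv f x v $ i = dir_deriv (%x. f x $ i) x v"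
 using dir_deriv_eq[OF bounded_linear.has_derivative[OF bounded_linear_vec_nth smooth_on_has_derivative[OF assms]], of i] by simp

lemma DERIV_along_curve:
 fixes f :: "'a::euclidean_space => real"
 assumes "smooth_on U f" "gm t \<in> U" "(gm has_vector_derivative v) (at t)"
 shows "((%t. f (gm t)) has_real_derivative dir_deriv f (gm t) v) (at t)"
proof -
 have l: "linear (dir_deriv f (gm t))" by (rule dir_deriv_linear[OF assms(1,2)])
 have "((%t. f (gm t)) has_derivative (%h. dir_deriv f (gm t) (h *\<^sub>R v))) (at t)"
  by (rule has_derivative_compose[OF assms(3)[unfolded has_vector_derivative_def] smooth_on_has_derivative[OF assms(1,2)]])
 then show ?thesis
  unfolding has_field_derivative_def by (rule has_derivative_eq_rhs) (simp add: linear_scale[OF l] fun_eq_iff)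
qed

text \<open>The curve is a segment in the straightened coordinates.\<close>

lemma curve_in_flat:
 fixes Ps :: "real ^ 'v::finite => real ^ 'v"
 assumes s: "smooth_on Og Ps" and x0: "x0 \<in> Og" and inj: "inj (dir_deriv Ps x0)"
  and J: "\<forall>i\<in>J. Ps x0 $ i = 0" and v: "\<forall>i\<in>J. dir_deriv Ps x0 v $ i = 0"
 obtains gm dl where "dl > (0::real)" "gm 0 = x0" "(gm has_vector_derivative v) (at 0)"
  "\<forall>t. \<bar>t\<bar> < dl --> gm t \<in> Og \<and> (\<forall>i\<in>J. Ps (gm t) $ i = 0)"
proof -
 obtain U H where U: "open U" "x0 \<in> U" "U \<subseteq> Og" "open (Ps ` U)" and sH: "smooth_on (Ps ` U) H"
  and H: "\<And>x. x \<in> U ==> H (Ps x) = x"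
  using smooth_local_inverse[OF s x0 inj] by metis
 define path where "path t = Ps x0 + t *\<^sub>R dir_deriv Ps x0 v" for t
 have in0: "Ps x0 \<in> Ps ` U" using U(2) by blast
 have pd: "(path has_vector_derivative dir_deriv Ps x0 v) (at 0)"
  unfolding path_def by (rule has_vector_derivative_eq_rhs, (rule derivative_intros)+) simp
 have "continuous_on UNIV path" unfolding path_def by (intro continuous_intros)
 then have "open (path -` (Ps ` U))" by (rule open_vimage[OF U(4)])
 moreover have "0 \<in> path -` (Ps ` U)" using in0 by (simp add: path_def)
 ultimately obtain dl where dl: "dl > 0" "ball 0 dl \<subseteq> path -` (Ps ` U)" using open_contains_ball by blast
 have p0: "path 0 = Ps x0" by (simp add: path_def)
 have "((%t. H (path t)) has_derivative (%h. dir_deriv H (Ps x0) (h *\<^sub>R dir_deriv Ps x0 v))) (at 0)"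
  by (rule has_derivative_compose[OF pd[unfolded has_vector_derivative_def]])
   (use smooth_on_has_derivative[OF sH in0] p0 in simp)
 moreover have "dir_deriv H (Ps x0) (dir_deriv Ps x0 v) = v"
 proof -
  have "((%x. H (Ps x)) has_derivative (%v. dir_deriv H (Ps x0) (dir_deriv Ps x0 v))) (at x0)"
   by (rule has_derivative_compose[OF smooth_on_has_derivative[OF s x0] smooth_on_has_derivative[OF sH in0]])
  then have "((%x. x) has_derivative (%v. dir_deriv H (Ps x0) (dir_deriv Ps x0 v))) (at x0)"
   by (rule has_derivative_transform_within_open[OF _ U(1,2)]) (rule H)
  from fun_cong[OF has_derivative_unique[OF this has_derivative_ident], of v] show ?thesis .
 qed
 ultimately have d: "((%t. H (path t)) has_vector_derivative v) (at 0)"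
  unfolding has_vector_derivative_def
  by (simp add: linear_scale[OF dir_deriv_linear[OF sH in0]])
 show ?thesis
 proof (rule that[OF dl(1) _ d], unfold p0, rule H[OF U(2)], intro allI impI)
  fix t :: real assume "\<bar>t\<bar> < dl"
  then have "path t \<in> Ps ` U" using dl(2) by (auto simp: dist_norm)
  then obtain x where x: "x \<in> U" "path t = Ps x" by (elim imageE) (rule that)
  have "path t $ i = 0" if "i \<in> J" for i using J v that by (simp add: path_def)
  then show "H (path t) \<in> Og \<and> (\<forall>i\<in>J. Ps (H (path t)) $ i = 0)"
   using x H[OF x(1)] U(3) by auto
 qed
qed

text \<open>
 The inverse of the closed immersion recovers a point up to a scalar from the quotients of the sections.
 A tangent vector along which all the quotients are stationary is therefore radial, and zero if it is orthogonal to \<open>x0\<close>.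
\<close>

lemma immersion_injective_tangent:
 fixes Ps :: "real ^ 'v::finite => real ^ 'v" and u :: "nat => real ^ 'v => real"
 assumes s: "smooth_on Og Ps" and x0: "x0 \<in> Og" and inj: "inj (dir_deriv Ps x0)"
  and J: "\<forall>i\<in>J. Ps x0 $ i = 0" and v: "\<And>i. i \<in> J ==> dir_deriv Ps x0 v $ i = 0"
  and su: "\<And>a. smooth_on Og (u a)" and uv: "\<And>a. dir_deriv (u a) x0 v = 0" and orth: "x0 \<bullet> v = 0"
  and P: "\<forall>x\<in>Og. (\<forall>i\<in>J. Ps x $ i = 0) --> (\<exists>c. \<forall>i. peval_real (P i) (%a. u a x) = c * x $ i)"
  and P0: "peval_real (P i0) (%a. u a x0) ~= 0"
 shows "v = 0"
proof -
 have v': "\<forall>i\<in>J. dir_deriv Ps x0 v $ i = 0" using v by blast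
 obtain gm dl where gm: "dl > 0" "gm 0 = x0" "(gm has_vector_derivative v) (at 0)"
  "\<forall>t. \<bar>t\<bar> < dl --> gm t \<in> Og \<and> (\<forall>i\<in>J. Ps (gm t) $ i = 0)"
  by (rule curve_in_flat[OF s x0 inj J v'])
 define p where "p i t = peval_real (P i) (%a. u a (gm t))" for i t
 define S where "S t = (\<Sum>i\<in>UNIV. p i t * x0 $ i)" for t
 have du: "((%t. u a (gm t)) has_real_derivative 0) (at 0)" for a
  using DERIV_along_curve[OF su[of a] _ gm(3)] x0 uv[of a] by (simp add: gm(2))
 have dp: "(p i has_real_derivative 0) (at 0)" for i
  unfolding p_def by (rule peval_real_derivative_zero[OF du])
 have dS: "(S has_real_derivative (\<Sum>i\<in>UNIV. 0 * x0 $ i)) (at 0)"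
  unfolding S_def by (intro DERIV_sum DERIV_cmult_right dp)
 have dgm: "((%t. gm t $ i) has_real_derivative v $ i) (at 0)" for i
  using bounded_linear.has_vector_derivative[OF bounded_linear_vec_nth gm(3), of i]
  by (simp add: has_real_derivative_iff_has_vector_derivative)
 have di: "((%t. x0 \<bullet> gm t) has_real_derivative 0) (at 0)"
  using bounded_linear.has_vector_derivative[OF bounded_linear_inner_right gm(3), of x0] orth
  by (simp add: has_real_derivative_iff_has_vector_derivative)
 obtain c0 where c0: "\<forall>i. peval_real (P i) (%a. u a x0) = c0 * x0 $ i" using P x0 J by blast
 have "S 0 = c0 * (x0 \<bullet> x0)" by (simp add: S_def p_def gm(2) c0 inner_vec_def sum_distrib_left mult_ac)
 moreover have "c0 ~= 0" "x0 ~= 0" using P0 c0 by auto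
 ultimately have S0: "S 0 ~= 0" by simp
 have "v $ i = 0" for i
 proof -
  \<comment> \<open>both sides express that the vector \<open>p\<close> is proportional to \<open>gm t\<close>\<close>
  have eq: "p i t * (x0 \<bullet> gm t) = S t * gm t $ i" if "\<bar>t\<bar> < dl" for t
  proof -
   obtain c where "\<forall>i. peval_real (P i) (%a. u a (gm t)) = c * gm t $ i" using P gm(4) \<open>\<bar>t\<bar> < dl\<close> by blast
   then show ?thesis by (simp add: p_def S_def inner_vec_def sum_distrib_left sum_distrib_right mult_ac)
  qed
  have 1: "((%t. p i t * (x0 \<bullet> gm t)) has_real_derivative 0 * (x0 \<bullet> gm 0) + 0 * p i 0) (at 0)"
   by (rule DERIV_mult[OF dp di])
  have 2: "((%t. S t * gm t $ i) has_real_derivative (\<Sum>i\<in>UNIV. 0 * x0 $ i) * gm 0 $ i + v $ i * S 0) (at 0)"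
   by (rule DERIV_mult[OF dS dgm])
  have "((%t. p i t * (x0 \<bullet> gm t)) has_real_derivative (\<Sum>i\<in>UNIV. 0 * x0 $ i) * gm 0 $ i + v $ i * S 0) (at 0)"
  proof (rule has_field_derivative_transform_within_open[OF 2 open_ball])
   show "0 \<in> ball 0 dl" using gm(1) by simp
   fix t :: real assume "t \<in> ball 0 dl"
   then show "S t * gm t $ i = p i t * (x0 \<bullet> gm t)" using eq[of t] by (simp add: dist_norm)
  qed
  from DERIV_unique[OF 1 this] show ?thesis using S0 by simp
 qed
 then show ?thesis by (simp add: vec_eq_iff)
qed

text \<open>
 The local inverse of the closed immersion, restricted to real points. The multiple of \<open>x\<close> may be zero
 away from \<open>x0\<close>.
\<close>

lemma immersion_inverse_real:
 fixes X :: "(complex ^ 'v::finite) set"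
 assumes X: "irred_closed X" and g: "generating_sections X D k s" and ci: "closed_immersion X k (section_map X D k s)"
  and x0: "cvec x0 \<in> X"
 obtains P :: "'v => nat rpoly" and d where "\<forall>i. homogeneous d (P i)"
  "\<exists>i. peval_real (P i) (real_sections X D k s x0) ~= 0"
  "\<forall>x. cvec x \<in> X --> (\<exists>c. \<forall>i. peval_real (P i) (real_sections X D k s x) = c * x $ i)"
proof -
 let ?phi = "section_map X D k s"
 obtain P :: "'v => nat rpoly" and d where P: "\<forall>j. homogeneous d (P j)" "\<exists>j. peval (P j) (?phi (cvec x0)) ~= 0"
  "\<forall>q\<in>X. (\<exists>j. peval (P j) (?phi q) ~= 0) --> (\<exists>c. c ~= 0 \<and> (\<forall>j. peval (P j) (?phi q) = c * q $ j))"
  using ci x0 unfolding closed_immersion_def by blast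
 have real: "peval (P j) (?phi (cvec x)) = complex_of_real (peval_real (P j) (real_sections X D k s x))" if "cvec x \<in> X" for x j
 proof -
  have "?phi (cvec x) = (%a. complex_of_real (real_sections X D k s x a))"
   using section_map_cvec[OF X g that] by (simp add: fun_eq_iff)
  then show ?thesis by (simp only: peval_of_real)
 qed
 have "\<exists>c. \<forall>i. peval_real (P i) (real_sections X D k s x) = c * x $ i" if x: "cvec x \<in> X" for x
 proof (cases "\<exists>j. peval (P j) (?phi (cvec x)) ~= 0")
  case True
  then obtain c where c: "\<forall>j. peval (P j) (?phi (cvec x)) = c * cvec x $ j" using P(3) x by blast
  have "peval_real (P i) (real_sections X D k s x) = Re c * x $ i" for i
  proof -
   have "complex_of_real (peval_real (P i) (real_sections X D k s x)) = c * complex_of_real (x $ i)"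
    using c real[OF x, of i] by simp
   from arg_cong[OF this, of Re] show ?thesis by simp
  qed
  then show ?thesis by blast
 next
  case False
  then show ?thesis using real[OF x] by (intro exI[of _ 0]) simp
 qed
 moreover have "\<exists>i. peval_real (P i) (real_sections X D k s x0) ~= 0" using P(2) real[OF x0] by simp
 ultimately show ?thesis using P(1) by (intro that[of d P]) blast+
qed

text \<open>
 The representative \<open>A *v x0\<close> of the line onto which \<open>A\<close> projects, normalised so that its inner product
 with \<open>x0\<close> is that of \<open>x0\<close> with itself.
\<close>

definition line_rep :: "real ^ 'v::finite => real ^ 'v ^ 'v => real ^ 'v" where
 "line_rep x0 A = ((x0 \<bullet> x0) / (x0 \<bullet> (A *v x0))) *\<^sub>R (A *v x0)"

lemma linear_matrix_apply: "linear (%A :: real ^ 'v::finite ^ 'v. A *v x)"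
 by (rule linearI) (simp_all add: vec_eq_iff matrix_vector_mult_def distrib_right distrib_left sum.distrib sum_distrib_left mult_ac)

lemma line_rep_open:
 fixes x0 :: "real ^ 'v::finite"
 shows "open {A. x0 \<bullet> (A *v x0) ~= 0}"
proof -
 have "bounded_linear (%A :: real ^ 'v ^ 'v. A *v x0)"
  using linear_matrix_apply[of x0] unfolding linear_conv_bounded_linear .
 then have "continuous_on UNIV (%A :: real ^ 'v ^ 'v. x0 \<bullet> (A *v x0))"
  by (intro continuous_on_inner continuous_on_const linear_continuous_on)
 then have "open ((%A. x0 \<bullet> (A *v x0)) -` (- {0}))" by (intro open_vimage) auto
 then show ?thesis by (simp add: vimage_def)
qed

lemma line_rep_smooth: "smooth_on {A. x0 \<bullet> (A *v x0) ~= 0} (line_rep x0)"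
 unfolding line_rep_def[abs_def]
 by (intro smooth_on_scaleR smooth_on_divide smooth_on_inner smooth_on_const line_rep_open
   smooth_on_linear[OF linear_matrix_apply] smooth_on_id) simp

lemma line_rep_line_projection:
 assumes "x0 \<bullet> x ~= 0"
 shows "line_rep x0 (line_projection x) = ((x0 \<bullet> x0) / (x0 \<bullet> x)) *\<^sub>R x"
proof -
 have "x ~= 0" using assms by auto
 then show ?thesis using assms by (simp add: line_rep_def line_projection_mult inner_commute[of x x0])
qed

lemma line_rep_defined: "x ~= 0 ==> x0 \<bullet> (line_projection x *v x0) ~= 0 \<longleftrightarrow> x0 \<bullet> x ~= 0"
 by (simp add: line_projection_mult inner_commute)

lemma real_locus_eq: "real_locus X = {line_projection x |x. x ~= 0 \<and> cvec x \<in> X}"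
 by (simp add: real_locus_def)

text \<open>
 Adding to the equations of the cone over \<open>X\<close> the radial coordinate and suitable quotients of sections
 gives coordinates of the ambient space; the quotients are then coordinates on \<open>X(\<real>)\<close>.
\<close>

lemma real_section_chart:
 fixes X :: "(complex ^ 'v::finite) set"
 assumes X: "irred_closed X" and dim: "\<And>z. z \<in> X ==> vec.dim (cone_tangent_space X z) = Suc CARD('n::finite)"
  and D: "real_divisor X D" and g: "generating_sections X D k s"
  and ci: "closed_immersion X k (section_map X D k s)" and x0: "cvec x0 \<in> X"
 shows "\<exists>V sg Q psi q j l. line_projection x0 \<in> Q \<and>
  hchart k (real_locus X) (real_zeros X D k s) V (sg :: real ^ 'n => real ^ 'v ^ 'v) Q psi q j l"
proof -
 let ?phi = "real_sections X D k s" and ?zt = "x0 \<bullet> x0"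
 have Xc: "real_closed X" using X by (simp add: irred_closed_def)
 have nz: "x ~= 0" if "cvec x \<in> X" for x using real_closed_nonzero[OF Xc that] cvec_eq_0 by blast
 have x0nz: "x0 ~= 0" by (rule nz[OF x0])
 have zt: "?zt ~= 0" using x0nz by simp
 obtain e Q dN N where Q: "\<forall>l. homogeneous e (Q l)" "\<forall>l>k. Q l = 0" "homogeneous dN N" "peval_real N (vec_nth x0) ~= 0"
  "\<forall>x. cvec x \<in> X --> peval_real N (vec_nth x) ~= 0 --> (\<exists>c. c ~= 0 \<and> (\<forall>l. ?phi x l = c * peval_real (Q l) (vec_nth x)))"
  by (rule real_sections_locally_polynomial[OF X D g x0])
 obtain J Og and Ps :: "real ^ 'v => real ^ 'v" where J: "card (- J) = Suc CARD('n)" and sPs: "smooth_on Og Ps"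
  and x0Og: "x0 \<in> Og" and injPs: "inj (dir_deriv Ps x0)"
  and flat: "\<forall>x\<in>Og. cvec x \<in> X \<longleftrightarrow> (\<forall>j\<in>J. Ps x $ j = 0)"
  by (rule real_cone_flat[OF Xc dim x0])
 define qr where "qr a x = peval_real (Q a) (vec_nth x)" for a and x :: "real ^ 'v"
 have sq: "smooth_on UNIV (qr a)" for a
  unfolding qr_def[abs_def] by (intro peval_real_smooth smooth_on_vec_nth smooth_on_id open_UNIV)
 have sN: "smooth_on UNIV (%x. peval_real N (vec_nth x))"
  by (intro peval_real_smooth smooth_on_vec_nth smooth_on_id open_UNIV)
 obtain c0 where c0: "c0 ~= 0" "\<forall>l. ?phi x0 l = c0 * qr l x0" using Q(4,5) x0 unfolding qr_def by blast
 obtain j where j: "j \<le> k" "qr j x0 ~= 0"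
 proof -
  obtain j where j: "j \<le> k" "section_map X D k s (cvec x0) j ~= 0" using section_map_nonzero[OF X g x0] by blast
  have "qr j x0 ~= 0" using j(2) section_map_cvec[OF X g x0, of j] c0 by auto
  then show thesis using j(1) by (rule that[rotated])
 qed
 define Og1 where "Og1 = Og \<inter> ((qr j -` (- {0})) \<inter> (%x. peval_real N (vec_nth x)) -` (- {0}))"
 have op1: "open Og1" unfolding Og1_def
  by (intro open_Int open_vimage smooth_on_open[OF sPs] smooth_on_continuous[OF sq] smooth_on_continuous[OF sN]) auto
 have x01: "x0 \<in> Og1" using x0Og j(2) Q(4) by (simp add: Og1_def)
 have sub1: "Og1 \<subseteq> Og" by (auto simp: Og1_def)
 have sPs1: "smooth_on Og1 Ps" by (rule smooth_on_subset[OF sPs op1 sub1])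
 define u where "u a x = qr a x / qr j x" for a x
 have su: "smooth_on Og1 (u a)" for a
  unfolding u_def[abs_def]
  by (intro smooth_on_divide smooth_on_subset[OF sq op1 subset_UNIV]) (auto simp: Og1_def)
 have phiu: "\<exists>c. c ~= 0 \<and> ?phi x = (%a. c * u a x)" if x: "cvec x \<in> X" "x \<in> Og1" for x
 proof -
  obtain c where c: "c ~= 0" "\<forall>l. ?phi x l = c * qr l x" using Q(5) x unfolding qr_def Og1_def by blast
  have "qr j x ~= 0" using x(2) by (auto simp: Og1_def)
  then show ?thesis using c by (intro exI[of _ "c * qr j x"]) (simp add: u_def fun_eq_iff)
 qed
 obtain P :: "'v => nat rpoly" and d where P: "\<forall>i. homogeneous d (P i)" "\<exists>i. peval_real (P i) (?phi x0) ~= 0"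
  "\<forall>x. cvec x \<in> X --> (\<exists>c. \<forall>i. peval_real (P i) (?phi x) = c * x $ i)"
  by (rule immersion_inverse_real[OF X g ci x0])
 have Pphi: "\<exists>c. c ~= 0 \<and> (\<forall>i. peval_real (P i) (?phi x) = c * peval_real (P i) (%a. u a x))" if x: "cvec x \<in> X" "x \<in> Og1" for x
 proof -
  obtain c where c: "c ~= 0" "?phi x = (%a. c * u a x)" using phiu[OF x] by blast
  have "peval_real (P i) (?phi x) = c ^ d * peval_real (P i) (%a. u a x)" for i
   unfolding c(2) by (rule peval_real_scale) (use P(1) in blast)
  then show ?thesis using c(1) by (intro exI[of _ "c ^ d"]) simp
 qed
 obtain i0 where i0: "peval_real (P i0) (%a. u a x0) ~= 0"
  using P(2) Pphi[OF x0 x01] by (metis mult_zero_right)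
 have Pu: "\<forall>x\<in>Og1. (\<forall>i\<in>J. Ps x $ i = 0) --> (\<exists>c. \<forall>i. peval_real (P i) (%a. u a x) = c * x $ i)"
 proof (intro ballI impI)
  fix x assume x: "x \<in> Og1" "\<forall>i\<in>J. Ps x $ i = 0"
  have xX: "cvec x \<in> X" using flat x sub1 by blast
  obtain c where c: "\<forall>i. peval_real (P i) (?phi x) = c * x $ i" using P(3) xX by blast
  obtain c' where c': "c' ~= 0" "\<forall>i. peval_real (P i) (?phi x) = c' * peval_real (P i) (%a. u a x)" using Pphi[OF xX x(1)] by blast
  have "peval_real (P i) (%a. u a x) = (c / c') * x $ i" for i
  proof -
   have "c' * peval_real (P i) (%a. u a x) = c * x $ i" using c c' by metis
   then show ?thesis using c'(1) by (simp add: field_simps)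
  qed
  then show "\<exists>c. \<forall>i. peval_real (P i) (%a. u a x) = c * x $ i" by blast
 qed
 have J0: "\<forall>i\<in>J. Ps x0 $ i = 0" using flat x0 x0Og by blast
 have radial: "dir_deriv Ps x0 x0 $ i = 0" if i: "i \<in> J" for i
 proof -
  let ?gm = "%t::real. (1 + t) *\<^sub>R x0"
  have d: "(?gm has_vector_derivative x0) (at 0)"
   by (rule has_vector_derivative_eq_rhs, (rule derivative_intros)+) simp
  have "smooth_on Og (%x. Ps x $ i)" by (rule smooth_on_vec_nth[OF sPs])
  from DERIV_along_curve[OF this _ d] have 1: "((%t. Ps (?gm t) $ i) has_real_derivative dir_deriv (%x. Ps x $ i) x0 x0) (at 0)"
   using x0Og by simp
  have "continuous_on UNIV ?gm" by (intro continuous_intros)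
  then have o: "open (?gm -` Og \<inter> ball 0 1)" by (intro open_Int open_vimage smooth_on_open[OF sPs] open_ball)
  have "((%t. Ps (?gm t) $ i) has_real_derivative 0) (at 0)"
  proof (rule has_field_derivative_transform_within_open[OF DERIV_const o])
   show "0 \<in> ?gm -` Og \<inter> ball 0 1" using x0Og by simp
   fix t :: real assume t: "t \<in> ?gm -` Og \<inter> ball 0 1"
   then have "1 + t ~= 0" by (auto simp: dist_norm)
   then have "cvec (?gm t) \<in> X" by (rule cvec_scale_mem[OF Xc x0])
   then show "0 = Ps (?gm t) $ i" using flat t i by auto
  qed
  from DERIV_unique[OF 1 this] show ?thesis by (simp add: dir_deriv_nth[OF sPs x0Og])
 qed
 have u0: "dir_deriv (u a) x0 v = 0" if "a > k" for a v
 proof -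
  have "u a = (%x. 0)" using Q(2) that by (simp add: u_def[abs_def] qr_def peval_real_def peval_zero)
  then show ?thesis by (simp add: dir_deriv_eq[OF has_derivative_const])
 qed
 have ker: "v = 0" if 1: "\<And>i. i \<in> J ==> dir_deriv Ps x0 v $ i = 0" and 2: "\<And>a. a \<le> k ==> dir_deriv (u a) x0 v = 0" and 3: "x0 \<bullet> v = 0" for v
 proof -
  have all: "dir_deriv (u a) x0 v = 0" for a using 2 u0 by (cases "a \<le> k") auto
  show ?thesis by (rule immersion_injective_tangent[OF sPs1 x01 injPs J0 1 su all 3 Pu i0])
 qed
 have "\<exists>l :: 'n => nat. (\<forall>i. l i \<le> k) \<and>
   (\<forall>v. (\<forall>i\<in>J. dir_deriv Ps x0 v $ i = 0) --> (\<forall>i. dir_deriv (u (l i)) x0 v = 0) --> x0 \<bullet> v = 0 --> v = 0)"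
  by (rule choose_functionals[OF dir_deriv_linear[OF sPs x0Og] injPs J x0nz radial dir_deriv_linear[OF su x01] ker])
 then obtain l :: "'n => nat" where l: "\<forall>i. l i \<le> k" and lker:
  "\<forall>v. (\<forall>i\<in>J. dir_deriv Ps x0 v $ i = 0) --> (\<forall>i. dir_deriv (u (l i)) x0 v = 0) --> x0 \<bullet> v = 0 --> v = 0"
  by (elim exE conjE) (rule that)
 obtain kp where kp: "bij_betw kp (- J) (UNIV :: 'n option set)"
  using finite_same_card_bij[of "- J" "UNIV :: 'n option set"] J by (auto simp: card_UNIV_option)
 \<comment> \<open>coordinates of the ambient space: equations of the cone, radial coordinate, quotients of sections\<close>
 define Th where "Th x = (\<chi> i. if i \<in> J then Ps x $ i else case kp i of None => x0 \<bullet> x | Some m => u (l m) x)" for x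
 have comp: "Th x $ i = (if i \<in> J then Ps x $ i else case kp i of None => x0 \<bullet> x | Some m => u (l m) x)" for x i
  by (simp add: Th_def)
 have scomp: "smooth_on Og1 (%x. if i \<in> J then Ps x $ i else case kp i of None => x0 \<bullet> x | Some m => u (l m) x)" for i
  by (cases "i \<in> J"; cases "kp i")
   (simp_all add: smooth_on_vec_nth[OF sPs1] su smooth_on_inner[OF smooth_on_const[OF op1] smooth_on_id[OF op1]])
 have sTh: "smooth_on Og1 Th" unfolding Th_def[abs_def] by (rule smooth_on_vec_lambda[OF scomp])
 have inner_deriv: "dir_deriv (%x. x0 \<bullet> x) x0 v = x0 \<bullet> v" for v
  using dir_deriv_eq[OF bounded_linear_imp_has_derivative[OF bounded_linear_inner_right[of x0]], of x0] by simp
 have "v = 0" if v: "dir_deriv Th x0 v = 0" for v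
 proof -
  have c: "dir_deriv (%x. if i \<in> J then Ps x $ i else case kp i of None => x0 \<bullet> x | Some m => u (l m) x) x0 v = 0" for i
   using dir_deriv_nth[OF sTh x01, of v i] v by (simp add: comp)
  have 1: "\<forall>i\<in>J. dir_deriv Ps x0 v $ i = 0"
  proof
   fix i assume "i \<in> J"
   then show "dir_deriv Ps x0 v $ i = 0" using c[of i] by (simp add: dir_deriv_nth[OF sPs x0Og])
  qed
  have ex: "\<exists>i. i \<notin> J \<and> kp i = y" for y using bij_betw_imp_surj_on[OF kp] by (metis ComplD UNIV_I imageE)
  have 2: "\<forall>m. dir_deriv (u (l m)) x0 v = 0"
  proof
   fix m
   obtain i where "i \<notin> J" "kp i = Some m" using ex by blast
   then show "dir_deriv (u (l m)) x0 v = 0" using c[of i] by simp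
  qed
  obtain i where "i \<notin> J" "kp i = None" using ex by blast
  then have "x0 \<bullet> v = 0" using c[of i] by (simp add: inner_deriv)
  then show ?thesis using lker 1 2 by blast
 qed
 then have injTh: "inj (dir_deriv Th x0)"
  using linear_injective_0[OF dir_deriv_linear[OF sTh x01]] by blast
 obtain U G where U: "open U" "x0 \<in> U" "U \<subseteq> Og1" "open (Th ` U)" and sG: "smooth_on (Th ` U) G"
  and G: "\<And>x. x \<in> U ==> G (Th x) = x"
  using smooth_local_inverse[OF sTh x01 injTh] by metis
 \<comment> \<open>the slice of the cone with fixed radial coordinate, parametrized by the quotients of sections\<close>
 define E where "E y = (\<chi> i. if i \<in> J then 0 else case kp i of None => ?zt | Some m => y $ m)" for y :: "real ^ 'n"
 have sE: "smooth_on UNIV E"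
 proof -
  have "smooth_on UNIV (%y :: real ^ 'n. if i \<in> J then 0 else case kp i of None => ?zt | Some m => y $ m)" for i
   by (cases "i \<in> J"; cases "kp i") (simp_all add: smooth_on_const smooth_on_vec_nth smooth_on_id)
  then show ?thesis unfolding E_def[abs_def] by (rule smooth_on_vec_lambda)
 qed
 define V where "V = E -` (Th ` U)"
 define pt where "pt y = G (E y)" for y
 have opV: "open V" unfolding V_def by (rule open_vimage[OF U(4) smooth_on_continuous[OF sE]])
 have spt: "smooth_on V pt"
  unfolding pt_def by (rule smooth_on_compose[OF sG smooth_on_subset[OF sE opV subset_UNIV]]) (auto simp: V_def)
 have pt: "pt y \<in> U \<and> Th (pt y) = E y" if "y \<in> V" for y
  using that G unfolding V_def pt_def by (auto simp: vimage_def)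
 have ptX: "cvec (pt y) \<in> X" and ptu: "u (l m) (pt y) = y $ m" and ptzt: "x0 \<bullet> pt y = ?zt" if y: "y \<in> V" for y m
 proof -
  have e: "Th (pt y) $ i = E y $ i" for i using pt[OF y] by simp
  have "Ps (pt y) $ i = 0" if "i \<in> J" for i using e[of i] that by (simp add: comp E_def)
  then show "cvec (pt y) \<in> X" using flat pt[OF y] U(3) sub1 by blast
  have ex: "\<exists>i. i \<notin> J \<and> kp i = z" for z using bij_betw_imp_surj_on[OF kp] by (metis ComplD UNIV_I imageE)
  obtain i where "i \<notin> J" "kp i = Some m" using ex by blast
  then show "u (l m) (pt y) = y $ m" using e[of i] by (simp add: comp E_def)
  obtain i where "i \<notin> J" "kp i = None" using ex by blast
  then show "x0 \<bullet> pt y = ?zt" using e[of i] by (simp add: comp E_def)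
 qed
 define sg where "sg y = line_projection (pt y)" for y
 define W where "W = {A :: real ^ 'v ^ 'v. x0 \<bullet> (A *v x0) ~= 0}"
 define Qs where "Qs = W \<inter> line_rep x0 -` U"
 define psi where "psi A = (\<chi> m. u (l m) (line_rep x0 A))" for A
 have opQ: "open Qs"
  unfolding Qs_def W_def
  by (rule continuous_open_preimage[OF smooth_on_continuous[OF line_rep_smooth] line_rep_open U(1)])
 have spsi: "smooth_on Qs psi"
 proof -
  have "smooth_on Qs (%A. u (l m) (line_rep x0 A))" for m
   by (rule smooth_on_compose[OF su smooth_on_subset[OF line_rep_smooth opQ]]) (use U(3) in \<open>auto simp: Qs_def W_def\<close>)
  then show ?thesis unfolding psi_def[abs_def] by (rule smooth_on_vec_lambda)
 qed
 have ssg: "smooth_on V sg"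
  unfolding sg_def by (rule smooth_on_compose[OF line_projection_smooth spt]) (use nz ptX in auto)
 have 3: "sg y \<in> real_locus X \<and> sg y \<in> Qs \<and> psi (sg y) = y" if y: "y \<in> V" for y
 proof -
  have n: "pt y ~= 0" by (rule nz[OF ptX[OF y]])
  have i: "x0 \<bullet> pt y ~= 0" using ptzt[OF y] zt by simp
  have rep: "line_rep x0 (sg y) = pt y" unfolding sg_def line_rep_line_projection[OF i] using ptzt[OF y] zt by simp
  have "sg y \<in> real_locus X" unfolding real_locus_eq sg_def using n ptX[OF y] by blast
  moreover have "sg y \<in> Qs" unfolding Qs_def W_def using rep pt[OF y] line_rep_defined[OF n, of x0] i by (simp add: sg_def)
  moreover have "psi (sg y) = y" by (simp add: psi_def rep ptu[OF y] vec_eq_iff)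
  ultimately show ?thesis by blast
 qed
 have 4: "psi A \<in> V \<and> sg (psi A) = A" if A: "A \<in> real_locus X" "A \<in> Qs" for A
 proof -
  obtain x where x: "A = line_projection x" "x ~= 0" "cvec x \<in> X" using A(1) unfolding real_locus_eq by blast
  have i: "x0 \<bullet> x ~= 0" using A(2) line_rep_defined[OF x(2), of x0] by (simp add: Qs_def W_def x(1))
  define t where "t = ?zt / (x0 \<bullet> x)"
  define x' where "x' = t *\<^sub>R x"
  have t: "t ~= 0" using i zt by (simp add: t_def)
  have rep: "line_rep x0 A = x'" unfolding x(1) line_rep_line_projection[OF i] x'_def t_def ..
  have x'U: "x' \<in> U" using A(2) rep by (simp add: Qs_def)
  have x'X: "cvec x' \<in> X" unfolding x'_def by (rule cvec_scale_mem[OF Xc x(3) t])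
  have "x0 \<bullet> x' = ?zt" using i by (simp add: x'_def t_def)
  moreover have "\<forall>i\<in>J. Ps x' $ i = 0" using flat x'X x'U U(3) sub1 by blast
  ultimately have e: "Th x' = E (psi A)"
   by (auto simp: vec_eq_iff comp E_def psi_def rep split: option.split)
  then have "psi A \<in> V" unfolding V_def using x'U by (metis imageI vimageI)
  moreover have "sg (psi A) = A"
   unfolding sg_def pt_def e[symmetric] G[OF x'U] unfolding x'_def x(1) by (rule line_projection_scale[OF t])
  ultimately show ?thesis by blast
 qed
 have 5: "sg y \<in> real_zeros X D k s p \<longleftrightarrow> p (%a. u a (pt y)) = 0" if p: "hpoly k m p" and y: "y \<in> V" for m p y
 proof -
  obtain c where c: "c ~= 0" "?phi (pt y) = (%a. c * u a (pt y))" using phiu[OF ptX[OF y]] pt[OF y] U(3) by blast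
  have "sg y \<in> real_zeros X D k s p \<longleftrightarrow> p (?phi (pt y)) = 0"
   unfolding sg_def by (rule real_zeros_iff[OF X D g ptX[OF y] nz[OF ptX[OF y]] p])
  then show ?thesis unfolding c(2) hpoly_zero_scale[OF p c(1)] .
 qed
 have uj: "u j (pt y) = 1" if "y \<in> V" for y using pt[OF that] U(3) by (auto simp: u_def Og1_def)
 have sq': "smooth_on V (%y. u a (pt y))" for a
  by (rule smooth_on_compose[OF su spt]) (use pt U(3) in blast)
 have ch: "hchart k (real_locus X) (real_zeros X D k s) V sg Qs psi (%a y. u a (pt y)) j l"
  unfolding hchart_def
 proof (intro conjI ballI allI impI)
  show "smooth_on V sg" "smooth_on Qs psi" "j \<le> k" by (rule ssg, rule spsi, rule j(1))
  show "\<And>i. l i \<le> k" using l by blast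
  show "\<And>a. a \<le> k ==> smooth_on V (%y. u a (pt y))" by (rule sq')
  fix y assume y: "y \<in> V"
  show "sg y \<in> real_locus X" "sg y \<in> Qs" "psi (sg y) = y" using 3[OF y] by auto
  show "u j (pt y) = 1" by (rule uj[OF y])
  show "\<And>i. u (l i) (pt y) = y $ i" by (rule ptu[OF y])
 next
  fix A assume "A \<in> real_locus X" "A \<in> Qs"
  from 4[OF this] show "psi A \<in> V" "sg (psi A) = A" by auto
 next
  fix m p y assume "hpoly k m p" "y \<in> V"
  then show "sg y \<in> real_zeros X D k s p \<longleftrightarrow> p (%a. u a (pt y)) = 0" by (rule 5)
 qed
 have "line_rep x0 (line_projection x0) = x0" using line_rep_line_projection[of x0 x0] zt by simp
 then have "line_projection x0 \<in> Qs" using U(2) zt line_rep_defined[OF x0nz, of x0] by (simp add: Qs_def W_def)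
 then show ?thesis using ch by blast
qed

section \<open>Real hypersurfaces with many components\<close>

text \<open>Every real point is represented by a unit vector.\<close>

lemma real_locus_compact:
 fixes X :: "(complex ^ 'v::finite) set"
 assumes X: "real_closed X"
 shows "compact (real_locus X)"
proof -
 obtain E :: "'v rpoly set" where E: "X = {z. z ~= 0 \<and> (\<forall>F\<in>E. pevalv F z = 0)}"
  using X unfolding real_closed_def by blast
 define K where "K = {x. norm x = 1 \<and> cvec x \<in> X}"
 have K: "K = sphere 0 1 \<inter> (\<Inter>F\<in>E. (%x. peval_real F (vec_nth x)) -` {0})"
  unfolding K_def E by (auto simp: cvec_eq_0 vec_nth_cvec peval_of_real)
 have "closed ((%x :: real ^ 'v. peval_real F (vec_nth x)) -` {0})" for F
 proof (rule closed_vimage[OF closed_singleton])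
  show "continuous_on UNIV (%x :: real ^ 'v. peval_real F (vec_nth x))"
   by (intro smooth_on_continuous peval_real_smooth smooth_on_vec_nth smooth_on_id open_UNIV)
 qed
 then have cK: "compact K" unfolding K by (intro compact_Int_closed compact_sphere closed_INT ballI)
 have "real_locus X = line_projection ` K"
 proof (intro set_eqI iffI)
  fix A assume "A \<in> real_locus X"
  then obtain x where x: "A = line_projection x" "x ~= 0" "cvec x \<in> X" unfolding real_locus_eq by blast
  have "(1 / norm x) *\<^sub>R x \<in> K" using x cvec_scale_mem[OF X x(3), of "1 / norm x"] by (simp add: K_def)
  moreover have "A = line_projection ((1 / norm x) *\<^sub>R x)" using x(1,2) by (simp add: line_projection_scale)
  ultimately show "A \<in> line_projection ` K" by blast
 next
  fix A assume "A \<in> line_projection ` K"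
  then show "A \<in> real_locus X" unfolding real_locus_eq K_def by force
 qed
 moreover have "continuous_on K line_projection"
  by (rule continuous_on_subset[OF smooth_on_continuous[OF line_projection_smooth]]) (auto simp: K_def)
 ultimately show ?thesis using compact_continuous_image cK by metis
qed

text \<open>In codimension zero it would be open, compact and nonempty.\<close>

lemma closed_submanifold_positive_codim:
 fixes \<Sigma> :: "(real ^ 'n::finite) set"
 assumes "closed_submanifold d \<Sigma>"
 shows "d ~= CARD('n)"
proof
 assume d: "d = CARD('n)"
 have S: "submanifold d \<Sigma>" "compact \<Sigma>" "\<Sigma> ~= {}" using assms by (auto simp: closed_submanifold_def)
 have "\<exists>U. open U \<and> p \<in> U \<and> U \<subseteq> \<Sigma>" if p: "p \<in> \<Sigma>" for p
 proof -
  obtain U V and f :: "real ^ 'n => real ^ 'n" and g W where H: "p \<in> U \<and> smooth_on U f \<and> smooth_on V g \<and> f ` U = V \<and> g ` V = U \<and>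
    (\<forall>x\<in>U. g (f x) = x) \<and> (\<forall>y\<in>V. f (g y) = y) \<and> subspace W \<and> dim W = d \<and> f ` (\<Sigma> \<inter> U) = W \<inter> V"
   using bspec[OF S(1)[unfolded submanifold_def] p] by (elim exE) (rule that)
  then have f: "p \<in> U" "smooth_on U f" "f ` U = V" "\<forall>x\<in>U. g (f x) = x"
   "subspace W" "dim W = d" "f ` (\<Sigma> \<inter> U) = W \<inter> V"
   by blast+
  have "W = UNIV" using f(5,6) d dim_eq_full[of W] by (simp add: span_eq_iff[THEN iffD2])
  then have "f ` (\<Sigma> \<inter> U) = f ` U" using f(3,7) by simp
  note eq = this
  have "U \<subseteq> \<Sigma>"
  proof
   fix x assume x: "x \<in> U"
   then have "f x \<in> f ` (\<Sigma> \<inter> U)" unfolding eq by (rule imageI)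
   then obtain y where y: "f x = f y" "y \<in> \<Sigma>" "y \<in> U" by (elim imageE IntE) (rule that)
   have "x = g (f x)" using f(4) x by simp
   also have "\<dots> = y" unfolding y(1) using f(4) y(3) by simp
   finally show "x \<in> \<Sigma>" using y(2) by simp
  qed
  then show ?thesis using f(1) smooth_on_open[OF f(2)] by blast
 qed
 then have "open \<Sigma>" by (subst open_subopen) blast
 then have "\<Sigma> = UNIV" using clopen[of \<Sigma>] compact_imp_closed[OF S(2)] S(3) by blast
 then show False using S(2) compact_imp_bounded not_bounded_UNIV by blast
qed

lemma real_zeros_of_divisor:
 fixes X :: "(complex ^ 'v::finite) set"
 assumes X: "irred_closed X" and D: "real_divisor X D" and g: "generating_sections X D k s"
  and p: "hpoly k m p" and nz: "\<not> real_locus X \<subseteq> real_zeros X D k s p"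
 shows "\<exists>Z :: 'v divisor. Z \<in> linear_system X (multiple m D) \<and> real_locus (hypersurface X Z) = real_zeros X D k s p"
proof -
 obtain pc where pc: "complexification m p pc TYPE('v)" using complexification_exists[OF p] by blast
 have val: "pc (section_map X D k s (cvec x)) = complex_of_real (p (real_sections X D k s x))" if "cvec x \<in> X" for x
 proof -
  have "section_map X D k s (cvec x) = (%l. complex_of_real (real_sections X D k s x l))"
   using section_map_cvec[OF X g that] by (simp add: fun_eq_iff)
  then show ?thesis using pc unfolding complexification_def by simp
 qed
 obtain x where x: "x ~= 0" "cvec x \<in> X" "line_projection x \<notin> real_zeros X D k s p"
  using nz unfolding real_locus_eq by blast
 have "p (real_sections X D k s x) ~= 0" using x unfolding real_zeros_def by blast
 then have "\<exists>z\<in>X. pc (section_map X D k s z) ~= 0" using x(2) val[OF x(2)] by (intro bexI[of _ "cvec x"]) simp_all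
 from form_divisor_in_linear_system[OF X D g pc this]
 obtain Z :: "'v divisor" where Z: "Z \<in> linear_system X (multiple m D)"
  "hypersurface X Z = {z \<in> X. pc (section_map X D k s z) = 0}" by blast
 have "real_locus (hypersurface X Z) = real_zeros X D k s p"
  unfolding real_locus_eq real_zeros_def Z(2) using val by auto
 then show ?thesis using Z(1) by blast
qed

theorem theorem1p5:
  fixes X :: "(complex ^ 'v::finite) set" and D :: "'v divisor"
    and \<Sigma> :: "(real ^ 'n::finite) set" and d r :: nat
  assumes "real_algebraic_variety X" and "krull_dim X = enat CARD('n)"
    and "real_divisor X D" and "very_ample X D"
    and "closed_submanifold d \<Sigma>" and "d + r = CARD('n)"
    and "trivial_normal_bundle r \<Sigma>"
  shows "\<exists>c>0. \<exists>m\<^sub>0::nat. \<forall>m\<ge>m\<^sub>0. \<exists>Z :: nat \<Rightarrow> 'v divisor.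
           (\<forall>i\<in>{1..r}. Z i \<in> linear_system X (multiple m D)) \<and>
           submanifold d (\<Inter>i\<in>{1..r}. real_locus (hypersurface X (Z i))) \<and>
           ereal (c * real m ^ CARD('n))
             \<le> ereal_of_enat (num_copies \<Sigma> (\<Inter>i\<in>{1..r}. real_locus (hypersurface X (Z i))))"
proof -
 have X: "irred_closed X" and Xc: "real_closed X" and sm: "smooth_variety X" and ne: "real_locus X ~= {}"
  using assms(1) by (auto simp: real_algebraic_variety_def irred_closed_def)
 have dim: "vec.dim (cone_tangent_space X z) = Suc CARD('n)" if "z \<in> X" for z
  using sm that assms(2) by (simp add: smooth_variety_def one_enat_def)
 obtain k s where g: "generating_sections X D k s" and ci: "closed_immersion X k (section_map X D k s)"
  using assms(4) unfolding very_ample_def by blast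
 have r: "r ~= 0" using closed_submanifold_positive_codim[OF assms(5)] assms(6) by auto
 obtain nu :: "nat => real ^ 'n => real ^ 'n" where nu: "\<forall>i<r. smooth_map \<Sigma> (nu i)"
  "\<forall>p\<in>\<Sigma>. inj_on (%i. nu i p) {..<r} \<and> independent ((%i. nu i p) ` {..<r}) \<and> span ((%i. nu i p) ` {..<r}) = normal_space \<Sigma> p"
  using assms(7) unfolding trivial_normal_bundle_def by blast
 obtain R :: "'n set" where R: "card R = r"
  using obtain_subset_with_card_n[of r "UNIV :: 'n set"] assms(6) by auto
 have Rne: "R ~= {}" using R r by auto
 obtain bt where bt: "bij_betw bt R {..<r}" using finite_same_card_bij[of R "{..<r}"] R by auto
 obtain gm where gm: "bij_betw gm {1..r} R" using finite_same_card_bij[of "{1..r}" R] R by auto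
 define mu where "mu i = nu (bt i)" for i
 have btr: "bt i < r" if "i \<in> R" for i using bij_betwE[OF bt] that by blast
 have im: "(%i. mu i p) ` R = (%i. nu i p) ` {..<r}" for p
  unfolding mu_def bij_betw_imp_surj_on[OF bt, symmetric] by (simp add: image_image)
 have 1: "smooth_map \<Sigma> (mu i)" if "i \<in> R" for i using nu(1) btr[OF that] by (simp add: mu_def)
 have 2: "inj_on (%i. mu i p) R \<and> independent ((%i. mu i p) ` R)" if p: "p \<in> \<Sigma>" for p
 proof
  have "inj_on ((%i. nu i p) \<circ> bt) R"
   using nu(2) p bt by (intro comp_inj_on) (auto simp: bij_betw_def)
  then show "inj_on (%i. mu i p) R" by (simp add: mu_def comp_def)
  show "independent ((%i. mu i p) ` R)" unfolding im using nu(2) p by blast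
 qed
 have 3: "mu i p \<in> normal_space \<Sigma> p" if "p \<in> \<Sigma>" "i \<in> R" for p i
 proof -
  have "mu i p \<in> span ((%i. mu i p) ` R)" using that(2) by (intro span_base imageI)
  then show ?thesis unfolding im using nu(2) that(1) by simp
 qed
 have ch: "\<exists>V sg Q psi q j l. A \<in> Q \<and> hchart k (real_locus X) (real_zeros X D k s) V (sg :: real ^ 'n => real ^ 'v ^ 'v) Q psi q j l"
  if A: "A \<in> real_locus X" for A
 proof -
  obtain x where x: "A = line_projection x" "cvec x \<in> X" using A unfolding real_locus_eq by blast
  show ?thesis unfolding x(1) by (rule real_section_chart[OF X dim assms(3) g ci x(2)])
 qed
 have sub: "real_zeros X D k s p \<subseteq> real_locus X" for p
  unfolding real_zeros_def real_locus_eq by blast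
 have dR: "d + card R = CARD('n)" using assms(6) R by simp
 obtain c m0 where c: "c > 0" and main: "\<forall>m\<ge>m0. \<exists>P :: 'n => (nat => real) => real. (\<forall>i. hpoly k m (P i)) \<and>
  (\<forall>i\<in>R. \<not> real_locus X \<subseteq> real_zeros X D k s (P i)) \<and> submanifold d (\<Inter>i\<in>R. real_zeros X D k s (P i)) \<and>
  ereal (c * real m ^ CARD('n)) \<le> ereal_of_enat (num_copies \<Sigma> (\<Inter>i\<in>R. real_zeros X D k s (P i)))"
  using many_copies_in_charts[OF real_locus_compact[OF Xc] ne ch sub assms(5) Rne dR 1 2 3] by blast
 have "\<exists>Z :: nat => 'v divisor.
     (\<forall>i\<in>{1..r}. Z i \<in> linear_system X (multiple m D)) \<and>
     submanifold d (\<Inter>i\<in>{1..r}. real_locus (hypersurface X (Z i))) \<and>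
     ereal (c * real m ^ CARD('n))
      \<le> ereal_of_enat (num_copies \<Sigma> (\<Inter>i\<in>{1..r}. real_locus (hypersurface X (Z i))))" if m: "m \<ge> m0" for m
 proof -
  obtain P :: "'n => (nat => real) => real" where P: "\<forall>i. hpoly k m (P i)"
   "\<forall>i\<in>R. \<not> real_locus X \<subseteq> real_zeros X D k s (P i)" "submanifold d (\<Inter>i\<in>R. real_zeros X D k s (P i))"
   "ereal (c * real m ^ CARD('n)) \<le> ereal_of_enat (num_copies \<Sigma> (\<Inter>i\<in>R. real_zeros X D k s (P i)))"
   using main m by blast
  have "\<forall>i\<in>R. \<exists>Z :: 'v divisor. Z \<in> linear_system X (multiple m D) \<and> real_locus (hypersurface X Z) = real_zeros X D k s (P i)"
  proof
   fix i assume "i \<in> R"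
   with P(2) have "\<not> real_locus X \<subseteq> real_zeros X D k s (P i)" by blast
   then show "\<exists>Z :: 'v divisor. Z \<in> linear_system X (multiple m D) \<and> real_locus (hypersurface X Z) = real_zeros X D k s (P i)"
    by (rule real_zeros_of_divisor[OF X assms(3) g spec[OF P(1)]])
  qed
  from bchoice[OF this] obtain Y where Y: "\<forall>i\<in>R. Y i \<in> linear_system X (multiple m D) \<and> real_locus (hypersurface X (Y i)) = real_zeros X D k s (P i)" ..
  have gmR: "gm i \<in> R" if "i \<in> {1..r}" for i using bij_betwE[OF gm] that by blast
  have eq: "(\<Inter>i\<in>{1..r}. real_locus (hypersurface X (Y (gm i)))) = (\<Inter>i\<in>R. real_zeros X D k s (P i))"
  proof -
   have "(\<Inter>i\<in>{1..r}. real_locus (hypersurface X (Y (gm i)))) = (\<Inter>i\<in>{1..r}. real_zeros X D k s (P (gm i)))"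
    using Y gmR by (intro INF_cong[OF refl]) simp
   also have "\<dots> = (\<Inter>i\<in>gm ` {1..r}. real_zeros X D k s (P i))" by (simp only: image_image)
   finally show ?thesis unfolding bij_betw_imp_surj_on[OF gm] .
  qed
  show ?thesis
   by (rule exI[of _ "%i. Y (gm i)"], unfold eq) (use Y gmR P(3,4) in simp)
 qed
 then show ?thesis using c by blast
qed

end
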